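(* Let $U\subset\mathbb{C}^n$ be a domain, let $\Omega\subset U\times\mathbb{C}^m$ be a family of bounded domains over $U$ that admits a plurisubharmonic defining function, and let $\varphi$ be a $C^2$ plurisubharmonic function defined on some neighborhood of $\overline\Omega$ in $U\times\mathbb{C}^m$. Assume that all fibers $\Omega_t$ ($t\in U$) are (connected) circular domains in $\mathbb{C}^m$ containing the origin and that $\varphi(t,z)$ is $S^1$-invariant with respect to $z$. Let $k\ge0$ be an integer and, for $t\in U$, let $E^k_t$ be the space of homogeneous polynomials on $\mathbb{C}^m$ of degree $k$, with inner product $h_t$ given by $$h_t(f,g)=\int_{\Omega_t}f\,\bar g\,e^{-\varphi_t}\,d\lambda_z,\qquad f,g\in E^k_t,$$ where $\varphi_t(z)=\varphi(t,z)$. Set $E^k=\bigcup_{t\in U}E^k_t$, viewed as a (trivial) holomorphic vector bundle over $U$ in the natural way. If there exist $0<r<s$ such that $B_{r,s}:=\{z\in\mathbb{C}^m\mid r\le\|z\|\le s\}\subset\Omega_t$ for all $t\in U$ and $\varphi$ is strictly plurisubharmonic on $U\times B_{r,s}$, then the curvature of the holomorphic Hermitian vector bundle $(E^k,h)$ is strictly positive in the sense of Nakano.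
   Context: Notation: $p:\mathbb{C}^n\times\mathbb{C}^m\to\mathbb{C}^n$ is the natural projection; for $A\subset\mathbb{C}^n\times\mathbb{C}^m$, $A_t=p^{-1}(t)\cap A$ is the fiber over $t$, regarded as a subset of $\mathbb{C}^m$. $d\lambda_z$ is Lebesgue measure on $\mathbb{C}^m$. Closures $\overline\Omega$ are taken in $U\times\mathbb{C}^m$. A family of domains of dimension $m$ over a domain $U\subset\mathbb{C}^n$ is a domain $\Omega\subset U\times\mathbb{C}^m$ with $p(\Omega)=U$; it is a family of bounded domains if every fiber $\Omega_t$ ($t\in U$) is bounded. It has $C^k$ boundary ($k\ge1$) if there is a $C^k$ real function $\rho(t,z)$ on some neighborhood of $\overline\Omega$ in $U\times\mathbb{C}^m$ such that $\Omega=\{\rho<0\}$ and, for every $t\in U$, the differential of $z\mapsto\rho(t,z)$ is nonzero at every point of $\partial\Omega_t$; such $\rho$ is called a defining function. A family with $C^2$ boundary has (admits) a plurisubharmonic defining function if it admits a ($C^2$) defining function that is plurisubharmonic on some neighborhood of $\overline\Omega$ in $U\times\mathbb{C}^m$. A $C^2$ function is strictly plurisubharmonic on a set if its complex Hessian is positive definite at every point of the set. A domain $D\subset\mathbb{C}^m$ is circular if it is invariant under the $S^1$-action $e^{i\theta}\cdot(z_1,\dots,z_m)=(e^{i\theta}z_1,\dots,e^{i\theta}z_m)$, $\theta\in\mathbb{R}$. Nakano positivity: for a Hermitian holomorphic vector bundle $(E,h)$ over a domain with coordinates $t=(t_1,\dots,t_n)$, let $D$ be the $(1,0)$-part of the Chern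 connection, with components $D_{t_j}$, and write the Chern curvature as $\Theta=\sum_{j,l}\Theta_{jl}\,dt_j\wedge d\bar t_l$, $\Theta_{jl}=[D_{t_j},\bar\partial_{t_l}]$. The curvature is strictly positive in the sense of Nakano if at every point $\sum_{j,l}h(\Theta_{jl}u_j,u_l)>0$ for every nonzero $n$-tuple $(u_1,\dots,u_n)$ of elements of the fiber. *)

theory Defs
  imports "HOL-Analysis.Analysis"
begin

section \<open>Functions of class \<open>C\<^sup>k\<close>, Wirtinger derivatives, plurisubharmonicity\<close>

text \<open>Meant for open \<open>S\<close> and finite-dimensional domain, where continuity of all iterated
  directional derivatives is the usual notion.\<close>

fun Ck_on :: "nat \<Rightarrow> ('a::real_normed_vector \<Rightarrow> 'b::real_normed_vector) \<Rightarrow> 'a set \<Rightarrow> bool" where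
  "Ck_on 0 f S \<longleftrightarrow> continuous_on S f"
| "Ck_on (Suc k) f S \<longleftrightarrow>
     f differentiable_on S \<and> (\<forall>v. Ck_on k (\<lambda>x. frechet_derivative f (at x) v) S)"

text \<open>A complex coordinate is given by the embedding \<open>e\<close> of its coordinate line: the real
  directions of the coordinate are \<open>e 1\<close> and \<open>e \<i>\<close>. The two operators are
  \<open>\<partial> = (\<partial>\<^sub>x - \<i> \<partial>\<^sub>y) / 2\<close> and its conjugate.\<close>

definition wirtinger :: "(complex \<Rightarrow> 'a) \<Rightarrow> ('a::real_normed_vector \<Rightarrow> complex) \<Rightarrow> 'a \<Rightarrow> complex" where
  "wirtinger e f x =
     (frechet_derivative f (at x) (e 1) - \<i> * frechet_derivative f (at x) (e \<i>)) / 2"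

definition wirtinger_bar :: "(complex \<Rightarrow> 'a) \<Rightarrow> ('a::real_normed_vector \<Rightarrow> complex) \<Rightarrow> 'a \<Rightarrow> complex" where
  "wirtinger_bar e f x =
     (frechet_derivative f (at x) (e 1) + \<i> * frechet_derivative f (at x) (e \<i>)) / 2"

text \<open>The coordinates of \<open>\<complex>\<^sup>n \<times> \<complex>\<^sup>m\<close> are indexed by the sum type.\<close>

fun coord :: "'n::finite + 'm::finite \<Rightarrow> complex \<Rightarrow> (complex^'n) \<times> (complex^'m)" where
  "coord (Inl j) c = (axis j c, 0)"
| "coord (Inr k) c = (0, axis k c)"

definition complex_hessian ::
    "((complex^'n) \<times> (complex^'m) \<Rightarrow> real) \<Rightarrow> (complex^'n) \<times> (complex^'m) \<Rightarrow> complex^('n + 'm)^('n + 'm)" where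
  "complex_hessian u x =
     (\<chi> a b. wirtinger (coord a) (wirtinger_bar (coord b) (\<lambda>y. complex_of_real (u y))) x)"

definition positive_definite :: "complex^'i^'i \<Rightarrow> bool" where
  "positive_definite A \<longleftrightarrow>
     (\<forall>w::complex^'i. w \<noteq> 0 \<longrightarrow>
        (let q = (\<Sum>a\<in>UNIV. \<Sum>b\<in>UNIV. A $ a $ b * w $ a * cnj (w $ b)) in q \<in> \<real> \<and> 0 < Re q))"

definition strictly_plurisubharmonic_on ::
    "((complex^'n) \<times> (complex^'m)) set \<Rightarrow> ((complex^'n) \<times> (complex^'m) \<Rightarrow> real) \<Rightarrow> bool" where
  "strictly_plurisubharmonic_on S u \<longleftrightarrow> (\<forall>x\<in>S. positive_definite (complex_hessian u x))"

definition cscale :: "complex \<Rightarrow> (complex^'n) \<times> (complex^'m) \<Rightarrow> (complex^'n) \<times> (complex^'m)" where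
  "cscale c x = (c *s fst x, c *s snd x)"

text \<open>The sub-mean-value inequality on all closed discs in complex lines. Upper semicontinuity is
  replaced by continuity, since only continuous real-valued functions occur; the integral is then
  always a proper one.\<close>

definition plurisubharmonic_on ::
    "((complex^'n) \<times> (complex^'m)) set \<Rightarrow> ((complex^'n) \<times> (complex^'m) \<Rightarrow> real) \<Rightarrow> bool" where
  "plurisubharmonic_on W u \<longleftrightarrow>
     continuous_on W u \<and>
     (\<forall>x v. (\<forall>c\<in>cball 0 1. x + cscale c v \<in> W) \<longrightarrow>
        u x \<le> integral {0..2*pi} (\<lambda>\<theta>. u (x + cscale (cis \<theta>) v)) / (2*pi))"

section \<open>Families of domains\<close>

definition is_domain :: "'a::topological_space set \<Rightarrow> bool" where
  "is_domain D \<longleftrightarrow> open D \<and> connected D \<and> D \<noteq> {}"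

definition fiber :: "('a \<times> 'b) set \<Rightarrow> 'a \<Rightarrow> 'b set" where
  "fiber A t = {z. (t, z) \<in> A}"

definition family_of_bounded_domains ::
    "(complex^'n) set \<Rightarrow> ((complex^'n) \<times> (complex^'m)) set \<Rightarrow> bool" where
  "family_of_bounded_domains U \<Omega> \<longleftrightarrow>
     is_domain U \<and> is_domain \<Omega> \<and> fst ` \<Omega> = U \<and> (\<forall>t\<in>U. bounded (fiber \<Omega> t))"

text \<open>\<open>W\<close> is an open neighbourhood of the closure of \<open>\<Omega>\<close> relative to \<open>U \<times> \<complex>\<^sup>m\<close>.\<close>

definition closure_nbhd ::
    "(complex^'n) set \<Rightarrow> ((complex^'n) \<times> (complex^'m)) set \<Rightarrow> ((complex^'n) \<times> (complex^'m)) set \<Rightarrow> bool" where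
  "closure_nbhd U \<Omega> W \<longleftrightarrow>
     open W \<and> W \<subseteq> U \<times> UNIV \<and> closure \<Omega> \<inter> (U \<times> UNIV) \<subseteq> W"

definition defining_function ::
    "nat \<Rightarrow> (complex^'n) set \<Rightarrow> ((complex^'n) \<times> (complex^'m)) set \<Rightarrow> ((complex^'n) \<times> (complex^'m)) set
      \<Rightarrow> ((complex^'n) \<times> (complex^'m) \<Rightarrow> real) \<Rightarrow> bool" where
  "defining_function k U \<Omega> W \<rho> \<longleftrightarrow>
     closure_nbhd U \<Omega> W \<and> Ck_on k \<rho> W \<and> \<Omega> = {x \<in> W. \<rho> x < 0} \<and>
     (\<forall>t\<in>U. \<forall>z\<in>frontier (fiber \<Omega> t).
        frechet_derivative (\<lambda>w. \<rho> (t, w)) (at z) \<noteq> (\<lambda>v. 0))"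

definition admits_psh_defining_function ::
    "(complex^'n) set \<Rightarrow> ((complex^'n) \<times> (complex^'m)) set \<Rightarrow> bool" where
  "admits_psh_defining_function U \<Omega> \<longleftrightarrow>
     (\<exists>W W' \<rho>. defining_function 2 U \<Omega> W \<rho> \<and>
        closure_nbhd U \<Omega> W' \<and> W' \<subseteq> W \<and> plurisubharmonic_on W' \<rho>)"

definition circular :: "(complex^'m) set \<Rightarrow> bool" where
  "circular D \<longleftrightarrow> (\<forall>\<theta>. (\<lambda>z. cis \<theta> *s z) ` D = D)"

definition S1_invariant_on ::
    "((complex^'n) \<times> (complex^'m)) set \<Rightarrow> ((complex^'n) \<times> (complex^'m) \<Rightarrow> real) \<Rightarrow> bool" where
  "S1_invariant_on W \<phi> \<longleftrightarrow>
     (\<forall>t z \<theta>. (t, z) \<in> W \<and> (t, cis \<theta> *s z) \<in> W \<longrightarrow> \<phi> (t, cis \<theta> *s z) = \<phi> (t, z))"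

section \<open>Trivial Hermitian holomorphic vector bundles\<close>

text \<open>The fibre is a finite-dimensional complex vector space \<open>V\<close> of functions on a set \<open>'a\<close>, so a
  section is a map \<open>u\<close> with \<open>u t \<in> V\<close>. Evaluations at points span the dual of \<open>V\<close>; hence
  regularity and derivatives of sections can be taken pointwise. The metric is only required to
  be of class \<open>C\<^sup>2\<close>, which is what its curvature needs.\<close>

definition finite_dim_function_space :: "('a \<Rightarrow> complex) set \<Rightarrow> bool" where
  "finite_dim_function_space V \<longleftrightarrow>
     (\<exists>B. finite B \<and> V = {f. \<exists>c. f = (\<lambda>x. \<Sum>b\<in>B. c b * b x)})"

definition hermitian_inner_product ::
    "('a \<Rightarrow> complex) set \<Rightarrow> (('a \<Rightarrow> complex) \<Rightarrow> ('a \<Rightarrow> complex) \<Rightarrow> complex) \<Rightarrow> bool" where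
  "hermitian_inner_product V h \<longleftrightarrow>
     (\<forall>f\<in>V. \<forall>f'\<in>V. \<forall>g\<in>V. \<forall>a b. h (\<lambda>x. a * f x + b * f' x) g = a * h f g + b * h f' g) \<and>
     (\<forall>f\<in>V. \<forall>g\<in>V. h g f = cnj (h f g)) \<and>
     (\<forall>f\<in>V. f \<noteq> (\<lambda>x. 0) \<longrightarrow> 0 < Re (h f f))"

definition hermitian_bundle ::
    "(complex^'n) set \<Rightarrow> ('a \<Rightarrow> complex) set
      \<Rightarrow> (complex^'n \<Rightarrow> ('a \<Rightarrow> complex) \<Rightarrow> ('a \<Rightarrow> complex) \<Rightarrow> complex) \<Rightarrow> bool" where
  "hermitian_bundle U V h \<longleftrightarrow>
     finite_dim_function_space V \<and> (\<forall>t\<in>U. hermitian_inner_product V (h t)) \<and>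
     (\<forall>f\<in>V. \<forall>g\<in>V. Ck_on 2 (\<lambda>t. h t f g) U)"

definition Ck_section ::
    "nat \<Rightarrow> (complex^'n) set \<Rightarrow> ('a \<Rightarrow> complex) set \<Rightarrow> (complex^'n \<Rightarrow> 'a \<Rightarrow> complex) \<Rightarrow> bool" where
  "Ck_section k U V u \<longleftrightarrow> (\<forall>t\<in>U. u t \<in> V) \<and> (\<forall>x. Ck_on k (\<lambda>t. u t x) U)"

definition dbar :: "'n::finite \<Rightarrow> (complex^'n \<Rightarrow> 'a \<Rightarrow> complex) \<Rightarrow> complex^'n \<Rightarrow> 'a \<Rightarrow> complex" where
  "dbar l u t = (\<lambda>x. wirtinger_bar (axis l) (\<lambda>s. u s x) t)"

text \<open>The component \<open>D\<^sub>j\<close> of the (1,0)-part of the Chern connection, determined by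
  \<open>\<partial>\<^sub>j h(u,v) = h(D\<^sub>j u, v) + h(u, \<partial>-bar\<^sub>j v)\<close>.\<close>

definition chern_D ::
    "(complex^'n) set \<Rightarrow> ('a \<Rightarrow> complex) set
      \<Rightarrow> (complex^'n \<Rightarrow> ('a \<Rightarrow> complex) \<Rightarrow> ('a \<Rightarrow> complex) \<Rightarrow> complex)
      \<Rightarrow> 'n::finite \<Rightarrow> (complex^'n \<Rightarrow> 'a \<Rightarrow> complex) \<Rightarrow> complex^'n \<Rightarrow> 'a \<Rightarrow> complex" where
  "chern_D U V h j u t =
     (THE g. g \<in> V \<and>
        (\<forall>v. Ck_section 1 U V v \<longrightarrow>
           wirtinger (axis j) (\<lambda>s. h s (u s) (v s)) t = h t g (v t) + h t (u t) (dbar j v t)))"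

definition chern_curvature ::
    "(complex^'n) set \<Rightarrow> ('a \<Rightarrow> complex) set
      \<Rightarrow> (complex^'n \<Rightarrow> ('a \<Rightarrow> complex) \<Rightarrow> ('a \<Rightarrow> complex) \<Rightarrow> complex)
      \<Rightarrow> 'n::finite \<Rightarrow> 'n \<Rightarrow> (complex^'n \<Rightarrow> 'a \<Rightarrow> complex) \<Rightarrow> complex^'n \<Rightarrow> 'a \<Rightarrow> complex" where
  "chern_curvature U V h j l u t =
     (\<lambda>x. chern_D U V h j (dbar l u) t x - dbar l (chern_D U V h j u) t x)"

text \<open>The curvature is tensorial, so its value on an element of the fibre may be computed on any
  extension to a section; the constant one is used.\<close>

definition nakano_positive ::
    "(complex^'n) set \<Rightarrow> ('a \<Rightarrow> complex) set
      \<Rightarrow> (complex^'n \<Rightarrow> ('a \<Rightarrow> complex) \<Rightarrow> ('a \<Rightarrow> complex) \<Rightarrow> complex) \<Rightarrow> bool" where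
  "nakano_positive U V h \<longleftrightarrow>
     (\<forall>t\<in>U. \<forall>u::'n::finite \<Rightarrow> 'a \<Rightarrow> complex.
        (\<forall>j. u j \<in> V) \<and> (\<exists>j. u j \<noteq> (\<lambda>x. 0)) \<longrightarrow>
        (let q = (\<Sum>j\<in>UNIV. \<Sum>l\<in>UNIV. h t (chern_curvature U V h j l (\<lambda>_. u j) t) (u l))
         in q \<in> \<real> \<and> 0 < Re q))"

section \<open>The bundle of homogeneous polynomials\<close>

definition homogeneous_polys :: "nat \<Rightarrow> (complex^'m \<Rightarrow> complex) set" where
  "homogeneous_polys k =
     {f. \<exists>c. f = (\<lambda>z. \<Sum>\<alpha> | (\<Sum>i\<in>UNIV. \<alpha> i) = k. c (\<alpha>::'m::finite \<Rightarrow> nat) * (\<Prod>i\<in>UNIV. (z $ i) ^ \<alpha> i))}"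

definition L2_metric ::
    "((complex^'n) \<times> (complex^'m)) set \<Rightarrow> ((complex^'n) \<times> (complex^'m) \<Rightarrow> real)
      \<Rightarrow> complex^'n \<Rightarrow> (complex^'m \<Rightarrow> complex) \<Rightarrow> (complex^'m \<Rightarrow> complex) \<Rightarrow> complex" where
  "L2_metric \<Omega> \<phi> t f g =
     (LINT z:fiber \<Omega> t|lborel. f z * cnj (g z) * complex_of_real (exp (- \<phi> (t, z))))"

end

theory Submission
  imports Defs
begin

text \<open>
  Plurisubharmonicity of \<open>\<rho>\<close> makes the fibres balanced, so in polar coordinates the metric becomes
  \<open>h(f, g) = \<integral> f cnj(g) exp(-\<psi>(t, x)) dx\<close> over the fixed annulus \<open>1 \<le> |x| \<le> e\<close>. Here \<open>\<psi> = - M ln R - ln K\<close>, where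
  \<open>R\<close> is the radial function of the fibre and \<open>K\<close> a weighted integral of \<open>exp(-\<phi>)\<close> along a ray.
  Plurisubharmonicity of \<open>- ln R\<close> (from Hopf's lemma) and a one-dimensional Prekopa argument, made
  strict by the shell on which \<open>\<phi>\<close> is strictly plurisubharmonic, show that the Levi form of \<open>\<psi>\<close> is positive
  in all non-radial directions.

  With \<open>\<omega> = \<Sum>\<^sub>j (\<partial>\<^sub>j \<psi>) u\<^sub>j\<close>, the Nakano form at \<open>(u\<^sub>j)\<close> is the integral of \<open>\<Sum>\<^sub>j\<^sub>l \<psi>\<^sub>j\<^sub>l u\<^sub>j cnj(u\<^sub>l)\<close> minus
  the squared norm of the component of \<open>\<omega>\<close> orthogonal to the holomorphic polynomials. That norm is
  estimated by a Hormander-type argument for functions homogeneous of degree \<open>k\<close>: a Bochner inequality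
  on the annulus, with the d-bar equation solved approximately on spaces of polynomials.
\<close>

abbreviation dd :: "'a::real_normed_vector => ('a => 'b::real_normed_vector) => 'a => 'b" where
 "dd v f \<equiv> \<lambda>x. frechet_derivative f (at x) v"

abbreviation dz :: "'i::finite => (complex^'i => complex) => complex^'i => complex" where
 "dz a \<equiv> wirtinger (axis a)"

abbreviation dzb :: "'i::finite => (complex^'i => complex) => complex^'i => complex" where
 "dzb a \<equiv> wirtinger_bar (axis a)"

abbreviation Sum_UNIV :: "('i => 'a::comm_monoid_add) => 'a" (binder "\<Oplus>" 10) where
 "Sum_UNIV f \<equiv> sum f UNIV"

notation scaleR (infixr "*R" 75)

lemma dd_eq: "(f has_derivative f') (at x) ==> dd v f x = f' v"
 using frechet_derivative_at by metis

lemma dd_cong: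
 assumes "open S" "x \<in> S" "\<And>y. y \<in> S ==> f y = g y"
 shows "dd v f x = dd v g x"
proof -
 have "(f has_derivative F) (at x) \<longleftrightarrow> (g has_derivative F) (at x)" for F
  using assms has_derivative_transform_within_open[OF _ assms(1,2)] by metis
 then show ?thesis unfolding frechet_derivative_def by simp
qed

lemma Ck_subset: "Ck_on k f S ==> T \<subseteq> S ==> Ck_on k f T"
 by (induction k arbitrary: f) (auto intro: continuous_on_subset differentiable_on_subset)

lemma Ck_SucD: "Ck_on (Suc k) f S ==> Ck_on k f S"
proof (induction k arbitrary: f)
 case 0
 then show ?case by (simp add: differentiable_imp_continuous_on)
next
 case (Suc k)
 then show ?case by (metis Ck_on.simps(2))
qed

lemma Ck_mono: "Ck_on k f S ==> j \<le> k ==> Ck_on j f S"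
 by (induction k) (metis le_0_eq, metis Ck_SucD le_Suc_eq)

lemma Ck_continuous: "Ck_on k f S ==> continuous_on S f"
 using Ck_mono[of k f S 0] by simp

lemma Ck_deriv: "open S ==> Ck_on (Suc k) f S ==> x \<in> S
  ==> (f has_derivative frechet_derivative f (at x)) (at x)"
 by (metis Ck_on.simps(2) differentiable_on_eq_differentiable_at frechet_derivative_works)

lemma Ck_dd: "Ck_on (Suc k) f S ==> Ck_on k (dd v f) S"
 by simp

lemma Ck_cong:
 assumes "open S" "Ck_on k f S" "\<And>x. x \<in> S ==> f x = g x"
 shows "Ck_on k g S"
 using assms(2,3)
proof (induction k arbitrary: f g)
 case 0
 then show ?case by (simp cong: continuous_on_cong)
next
 case (Suc k)
 have d: "g differentiable_on S"
  unfolding differentiable_on_def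
 proof
  fix x assume x: "x \<in> S"
  have "f differentiable (at x within S)"
   using Suc.prems(1) x by (simp add: differentiable_on_def)
  then obtain D where "(f has_derivative D) (at x within S)" by (auto simp: differentiable_def)
  then have "(g has_derivative D) (at x within S)"
   by (rule has_derivative_transform[OF x, rotated]) (simp add: Suc.prems(2))
  then show "g differentiable (at x within S)" by (rule differentiableI)
 qed
 have "Ck_on k (dd v g) S" for v
 proof (rule Suc.IH[of "dd v f"])
  show "Ck_on k (dd v f) S" using Suc.prems(1) by simp
  show "dd v f x = dd v g x" if "x \<in> S" for x
   by (rule dd_cong[OF assms(1) that Suc.prems(2)])
 qed
 with d show ?case by simp
qed

lemma Ck_SucI:
 assumes "open S" "\<And>x. x \<in> S ==> (f has_derivative f' x) (at x)" "\<And>v. Ck_on k (\<lambda>x. f' x v) S"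
 shows "Ck_on (Suc k) f S"
proof -
 have "f differentiable_on S"
  using assms(1,2) by (auto simp: differentiable_on_def intro: differentiableI has_derivative_at_withinI)
 moreover have "Ck_on k (dd v f) S" for v
  using assms(3)[of v] by (rule Ck_cong[OF assms(1)]) (simp add: dd_eq[OF assms(2)])
 ultimately show ?thesis by simp
qed

lemma Ck_local:
 assumes "\<And>x. x \<in> S ==> \<exists>T. open T \<and> x \<in> T \<and> Ck_on k f T"
 shows "Ck_on k f S"
 using assms
proof (induction k arbitrary: f)
 case 0
 show ?case
  unfolding Ck_on.simps continuous_on_eq_continuous_within
 proof
  fix x assume "x \<in> S"
  then obtain T where "open T" "x \<in> T" "continuous_on T f" using 0 by force
  then show "continuous (at x within S) f"
   using continuous_at_imp_continuous_at_within continuous_on_eq_continuous_at by blast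
 qed
next
 case (Suc k)
 have "f differentiable_on S"
  unfolding differentiable_on_def
  by (metis Suc.prems Ck_on.simps(2) differentiable_at_withinI differentiable_on_eq_differentiable_at)
 moreover have "Ck_on k (dd v f) S" for v
  by (intro Suc.IH) (use Suc.prems in force)
 ultimately show ?case by simp
qed

lemma Ck_const [simp, intro]: "Ck_on k (\<lambda>x. c) S"
 by (induction k arbitrary: c) auto

lemma Ck_linear: "bounded_linear f ==> open S ==> Ck_on k f S"
 by (cases k) (auto intro!: Ck_SucI[of S f "\<lambda>_. f"] bounded_linear_imp_has_derivative
   simp: linear_continuous_on simp del: Ck_on.simps(2))

lemma Ck_add:
 "open S ==> Ck_on k f S ==> Ck_on k g S ==> Ck_on k (\<lambda>x. f x + g x) S"
proof (induction k arbitrary: f g)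
 case (Suc k)
 show ?case
  by (rule Ck_SucI[OF Suc.prems(1), where f'="\<lambda>x v. dd v f x + dd v g x"])
   (use Suc in \<open>auto intro!: derivative_intros Ck_deriv\<close>)
qed (auto intro: continuous_on_add)

lemma Ck_bilinear:
 assumes "bounded_bilinear b" "open S" "Ck_on k f S" "Ck_on k g S"
 shows "Ck_on k (\<lambda>x. b (f x) (g x)) S"
 using assms(3,4)
proof (induction k arbitrary: f g)
 case 0
 then show ?case by (auto intro: bounded_bilinear.continuous_on[OF assms(1)])
next
 case (Suc k)
 note fg = Ck_SucD[OF Suc.prems(1)] Ck_SucD[OF Suc.prems(2)]
 show ?case
 proof (rule Ck_SucI[OF assms(2), where f'="\<lambda>x v. b (f x) (dd v g x) + b (dd v f x) (g x)"])
  show "((\<lambda>x. b (f x) (g x)) has_derivative (\<lambda>v. b (f x) (dd v g x) + b (dd v f x) (g x))) (at x)"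
   if "x \<in> S" for x
   by (rule bounded_bilinear.FDERIV[OF assms(1)]) (use that Suc.prems assms(2) in \<open>auto intro!: Ck_deriv simp del: Ck_on.simps(2)\<close>)
 qed (use Suc.prems in \<open>intro Ck_add Suc.IH fg assms(2); simp\<close>)
qed

lemmas Ck_mult = Ck_bilinear[OF bounded_bilinear_mult]
lemmas Ck_scaleR = Ck_bilinear[OF bounded_bilinear_scaleR]
lemmas Ck_inner = Ck_bilinear[OF bounded_bilinear_inner]

lemma Ck_sum: "open S ==> (\<And>i. i \<in> I ==> Ck_on k (f i) S) ==> Ck_on k (\<lambda>x. \<Sum>i\<in>I. f i x) S"
 by (induction I rule: infinite_finite_induct) (auto intro!: Ck_add)

lemma Ck_linear_compose:
 assumes "bounded_linear h" "open S" "Ck_on k f S" shows "Ck_on k (\<lambda>x. h (f x)) S"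
 using assms(3)
proof (induction k arbitrary: f)
 case 0
 then show ?case using assms by (auto intro: bounded_linear.continuous_on)
next
 case (Suc k)
 show ?case
  by (rule Ck_SucI[OF assms(2), where f'="\<lambda>x v. h (dd v f x)"])
   (use Suc assms in \<open>auto intro!: bounded_linear.has_derivative[OF assms(1)] Ck_deriv\<close>)
qed

lemma Ck_minus: "open S ==> Ck_on k f S ==> Ck_on k (\<lambda>x. - f x) S"
 by (intro Ck_linear_compose[OF bounded_linear_minus[OF bounded_linear_ident]])

lemma Ck_diff: "open S ==> Ck_on k f S ==> Ck_on k g S ==> Ck_on k (\<lambda>x. f x - g x) S"
 using Ck_add[of S k f "\<lambda>x. - g x"] Ck_minus by fastforce

lemmas Ck_of_real = Ck_linear_compose[OF bounded_linear_of_real]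
lemmas Ck_Re = Ck_linear_compose[OF bounded_linear_Re]
lemmas Ck_cnj = Ck_linear_compose[OF bounded_linear_cnj]
lemmas Ck_fst = Ck_linear_compose[OF bounded_linear_fst]
lemmas Ck_snd = Ck_linear_compose[OF bounded_linear_snd]

lemma Ck_id: "open S ==> Ck_on k (\<lambda>x. x) S"
 by (rule Ck_linear[OF bounded_linear_ident])

lemma bounded_linear_Pair1: "bounded_linear (\<lambda>x. (x, 0))"
 by (intro bounded_linear_Pair bounded_linear_ident bounded_linear_zero)

lemma bounded_linear_Pair2: "bounded_linear (\<lambda>x. (0, x))"
 by (intro bounded_linear_Pair bounded_linear_ident bounded_linear_zero)

lemma Ck_Pair:
 assumes "open S" "Ck_on k f S" "Ck_on k g S" shows "Ck_on k (\<lambda>x. (f x, g x)) S"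
 using Ck_add[OF assms(1) Ck_linear_compose[OF bounded_linear_Pair1 assms(1,2)]
   Ck_linear_compose[OF bounded_linear_Pair2 assms(1,3)]] by simp

lemma Ck_compose:
 fixes f :: "'a::real_normed_vector => 'b::euclidean_space"
 assumes "open S" "open T" "f ` S \<subseteq> T" "Ck_on k f S" "Ck_on k g T"
 shows "Ck_on k (\<lambda>x. g (f x)) S"
 using assms(4,5)
proof (induction k arbitrary: g)
 case 0
 then show ?case using assms(3) by (auto intro: continuous_on_compose2)
next
 case (Suc k)
 have fk: "Ck_on k f S" using Suc.prems Ck_SucD by blast
 have d: "((\<lambda>x. g (f x)) has_derivative (\<lambda>v. dd (dd v f x) g (f x))) (at x)" if "x \<in> S" for x
  by (rule has_derivative_compose[OF Ck_deriv[OF assms(1) Suc.prems(1) that]])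
   (use Ck_deriv[OF assms(2) Suc.prems(2)] assms(3) that in auto)
 have e: "(\<Sum>b\<in>Basis. (dd v f x \<bullet> b) *R dd b g (f x)) = dd (dd v f x) g (f x)" if "x \<in> S" for x v
 proof -
  have l: "linear (frechet_derivative g (at (f x)))"
   using Ck_deriv[OF assms(2) Suc.prems(2)] assms(3) that has_derivative_linear by blast
  show ?thesis
   by (subst (3) euclidean_representation[symmetric])
    (simp add: linear_sum[OF l] linear_scale[OF l] o_def)
 qed
 have "Ck_on k (\<lambda>x. \<Sum>b\<in>Basis. (dd v f x \<bullet> b) *R dd b g (f x)) S" for v
  using Suc.prems fk
  by (intro Ck_sum Ck_scaleR Ck_inner Suc.IH assms(1) Ck_const) auto
 then have "Ck_on k (\<lambda>x. dd (dd v f x) g (f x)) S" for v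
  by (rule Ck_cong[OF assms(1)]) (simp add: e)
 then show ?case
  by (intro Ck_SucI[OF assms(1) d])
qed

lemma Ck_exp:
 "open S ==> Ck_on k (exp :: 'a::{euclidean_space,real_normed_field,banach} => 'a) S"
proof (induction k)
 case (Suc k)
 show ?case
  by (rule Ck_SucI[OF Suc.prems, where f'="\<lambda>x v. exp x * v"])
   (use Suc in \<open>auto intro!: Ck_mult Ck_const DERIV_exp[unfolded has_field_derivative_def]\<close>)
qed (auto intro: continuous_intros)

lemma Ck_inverse:
 "open S ==> 0 \<notin> S ==> Ck_on k (inverse :: real => real) S"
proof (induction k)
 case (Suc k)
 show ?case
  by (rule Ck_SucI[OF Suc.prems(1), where f'="\<lambda>x v. - (inverse x * v * inverse x)"])
   (use Suc in \<open>auto intro!: Ck_mult Ck_minus Ck_const has_derivative_inverse'\<close>)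
qed (auto intro!: continuous_intros)

lemma Ck_ln:
 "Ck_on k (ln :: real => real) {0<..}"
proof (cases k)
 case (Suc j)
 show ?thesis unfolding Suc
  by (rule Ck_SucI[where f'="\<lambda>x v. inverse x * v"])
   (auto intro!: Ck_mult Ck_const Ck_inverse has_derivative_ln derivative_eq_intros)
qed (auto intro!: continuous_intros)

lemma Ck_exp_compose:
 fixes f :: "'a::real_normed_vector => 'b::{euclidean_space,real_normed_field,banach}"
 shows "open S ==> Ck_on k f S ==> Ck_on k (\<lambda>x. exp (f x)) S"
 by (rule Ck_compose[of S UNIV f k exp]) (auto intro: Ck_exp)

lemma Ck_ln_compose:
 "open S ==> Ck_on k f S ==> (\<And>x. x \<in> S ==> 0 < f x) ==> Ck_on k (\<lambda>x. ln (f x) :: real) S"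
 by (rule Ck_compose[of S "{0<..}" f k ln]) (auto intro: Ck_ln)

lemma Ck_inverse_compose:
 "open S ==> Ck_on k f S ==> (\<And>x. x \<in> S ==> f x \<noteq> 0) ==> Ck_on k (\<lambda>x. inverse (f x :: real)) S"
 by (rule Ck_compose[of S "-{0}" f k inverse]) (auto intro: Ck_inverse)

lemma Ck_divide:
 "open S ==> Ck_on k f S ==> Ck_on k g S ==> (\<And>x. x \<in> S ==> g x \<noteq> 0) ==> Ck_on k (\<lambda>x. f x / g x :: real) S"
 unfolding divide_inverse by (intro Ck_mult Ck_inverse_compose)

lemma Ck_power:
 fixes f :: "'a::real_normed_vector => 'b::real_normed_field"
 shows "open S ==> Ck_on k f S ==> Ck_on k (\<lambda>x. f x ^ n) S"
 by (induction n) (auto intro: Ck_mult)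

lemma Ck_implicit:
 fixes g :: "'a::euclidean_space \<times> real => real"
 assumes "open X" "open T" "Ck_on (Suc k) g T" "continuous_on X c"
  and zero: "\<And>x. x \<in> X ==> (x, c x) \<in> T \<and> g (x, c x) = 0 \<and> dd (0, 1) g (x, c x) \<noteq> 0"
 shows "Ck_on (Suc k) c X"
proof -
 have der: "(c has_derivative (\<lambda>v. - (dd (v, 0) g (x, c x) / dd (0, 1) g (x, c x)))) (at x)" (is "(c has_derivative ?c') _")
  if x: "x \<in> X" for x
 proof -
  define D where "D = frechet_derivative g (at (x, c x))"
  have gD: "(g has_derivative D) (at (x, c x))"
   unfolding D_def using Ck_deriv[OF assms(2,3)] zero[OF x] by blast
  interpret D: bounded_linear D using gD by (rule has_derivative_bounded_linear)
  define a where "a = D (0, 1)"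
  have a: "a \<noteq> 0" using zero[OF x] by (simp add: a_def D_def)
  define c' where "c' = (\<lambda>v. - (D (v, 0) / a))"
  have Dsplit: "D (v, s) = a * (s - c' v)" for v s
  proof -
   have "D (v, s) = D ((v, 0) + s *R (0, 1))" by simp
   also have "\<dots> = D (v, 0) + s * a" unfolding D.add D.scaleR a_def by simp
   finally show ?thesis using a by (simp add: c'_def field_simps)
  qed
  have blc: "bounded_linear c'"
   unfolding c'_def
   by (intro bounded_linear_minus bounded_linear_compose[OF bounded_linear_divide]
     bounded_linear_compose[OF D.bounded_linear_axioms bounded_linear_Pair1])
  obtain B where B: "B > 0" "\<And>v. norm (c' v) \<le> norm v * B"
   using bounded_linear.pos_bounded[OF blc] by blast
  have "(c has_derivative c') (at x)"
   unfolding has_derivative_at_alt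
  proof (intro conjI blc allI impI)
   fix e :: real assume e: "0 < e"
   define e' where "e' = min (\<bar>a\<bar> / 2) (e * \<bar>a\<bar> / (2 * (1 + B)))"
   have e': "0 < e'" using a e B by (simp add: e'_def)
   have e'1: "e' \<le> \<bar>a\<bar> / 2" and e'2: "e' \<le> e * \<bar>a\<bar> / (2 * (1 + B))"
    unfolding e'_def by (rule min.cobounded1 min.cobounded2)+
   obtain d where d: "d > 0" "\<And>y. norm (y - (x, c x)) < d ==>
     norm (g y - g (x, c x) - D (y - (x, c x))) \<le> e' * norm (y - (x, c x))"
    using gD e' unfolding has_derivative_at_alt by metis
   have "isCont c x" using assms(1,4) x continuous_on_eq_continuous_at by blast
   then have "isCont (\<lambda>y. (y, c y)) x" by (intro continuous_Pair continuous_ident)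
   then obtain d' where d': "d' > 0" "\<And>y. dist y x < d' ==> dist (y, c y) (x, c x) < d"
    using d(1) unfolding continuous_at_eps_delta by (metis dist_commute)
   obtain d'' where d'': "d'' > 0" "ball x d'' \<subseteq> X" using assms(1) x open_contains_ball by blast
   show "\<exists>d>0. \<forall>y. norm (y - x) < d \<longrightarrow> norm (c y - c x - c' (y - x)) \<le> e * norm (y - x)"
   proof (intro exI[of _ "min d' d''"] conjI allI impI)
    fix y assume y: "norm (y - x) < min d' d''"
    let ?h = "norm (y - x)" and ?k = "\<bar>c y - c x\<bar>" and ?r = "\<bar>c y - c x - c' (y - x)\<bar>"
    have "y \<in> X" using y d'' by (auto simp: dist_norm norm_minus_commute subset_iff)
    then have "g (y, c y) = 0" "g (x, c x) = 0" using zero x by auto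
    with d(2)[of "(y, c y)"] d'(2)[of y] y have "\<bar>D (y - x, c y - c x)\<bar> \<le> e' * norm (y - x, c y - c x)"
     by (simp add: dist_norm)
    also have "norm (y - x, c y - c x) \<le> ?h + ?k"
     by (metis norm_Pair_le real_norm_def)
    finally have 1: "\<bar>a\<bar> * ?r \<le> e' * (?h + ?k)"
     using e' by (simp add: Dsplit abs_mult mult_left_mono)
    have "?k \<le> ?r + ?h * B" using B(2)[of "y - x"] by simp
    then have "e' * (?h + ?k) \<le> e' * (?r + ?h * (1 + B))"
     using e' by (intro mult_left_mono) (auto simp: algebra_simps)
    also have "\<dots> \<le> \<bar>a\<bar> / 2 * ?r + e * \<bar>a\<bar> / (2 * (1 + B)) * (?h * (1 + B))"
     unfolding distrib_left[of e' "?r" "?h * (1 + B)"] by (intro add_mono mult_right_mono e'1 e'2) (use B in auto)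
    also have "\<dots> = \<bar>a\<bar> / 2 * ?r + e * \<bar>a\<bar> / 2 * ?h" using B by (simp add: field_simps)
    finally have "\<bar>a\<bar> * ?r \<le> \<bar>a\<bar> / 2 * ?r + e * \<bar>a\<bar> / 2 * ?h" using 1 by linarith
    then have "\<bar>a\<bar> * ?r \<le> \<bar>a\<bar> * (e * ?h)" by (simp add: field_simps)
    then show "norm (c y - c x - c' (y - x)) \<le> e * norm (y - x)" using a by simp
   qed (use d' d'' in auto)
  qed
  then show ?thesis by (simp add: c'_def a_def D_def)
 qed
 show ?thesis
  using assms(3)
 proof (induction k)
  case 0
  have comp: "Ck_on 0 (\<lambda>x. dd v g (x, c x)) X" for v
  proof -
   have "continuous_on T (dd v g)" using Ck_continuous[OF Ck_dd[OF 0]] .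
   then show ?thesis
    unfolding Ck_on.simps
    by (rule continuous_on_compose2[OF _ continuous_on_Pair[OF continuous_on_id assms(4)]]) (use zero in auto)
  qed
  show ?case
   by (rule Ck_SucI[OF assms(1) der]) (auto intro!: Ck_minus Ck_divide comp assms(1) zero[THEN conjunct2, THEN conjunct2] simp del: Ck_on.simps)
 next
  case (Suc k)
  have c: "Ck_on (Suc k) c X" using Suc Ck_SucD by blast
  have comp: "Ck_on (Suc k) (\<lambda>x. dd v g (x, c x)) X" for v
   by (rule Ck_compose[of X T "\<lambda>x. (x, c x)"])
    (use Suc zero assms c in \<open>auto intro!: Ck_Pair Ck_id simp del: Ck_on.simps(2) intro: Ck_dd\<close>)
  show ?case
   by (rule Ck_SucI[OF assms(1) der])
    (auto intro!: Ck_minus Ck_divide comp assms(1) zero[THEN conjunct2, THEN conjunct2] simp del: Ck_on.simps)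
 qed
qed

lemma set_integrable_compact:
 fixes f :: "'a::euclidean_space => 'b::{banach, second_countable_topology}"
 shows "compact K ==> continuous_on K f ==> set_integrable lborel K f"
 unfolding set_integrable_def by (rule borel_integrable_compact)

lemma norm_set_integral_le:
 fixes f :: "'a::euclidean_space => 'b::{banach, second_countable_topology}"
 assumes "compact K" "continuous_on K f" "\<And>x. x \<in> K ==> norm (f x) \<le> B"
 shows "norm (LINT x:K|lborel. f x) \<le> measure lborel K * B"
proof -
 have "norm (LINT x:K|lborel. f x) \<le> (LINT x:K|lborel. norm (f x))"
  by (rule set_integral_norm_bound[OF set_integrable_compact[OF assms(1,2)]])
 also have "\<dots> \<le> (LINT x:K|lborel. B)"
  by (intro set_integral_mono set_integrable_compact assms continuous_intros)
 also have "\<dots> = measure lborel K * B"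
  using assms(1) by (simp add: set_lebesgue_integral_def compact_imp_closed borel_closed)
 finally show ?thesis .
qed

lemma has_derivative_integral_compact:
 fixes F :: "'a::euclidean_space \<times> 'b::euclidean_space => 'c::{banach, second_countable_topology}"
 assumes "open U" "open T" "compact K" "U \<times> K \<subseteq> T" "Ck_on (Suc k) F T" "t0 \<in> U"
 shows "((\<lambda>t. LINT x:K|lborel. F (t, x)) has_derivative (\<lambda>v. LINT x:K|lborel. dd (v, 0) F (t0, x))) (at t0)"
proof -
 have lin: "linear (frechet_derivative F (at (t, x)))" if "t \<in> U" "x \<in> K" for t x
  using Ck_deriv[OF assms(2,5), of "(t, x)"] that assms(4) has_derivative_linear by blast
 have contF: "continuous_on K (\<lambda>x. F (t, x))" if "t \<in> U" for t
  by (rule continuous_on_compose2[OF Ck_continuous[OF assms(5)]])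
   (use that assms in \<open>auto intro!: continuous_intros\<close>)
 have contd: "continuous_on (U \<times> K) (dd v F)" for v
  using continuous_on_subset[OF Ck_continuous[OF Ck_dd[OF assms(5)]] assms(4)] .
 have contD: "continuous_on K (\<lambda>x. dd v F (t, x))" if "t \<in> U" for t v
  by (rule continuous_on_compose2[OF contd[of v]])
   (use that in \<open>auto intro!: continuous_intros\<close>)
 have exp: "dd (v, 0) F (t, x) = (\<Sum>b\<in>Basis. (v \<bullet> b) *R dd (b, 0) F (t, x))" if "t \<in> U" "x \<in> K" for v t x
 proof -
  have v: "(v, 0) = (\<Sum>b\<in>Basis. (v \<bullet> b) *R (b, 0::'b))"
   by (simp add: prod_eq_iff fst_sum snd_sum euclidean_representation)
  show ?thesis
   unfolding v by (simp only: linear_sum[OF lin[OF that]] linear_scale[OF lin[OF that]])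
 qed
 let ?L = "\<lambda>v. LINT x:K|lborel. dd (v, 0) F (t0, x)"
 have Lexp: "?L v = (\<Sum>b\<in>Basis. (v \<bullet> b) *R ?L b)" for v
 proof -
  have "?L v = (LINT x:K|lborel. (\<Sum>b\<in>Basis. (v \<bullet> b) *R dd (b, 0) F (t0, x)))"
   by (rule set_lebesgue_integral_cong) (use assms exp in \<open>auto simp: compact_imp_closed borel_closed\<close>)
  also have "\<dots> = (\<Sum>b\<in>Basis. (LINT x:K|lborel. (v \<bullet> b) *R dd (b, 0) F (t0, x)))"
   unfolding set_lebesgue_integral_def scaleR_sum_right
   by (rule Bochner_Integration.integral_sum)
    (rule set_integrable_compact[OF assms(3), unfolded set_integrable_def]; intro continuous_intros contD[OF assms(6)])
  also have "\<dots> = (\<Sum>b\<in>Basis. (v \<bullet> b) *R ?L b)"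
   by (intro sum.cong) (auto simp: set_integral_scaleR_right)
  finally show ?thesis .
 qed
 have bl: "bounded_linear ?L"
  by (subst Lexp) (intro bounded_linear_sum bounded_linear_scaleR_left[THEN bounded_linear_compose] bounded_linear_inner_left)
 show ?thesis
  unfolding has_derivative_at_alt
 proof (intro conjI bl allI impI)
  fix e :: real assume e: "0 < e"
  define e' where "e' = e / (measure lborel K + 1)"
  have pos: "measure lborel K + 1 > 0" by (rule add_nonneg_pos[OF measure_nonneg zero_less_one])
  define e2 where "e2 = e' / real DIM('a)"
  have e': "0 < e'" "0 < e2" using e pos unfolding e'_def e2_def by (auto intro!: divide_pos_pos mult_pos_pos simp del: divide_divide_eq_left)
  have "\<exists>X. t0 \<in> X \<and> open X \<and> (\<forall>t\<in>X \<inter> U. \<forall>x\<in>K. dist (dd (b, 0) F (t, x)) (dd (b, 0) F (t0, x)) \<le> e2)" for b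
   using continuous_on_prod_compactE[OF contd assms(3,6) e'(2)] by metis
  then obtain X where X: "\<And>b. t0 \<in> X b" "\<And>b. open (X b)"
   "\<And>b t x. t \<in> X b ==> t \<in> U ==> x \<in> K ==> dist (dd (b, 0) F (t, x)) (dd (b, 0) F (t0, x)) \<le> e2"
   by (metis IntI)
  have "open (U \<inter> (\<Inter>b\<in>Basis. X b))" using assms(1) X(2) by (intro open_Int open_INT) auto
  then obtain d where d: "d > 0" "ball t0 d \<subseteq> U \<inter> (\<Inter>b\<in>Basis. X b)"
   using X(1) assms(6) open_contains_ball by (metis INT_I IntI)
  show "\<exists>d>0. \<forall>t. norm (t - t0) < d \<longrightarrow>
    norm ((LINT x:K|lborel. F (t, x)) - (LINT x:K|lborel. F (t0, x)) - ?L (t - t0)) \<le> e * norm (t - t0)"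
  proof (intro exI[of _ d] conjI d(1) allI impI)
   fix t assume t: "norm (t - t0) < d"
   have tb: "t \<in> ball t0 d" using t by (simp add: dist_norm norm_minus_commute)
   then have tU: "t \<in> U" using d(2) by auto
   have pt: "norm (F (t, x) - F (t0, x) - dd (t - t0, 0) F (t0, x)) \<le> norm (t - t0) * e'" if x: "x \<in> K" for x
   proof (rule differentiable_bound_linearization[of t0 t "ball t0 d" "\<lambda>t. F (t, x)" "\<lambda>s v. dd (v, 0) F (s, x)" t0 e'])
    show "t0 + u *R (t - t0) \<in> ball t0 d" if "u \<in> {0..1}" for u
    proof -
     have "\<bar>u\<bar> * norm (t - t0) \<le> 1 * norm (t - t0)" using that by (intro mult_right_mono) auto
     then show ?thesis using t by (simp add: dist_norm)
    qed
    show "((\<lambda>t. F (t, x)) has_derivative (\<lambda>v. dd (v, 0) F (s, x))) (at s within ball t0 d)" if "s \<in> ball t0 d" for s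
    proof (rule has_derivative_at_withinI)
     have "(F has_derivative frechet_derivative F (at (s, x))) (at (s, x))"
      using Ck_deriv[OF assms(2,5)] d(2) that x assms(4) by blast
     moreover have "((\<lambda>t. (t, x)) has_derivative (\<lambda>v. (v, 0))) (at s)"
      by (auto intro!: derivative_eq_intros)
     ultimately show "((\<lambda>t. F (t, x)) has_derivative (\<lambda>v. dd (v, 0) F (s, x))) (at s)"
      using has_derivative_compose by fastforce
    qed
    show "onorm ((\<lambda>v. dd (v, 0) F (s, x)) - (\<lambda>v. dd (v, 0) F (t0, x))) \<le> e'" if s: "s \<in> ball t0 d" for s
     unfolding fun_diff_def
    proof (rule onorm_bound)
     fix v :: 'a
     have sU: "s \<in> U" using s d(2) by auto
     have "dd (v, 0) F (s, x) - dd (v, 0) F (t0, x)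
       = (\<Sum>b\<in>Basis. (v \<bullet> b) *R (dd (b, 0) F (s, x) - dd (b, 0) F (t0, x)))"
      by (simp add: exp[OF sU x, of v] exp[OF assms(6) x, of v] sum_subtractf scaleR_diff_right)
     also have "norm \<dots> \<le> (\<Sum>b\<in>(Basis :: 'a set). norm v * e2)"
     proof (rule sum_norm_le)
      fix b :: 'a assume b: "b \<in> Basis"
      have "dist (dd (b, 0) F (s, x)) (dd (b, 0) F (t0, x)) \<le> e2"
       using s d(2) b by (intro X(3) x) auto
      then show "norm ((v \<bullet> b) *R (dd (b, 0) F (s, x) - dd (b, 0) F (t0, x))) \<le> norm v * e2"
       using Basis_le_norm[OF b, of v] by (simp add: dist_norm mult_mono)
     qed
     also have "\<dots> = e' * norm v" by (simp add: e2_def)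
     finally show "norm (dd (v, 0) F (s, x) - dd (v, 0) F (t0, x)) \<le> e' * norm v" .
    qed (use e' in simp)
    show "t0 \<in> ball t0 d" using d by simp
   qed
   have "(LINT x:K|lborel. F (t, x)) - (LINT x:K|lborel. F (t0, x)) - ?L (t - t0)
     = (LINT x:K|lborel. F (t, x) - F (t0, x) - dd (t - t0, 0) F (t0, x))"
    using set_integrable_compact[OF assms(3) contF[OF tU]] set_integrable_compact[OF assms(3) contF[OF assms(6)]]
     set_integrable_compact[OF assms(3) contD[OF assms(6)]]
    by (simp add: set_integral_diff)
   also have "norm \<dots> \<le> measure lborel K * (norm (t - t0) * e')"
    by (intro norm_set_integral_le assms(3) pt continuous_intros contF contD tU assms(6))
   also have "\<dots> \<le> (measure lborel K + 1) * (norm (t - t0) * e')"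
    using e' by (intro mult_right_mono) auto
   also have "\<dots> = e * norm (t - t0)"
    unfolding e'_def by (simp add: add_nonneg_eq_0_iff)
   finally show "norm ((LINT x:K|lborel. F (t, x)) - (LINT x:K|lborel. F (t0, x)) - ?L (t - t0)) \<le> e * norm (t - t0)" .
  qed
 qed
qed

lemma Ck_integral:
 fixes F :: "'a::euclidean_space \<times> 'b::euclidean_space => 'c::{banach, second_countable_topology}"
 assumes "open U" "open T" "compact K" "U \<times> K \<subseteq> T" "Ck_on k F T"
 shows "Ck_on k (\<lambda>t. LINT x:K|lborel. F (t, x)) U"
 using assms(5)
proof (induction k arbitrary: F)
 case 0
 have c: "continuous_on (U \<times> K) F" using 0 assms(4) by (auto intro: continuous_on_subset)
 have cK: "continuous_on K (\<lambda>x. F (t, x))" if "t \<in> U" for t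
  by (rule continuous_on_compose2[OF c]) (use that in \<open>auto intro!: continuous_intros\<close>)
 show ?case
  unfolding Ck_on.simps continuous_on_iff
 proof (intro ballI allI impI)
  fix t0 and e :: real assume t0: "t0 \<in> U" and e: "0 < e"
  define e' where "e' = e / (measure lborel K + 1) / 2"
  have pos: "measure lborel K + 1 > 0" by (rule add_nonneg_pos[OF measure_nonneg zero_less_one])
  have e': "0 < e'" using e pos unfolding e'_def by (intro divide_pos_pos) auto
  obtain X where X: "t0 \<in> X" "open X" "\<forall>t\<in>X \<inter> U. \<forall>x\<in>K. dist (F (t, x)) (F (t0, x)) \<le> e'"
   using continuous_on_prod_compactE[OF c assms(3) t0 e'] by metis
  obtain d where d: "d > 0" "ball t0 d \<subseteq> X" using X open_contains_ball by blast
  show "\<exists>d>0. \<forall>t\<in>U. dist t t0 < d \<longrightarrow> dist (LINT x:K|lborel. F (t, x)) (LINT x:K|lborel. F (t0, x)) < e"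
  proof (intro exI[of _ d] conjI d(1) ballI impI)
   fix t assume t: "t \<in> U" "dist t t0 < d"
   have "(LINT x:K|lborel. F (t, x)) - (LINT x:K|lborel. F (t0, x)) = (LINT x:K|lborel. F (t, x) - F (t0, x))"
    using set_integrable_compact[OF assms(3) cK[OF t(1)]] set_integrable_compact[OF assms(3) cK[OF t0]]
    by simp
   also have "norm \<dots> \<le> measure lborel K * e'"
    by (rule norm_set_integral_le[OF assms(3)])
     (use X(3) t t0 d in \<open>auto intro!: continuous_intros cK simp: dist_norm norm_minus_commute[of t0] subset_iff\<close>)
   also have "\<dots> \<le> (measure lborel K + 1) * e'"
    using e' by (intro mult_right_mono) auto
   also have "\<dots> = e / 2" using pos unfolding e'_def by (metis less_numeral_extra(3) nonzero_mult_div_cancel_left times_divide_eq_left times_divide_eq_right mult.commute)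
   also have "\<dots> < e" using e by simp
   finally show "dist (LINT x:K|lborel. F (t, x)) (LINT x:K|lborel. F (t0, x)) < e" by (simp add: dist_norm)
  qed
 qed
next
 case (Suc k)
 show ?case
  by (rule Ck_SucI[OF assms(1) has_derivative_integral_compact[OF assms(1-4) Suc.prems]])
   (use Suc in auto)
qed

lemma dd_line_derivative:
 fixes g :: "'a::real_normed_vector => real"
 assumes S: "open S" and g: "Ck_on (Suc k) g S" and s: "x + s *R V \<in> S"
 shows "((\<lambda>s. g (x + s *R V)) has_real_derivative dd V g (x + s *R V)) (at s)"
proof -
 note d = Ck_deriv[OF S g s]
 have "((\<lambda>s. g (x + s *R V)) has_derivative (\<lambda>h. dd (h *R V) g (x + s *R V))) (at s)"
  by (rule has_derivative_compose[of "\<lambda>s. x + s *R V" "\<lambda>h. h *R V" _ _ g, OF _ d])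
   (auto intro!: derivative_eq_intros)
 moreover have "dd (h *R V) g (x + s *R V) = dd V g (x + s *R V) * h" for h
  using linear_scale[OF has_derivative_linear[OF d]] by simp
 ultimately show ?thesis by (simp add: has_field_derivative_def)
qed

lemma Ck_2: "Ck_on 2 f S ==> Ck_on (Suc (Suc 0)) f S"
 by (simp only: numeral_2_eq_2)

lemma dd_commute_real:
 fixes f :: "'a::real_normed_vector => real"
 assumes "open S" "Ck_on 2 f S" "x \<in> S"
 shows "dd v (dd w f) x = dd w (dd v f) x"
proof (rule ccontr)
 assume ne: "dd v (dd w f) x \<noteq> dd w (dd v f) x"
 define e where "e = \<bar>dd v (dd w f) x - dd w (dd v f) x\<bar> / 2"
 have e: "e > 0" using ne by (simp add: e_def)
 note C2 = Ck_2[OF assms(2)]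
 have C1: "Ck_on (Suc 0) (dd u f) S" for u using C2 Ck_dd by blast
 have C0: "isCont (dd u (dd u' f)) x" for u u'
  using Ck_continuous[OF Ck_dd[OF C1]] assms continuous_on_eq_continuous_at by blast
 have ex: "\<exists>d>0. \<forall>y. dist y x < d \<longrightarrow> \<bar>dd u (dd u' f) y - dd u (dd u' f) x\<bar> < e" for u u'
  using C0[of u' u] unfolding continuous_at_eps_delta dist_real_def using e by (elim allE[of _ e]) simp
 obtain d1 where d1: "d1 > 0" "\<forall>y. dist y x < d1 \<longrightarrow> \<bar>dd v (dd w f) y - dd v (dd w f) x\<bar> < e"
  using ex[where u=v and u'=w] by (elim exE conjE)
 obtain d2 where d2: "d2 > 0" "\<forall>y. dist y x < d2 \<longrightarrow> \<bar>dd w (dd v f) y - dd w (dd v f) x\<bar> < e"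
  using ex[where u=w and u'=v] by (elim exE conjE)
 obtain d3 where d3: "d3 > 0" "ball x d3 \<subseteq> S" using openE[OF assms(1,3)] by metis
 define d where "d = min d1 (min d2 d3)"
 define h where "h = d / (norm v + norm w + 1) / 2"
 have nn: "norm v + norm w + 1 > 0" by (intro add_nonneg_pos add_nonneg_nonneg) auto
 have d0: "d > 0" using d1 d2 d3 by (simp add: d_def)
 have h: "h > 0" unfolding h_def using d0 nn by simp
 have hb: "h * (norm v + norm w) < d"
 proof -
  have "h * (norm v + norm w) \<le> h * (norm v + norm w + 1)" using h by (intro mult_left_mono) auto
  also have "\<dots> = d / 2" using nn unfolding h_def by (simp only: times_divide_eq_left nonzero_eq_divide_eq less_imp_neq[symmetric]) simp
  finally show ?thesis using d0 by linarith
 qed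
 have near: "dist (x + s *R v' + t *R w') x < d" if "0 \<le> s" "s \<le> h" "0 \<le> t" "t \<le> h" "norm v' + norm w' = norm v + norm w" for s t v' w'
 proof -
  have "norm (s *R v' + t *R w') \<le> s * norm v' + t * norm w'"
   using norm_triangle_ineq[of "s *R v'" "t *R w'"] that by simp
  also have "\<dots> \<le> h * norm v' + h * norm w'" using that by (intro add_mono mult_right_mono) auto
  finally show ?thesis using hb that by (simp add: dist_norm distrib_left[symmetric])
 qed
 have key: "\<exists>y. dist y x < d \<and> f (x + h *R v' + h *R w') - f (x + h *R v') - f (x + h *R w') + f x = h * h * dd w' (dd v' f) y"
  if vw: "norm v' + norm w' = norm v + norm w" for v' w'
 proof -
  let ?g = "\<lambda>s. f (x + h *R w' + s *R v') - f (x + s *R v')"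
  have inS: "x + s *R v' + t *R w' \<in> S" if "0 \<le> s" "s \<le> h" "0 \<le> t" "t \<le> h" for s t
   using near[OF that vw] d3 by (auto simp: d_def dist_commute subset_iff)
  have "(?g has_real_derivative (dd v' f (x + h *R w' + s *R v') - dd v' f (x + s *R v'))) (at s)" if "0 \<le> s" "s \<le> h" for s
   using inS[of s h] inS[of s 0] that h Ck_SucD[OF C2]
   by (intro DERIV_diff dd_line_derivative[OF assms(1) Ck_SucD[OF C2]]) (auto simp: algebra_simps)
  from MVT2[OF h this] obtain s where s: "0 < s" "s < h"
   "?g h - ?g 0 = (h - 0) * (dd v' f (x + h *R w' + s *R v') - dd v' f (x + s *R v'))" by auto
  have "((\<lambda>t. dd v' f (x + s *R v' + t *R w')) has_real_derivative dd w' (dd v' f) (x + s *R v' + t *R w')) (at t)" if "0 \<le> t" "t \<le> h" for t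
   using inS[of s t] that s by (intro dd_line_derivative[OF assms(1) C1]) auto
  from MVT2[OF h this] obtain t where t: "0 < t" "t < h"
   "dd v' f (x + s *R v' + h *R w') - dd v' f (x + s *R v' + 0 *R w') = (h - 0) * dd w' (dd v' f) (x + s *R v' + t *R w')"
   by auto
  show ?thesis
   using near[of s t v' w'] s t vw
   by (intro exI[of _ "x + s *R v' + t *R w'"]) (auto simp: algebra_simps)
 qed
 obtain y1 where y1: "dist y1 x < d" "f (x + h *R v + h *R w) - f (x + h *R v) - f (x + h *R w) + f x = h * h * dd w (dd v f) y1"
  using key[of v w] by auto
 obtain y2 where y2: "dist y2 x < d" "f (x + h *R w + h *R v) - f (x + h *R w) - f (x + h *R v) + f x = h * h * dd v (dd w f) y2"
  using key[of w v] by auto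
 have "h * h * dd w (dd v f) y1 = h * h * dd v (dd w f) y2"
  using y1(2) y2(2) by (simp add: algebra_simps)
 then have "dd w (dd v f) y1 = dd v (dd w f) y2" using h by simp
 moreover have "\<bar>dd w (dd v f) y1 - dd w (dd v f) x\<bar> < e" using y1 d2 by (simp add: d_def)
 moreover have "\<bar>dd v (dd w f) y2 - dd v (dd w f) x\<bar> < e" using y2 d1 by (simp add: d_def)
 ultimately show False unfolding e_def by argo
qed

lemma dd_linear_compose:
 assumes "bounded_linear h" "open S" "Ck_on (Suc k) f S" "x \<in> S"
 shows "dd v (\<lambda>x. h (f x)) x = h (dd v f x)"
 by (rule dd_eq[OF bounded_linear.has_derivative[OF assms(1) Ck_deriv[OF assms(2-4)]]])

lemma dd_commute:
 fixes f :: "'a::real_normed_vector => 'b::euclidean_space"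
 assumes "open S" "Ck_on 2 f S" "x \<in> S"
 shows "dd v (dd w f) x = dd w (dd v f) x"
proof (rule euclidean_eqI)
 fix b :: 'b assume "b \<in> Basis"
 note C2 = Ck_2[OF assms(2)]
 have bl: "bounded_linear (\<lambda>y. y \<bullet> b)" by (rule bounded_linear_inner_left)
 have *: "dd u (dd u' f) x \<bullet> b = dd u (dd u' (\<lambda>x. f x \<bullet> b)) x" for u u'
 proof -
  have "dd u (dd u' f) x \<bullet> b = dd u (\<lambda>x. dd u' f x \<bullet> b) x"
   by (rule dd_linear_compose[OF bl assms(1) Ck_dd[OF C2] assms(3), symmetric])
  also have "\<dots> = dd u (dd u' (\<lambda>x. f x \<bullet> b)) x"
   by (rule dd_cong[OF assms(1,3)]) (rule dd_linear_compose[OF bl assms(1) C2, symmetric])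
  finally show ?thesis .
 qed
 show "dd v (dd w f) x \<bullet> b = dd w (dd v f) x \<bullet> b"
  unfolding * by (rule dd_commute_real[OF assms(1) _ assms(3)]) (intro Ck_linear_compose[OF bl] assms)
qed

lemma dd_linear:
 assumes "open S" "Ck_on (Suc k) f S" "x \<in> S"
 shows "linear (\<lambda>v. dd v f x)"
 using has_derivative_linear[OF Ck_deriv[OF assms]] .

lemma dd_const [simp]: "dd v (\<lambda>x. c) x = 0"
 by simp

lemma dd_add:
 assumes "open S" "Ck_on (Suc k) f S" "Ck_on (Suc k) g S" "x \<in> S"
 shows "dd v (\<lambda>x. f x + g x) x = dd v f x + dd v g x"
 by (rule dd_eq, rule has_derivative_add[OF Ck_deriv[OF assms(1,2,4)] Ck_deriv[OF assms(1,3,4)]])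

lemma dd_bilinear:
 assumes "bounded_bilinear b" "open S" "Ck_on (Suc k) f S" "Ck_on (Suc k) g S" "x \<in> S"
 shows "dd v (\<lambda>x. b (f x) (g x)) x = b (f x) (dd v g x) + b (dd v f x) (g x)"
 by (rule dd_eq, rule bounded_bilinear.FDERIV[OF assms(1) Ck_deriv[OF assms(2,3,5)] Ck_deriv[OF assms(2,4,5)]])

lemma dd_sum:
 assumes "open S" "\<And>i. i \<in> I ==> Ck_on (Suc k) (f i) S" "x \<in> S"
 shows "dd v (\<lambda>x. \<Sum>i\<in>I. f i x) x = (\<Sum>i\<in>I. dd v (f i) x)"
 by (rule dd_eq, rule has_derivative_sum) (use Ck_deriv[OF assms(1,2,3)] in auto)

lemma dd_exp_minus:
 assumes "open S" "Ck_on (Suc k) P S" "x \<in> S"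
 shows "dd v (\<lambda>x. complex_of_real (exp (- P x))) x = - complex_of_real (dd v P x) * complex_of_real (exp (- P x))"
 by (rule dd_eq) (auto intro!: derivative_eq_intros Ck_deriv[OF assms])

lemma wirtinger_cong:
 assumes "open S" "x \<in> S" "\<And>y. y \<in> S ==> f y = g y"
 shows "wirtinger e f x = wirtinger e g x" "wirtinger_bar e f x = wirtinger_bar e g x"
 unfolding wirtinger_def wirtinger_bar_def by (simp_all only: dd_cong[OF assms])

lemma Ck_wirtinger:
 assumes "open S" "Ck_on (Suc k) f S"
 shows "Ck_on k (wirtinger e f) S" "Ck_on k (wirtinger_bar e f) S"
proof -
 note d = Ck_dd[OF assms(2)] and [intro] = assms(1)
 show "Ck_on k (wirtinger e f) S"
  unfolding wirtinger_def[abs_def] divide_inverse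
  by (intro Ck_mult Ck_diff d Ck_const assms(1))
 show "Ck_on k (wirtinger_bar e f) S"
  unfolding wirtinger_bar_def[abs_def] divide_inverse
  by (intro Ck_mult Ck_add d Ck_const assms(1))
qed

lemma wirtinger_const [simp]: "wirtinger e (\<lambda>x. c) x = 0" "wirtinger_bar e (\<lambda>x. c) x = 0"
 by (simp_all add: wirtinger_def wirtinger_bar_def)

lemma wirtinger_add:
 assumes "open S" "Ck_on (Suc k) f S" "Ck_on (Suc k) g S" "x \<in> S"
 shows "wirtinger e (\<lambda>x. f x + g x) x = wirtinger e f x + wirtinger e g x"
  "wirtinger_bar e (\<lambda>x. f x + g x) x = wirtinger_bar e f x + wirtinger_bar e g x"
 unfolding wirtinger_def wirtinger_bar_def by (simp_all add: dd_add[OF assms] field_simps)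

lemma wirtinger_mult:
 assumes "open S" "Ck_on (Suc k) f S" "Ck_on (Suc k) g S" "x \<in> S"
 shows "wirtinger e (\<lambda>x. f x * g x) x = wirtinger e f x * g x + f x * wirtinger e g x"
  "wirtinger_bar e (\<lambda>x. f x * g x) x = wirtinger_bar e f x * g x + f x * wirtinger_bar e g x"
 unfolding wirtinger_def wirtinger_bar_def by (simp_all add: dd_bilinear[OF bounded_bilinear_mult assms] field_simps)

lemma wirtinger_cmult:
 assumes "open S" "Ck_on (Suc k) f S" "x \<in> S"
 shows "wirtinger e (\<lambda>x. c * f x) x = c * wirtinger e f x"
  "wirtinger_bar e (\<lambda>x. c * f x) x = c * wirtinger_bar e f x"
 using wirtinger_mult[OF assms(1) Ck_const[of "Suc k" c] assms(2,3)] by simp_all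

lemma wirtinger_minus:
 assumes "open S" "Ck_on (Suc k) f S" "x \<in> S"
 shows "wirtinger e (\<lambda>x. - f x) x = - wirtinger e f x"
  "wirtinger_bar e (\<lambda>x. - f x) x = - wirtinger_bar e f x"
 using wirtinger_cmult[OF assms, of e "-1"] by simp_all

lemma wirtinger_diff:
 assumes "open S" "Ck_on (Suc k) f S" "Ck_on (Suc k) g S" "x \<in> S"
 shows "wirtinger e (\<lambda>x. f x - g x) x = wirtinger e f x - wirtinger e g x"
  "wirtinger_bar e (\<lambda>x. f x - g x) x = wirtinger_bar e f x - wirtinger_bar e g x"
 using wirtinger_add[OF assms(1,2) Ck_minus[OF assms(1,3)] assms(4)] wirtinger_minus[OF assms(1,3,4)] by simp_all

lemma wirtinger_sum:
 assumes "open S" "\<And>i. i \<in> I ==> Ck_on (Suc k) (f i) S" "x \<in> S"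
 shows "wirtinger e (\<lambda>x. \<Sum>i\<in>I. f i x) x = (\<Sum>i\<in>I. wirtinger e (f i) x)" (is ?g1)
  "wirtinger_bar e (\<lambda>x. \<Sum>i\<in>I. f i x) x = (\<Sum>i\<in>I. wirtinger_bar e (f i) x)" (is ?g2)
proof -
 have *: "dd v (\<lambda>x. \<Sum>i\<in>I. f i x) x = (\<Sum>i\<in>I. dd v (f i) x)" for v
  by (rule dd_sum[OF assms])
 show ?g1
  ?g2
  unfolding wirtinger_def wirtinger_bar_def *
  by (simp_all add: sum_distrib_left sum.distrib sum_subtractf sum_divide_distrib[symmetric])
qed

lemma wirtinger_cnj:
 assumes "open S" "Ck_on (Suc k) f S" "x \<in> S"
 shows "wirtinger e (\<lambda>x. cnj (f x)) x = cnj (wirtinger_bar e f x)"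
  "wirtinger_bar e (\<lambda>x. cnj (f x)) x = cnj (wirtinger e f x)"
 unfolding wirtinger_def wirtinger_bar_def dd_linear_compose[OF bounded_linear_cnj assms] by simp_all

lemma wirtinger_of_real:
 assumes "open S" "Ck_on (Suc k) P S" "x \<in> S"
 shows "wirtinger e (\<lambda>x. complex_of_real (P x)) x = cnj (wirtinger_bar e (\<lambda>x. complex_of_real (P x)) x)"
 using wirtinger_cnj(1)[OF assms(1) Ck_of_real[OF assms(1,2)] assms(3), of e] by simp

lemma wirtinger_exp_minus:
 assumes "open S" "Ck_on (Suc k) P S" "x \<in> S"
 shows "wirtinger e (\<lambda>x. complex_of_real (exp (- P x))) x
   = - wirtinger e (\<lambda>x. complex_of_real (P x)) x * complex_of_real (exp (- P x))"
  "wirtinger_bar e (\<lambda>x. complex_of_real (exp (- P x))) x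
   = - wirtinger_bar e (\<lambda>x. complex_of_real (P x)) x * complex_of_real (exp (- P x))"
 unfolding wirtinger_def wirtinger_bar_def dd_exp_minus[OF assms] dd_linear_compose[OF bounded_linear_of_real assms]
 by (simp_all add: field_simps)

lemma wirtinger_commute:
 assumes "open S" "Ck_on 2 f S" "x \<in> S"
 shows "wirtinger e (wirtinger_bar e' f) x = wirtinger_bar e' (wirtinger e f) x" (is ?g1)
  "wirtinger e (wirtinger e' f) x = wirtinger e' (wirtinger e f) x" (is ?g2)
  "wirtinger_bar e (wirtinger_bar e' f) x = wirtinger_bar e' (wirtinger_bar e f) x" (is ?g3)
proof -
 note C2 = Ck_2[OF assms(2)]
 have A: "dd v (\<lambda>x. (dd a f x + c * dd b f x) / 2) x = (dd v (dd a f) x + c * dd v (dd b f) x) / 2" for v a b c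
 proof -
  have 1: "Ck_on (Suc 0) (\<lambda>x. c * dd b f x) S"
   by (intro Ck_mult assms(1) Ck_const Ck_dd[OF C2])
  have "dd v (\<lambda>x. (dd a f x + c * dd b f x) / 2) x = dd v (\<lambda>x. dd a f x + c * dd b f x) x / 2"
   by (rule dd_linear_compose[OF bounded_linear_divide assms(1) _ assms(3), where k=0])
    (intro Ck_add assms(1) Ck_dd[OF C2] 1)
  then show ?thesis
   by (simp add: dd_add[OF assms(1) Ck_dd[OF C2] 1 assms(3)]
     dd_bilinear[OF bounded_bilinear_mult assms(1) Ck_const Ck_dd[OF C2] assms(3)])
 qed
 have A': "dd v (\<lambda>x. (dd a f x - \<i> * dd b f x) / 2) x = (dd v (dd a f) x - \<i> * dd v (dd b f) x) / 2" for v a b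
  using A[where c="-\<i>"] by (simp only: mult_minus_left add_uminus_conv_diff)
 note B = A' A[where c="\<i>"]
 note s = dd_commute[OF assms]
 show ?g1
  unfolding wirtinger_def[abs_def] wirtinger_bar_def[abs_def] B s[of "e 1"] s[of "e \<i>"]
  by (simp add: field_simps)
 show ?g2
  unfolding wirtinger_def[abs_def] wirtinger_bar_def[abs_def] B s[of "e 1"] s[of "e \<i>"]
  by (simp add: field_simps)
 show ?g3
  unfolding wirtinger_def[abs_def] wirtinger_bar_def[abs_def] B s[of "e 1"] s[of "e \<i>"]
  by (simp add: field_simps)
qed

lemma norm_cmult_vec: "norm (c *s v) = norm c * norm (v :: complex^'m)"
 by (simp add: norm_vec_def norm_mult L2_set_right_distrib)

lemma bounded_bilinear_cmult_vec: "bounded_bilinear (\<lambda>c v. c *s (v :: complex^'m))"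
proof
 show "\<exists>K. \<forall>a b. norm (a *s (b :: complex^'m)) \<le> norm a * norm b * K"
  by (intro exI[of _ 1]) (simp add: norm_cmult_vec)
qed (simp_all add: vec_eq_iff algebra_simps)

lemmas Ck_vec_nth = Ck_linear_compose[OF bounded_linear_vec_nth]

lemma wirtinger_nth:
 "dz j (\<lambda>z :: complex^'m. z $ i) x = (if i = j then 1 else 0)"
 "dzb j (\<lambda>z :: complex^'m. z $ i) x = 0"
proof -
 have "dd v (\<lambda>z :: complex^'m. z $ i) x = v $ i" for v
  by (rule dd_eq) (rule bounded_linear_imp_has_derivative[OF bounded_linear_vec_nth])
 then show "dz j (\<lambda>z :: complex^'m. z $ i) x = (if i = j then 1 else 0)"
  "dzb j (\<lambda>z :: complex^'m. z $ i) x = 0"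
  by (auto simp: wirtinger_def wirtinger_bar_def axis_def)
qed

definition d2_on :: "real => (real => 'a::real_normed_vector) => (real => 'a) => 'a => 'a => bool" where
 "d2_on e c c1 v a \<longleftrightarrow> e > 0 \<and> (\<forall>s. \<bar>s\<bar> < e \<longrightarrow> (c has_vector_derivative c1 s) (at s)) \<and>
   c1 0 = v \<and> (c1 has_vector_derivative a) (at 0)"

lemma d2_onD:
 assumes "d2_on e c c1 v a"
 shows "e > 0" "\<And>s. \<bar>s\<bar> < e ==> (c has_vector_derivative c1 s) (at s)" "c1 0 = v" "(c1 has_vector_derivative a) (at 0)"
 using assms by (auto simp: d2_on_def)

definition has_d2 :: "(real => 'a::real_normed_vector) => 'a => 'a => bool" where
 "has_d2 c v a \<longleftrightarrow> (\<exists>e c1. d2_on e c c1 v a)"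

lemmas has_d2_defs = has_d2_def d2_on_def

lemma has_d2_unique:
 assumes "has_d2 c v a" "has_d2 c' v' a'" "e0 > 0" "\<And>s. \<bar>s\<bar> < e0 ==> c s = c' s"
 shows "v = v'" "a = a'"
proof -
 obtain e c1 where "d2_on e c c1 v a" using assms(1) has_d2_def by blast
 note c = d2_onD[OF this]
 obtain e' c1' where "d2_on e' c' c1' v' a'" using assms(2) has_d2_def by blast
 note c' = d2_onD[OF this]
 define d where "d = min e0 (min e e')"
 have d: "d > 0" using c c' assms by (simp add: d_def)
 have eq: "c1 s = c1' s" if "\<bar>s\<bar> < d" for s
 proof -
  have "(c' has_vector_derivative c1 s) (at s)"
   by (rule has_vector_derivative_transform_within_open[of c _ _ "{-d<..<d}"])
    (use that assms(4) c(2) in \<open>auto simp: d_def\<close>)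
  then show ?thesis using c'(2)[of s] that by (auto simp: d_def intro: vector_derivative_unique_at)
 qed
 show "v = v'" using eq[of 0] d c c' by simp
 have "(c1' has_vector_derivative a) (at 0)"
  by (rule has_vector_derivative_transform_within_open[of c1 _ _ "{-d<..<d}"])
   (use d c(4) eq in auto)
 then show "a = a'" using c'(4) by (rule vector_derivative_unique_at)
qed

lemma has_d2_Ck:
 fixes c :: "real => 'a::real_normed_vector"
 assumes "open S" "Ck_on 2 c S" "0 \<in> S"
 shows "has_d2 c (dd 1 c 0) (dd 1 (dd 1 c) 0)"
proof -
 note C2 = Ck_2[OF assms(2)]
 obtain e where e: "e > 0" "ball 0 e \<subseteq> S" using assms open_contains_ball by blast
 have vd: "(g has_vector_derivative dd 1 g s) (at s)" if "s \<in> S" "Ck_on (Suc k) g S" for g :: "real => 'a" and s k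
 proof -
  have "dd x g s = x *R dd 1 g s" for x
   using linear_scale[OF dd_linear[OF assms(1) that(2,1)], of x 1] by simp
  then have "frechet_derivative g (at s) = (\<lambda>x. x *R dd 1 g s)" by (rule ext)
  then show ?thesis
   using Ck_deriv[OF assms(1) that(2,1)] by (simp add: has_vector_derivative_def)
 qed
 show ?thesis
  unfolding has_d2_defs
  by (intro exI[of _ e] exI[of _ "dd 1 c"] conjI e allI impI vd[OF _ C2] vd[OF _ Ck_dd[OF C2]] assms(3) refl)
   (use e in \<open>auto simp: subset_iff\<close>)
qed

lemma has_d2_add:
 assumes "has_d2 c v a" "has_d2 c' v' a'"
 shows "has_d2 (\<lambda>s. c s + c' s) (v + v') (a + a')"
proof -
 obtain e c1 where "d2_on e c c1 v a" using assms(1) has_d2_def by blast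
 note c = d2_onD[OF this]
 obtain e' c1' where "d2_on e' c' c1' v' a'" using assms(2) has_d2_def by blast
 note c' = d2_onD[OF this]
 show ?thesis unfolding has_d2_defs
  by (intro exI[of _ "min e e'"] exI[of _ "\<lambda>s. c1 s + c1' s"] conjI)
   (use c c' in \<open>auto intro!: has_vector_derivative_add\<close>)
qed

lemma has_d2_bilinear:
 assumes "bounded_bilinear b" "has_d2 c v a" "has_d2 c' v' a'"
 shows "has_d2 (\<lambda>s. b (c s) (c' s)) (b (c 0) v' + b v (c' 0)) (b (c 0) a' + 2 *R b v v' + b a (c' 0))"
proof -
 obtain e c1 where "d2_on e c c1 v a" using assms(2) has_d2_def by blast
 note c = d2_onD[OF this]
 obtain e' c1' where "d2_on e' c' c1' v' a'" using assms(3) has_d2_def by blast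
 note c' = d2_onD[OF this]
 have "((\<lambda>s. b (c s) (c1' s) + b (c1 s) (c' s)) has_vector_derivative
   (b (c 0) a' + b (c1 0) (c1' 0)) + (b (c1 0) (c1' 0) + b a (c' 0))) (at 0)"
  using c(1) c(2)[of 0] c'(1) c'(2)[of 0] c(4) c'(4)
  by (intro has_vector_derivative_add bounded_bilinear.has_vector_derivative[OF assms(1)]) auto
 moreover have "(b (c 0) a' + b (c1 0) (c1' 0)) + (b (c1 0) (c1' 0) + b a (c' 0)) = b (c 0) a' + 2 *R b v v' + b a (c' 0)"
  unfolding c(3) c'(3) scaleR_2 by (simp add: add_ac)
 ultimately have "((\<lambda>s. b (c s) (c1' s) + b (c1 s) (c' s)) has_vector_derivative
   b (c 0) a' + 2 *R b v v' + b a (c' 0)) (at 0)" by (simp only:)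
 moreover have "((\<lambda>s. b (c s) (c' s)) has_vector_derivative b (c s) (c1' s) + b (c1 s) (c' s)) (at s)"
  if "\<bar>s\<bar> < min e e'" for s
  using that c(2) c'(2) by (intro bounded_bilinear.has_vector_derivative[OF assms(1)]) auto
 ultimately show ?thesis unfolding has_d2_defs
  by (intro exI[of _ "min e e'"] exI[of _ "\<lambda>s. b (c s) (c1' s) + b (c1 s) (c' s)"] conjI allI impI)
   (use c(1,3) c'(1,3) in auto)
qed

lemma has_d2_affine: "has_d2 (\<lambda>s. p + s *R v) v 0"
 unfolding has_d2_defs
 by (intro exI[of _ 1] exI[of _ "\<lambda>s. v"]) (auto intro!: derivative_eq_intros)

lemma has_d2_Pair:
 assumes "has_d2 c v a" "has_d2 c' v' a'"
 shows "has_d2 (\<lambda>s. (c s, c' s)) (v, v') (a, a')"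
proof -
 obtain e c1 where "d2_on e c c1 v a" using assms(1) has_d2_def by blast
 note c = d2_onD[OF this]
 obtain e' c1' where "d2_on e' c' c1' v' a'" using assms(2) has_d2_def by blast
 note c' = d2_onD[OF this]
 show ?thesis unfolding has_d2_defs
  by (intro exI[of _ "min e e'"] exI[of _ "\<lambda>s. (c1 s, c1' s)"] conjI)
   (use c c' in \<open>auto intro!: has_vector_derivative_Pair\<close>)
qed

lemma has_d2_compose:
 fixes c :: "real => 'a::euclidean_space" and u :: "'a => 'b::real_normed_vector"
 assumes "has_d2 c v a" "open S" "Ck_on 2 u S" "c 0 \<in> S"
 shows "has_d2 (\<lambda>s. u (c s)) (dd v u (c 0)) (dd v (dd v u) (c 0) + dd a u (c 0))"
proof -
 note C2 = Ck_2[OF assms(3)]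
 note C1 = Ck_dd[OF C2]
 obtain e c1 where "d2_on e c c1 v a" using assms(1) has_d2_def by blast
 note c = d2_onD[OF this]
 have "isCont c 0" using c(1) c(2)[of 0] has_vector_derivative_continuous by auto
 then obtain e' where e': "e' > 0" "\<And>s. \<bar>s\<bar> < e' ==> c s \<in> S"
  using assms(2,4) unfolding continuous_at_open
  by (metis (no_types, opaque_lifting) dist_0_norm dist_commute mem_ball open_contains_ball_eq real_norm_def subset_iff)
 define d where "d = min e e'"
 have d: "d > 0" using c e' by (simp add: d_def)
 have chain: "((\<lambda>s. g (c s)) has_vector_derivative dd (c1 s) g (c s)) (at s)" if "\<bar>s\<bar> < d" "Ck_on (Suc k) g S" for g :: "'a => 'b" and s k
 proof -
  have cs: "c s \<in> S" "(c has_derivative (\<lambda>x. x *R c1 s)) (at s)" using that e' c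
   by (auto simp: d_def has_vector_derivative_def)
  have "((\<lambda>x. g (c x)) has_derivative (\<lambda>x. dd (x *R c1 s) g (c s))) (at s)"
   by (rule has_derivative_compose[OF cs(2) Ck_deriv[OF assms(2) that(2) cs(1)]])
  then show ?thesis
   unfolding has_vector_derivative_def by (simp only: linear_scale[OF dd_linear[OF assms(2) that(2) cs(1)]])
 qed
 have ex: "dd w g (c s) = (\<Sum>b\<in>Basis. (w \<bullet> b) *R dd b g (c s))" if "\<bar>s\<bar> < d" "Ck_on (Suc k) g S" for g :: "'a => 'b" and s k w
 proof -
  have l: "linear (\<lambda>v. dd v g (c s))" using dd_linear[OF assms(2) that(2)] e' that by (auto simp: d_def)
  have "dd (\<Sum>b\<in>Basis. (w \<bullet> b) *R b) g (c s) = (\<Sum>b\<in>Basis. (w \<bullet> b) *R dd b g (c s))"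
   by (simp only: linear_sum[OF l] linear_scale[OF l])
  then show ?thesis by (simp only: euclidean_representation)
 qed
 have "((\<lambda>s. \<Sum>b\<in>Basis. (c1 s \<bullet> b) *R dd b u (c s)) has_vector_derivative
   (\<Sum>b\<in>Basis. (c1 0 \<bullet> b) *R dd (c1 0) (dd b u) (c 0) + (a \<bullet> b) *R dd b u (c 0))) (at 0)"
  using d c(4)
  by (intro has_vector_derivative_sum bounded_bilinear.has_vector_derivative[OF bounded_bilinear_scaleR] chain[OF _ C1]
     bounded_linear.has_vector_derivative[OF bounded_linear_inner_left]) auto
 then have "((\<lambda>s. dd (c1 s) u (c s)) has_vector_derivative
   (\<Sum>b\<in>Basis. (c1 0 \<bullet> b) *R dd (c1 0) (dd b u) (c 0) + (a \<bullet> b) *R dd b u (c 0))) (at 0)"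
  by (rule has_vector_derivative_transform_within_open[of _ _ _ "{-d<..<d}"])
   (use d ex[OF _ C2] in auto)
 moreover have "(\<Sum>b\<in>Basis. (c1 0 \<bullet> b) *R dd (c1 0) (dd b u) (c 0) + (a \<bullet> b) *R dd b u (c 0))
   = dd v (dd v u) (c 0) + dd a u (c 0)"
 proof -
  have "dd v (dd v u) (c 0) = dd v (\<lambda>x. \<Sum>b\<in>Basis. (v \<bullet> b) *R dd b u x) (c 0)"
  proof (rule dd_cong[OF assms(2,4)])
   fix y assume "y \<in> S"
   then have l: "linear (\<lambda>v. dd v u y)" using dd_linear[OF assms(2) C2] by blast
   have "dd (\<Sum>b\<in>Basis. (v \<bullet> b) *R b) u y = (\<Sum>b\<in>Basis. (v \<bullet> b) *R dd b u y)"
    by (simp only: linear_sum[OF l] linear_scale[OF l])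
   then show "dd v u y = (\<Sum>b\<in>Basis. (v \<bullet> b) *R dd b u y)" by (simp only: euclidean_representation)
  qed
  also have "\<dots> = (\<Sum>b\<in>Basis. (v \<bullet> b) *R dd v (dd b u) (c 0))"
   by (subst dd_sum[OF assms(2) _ assms(4), where k=0])
    (auto intro!: Ck_scaleR[OF assms(2)] C1 simp: dd_bilinear[OF bounded_bilinear_scaleR assms(2) Ck_const C1 assms(4)] simp del: Ck_on.simps)
  finally show ?thesis using ex[OF _ C2, of 0 a] d c(3) by (simp add: sum.distrib)
 qed
 ultimately show ?thesis unfolding has_d2_defs
  by (intro exI[of _ d] exI[of _ "\<lambda>s. dd (c1 s) u (c s)"] conjI allI impI chain[OF _ C2]) (use d c(3) in auto)
qed

lemma has_d2_local_min:
 fixes c :: "real => real"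
 assumes "has_d2 c v a" "e0 > 0" "\<And>s. \<bar>s\<bar> < e0 ==> c 0 \<le> c s"
 shows "v = 0" "0 \<le> a"
proof -
 obtain e c1 where "d2_on e c c1 v a" using assms(1) has_d2_def by blast
 note c = d2_onD[OF this]
 have d0: "(c has_real_derivative v) (at 0)"
  using c(1) c(2)[of 0] c(3) by (simp add: has_real_derivative_iff_has_vector_derivative)
 show v: "v = 0"
  by (rule DERIV_local_min[OF d0 assms(2)]) (use assms(3) in auto)
 show "0 \<le> a"
 proof (rule ccontr)
  assume "\<not> 0 \<le> a"
  then have "a < 0" by simp
  have "(c1 has_real_derivative a) (at 0)" using c(4) by (simp add: has_real_derivative_iff_has_vector_derivative)
  from DERIV_neg_dec_right[OF this \<open>a < 0\<close>] obtain d where d: "d > 0" "\<And>h. 0 < h ==> h < d ==> c1 (0 + h) < c1 0" by blast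
  define h where "h = min e0 (min e d) / 2"
  have h: "0 < h" "h < e0" "h < e" "h < d" using assms(2) c(1) d(1) by (auto simp: h_def min_def)
  have "\<And>x. 0 \<le> x ==> x \<le> h ==> (c has_real_derivative c1 x) (at x)"
   using c(2) h by (simp add: has_real_derivative_iff_has_vector_derivative)
  from MVT2[OF h(1) this] obtain z where z: "0 < z" "z < h" "c h - c 0 = (h - 0) * c1 z" by auto
  have "c1 z < 0" using d(2)[of z] z h c(3) v by simp
  then have "c h - c 0 < 0" using z h by (simp add: mult_pos_neg)
  then show False using assms(3)[of h] h by simp
 qed
qed

definition Lev :: "((complex^'n) \<times> (complex^'m) => real) => (complex^'n) \<times> (complex^'m) => (complex^'n) \<times> (complex^'m) => real" where
 "Lev u x V = (dd V (dd V u) x + dd (cscale \<i> V) (dd (cscale \<i> V) u) x) / 4"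

lemma bounded_bilinear_cscale: "bounded_bilinear (cscale :: complex => (complex^'n) \<times> (complex^'m) => _)"
proof
 have "norm (cscale a (b :: (complex^'n) \<times> (complex^'m))) = norm a * norm b" for a b
  by (simp add: cscale_def norm_Pair norm_cmult_vec power_mult_distrib real_sqrt_mult norm_prod_def
    flip: distrib_left)
 then show "\<exists>K. \<forall>a b. norm (cscale a (b :: (complex^'n) \<times> (complex^'m))) \<le> norm a * norm b * K"
  by (intro exI[of _ 1]) simp
qed (simp_all add: vec_eq_iff cscale_def prod_eq_iff algebra_simps)

interpretation cscale: bounded_bilinear "cscale :: complex => (complex^'n) \<times> (complex^'m) => _"
 by (rule bounded_bilinear_cscale)

lemma norm_cscale: "norm (cscale a V) = norm a * norm V"
 by (simp add: cscale_def norm_Pair norm_cmult_vec power_mult_distrib real_sqrt_mult norm_prod_def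
    flip: distrib_left)

lemma cscale_cscale [simp]: "cscale a (cscale b V) = cscale (a * b) V"
 by (simp add: cscale_def vec_eq_iff algebra_simps)

lemma cscale_1 [simp]: "cscale 1 V = V"
 by (simp add: cscale_def vec_eq_iff prod_eq_iff)

lemma cscale_of_real: "cscale (of_real r) V = r *R V"
 by (simp add: cscale_def prod_eq_iff vec_eq_iff) (simp add: scaleR_conv_of_real)

lemma dd2_linear:
 fixes u :: "'a::euclidean_space => 'b::euclidean_space"
 assumes "open S" "Ck_on 2 u S" "x \<in> S"
 shows "linear (\<lambda>v. dd v (dd w u) x)" "linear (\<lambda>v. dd w (dd v u) x)"
proof -
 note C2 = Ck_2[OF assms(2)]
 show 1: "linear (\<lambda>v. dd v (dd w u) x)" for w
  by (rule dd_linear[OF assms(1) Ck_dd[OF C2] assms(3)])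
 have "(\<lambda>v. dd w (dd v u) x) = (\<lambda>v. dd v (dd w u) x)"
  by (rule ext, rule dd_commute[OF assms])
 then show "linear (\<lambda>v. dd w (dd v u) x)" using 1 by simp
qed

lemma dd2_cis:
 fixes u :: "(complex^'n) \<times> (complex^'m) => real"
 assumes "open S" "Ck_on 2 u S" "x \<in> S"
 shows "dd (cscale (Complex a b) V) (dd (cscale (Complex a b) V) u) x =
  a^2 * dd V (dd V u) x + 2 * a * b * dd V (dd (cscale \<i> V) u) x
   + b^2 * dd (cscale \<i> V) (dd (cscale \<i> V) u) x"
proof -
 have "Complex a b = of_real a + of_real b * \<i>" by (simp add: complex_eq_iff)
 then have *: "cscale (Complex a b) V = a *R V + b *R cscale \<i> V"
  by (simp add: cscale.add_left cscale_of_real flip: cscale_cscale)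
 note l = dd2_linear[OF assms]
 show ?thesis
  unfolding * linear_add[OF l(1)] linear_add[OF l(2)] linear_scale[OF l(1)] linear_scale[OF l(2)]
  using dd_commute[OF assms, of "cscale \<i> V" V]
  by (simp add: power2_eq_square algebra_simps)
qed

lemma Lev_scale:
 assumes "open S" "Ck_on 2 u S" "x \<in> S"
 shows "Lev u x (cscale c V) = (norm c)^2 * Lev u x V"
proof -
 have "\<i> * c = Complex (- Im c) (Re c)" by (simp add: complex_eq_iff)
 then show ?thesis
  using dd2_cis[OF assms, of "Re c" "Im c" V] dd2_cis[OF assms, of "- Im c" "Re c" V]
  by (simp add: Lev_def cmod_power2 field_simps)
qed

lemma Lev_curve:
 fixes u :: "(complex^'n) \<times> (complex^'m) => real"
 assumes "open S" "Ck_on 2 u S" "has_d2 c V A" "has_d2 c' (cscale \<i> V) (- A)" "c 0 = x" "c' 0 = x" "x \<in> S"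
 shows "\<exists>d d'. has_d2 (\<lambda>s. u (c s)) (dd V u x) d \<and> has_d2 (\<lambda>s. u (c' s)) (dd (cscale \<i> V) u x) d' \<and> d + d' = 4 * Lev u x V"
proof -
 note C2 = Ck_2[OF assms(2)]
 show ?thesis
  using has_d2_compose[OF assms(3,1,2)] has_d2_compose[OF assms(4,1,2)] assms(5-7)
   linear_neg[OF dd_linear[OF assms(1) C2 assms(7)], of A]
  by (intro exI[of _ "dd V (dd V u) x + dd A u x"]
     exI[of _ "dd (cscale \<i> V) (dd (cscale \<i> V) u) x + dd (- A) u x"]) (simp add: Lev_def)
qed

text \<open>Averaging \<open>u\<close> over the circles through \<open>r V\<close> and \<open>r \<i>V\<close> makes the second derivative at
 \<open>r = 0\<close> of the integrand constant in the angle.\<close>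

lemma Lev_nonneg_of_psh:
 fixes u :: "(complex^'n) \<times> (complex^'m) => real"
 assumes W: "open W" and u: "Ck_on 2 u W" and psh: "plurisubharmonic_on W u" and x: "x \<in> W"
 shows "0 \<le> Lev u x V"
proof -
 define h :: "_ => real \<times> real => (complex^'n) \<times> (complex^'m)" where "h = (\<lambda>Y p. x + fst p *R cscale (cis (snd p)) Y)"
 have hk: "Ck_on k (h Y) UNIV" for k Y
  unfolding h_def cis_conv_exp
  by (intro Ck_add Ck_scaleR Ck_fst Ck_id Ck_const open_UNIV Ck_bilinear[OF bounded_bilinear_cscale]
    Ck_exp_compose Ck_mult Ck_of_real Ck_snd)
 define T where "T = h V -` W \<inter> h (cscale \<i> V) -` W"
 have T: "open T" unfolding T_def using Ck_continuous[OF hk] W by (intro open_Int open_vimage)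
 define F where "F = (\<lambda>p. u (h V p) + u (h (cscale \<i> V) p))"
 have F2: "Ck_on 2 F T" unfolding F_def
  by (intro Ck_add T Ck_compose[OF T W _ Ck_subset[OF hk] u]) (auto simp: T_def)
 note F2' = Ck_2[OF F2]
 obtain e where e: "e > 0" "ball x e \<subseteq> W" using W x open_contains_ball by blast
 define d where "d = e / (norm V + 1)"
 have nV: "norm V + 1 > 0" by (intro add_nonneg_pos) auto
 have d: "d > 0" using e nV by (simp add: d_def)
 have inW: "x + r *R cscale c V \<in> W" if "\<bar>r\<bar> < d" "norm c \<le> 1" for r c
 proof -
  have "norm (r *R cscale c V) = \<bar>r\<bar> * (norm c * norm V)" by (simp add: norm_cscale)
  also have "\<dots> \<le> \<bar>r\<bar> * (norm V + 1)"
   using mult_right_mono[OF that(2), of "norm V"] by (intro mult_left_mono) auto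
  also have "\<dots> < e" using that(1) nV by (simp add: d_def pos_less_divide_eq)
  finally have "x + r *R cscale c V \<in> ball x e" by (simp add: dist_norm)
  then show ?thesis using e(2) by blast
 qed
 let ?U = "{-d<..<d} :: real set" and ?K = "{0..2*pi} :: real set"
 have hW: "h V (r, q) \<in> W" "h (cscale \<i> V) (r, q) \<in> W" if "\<bar>r\<bar> < d" for r q
  using inW[OF that, of "cis q"] inW[OF that, of "cis q * \<i>"] by (simp_all add: h_def norm_mult)
 then have sub: "?U \<times> ?K \<subseteq> T" by (auto simp: T_def)
 define g where "g = (\<lambda>r. LINT q:?K|lborel. F (r, q))"
 have g2: "Ck_on 2 g ?U"
  unfolding g_def by (rule Ck_integral[OF _ T _ sub F2]) auto
 have dg: "dd 1 g r = (LINT q:?K|lborel. dd (1, 0) F (r, q))" if "r \<in> ?U" for r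
  unfolding g_def by (rule dd_eq[OF has_derivative_integral_compact[OF _ T _ sub F2' that]]) auto
 have "dd 1 (dd 1 g) 0 = dd 1 (\<lambda>r. LINT q:?K|lborel. dd (1, 0) F (r, q)) 0"
  by (rule dd_cong[of ?U]) (use d dg in auto)
 also have "\<dots> = (LINT q:?K|lborel. dd (1, 0) (dd (1, 0) F) (0, q))"
  by (rule dd_eq[OF has_derivative_integral_compact[OF _ T _ sub Ck_dd[OF F2']]]) (use d in auto)
 also have "\<dots> = (LINT q:?K|lborel. 4 * Lev u x V)"
 proof (rule set_lebesgue_integral_cong, simp, intro allI impI)
  fix q assume "q \<in> ?K"
  then have inT: "(0, q) \<in> T" using sub d by auto
  have 1: "has_d2 (\<lambda>s. F ((0, q) + s *R (1, 0))) (dd (1, 0) F (0, q)) (dd (1, 0) (dd (1, 0) F) (0, q))"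
   using has_d2_compose[OF has_d2_affine T F2, of "(0, q)" "(1, 0)"] inT linear_0[OF dd_linear[OF T F2' inT]] by simp
  have l: "has_d2 (\<lambda>s. u (x + s *R Y)) (dd Y u x) (dd Y (dd Y u) x)" for Y
   using has_d2_compose[OF has_d2_affine W u, of x Y] x linear_0[OF dd_linear[OF W Ck_2[OF u] x]] by simp
  let ?V = "cscale (cis q) V"
  have "dd (1, 0) (dd (1, 0) F) (0, q) = dd ?V (dd ?V u) x + dd (cscale \<i> ?V) (dd (cscale \<i> ?V) u) x"
   by (rule has_d2_unique(2)[OF 1 has_d2_add[OF l l], of 1]) (simp_all add: F_def h_def mult.commute)
  also have "\<dots> = 4 * Lev u x ?V" by (simp add: Lev_def)
  finally show "dd (1, 0) (dd (1, 0) F) (0, q) = 4 * Lev u x V" by (simp add: Lev_scale[OF W u x])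
 qed
 also have "\<dots> = 2 * pi * (4 * Lev u x V)" by (simp add: set_lebesgue_integral_def)
 finally have fin: "dd 1 (dd 1 g) 0 = 2 * pi * (4 * Lev u x V)" .
 have cY: "(\<lambda>q. u (h Y (r, q))) integrable_on ?K" if "\<And>q. h Y (r, q) \<in> W" for r Y
  by (intro integrable_continuous_interval continuous_on_compose2[OF Ck_continuous[OF u]]
    continuous_on_compose2[OF Ck_continuous[OF hk]]) (use that in \<open>auto intro!: continuous_intros\<close>)
 have gi: "g r = integral ?K (\<lambda>q. u (h V (r, q))) + integral ?K (\<lambda>q. u (h (cscale \<i> V) (r, q)))" if "\<bar>r\<bar> < d" for r
 proof -
  have "continuous_on ?K (\<lambda>q. F (r, q))"
   by (rule continuous_on_compose2[OF Ck_continuous[OF F2]]) (use that in \<open>auto intro!: continuous_intros subsetD[OF sub]\<close>)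
  then have "g r = integral ?K (\<lambda>q. F (r, q))"
   unfolding g_def by (intro set_borel_integral_eq_integral(2) set_integrable_compact compact_Icc)
  then show ?thesis unfolding F_def using hW[OF that] by (simp add: integral_add cY)
 qed
 have mean: "2 * pi * u x \<le> integral ?K (\<lambda>q. u (h (cscale c V) (r, q)))" if "\<bar>r\<bar> < d" "norm c = 1" for r c
 proof -
  have "u x \<le> integral ?K (\<lambda>q. u (x + cscale (cis q) (r *R cscale c V))) / (2 * pi)"
  proof (rule psh[unfolded plurisubharmonic_on_def, THEN conjunct2, rule_format])
   fix b :: complex assume "b \<in> cball 0 1"
   then show "x + cscale b (r *R cscale c V) \<in> W"
    using inW[OF that(1), of "b * c"] that(2) by (simp add: norm_mult cscale.scaleR_right)
  qed
  then show ?thesis by (simp add: h_def cscale.scaleR_right field_simps)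
 qed
 have "g 0 \<le> g r" if "\<bar>r\<bar> < d" for r
  using mean[OF that, of 1] mean[OF that, of \<i>] d by (simp add: gi that) (simp add: h_def)
 then have "0 \<le> dd 1 (dd 1 g) 0"
  using has_d2_local_min(2)[OF has_d2_Ck[OF _ g2] d(1)] d by auto
 then show ?thesis using pi_gt_zero unfolding fin by (auto simp: zero_le_mult_iff)
qed

lemma coord_scale: "coord a c = Re c *R coord a 1 + Im c *R coord a \<i>"
 by (cases a) (auto simp: axis_def vec_eq_iff complex_eq_iff)

lemma cscale_coord: "cscale c (coord a d) = coord a (c * d)"
 by (cases a) (auto simp: axis_def vec_eq_iff cscale_def)

lemma complex_hessian_entry:
 assumes "open S" "Ck_on 2 u S" "x \<in> S"
 shows "complex_hessian u x $ a $ b = (of_real (dd (coord a 1) (dd (coord b 1) u) x + dd (coord a \<i>) (dd (coord b \<i>) u) x)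
   + \<i> * of_real (dd (coord a 1) (dd (coord b \<i>) u) x - dd (coord a \<i>) (dd (coord b 1) u) x)) / 4"
proof -
 note C2 = Ck_2[OF assms(2)]
 have w: "wirtinger_bar (coord b) (\<lambda>y. complex_of_real (u y)) y = of_real (dd (coord b 1) u y / 2) + \<i> * of_real (dd (coord b \<i>) u y / 2)"
  if "y \<in> S" for y
  unfolding wirtinger_bar_def dd_linear_compose[OF bounded_linear_of_real assms(1) C2 that] by (simp add: field_simps)
 have C1: "Ck_on (Suc 0) (\<lambda>y. dd v u y / 2) S" for v
  by (intro Ck_linear_compose[OF bounded_linear_divide] assms Ck_dd[OF C2])
 have C1': "Ck_on (Suc 0) (\<lambda>y. complex_of_real (dd v u y / 2)) S" for v
  by (intro Ck_of_real C1 assms)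
 have 2: "dd v' (\<lambda>y. complex_of_real (dd v u y / 2)) x = of_real (dd v' (dd v u) x / 2)" for v v'
  unfolding dd_linear_compose[OF bounded_linear_of_real assms(1) C1 assms(3)]
   dd_linear_compose[OF bounded_linear_divide assms(1) Ck_dd[OF C2] assms(3)] ..
 have 3: "wirtinger (coord a) (\<lambda>y. complex_of_real (dd v u y / 2)) x = (of_real (dd (coord a 1) (dd v u) x) - \<i> * of_real (dd (coord a \<i>) (dd v u) x)) / 4" for v
  unfolding wirtinger_def 2 by (simp add: field_simps)
 have "complex_hessian u x $ a $ b = wirtinger (coord a) (\<lambda>y. of_real (dd (coord b 1) u y / 2) + \<i> * of_real (dd (coord b \<i>) u y / 2)) x"
  unfolding complex_hessian_def by (simp only: vec_lambda_beta wirtinger_cong(1)[OF assms(1,3) w])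
 also have "\<dots> = wirtinger (coord a) (\<lambda>y. of_real (dd (coord b 1) u y / 2)) x + \<i> * wirtinger (coord a) (\<lambda>y. of_real (dd (coord b \<i>) u y / 2)) x"
  unfolding wirtinger_add(1)[OF assms(1) C1' Ck_mult[OF assms(1) Ck_const C1'] assms(3)]
   wirtinger_cmult(1)[OF assms(1) C1' assms(3)] ..
 finally show ?thesis unfolding 3 by (simp add: add_divide_distrib diff_divide_distrib algebra_simps)
qed

lemma hessian_form:
 fixes u :: "(complex^'n) \<times> (complex^'m) => real" and w :: "'n + 'm => complex"
 assumes "open S" "Ck_on 2 u S" "x \<in> S"
 shows "(\<Oplus>a b. complex_hessian u x $ a $ b * w a * cnj (w b))
  = complex_of_real (Lev u x (\<Oplus>a. coord a (w a)))"
proof -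
 define A where "A = (\<lambda>a b. dd (coord a 1) (dd (coord b 1) u) x)"
 define B where "B = (\<lambda>a b. dd (coord a 1) (dd (coord b \<i>) u) x)"
 define C where "C = (\<lambda>a b. dd (coord a \<i>) (dd (coord b 1) u) x)"
 define D where "D = (\<lambda>a b. dd (coord a \<i>) (dd (coord b \<i>) u) x)"
 define p where "p = (\<lambda>a. Re (w a))"
 define q where "q = (\<lambda>a. Im (w a))"
 note s = dd_commute[OF assms]
 have sym: "A a b = A b a" "D a b = D b a" "C a b = B b a" for a b
  unfolding A_def B_def C_def D_def by (rule s)+
 note l = dd2_linear[OF assms]
 have ex: "dd (\<Oplus>a. coord a (v a)) (dd (\<Oplus>a. coord a (v a)) u) x
  = (\<Oplus>a b. Re (v a) * Re (v b) * A a b + Re (v a) * Im (v b) * B a b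
    + Im (v a) * Re (v b) * C a b + Im (v a) * Im (v b) * D a b)" for v :: "'n + 'm => complex"
 proof -
  have c: "dd (coord a c) (dd (coord b c') u) x = Re c * Re c' * A a b + Re c * Im c' * B a b
    + Im c * Re c' * C a b + Im c * Im c' * D a b" for a b c c'
   by (subst (1 2) coord_scale)
    (simp add: linear_add[OF l(1)] linear_add[OF l(2)] linear_scale[OF l(1)] linear_scale[OF l(2)]
     A_def B_def C_def D_def algebra_simps)
  have "dd (\<Oplus>a. coord a (v a)) (dd (\<Oplus>a. coord a (v a)) u) x
   = (\<Oplus>a. dd (coord a (v a)) (dd (\<Oplus>b. coord b (v b)) u) x)"
   by (rule linear_sum[OF l(1)])
  also have "\<dots> = (\<Oplus>a b. dd (coord a (v a)) (dd (coord b (v b)) u) x)"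
   by (intro sum.cong refl linear_sum[OF l(2)])
  finally show ?thesis by (simp only: c)
 qed
 have iV: "cscale \<i> (\<Oplus>a. coord a (w a)) = (\<Oplus>a. coord a (\<i> * w a))"
  by (simp add: cscale.sum_right cscale_coord)
 have "4 * Lev u x (\<Oplus>a. coord a (w a))
  = (\<Oplus>a b. (A a b + D a b) * (p a * p b + q a * q b) - (B a b - C a b) * (q a * p b - p a * q b))"
  unfolding Lev_def iV ex by (simp add: p_def q_def algebra_simps flip: sum.distrib)
 moreover have "(\<Oplus>a b. (A a b + D a b) * (q a * p b - p a * q b) + (B a b - C a b) * (p a * p b + q a * q b)) = 0" (is "?S = 0")
 proof -
  have "?S = (\<Oplus>b a. (A a b + D a b) * (q a * p b - p a * q b) + (B a b - C a b) * (p a * p b + q a * q b))"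
   by (rule sum.swap)
  also have "\<dots> = - ?S"
   unfolding sum_negf[symmetric]
   by (intro sum.cong refl) (simp add: sym(3) sym(1)[of _ "_ :: 'n + 'm"] algebra_simps, metis sym(1,2) add.commute)
  finally show ?thesis by simp
 qed
 moreover have "(\<Oplus>a b. complex_hessian u x $ a $ b * w a * cnj (w b)) =
   Complex (\<Oplus>a b. ((A a b + D a b) * (p a * p b + q a * q b) - (B a b - C a b) * (q a * p b - p a * q b)) / 4)
   (\<Oplus>a b. ((A a b + D a b) * (q a * p b - p a * q b) + (B a b - C a b) * (p a * p b + q a * q b)) / 4)"
  unfolding complex_hessian_entry[OF assms] complex_eq_iff
  by (auto simp: A_def B_def C_def D_def p_def q_def field_simps sum_divide_distrib[symmetric] intro!: sum.cong)
 ultimately show ?thesis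
  by (simp add: complex_eq_iff flip: sum_divide_distrib)
qed

definition ann :: "'a::real_normed_vector set" where
 "ann = {x. 1 \<le> norm x \<and> norm x \<le> exp 1}"

abbreviation ann_integral :: "('a::euclidean_space => 'b::{banach, second_countable_topology}) => 'b" (binder "LA " 10) where
 "ann_integral f \<equiv> set_lebesgue_integral lborel ann f"

lemma closed_ann: "closed ann"
 unfolding ann_def by (intro closed_Collect_conj closed_Collect_le continuous_intros)

lemma compact_ann: "compact (ann :: 'a::euclidean_space set)"
proof -
 have "bounded (ann :: 'a set)" by (rule boundedI[of _ "exp 1"]) (auto simp: ann_def)
 then show ?thesis using closed_ann compact_eq_bounded_closed by blast
qed

lemma ann_nz: "x \<in> ann ==> x \<noteq> 0"
 by (auto simp: ann_def)

lemma ann_sets [measurable]: "(ann :: 'a::euclidean_space set) \<in> sets borel"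
 by (rule borel_closed[OF closed_ann])

lemma nn_integral_scaleR:
 fixes f :: "'a::euclidean_space => ennreal"
 assumes [measurable]: "f \<in> borel_measurable borel" and c: "c > 0"
 shows "(\<integral>\<^sup>+x. f x \<partial>lborel) = ennreal (c ^ DIM('a)) * (\<integral>\<^sup>+x. f (c *R x) \<partial>lborel)"
 by (subst lborel_affine[of c 0])
  (use c in \<open>auto simp: nn_integral_density nn_integral_distr nn_integral_cmult\<close>)

text \<open>Fubini and the scaling of Lebesgue measure replace integration over the unit sphere by
 integration over the annulus, whose radial extent in the measure \<open>d\<tau>/\<tau>\<close> is one.\<close>

lemma nn_integral_polar:
 fixes G :: "'a::euclidean_space => ennreal"
 assumes G[measurable]: "G \<in> borel_measurable borel"
 shows "(\<integral>\<^sup>+x. (\<integral>\<^sup>+t. ennreal (indicator ann x * indicator {0<..} t * t ^ (DIM('a) - 1)) * G (t *R x) \<partial>lborel) \<partial>lborel)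
   = (\<integral>\<^sup>+x. G x \<partial>lborel)"
proof -
 let ?N = "DIM('a)"
 let ?u = "\<lambda>t x. ennreal (indicator {0<..} t / t * indicator ann (x /\<^sub>R t))"
 let ?v = "\<lambda>t x. ennreal (indicator ann x * indicator {0<..} t * t ^ (?N - 1))"
 have N: "?N > 0" by simp
 have inner: "(\<integral>\<^sup>+t. ?u t x \<partial>lborel) = 1" if x: "x \<noteq> 0" for x :: 'a
 proof -
  let ?J = "{norm x / exp 1..norm x}"
  have iff: "x /\<^sub>R t \<in> ann \<longleftrightarrow> t \<in> ?J" if "t > 0" for t
   using that x by (auto simp: ann_def field_simps)
  have "(\<integral>\<^sup>+t. ?u t x \<partial>lborel)
    = (\<integral>\<^sup>+t. ennreal (1 / t) * indicator ?J t \<partial>lborel)"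
  proof (rule nn_integral_cong)
   fix t :: real
   have "t \<notin> ?J" if "t \<le> 0"
    using that x zero_less_divide_iff[of "norm x" "exp 1"] by (auto simp: not_le intro: le_less_trans)
   then show "?u t x = ennreal (1 / t) * indicator ?J t"
    using iff[of t] by (cases "t > 0") (auto simp: indicator_def)
  qed
  also have "\<dots> = ennreal (ln (norm x) - ln (norm x / exp 1))"
  proof (rule nn_integral_FTC_Icc)
   have "norm x / exp 1 > 0" using x by simp
   then have p: "t > 0" if "norm x / exp 1 \<le> t" for t using that by linarith
   show "norm x / exp 1 \<le> norm x" using x by (simp add: field_simps)
   show "(ln has_real_derivative 1 / t) (at t)" if "t \<in> ?J" for t
    using that by (intro DERIV_ln_divide p) simp
   show "0 \<le> 1 / t" if "t \<in> ?J" for t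
    using p[of t] that by simp
  qed simp
  also have "\<dots> = 1" using x by (simp add: ln_div)
  finally show ?thesis .
 qed
 have "(\<integral>\<^sup>+x. (\<integral>\<^sup>+t. ?v t x * G (t *R x) \<partial>lborel) \<partial>lborel)
   = (\<integral>\<^sup>+t. (\<integral>\<^sup>+x. ?v t x * G (t *R x) \<partial>lborel) \<partial>lborel)"
  by (rule lborel_pair.Fubini') measurable
 also have "\<dots> = (\<integral>\<^sup>+t. (\<integral>\<^sup>+x. ?u t x * G x \<partial>lborel) \<partial>lborel)"
 proof (rule nn_integral_cong)
  fix t :: real
  show "(\<integral>\<^sup>+x. ?v t x * G (t *R x) \<partial>lborel)
    = (\<integral>\<^sup>+x. ?u t x * G x \<partial>lborel)"
  proof (cases "t > 0")
   case True
   have "(\<integral>\<^sup>+x. ?u t x * G x \<partial>lborel)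
    = ennreal (t ^ ?N) * (\<integral>\<^sup>+x. ennreal (indicator {0<..} t / t * indicator ann (x :: 'a)) * G (t *R x) \<partial>lborel)"
    using True by (subst nn_integral_scaleR[OF _ True]) auto
   also have "\<dots> = (\<integral>\<^sup>+x. ennreal (t ^ ?N) * (ennreal (indicator {0<..} t / t * indicator ann (x :: 'a)) * G (t *R x)) \<partial>lborel)"
    by (rule nn_integral_cmult[symmetric]) measurable
   also have "\<dots> = (\<integral>\<^sup>+x. ?v t x * G (t *R x) \<partial>lborel)"
   proof (rule nn_integral_cong)
    fix x :: 'a
    have "t ^ ?N * (indicator {0<..} t / t * indicator ann x) = indicator ann x * indicator {0<..} t * t ^ (?N - 1)"
     using True N by (cases ?N) auto
    moreover have "ennreal (t ^ ?N) * ennreal (indicator {0<..} t / t * indicator ann x) = ennreal (t ^ ?N * (indicator {0<..} t / t * indicator ann x))"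
     using True by (intro ennreal_mult[symmetric]) auto
    ultimately show "ennreal (t ^ ?N) * (ennreal (indicator {0<..} t / t * indicator ann x) * G (t *R x)) = ?v t x * G (t *R x)"
     by (simp only: mult.assoc[symmetric])
   qed
   finally show ?thesis ..
  qed simp
 qed
 also have "\<dots> = (\<integral>\<^sup>+x. (\<integral>\<^sup>+t. ?u t x * G x \<partial>lborel) \<partial>lborel)"
  by (rule lborel_pair.Fubini') measurable
 also have "\<dots> = (\<integral>\<^sup>+x. G x \<partial>lborel)"
 proof (rule nn_integral_cong_AE)
  have "AE x in lborel. x \<noteq> (0::'a)" by (rule AE_lborel_singleton)
  then show "AE x in lborel. (\<integral>\<^sup>+t. ?u t x * G x \<partial>lborel) = G x"
  proof eventually_elim
   case (elim x)
   have "(\<integral>\<^sup>+t. ?u t x * G x \<partial>lborel)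
    = (\<integral>\<^sup>+t. ?u t x \<partial>lborel) * G x"
    by (rule nn_integral_multc) measurable
   then show ?case using inner[OF elim] by simp
  qed
 qed
 finally show ?thesis .
qed

lemma integral_polar:
 fixes G :: "'a::euclidean_space => 'b::{banach, second_countable_topology}"
 assumes G: "integrable lborel G"
 shows "(LINT x|lborel. (LINT t|lborel. (indicator ann x * indicator {0<..} t * t ^ (DIM('a) - 1)) *R G (t *R x)))
   = (LINT x|lborel. G x)"
proof -
 let ?d = "\<lambda>p :: 'a \<times> real. indicator ann (fst p) * indicator {0<..} (snd p) * snd p ^ (DIM('a) - 1) :: real"
 let ?P = "lborel \<Otimes>\<^sub>M lborel :: ('a \<times> real) measure"
 let ?h = "\<lambda>p :: 'a \<times> real. snd p *R fst p"
 let ?D = "density ?P (\<lambda>p. ennreal (?d p))"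
 let ?Q = "distr ?D lborel ?h"
 have Gm[measurable]: "G \<in> borel_measurable borel" using borel_measurable_integrable[OF G] by simp
 have d: "?d \<in> borel_measurable ?P" by measurable
 have h: "?h \<in> measurable ?D lborel" by simp
 have eq: "?Q = lborel"
 proof (rule measure_eqI)
  fix X assume "X \<in> sets ?Q"
  then have [measurable]: "X \<in> sets borel" by simp
  have "emeasure ?Q X = (\<integral>\<^sup>+x. indicator X x \<partial>?Q)"
   by simp
  also have "\<dots> = (\<integral>\<^sup>+p. ennreal (?d p) * indicator X (?h p) \<partial>?P)"
   by (subst nn_integral_distr[OF h]) (auto intro!: nn_integral_density)
  also have "\<dots> = (\<integral>\<^sup>+x. (\<integral>\<^sup>+t. ennreal (indicator ann x * indicator {0<..} t * t ^ (DIM('a) - 1)) * indicator X (t *R x) \<partial>lborel) \<partial>lborel)"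
   by (subst lborel.nn_integral_fst[symmetric]) auto
  also have "\<dots> = (\<integral>\<^sup>+x. indicator X x \<partial>lborel)" by (rule nn_integral_polar) measurable
  finally show "emeasure ?Q X = emeasure lborel X" by simp
 qed simp
 have nn: "AE p in ?P. 0 \<le> ?d p" by (intro AE_I2) (auto simp: indicator_def)
 have "integrable ?Q G" unfolding eq by (rule G)
 then have "integrable ?D (\<lambda>p. G (?h p))"
  by (subst (asm) integrable_distr_eq[OF h]) simp_all
 then have int: "integrable ?P (\<lambda>p. ?d p *R G (?h p))"
  by (subst (asm) integrable_density[OF _ d nn]) auto
 have "(LINT x|lborel. G x) = (LINT p|?D. G (?h p))"
  by (subst eq[symmetric], subst integral_distr[OF h]) simp_all
 also have "\<dots> = (LINT p|?P. ?d p *R G (?h p))"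
  by (rule integral_density[OF _ d nn]) simp
 also have "\<dots> = (LINT x|lborel. (LINT t|lborel. ?d (x, t) *R G (?h (x, t))))"
  by (rule lborel_pair.integral_fst'[OF int, symmetric])
 finally show ?thesis by simp
qed

lemma integrable_radial_cutoff:
 fixes D :: "'a::euclidean_space => 'b::{banach, second_countable_topology}"
 assumes "continuous_on (-{0}) D" "continuous_on UNIV k" "0 < a" "\<And>s. s \<notin> {a..b} ==> k s = (0::real)"
 shows "integrable lborel (\<lambda>x. k (norm x) *R D x)"
proof -
 let ?K = "{x::'a. a \<le> norm x \<and> norm x \<le> b}"
 have "bounded ?K" by (rule boundedI[of _ b]) auto
 moreover have "closed ?K" by (intro closed_Collect_conj closed_Collect_le continuous_intros)
 ultimately have K: "compact ?K" using compact_eq_bounded_closed by blast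
 have "continuous_on ?K (\<lambda>x. k (norm x) *R D x)"
  by (intro continuous_intros continuous_on_compose2[OF assms(2)] continuous_on_subset[OF assms(1)]) (use assms(3) in auto)
 from set_integrable_compact[OF K this] have "integrable lborel (\<lambda>x. indicator ?K x *R k (norm x) *R D x)"
  by (simp add: set_integrable_def)
 moreover have "(\<lambda>x. indicator ?K x *R k (norm x) *R D x) = (\<lambda>x. k (norm x) *R D x)"
  using assms(4) by (auto simp: indicator_def fun_eq_iff)
 ultimately show ?thesis by simp
qed

lemma integral_homogeneous:
 fixes D :: "'a::euclidean_space => 'b::{banach, second_countable_topology}"
 assumes "continuous_on (-{0}) D" "\<And>t x. t > 0 ==> x \<noteq> 0 ==> D (t *R x) = inverse (t ^ DIM('a)) *R D x"
  and "continuous_on UNIV k" "0 < a" "\<And>s. s \<notin> {a..b} ==> k s = (0::real)"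
 shows "(LINT x|lborel. k (norm x) *R D x) = (LINT S:{a..b}|lborel. k S / S) *R (LA x. D x)"
proof -
 let ?I = "LINT S:{a..b}|lborel. k S / S"
 let ?w = "\<lambda>t x. indicator {0<..} t * (k (t * norm (x::'a)) / t)"
 have c: "(LINT t|lborel. indicator {0<..} t * (k (t * r) / t)) = ?I" if r: "r > 0" for r
 proof -
  have "?I = (LINT S|lborel. indicator {0<..} S * (k S / S))"
   unfolding set_lebesgue_integral_def
   by (rule Bochner_Integration.integral_cong) (use assms(4,5) in \<open>auto simp: indicator_def\<close>)
  also have "\<dots> = \<bar>r\<bar> *R (LINT t|lborel. indicator {0<..} (0 + r * t) * (k (0 + r * t) / (0 + r * t)))"
   by (rule lborel_integral_real_affine) (use r in auto)
  also have "\<dots> = (LINT t|lborel. r * (indicator {0<..} (r * t) * (k (r * t) / (r * t))))"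
   using r by (simp only: integral_mult_right_zero[symmetric] add_0 real_scaleR_def abs_of_pos)
  also have "\<dots> = (LINT t|lborel. indicator {0<..} t * (k (t * r) / t))"
   by (rule Bochner_Integration.integral_cong) (use r in \<open>auto simp: indicator_def zero_less_mult_iff mult.commute\<close>)
  finally show ?thesis ..
 qed
 obtain n where n: "DIM('a) = Suc n" using DIM_positive[where 'a='a] gr0_implies_Suc by blast
 have "(LINT x|lborel. k (norm x) *R D x)
  = (LINT x|lborel. (LINT t|lborel. (indicator ann x * indicator {0<..} t * t ^ (DIM('a) - 1)) *R (k (norm (t *R x)) *R D (t *R x))))"
  by (rule integral_polar[symmetric], rule integrable_radial_cutoff[OF assms(1,3-5)])
 also have "\<dots> = (LINT x|lborel. (LINT t|lborel. (?w t x) *R (indicator ann x *R D x)))"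
  by (intro Bochner_Integration.integral_cong refl)
   (auto simp: indicator_def assms(2) ann_nz n field_simps)
 also have "\<dots> = (LINT x|lborel. ?I *R (indicator ann x *R D x))"
 proof (intro Bochner_Integration.integral_cong refl)
  fix x :: 'a
  show "(LINT t|lborel. (?w t x) *R (indicator ann x *R D x)) = ?I *R (indicator ann x *R D x)"
  proof (cases "x \<in> ann")
   case True
   have "integrable lborel (\<lambda>t. ?w t x)"
   proof -
    have "integrable lborel (\<lambda>t. k (norm (norm x * t)) *R (indicator {0<..} t / t))"
    proof -
     have nx: "norm x > 0" using ann_nz[OF True] by simp
     have sup: "k (norm x * s) = 0" if "s \<notin> {a / norm x..b / norm x}" for s
      using assms(5)[of "norm x * s"] that nx by (auto simp: field_simps)
     have "continuous_on (- {0::real}) (\<lambda>t. indicator {0<..} t / t)"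
     proof -
      have o: "open ({0<..} :: real set)" "open ({..<0} :: real set)" by auto
      have "continuous_on ({0<..} \<union> {..<0::real}) (\<lambda>t. indicator {0<..} t / t :: real)"
      proof (rule continuous_on_open_Un[OF o])
       have "continuous_on {0<..} (\<lambda>t::real. 1 / t)" by (intro continuous_intros) auto
       then show "continuous_on {0<..} (\<lambda>t. indicator {0<..} t / t :: real)"
        by (rule continuous_on_eq) auto
       show "continuous_on {..<0} (\<lambda>t. indicator {0<..} t / t :: real)"
        by (rule continuous_on_eq[OF continuous_on_const[of _ 0]]) (auto simp: indicator_def)
      qed
      moreover have "{0<..} \<union> {..<0::real} = - {0}" by auto
      ultimately show ?thesis by simp
     qed
     then have "integrable lborel (\<lambda>t. k (norm x * norm t) *R (indicator {0<..} t / t :: real))"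
     proof (rule integrable_radial_cutoff[where k="\<lambda>s. k (norm x * s)"])
      show "continuous_on UNIV (\<lambda>s. k (norm x * s))"
       by (rule continuous_on_compose2[OF assms(3)]) (auto intro: continuous_intros)
      show "0 < a / norm x" using nx assms(4) by simp
     qed (rule sup)
     then show ?thesis by (simp add: abs_mult)
    qed
    then show ?thesis
     by (rule Bochner_Integration.integrable_cong[THEN iffD1, rotated 2])
      (auto simp: indicator_def abs_mult mult.commute)
   qed
   then have "(LINT t|lborel. (?w t x) *R (indicator ann x *R D x))
    = (LINT t|lborel. ?w t x) *R (indicator ann x *R D x)"
    by (rule integral_scaleR_left)
   then show ?thesis using c[of "norm x"] ann_nz[OF True] by simp
  qed simp
 qed
 also have "\<dots> = ?I *R (LA x. D x)"
  unfolding set_lebesgue_integral_def by (rule integral_scaleR_right)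
 finally show ?thesis .
qed

lemma integral_dd_compact_support:
 fixes H :: "'a::euclidean_space => 'b::{banach, second_countable_topology}"
 assumes "Ck_on (Suc 0) H UNIV" "\<And>x. norm x > R ==> H x = 0"
 shows "(LINT x:cball 0 (R + 1)|lborel. dd v H x) = 0"
proof -
 define F where "F = (\<lambda>p :: real \<times> 'a. H (snd p + fst p *R v))"
 have F: "Ck_on (Suc 0) F UNIV"
  unfolding F_def
  by (rule Ck_compose[where T=UNIV, OF open_UNIV open_UNIV _ _ assms(1)])
   (intro subset_UNIV Ck_add Ck_scaleR Ck_fst Ck_snd Ck_id Ck_const open_UNIV)+
 let ?K = "cball (0::'a) (R + 1)"
 define d where "d = 1 / (norm v + 1)"
 have nV: "norm v + 1 > 0" by (intro add_nonneg_pos) auto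
 have d: "d > 0" using nV by (simp add: d_def)
 let ?g = "\<lambda>t. LINT x:?K|lborel. F (t, x)"
 have g: "?g t = (LINT x|lborel. H x)" if "\<bar>t\<bar> < d" for t
 proof -
  have "norm (t *R v) < 1"
  proof -
   have "\<bar>t\<bar> * norm v \<le> \<bar>t\<bar> * (norm v + 1)" by (intro mult_left_mono) auto
   also have "\<dots> < 1" using that nV by (simp add: d_def pos_less_divide_eq)
   finally show ?thesis by simp
  qed
  then have "indicator ?K x *R H (x + t *R v) = H (x + t *R v)" for x
   using assms(2)[of "x + t *R v"] norm_triangle_ineq2[of x "- t *R v"] by (auto simp: indicator_def)
  then have "?g t = (LINT x|lborel. H (x + t *R v))" by (simp add: set_lebesgue_integral_def F_def)
  also have "\<dots> = (LINT x|lborel. H x)"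
   using lborel_distr_plus[of "t *R v"] Ck_continuous[OF assms(1)]
   by (subst (2) lborel_distr_plus[of "t *R v", symmetric], subst integral_distr)
    (auto simp: add.commute intro: borel_measurable_continuous_onI)
  finally show ?thesis .
 qed
 have "(?g has_derivative (\<lambda>s. LINT x:?K|lborel. dd (s, 0) F (0, x))) (at 0)"
  by (rule has_derivative_integral_compact[OF open_UNIV open_UNIV _ _ F]) auto
 moreover have "(?g has_derivative (\<lambda>s. 0)) (at 0)"
  by (rule has_derivative_transform_within_open[of "\<lambda>t. LINT x|lborel. H x" _ _ _ "{-d<..<d}"])
   (use g d in auto)
 ultimately have "(\<lambda>s. LINT x:?K|lborel. dd (s, 0) F (0, x)) = (\<lambda>s. 0)"
  by (rule has_derivative_unique)
 then have "(LINT x:?K|lborel. dd (1, 0) F (0, x)) = 0" by (rule fun_cong)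
 moreover have "dd (1, 0) F (0, x) = dd v H x" for x
 proof -
  have "(F has_derivative (\<lambda>p. frechet_derivative H (at (snd (0::real, x) + fst (0::real, x) *R v)) (snd p + fst p *R v))) (at (0, x))"
   unfolding F_def
   by (rule has_derivative_compose[OF _ Ck_deriv[OF open_UNIV assms(1) UNIV_I]]) (auto intro!: derivative_eq_intros)
  from dd_eq[OF this, of "(1, 0)"] show ?thesis by simp
 qed
 ultimately show ?thesis by simp
qed

lemma has_derivative_max0_square: "((\<lambda>y::real. (max 0 y)^2) has_derivative (\<lambda>v. 2 * max 0 y * v)) (at y)"
proof -
 consider "y > 0" | "y < 0" | "y = 0" by linarith
 then show ?thesis
 proof cases
  case 1
  show ?thesis
   by (rule has_derivative_transform_within_open[of "\<lambda>y. y^2" _ _ _ "{0<..}"])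
    (use 1 in \<open>auto intro!: derivative_eq_intros simp: max_def\<close>)
 next
  case 2
  show ?thesis
   by (rule has_derivative_transform_within_open[of "\<lambda>y. 0" _ _ _ "{..<0}"])
    (use 2 in \<open>auto intro!: derivative_eq_intros simp: max_def\<close>)
 next
  case 3
  have "norm ((max 0 y)^2 - (max 0 0)^2 - (2 * max 0 0 * (y - 0))) \<le> e * norm (y - 0)" if "norm (y - 0) < e" "e > 0" for y e :: real
  proof -
   have "(max 0 y)^2 \<le> \<bar>y\<bar> * \<bar>y\<bar>" by (auto simp: max_def power2_eq_square)
   also have "\<dots> \<le> e * \<bar>y\<bar>" using that by (intro mult_right_mono) auto
   finally show ?thesis by simp
  qed
  moreover have "bounded_linear (\<lambda>v::real. 2 * max 0 0 * v)" by (rule bounded_linear_mult_right)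
  ultimately show ?thesis
   unfolding 3 has_derivative_at_alt by blast
 qed
qed

lemma open_nz: "open (-{0::'a::real_normed_vector})"
 by auto

lemma dd_equivariant:
 fixes F :: "'a::real_normed_vector => 'b::real_normed_vector"
 assumes A: "bounded_linear A" and F: "Ck_on (Suc 0) F (-{0})" and nz: "A x \<noteq> 0" "x \<noteq> 0"
  and eq: "\<And>y. y \<noteq> 0 ==> F (A y) = h (F y)" and h: "(h has_derivative h') (at (F x))"
 shows "dd (A v) F (A x) = h' (dd v F x)"
proof -
 have z: "A x \<in> -{0}" "x \<in> -{0}" using nz by auto
 have "((\<lambda>x. F (A x)) has_derivative (\<lambda>v. dd (A v) F (A x))) (at x)"
  by (rule has_derivative_compose[OF bounded_linear_imp_has_derivative[OF A] Ck_deriv[OF open_nz F z(1)]])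
 moreover have "((\<lambda>x. h (F x)) has_derivative (\<lambda>v. h' (dd v F x))) (at x)"
  by (rule has_derivative_compose[OF Ck_deriv[OF open_nz F z(2)] h])
 then have "((\<lambda>x. F (A x)) has_derivative (\<lambda>v. h' (dd v F x))) (at x)"
  by (rule has_derivative_transform_within_open[OF _ open_nz z(2)]) (use eq in auto)
 ultimately have "(\<lambda>v. dd (A v) F (A x)) = (\<lambda>v. h' (dd v F x))" by (rule has_derivative_unique)
 then show ?thesis by (rule fun_cong)
qed

lemma dd_scaled:
 fixes F :: "'a::real_normed_vector => 'b::real_normed_vector"
 assumes F: "Ck_on (Suc 0) F (-{0})" and "t > 0" "x \<noteq> 0"
  and "\<And>y. y \<noteq> 0 ==> F (t *R y) = h (F y)" and "(h has_derivative h') (at (F x))"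
 shows "t *R dd v F (t *R x) = h' (dd v F x)"
 using dd_equivariant[OF bounded_linear_scaleR_right F, of t x h h' v] assms
  linear_scale[OF dd_linear[OF open_nz F, of "t *R x"], of t v] by simp

lemma integral_ann_dd_eq_0:
 fixes F :: "'a::euclidean_space => 'b::{banach, second_countable_topology}"
 assumes F: "Ck_on (Suc 0) F (-{0})" and hom: "\<And>t x. t > 0 ==> x \<noteq> 0 ==> F (t *R x) = (t / t ^ DIM('a)) *R F x"
 shows "(LA x. dd v F x) = 0"
proof -
 let ?I = "\<lambda>f. LINT s:{1..2}|lborel. f s / s"
 define q where "q = (\<lambda>y::real. (y - 1) * (2 - y))"
 define ch where "ch = (\<lambda>y. (max 0 (q y))^2)"
 define ch' where "ch' = (\<lambda>y. 2 * max 0 (q y) * (3 - 2 * y))"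
 have chd: "(ch has_derivative (\<lambda>h. h * ch' y)) (at y)" for y
 proof -
  have "(q has_derivative (\<lambda>h. h * (3 - 2 * y))) (at y)"
   unfolding q_def by (auto intro!: derivative_eq_intros simp: algebra_simps)
  from has_derivative_compose[OF this has_derivative_max0_square] show ?thesis
   unfolding ch_def ch'_def by (simp add: algebra_simps)
 qed
 have ch0: "ch y = 0" "ch' y = 0" if "y \<notin> {1..2}" for y
 proof -
  have "q y \<le> 0" using that unfolding q_def by (auto simp: mult_le_0_iff)
  then show "ch y = 0" "ch' y = 0" by (simp_all add: ch_def ch'_def max_def)
 qed
 have chc: "continuous_on S ch" "continuous_on S ch'" for S
  unfolding ch_def ch'_def q_def by (intro continuous_intros)+
 define H where "H = (\<lambda>x. ch (norm x) *R F x)"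
 have on0: "open (-{0::'a})" by auto
 have chn: "((\<lambda>x. ch (norm x)) has_derivative (\<lambda>v. (v \<bullet> x / norm x) * ch' (norm x))) (at x)" if "x \<noteq> 0" for x :: 'a
  using has_derivative_compose[OF has_derivative_norm[OF that] chd] by (simp add: sgn_div_norm divide_inverse mult.commute)
 have "Ck_on (Suc 0) (\<lambda>x::'a. ch (norm x)) (-{0})"
  by (rule Ck_SucI[OF on0 chn]) (auto intro!: continuous_intros continuous_on_compose2[OF chc(2)[of UNIV]])
 then have Hn: "Ck_on (Suc 0) H (-{0})" unfolding H_def by (intro Ck_scaleR on0 F)
 have H0: "H x = 0" if "norm x < 1" for x using ch0(1)[of "norm x"] that by (simp add: H_def)
 have H2: "H x = 0" if "norm x > 2" for x using ch0(1)[of "norm x"] that by (simp add: H_def)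
 have Hk: "Ck_on (Suc 0) H UNIV"
 proof (rule Ck_local)
  fix x :: 'a
  have "Ck_on (Suc 0) H (ball 0 1)"
   by (rule Ck_cong[OF _ Ck_const[of _ 0]]) (auto simp: H0)
  then show "\<exists>T. open T \<and> x \<in> T \<and> Ck_on (Suc 0) H T"
   using Hn on0 by (cases "x = 0") (auto intro: exI[of _ "ball 0 1"] exI[of _ "-{0}"])
 qed
 define D2 where "D2 = (\<lambda>x. ((x \<bullet> v) / (x \<bullet> x)) *R F x)"
 define ch2 where "ch2 = (\<lambda>s. s * ch' s)"
 have dH: "dd v H x = ch (norm x) *R dd v F x + ch2 (norm x) *R D2 x" if "x \<noteq> 0" for x
 proof -
  have "(H has_derivative (\<lambda>v. ch (norm x) *R dd v F x + ((v \<bullet> x / norm x) * ch' (norm x)) *R F x)) (at x)"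
   unfolding H_def using Ck_deriv[OF on0 F, of x] that by (intro has_derivative_scaleR chn) auto
  from dd_eq[OF this, of v] show ?thesis
   using that by (simp add: D2_def ch2_def dot_square_norm power2_eq_square inner_commute)
 qed
 have cdd: "continuous_on (-{0}) (dd v F)" using Ck_continuous[OF Ck_dd[OF F]] .
 have cD2: "continuous_on (-{0}) D2"
  unfolding D2_def by (intro continuous_intros Ck_continuous[OF F]) auto
 have homdd: "dd v F (t *R x) = inverse (t ^ DIM('a)) *R dd v F x" if "t > 0" "x \<noteq> 0" for t x
 proof -
  have "t *R dd v F (t *R x) = (t / t ^ DIM('a)) *R dd v F x"
   by (rule dd_scaled[OF F that]) (use hom that in \<open>auto intro!: derivative_eq_intros\<close>)
  then have "t *R dd v F (t *R x) = t *R (inverse (t ^ DIM('a)) *R dd v F x)" by (simp only: divide_inverse scaleR_scaleR)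
  then show ?thesis using that by (simp only: real_vector.scale_cancel_left) simp
 qed
 have homD2: "D2 (t *R x) = inverse (t ^ DIM('a)) *R D2 x" if "t > 0" "x \<noteq> 0" for t x
  using that by (simp add: D2_def hom field_simps)
 have supp: "ch s = 0" "ch2 s = 0" if "s \<notin> {1..2}" for s using ch0[OF that] by (simp_all add: ch2_def)
 have ch2c: "continuous_on UNIV ch2" unfolding ch2_def by (intro continuous_intros chc)
 have c2: "?I ch2 = 0"
 proof -
  have "(ch' has_integral ch 2 - ch 1) {1..2}"
   using chd by (intro fundamental_theorem_of_calculus)
    (auto simp: has_vector_derivative_def intro: has_derivative_at_withinI)
  then have "integral {1..2} ch' = 0" by (intro integral_unique) (simp add: ch_def q_def)
  moreover have "(LINT s:{1..2}|lborel. ch' s) = integral {1..2} ch'"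
   by (rule set_borel_integral_eq_integral(2), intro set_integrable_compact compact_Icc chc)
  moreover have "?I ch2 = (LINT s:{1..2}|lborel. ch' s)"
   by (rule set_lebesgue_integral_cong) (auto simp: ch2_def)
  ultimately show ?thesis by simp
 qed
 have c1: "?I ch > 0"
 proof -
  have ci: "continuous_on {1..2} (\<lambda>s. ch s / s)"
   by (intro continuous_intros chc) auto
  have "?I ch = integral {1..2} (\<lambda>s. ch s / s)"
   by (rule set_borel_integral_eq_integral(2), intro set_integrable_compact compact_Icc ci)
  moreover have "integral {1..2} (\<lambda>s. ch s / s) \<noteq> 0"
  proof
   assume "integral {1..2} (\<lambda>s. ch s / s) = 0"
   then have "\<forall>s\<in>{1..2}. ch s / s = 0"
    by (subst (asm) integral_eq_0_iff[OF ci]) (auto simp: ch_def)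
   then have "ch (3/2) / (3/2) = 0" by (rule bspec) simp
   then show False by (simp add: ch_def q_def)
  qed
  moreover have "integral {1..2} (\<lambda>s. ch s / s) \<ge> 0"
   by (rule integral_nonneg[OF integrable_continuous_real[OF ci]]) (auto simp: ch_def)
  ultimately show ?thesis by simp
 qed
 have "0 = (LINT x:cball 0 (2 + 1)|lborel. dd v H x)"
  by (rule integral_dd_compact_support[OF Hk H2, symmetric])
 also have "\<dots> = (LINT x|lborel. ch (norm x) *R dd v F x + ch2 (norm x) *R D2 x)"
  unfolding set_lebesgue_integral_def
 proof (rule integral_cong_AE)
  have "AE x in lborel. x \<noteq> (0::'a)" by (rule AE_lborel_singleton)
  then show "AE x in lborel. indicat_real (cball 0 (2 + 1)) x *R dd v H x = ch (norm x) *R dd v F x + ch2 (norm x) *R D2 x"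
  proof eventually_elim
   case (elim x)
   have "ch (norm x) = 0" "ch2 (norm x) = 0" if "norm x > 3" using supp[of "norm x"] that by auto
   then show ?case using elim by (cases "norm x > 3") (simp_all add: dH)
  qed
  have "continuous_on UNIV (dd v H)" using Ck_continuous[OF Ck_dd[OF Hk]] .
  then have "dd v H \<in> borel_measurable borel" by (rule borel_measurable_continuous_onI)
  then show "(\<lambda>x. indicat_real (cball 0 (2 + 1)) x *R dd v H x) \<in> borel_measurable lborel"
   unfolding measurable_lborel1 by (intro borel_measurable_scaleR borel_measurable_indicator) auto
  show "(\<lambda>x. ch (norm x) *R dd v F x + ch2 (norm x) *R D2 x) \<in> borel_measurable lborel"
   using borel_measurable_integrable[OF integrable_radial_cutoff[OF cdd chc(1) zero_less_one supp(1)]]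
    borel_measurable_integrable[OF integrable_radial_cutoff[OF cD2 ch2c zero_less_one supp(2)]]
   by (intro borel_measurable_add) auto
 qed
 also have "\<dots> = (LINT x|lborel. ch (norm x) *R dd v F x) + (LINT x|lborel. ch2 (norm x) *R D2 x)"
  by (intro Bochner_Integration.integral_add integrable_radial_cutoff[OF cdd chc(1) zero_less_one supp(1)]
    integrable_radial_cutoff[OF cD2 ch2c zero_less_one supp(2)])
 also have "\<dots> = ?I ch *R (LA x. dd v F x)"
 proof -
  have "(LINT x|lborel. ch (norm x) *R dd v F x) = ?I ch *R (LA x. dd v F x)"
   by (rule integral_homogeneous[OF cdd homdd chc(1) zero_less_one supp(1)])
  moreover have "(LINT x|lborel. ch2 (norm x) *R D2 x) = ?I ch2 *R (LA x. D2 x)"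
   by (rule integral_homogeneous[OF cD2 homD2 ch2c zero_less_one supp(2)])
  ultimately show ?thesis unfolding c2 by simp
 qed
 finally show ?thesis using c1 by auto
qed

definition cspan :: "('a => complex) set => ('a => complex) set" where
 "cspan B = {f. \<exists>c. f = (\<lambda>x. \<Sum>b\<in>B. c b * b x)}"

lemma cspan_base: "finite B ==> b \<in> B ==> b \<in> cspan B"
proof -
 assume B: "finite B" "b \<in> B"
 have "b = (\<lambda>x. \<Sum>b'\<in>B. (if b' = b then 1 else 0) * b' x)"
 proof
  fix x
  have "(\<Sum>b'\<in>B. (if b' = b then 1 else 0) * b' x) = (\<Sum>b'\<in>B. if b' = b then b x else 0)"
   by (intro sum.cong) auto
  then show "b x = (\<Sum>b'\<in>B. (if b' = b then 1 else 0) * b' x)" using B by simp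
 qed
 then show ?thesis unfolding cspan_def mem_Collect_eq by (intro exI[of _ "\<lambda>b'. if b' = b then 1 else 0"])
qed

lemma cspan_add: "f \<in> cspan B ==> g \<in> cspan B ==> (\<lambda>x. f x + g x) \<in> cspan B"
proof -
 assume "f \<in> cspan B" "g \<in> cspan B"
 then obtain c d where "f = (\<lambda>x. \<Sum>b\<in>B. c b * b x)" "g = (\<lambda>x. \<Sum>b\<in>B. d b * b x)" by (auto simp: cspan_def)
 then show ?thesis
  unfolding cspan_def by (auto intro!: exI[of _ "\<lambda>b. c b + d b"] simp: fun_eq_iff sum.distrib distrib_right)
qed

lemma cspan_cmult: "f \<in> cspan B ==> (\<lambda>x. a * f x) \<in> cspan B"
proof -
 assume "f \<in> cspan B"
 then obtain c where "f = (\<lambda>x. \<Sum>b\<in>B. c b * b x)" by (auto simp: cspan_def)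
 then show ?thesis
  unfolding cspan_def by (auto intro!: exI[of _ "\<lambda>b. a * c b"] simp: fun_eq_iff sum_distrib_left mult.assoc)
qed

lemma cspan_zero: "(\<lambda>x. 0) \<in> cspan B"
 unfolding cspan_def by (auto intro!: exI[of _ "\<lambda>b. 0"])

lemma cspan_sum: "(\<And>i. i \<in> I ==> f i \<in> cspan B) ==> (\<lambda>x. \<Sum>i\<in>I. f i x) \<in> cspan B"
 by (induction I rule: infinite_finite_induct) (auto intro: cspan_zero cspan_add)

lemma cspan_insert:
 assumes "finite B" "b \<notin> B" "f \<in> cspan (insert b B)"
 obtains f' c where "f' \<in> cspan B" "f = (\<lambda>x. f' x + c * b x)"
proof -
 obtain c where "f = (\<lambda>x. \<Sum>b'\<in>insert b B. c b' * b' x)" using assms(3) by (auto simp: cspan_def)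
 then show ?thesis
  using assms that[of "\<lambda>x. \<Sum>b'\<in>B. c b' * b' x" "c b"] by (auto simp: cspan_def add.commute)
qed

lemma cspan_mono: "finite C ==> B \<subseteq> C ==> f \<in> cspan B ==> f \<in> cspan C"
proof -
 assume *: "finite C" "B \<subseteq> C" "f \<in> cspan B"
 then obtain c where "f = (\<lambda>x. \<Sum>b\<in>B. c b * b x)" by (auto simp: cspan_def)
 then show ?thesis using * by (auto intro!: cspan_sum cspan_cmult cspan_base)
qed

section \<open>Bihomogeneous polynomials\<close>

inductive BH :: "nat => nat => (complex^'m => complex) => bool" where
 BH_const: "BH 0 0 (\<lambda>z. c)"
| BH_z: "BH a b f ==> BH (Suc a) b (\<lambda>z. z $ i * f z)"
| BH_zbar: "BH a b f ==> BH a (Suc b) (\<lambda>z. cnj (z $ i) * f z)"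
| BH_add: "BH a b f ==> BH a b g ==> BH a b (\<lambda>z. f z + g z)"

lemma BH_eq: "BH a b f ==> (\<And>z. f z = g z) ==> BH a b g"
 by (metis ext)

lemma BH_cmult: "BH a b f ==> BH a b (\<lambda>z. c * f z)"
proof (induction rule: BH.induct)
 case (BH_z a b f i)
 show ?case by (rule BH_eq[OF BH.BH_z[OF BH_z.IH, of i]]) simp
next
 case (BH_zbar a b f i)
 show ?case by (rule BH_eq[OF BH.BH_zbar[OF BH_zbar.IH, of i]]) simp
next
 case (BH_add a b f g)
 show ?case by (rule BH_eq[OF BH.BH_add[OF BH_add.IH]]) (simp add: distrib_left)
qed (rule BH_const)

lemma BH_zero: "BH a b (\<lambda>z :: complex^'m. 0)"
proof -
 have "\<exists>f :: complex^'m => complex. BH a b f"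
 proof (induction a)
  case 0
  then show ?case by (induction b) (use BH_const BH_zbar in blast)+
 next
  case (Suc a)
  then show ?case using BH_z by blast
 qed
 then show ?thesis using BH_cmult[of a b _ 0] by auto
qed

lemma BH_sum: "(\<And>i. i \<in> I ==> BH a b (f i)) ==> BH a b (\<lambda>z. \<Sum>i\<in>I. f i z)"
 by (induction I rule: infinite_finite_induct) (auto intro: BH_zero BH_add)

lemma BH_mult: "BH a b f ==> BH a' b' g ==> BH (a + a') (b + b') (\<lambda>z. f z * g z)"
proof (induction rule: BH.induct)
 case (BH_const c)
 then show ?case by (simp add: BH_cmult)
next
 case (BH_z a b f i)
 show ?case using BH_eq[OF BH.BH_z[OF BH_z.IH[OF BH_z.prems], of i]] by (simp add: mult.assoc)
next
 case (BH_zbar a b f i)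
 show ?case using BH_eq[OF BH.BH_zbar[OF BH_zbar.IH[OF BH_zbar.prems], of i]] by (simp add: mult.assoc)
next
 case (BH_add a b f g')
 show ?case using BH_eq[OF BH.BH_add[OF BH_add.IH(1)[OF BH_add.prems] BH_add.IH(2)[OF BH_add.prems]]] by (simp add: distrib_right)
qed

lemma BH_nth: "BH 1 0 (\<lambda>z. z $ i)" "BH 0 1 (\<lambda>z. cnj (z $ i))"
 using BH_z[OF BH_const[of 1], of i] BH_zbar[OF BH_const[of 1], of i] by simp_all

lemma BH_power: "BH a b f ==> BH (n * a) (n * b) (\<lambda>z. f z ^ n)"
 by (induction n) (auto simp: BH_const intro: BH_mult)

lemma BH_prod: "finite I ==> (\<And>i. i \<in> I ==> BH (a i) (b i) (f i)) ==> BH (sum a I) (sum b I) (\<lambda>z. \<Prod>i\<in>I. f i z)"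
 by (induction I rule: finite_induct) (auto simp: BH_const intro: BH_mult)

lemma BH_scale: "BH a b f ==> f (c *s z) = c ^ a * cnj c ^ b * f z"
 by (induction rule: BH.induct) (auto simp: algebra_simps)

lemma BH_Ck: "BH a b f ==> open S ==> Ck_on k f S"
 by (induction rule: BH.induct)
  (auto intro!: Ck_mult Ck_add Ck_cnj Ck_vec_nth Ck_id)

definition nn :: "complex^'m => complex" where
 "nn z = of_real ((norm z)^2)"

lemma nn_sum: "nn z = (\<Oplus>i. z $ i * cnj (z $ i))"
proof -
 have "(norm z)^2 = (\<Oplus>i. (cmod (z $ i))^2)"
  by (simp add: norm_vec_def L2_set_def sum_nonneg)
 then show ?thesis unfolding nn_def by (simp only: of_real_sum complex_norm_square)
qed

lemma BH_nn: "BH 1 1 nn"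
proof -
 have "BH 1 1 (\<lambda>z. \<Oplus>i. z $ i * cnj (z $ i))"
  using BH_mult[OF BH_nth] by (intro BH_sum) simp
 then show ?thesis by (rule BH_eq) (simp add: nn_sum)
qed

lemma Ck_nth: "open S ==> Ck_on k (\<lambda>z :: complex^'m. z $ i) S" "open S ==> Ck_on k (\<lambda>z :: complex^'m. cnj (z $ i)) S"
 by (intro Ck_cnj Ck_vec_nth Ck_id; assumption)+

lemma wirtinger_cnj_nth:
 "dz j (\<lambda>z :: complex^'m. cnj (z $ i)) x = 0"
 "dzb j (\<lambda>z :: complex^'m. cnj (z $ i)) x = (if i = j then 1 else 0)"
 using wirtinger_cnj[OF open_UNIV Ck_nth(1)[OF open_UNIV, of "Suc 0"] UNIV_I, of "axis j" i x] wirtinger_nth[of j i x] by auto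

lemma BH_wirtinger:
 fixes f :: "complex^'m => complex"
 assumes "BH a b f"
 shows "(a = 0 \<longrightarrow> dz i f = (\<lambda>z. 0)) \<and> BH (a - 1) b (dz i f) \<and>
  (b = 0 \<longrightarrow> dzb i f = (\<lambda>z. 0)) \<and> BH a (b - 1) (dzb i f)"
 using assms
proof (induction rule: BH.induct)
 case (BH_const c)
 show ?case using BH_zero[of 0 0] by (simp add: fun_eq_iff)
next
 case (BH_z a b f j)
 note C = BH_Ck[OF BH_z.hyps open_UNIV, of "Suc 0"]
 have w: "dz i (\<lambda>z. z $ j * f z) = (\<lambda>z. (if j = i then 1 else 0) * f z + z $ j * dz i f z)"
  "dzb i (\<lambda>z. z $ j * f z) = (\<lambda>z. z $ j * dzb i f z)"
  by (simp_all add: fun_eq_iff wirtinger_mult[OF open_UNIV Ck_nth(1)[OF open_UNIV] C UNIV_I] wirtinger_nth)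
 have "BH a b (\<lambda>z. z $ j * dz i f z)"
  using BH_z.IH BH.BH_z[of "a - 1" b "dz i f" j] BH_zero[of a b] by (cases a) auto
 then show ?case
  unfolding w using BH_z.IH BH_add[OF BH_cmult[OF BH_z.hyps]] BH.BH_z[of a "b - 1" "dzb i f" j] by auto
next
 case (BH_zbar a b f j)
 note C = BH_Ck[OF BH_zbar.hyps open_UNIV, of "Suc 0"]
 have w: "dzb i (\<lambda>z. cnj (z $ j) * f z) = (\<lambda>z. (if j = i then 1 else 0) * f z + cnj (z $ j) * dzb i f z)"
  "dz i (\<lambda>z. cnj (z $ j) * f z) = (\<lambda>z. cnj (z $ j) * dz i f z)"
  by (simp_all add: fun_eq_iff wirtinger_mult[OF open_UNIV Ck_nth(2)[OF open_UNIV] C UNIV_I] wirtinger_cnj_nth)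
 have "BH a b (\<lambda>z. cnj (z $ j) * dzb i f z)"
  using BH_zbar.IH BH.BH_zbar[of a "b - 1" "dzb i f" j] BH_zero[of a b] by (cases b) auto
 then show ?case
  unfolding w using BH_zbar.IH BH_add[OF BH_cmult[OF BH_zbar.hyps]] BH.BH_zbar[of "a - 1" b "dz i f" j] by auto
next
 case (BH_add a b f g)
 have w: "dz i (\<lambda>z. f z + g z) = (\<lambda>z. dz i f z + dz i g z)"
  "dzb i (\<lambda>z. f z + g z) = (\<lambda>z. dzb i f z + dzb i g z)"
  using wirtinger_add[OF open_UNIV BH_Ck[OF BH_add.hyps(1) open_UNIV, of "Suc 0"] BH_Ck[OF BH_add.hyps(2) open_UNIV] UNIV_I]
  by (simp_all add: fun_eq_iff)
 show ?case unfolding w using BH_add.IH BH.BH_add by auto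
qed

lemma BH_euler:
 fixes f :: "complex^'m => complex"
 assumes "BH a b f"
 shows "(\<Oplus>i. z $ i * dz i f z) = of_nat a * f z" (is ?g1)
  "(\<Oplus>i. cnj (z $ i) * dzb i f z) = of_nat b * f z" (is ?g2)
proof -
 have "(\<Oplus>i. z $ i * dz i f z) = of_nat a * f z \<and>
  (\<Oplus>i. cnj (z $ i) * dzb i f z) = of_nat b * f z"
  using assms
 proof (induction rule: BH.induct)
  case (BH_z a b f j)
  note C = BH_Ck[OF BH_z.hyps open_UNIV, of "Suc 0"]
  have w: "dz i (\<lambda>z. z $ j * f z) z = (if j = i then 1 else 0) * f z + z $ j * dz i f z"
   "dzb i (\<lambda>z. z $ j * f z) z = z $ j * dzb i f z" for i
   by (simp_all add: wirtinger_mult[OF open_UNIV Ck_nth(1)[OF open_UNIV] C UNIV_I] wirtinger_nth)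
  have "(\<Oplus>i. z $ i * dz i (\<lambda>z. z $ j * f z) z)
   = (\<Oplus>i. (if j = i then z $ i * f z else 0) + z $ j * (z $ i * dz i f z))"
   unfolding w by (intro sum.cong) (auto simp: algebra_simps)
  also have "\<dots> = z $ j * f z + z $ j * (\<Oplus>i. z $ i * dz i f z)"
   by (simp add: sum.distrib sum_distrib_left)
  also have "\<dots> = of_nat (Suc a) * (z $ j * f z)"
   using BH_z.IH by (simp add: algebra_simps)
  moreover have "(\<Oplus>i. cnj (z $ i) * dzb i (\<lambda>z. z $ j * f z) z) = z $ j * (\<Oplus>i. cnj (z $ i) * dzb i f z)"
   unfolding w sum_distrib_left by (simp add: mult_ac)
  ultimately show ?case using BH_z.IH by (simp add: mult_ac)
 next
  case (BH_zbar a b f j)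
  note C = BH_Ck[OF BH_zbar.hyps open_UNIV, of "Suc 0"]
  have w: "dzb i (\<lambda>z. cnj (z $ j) * f z) z = (if j = i then 1 else 0) * f z + cnj (z $ j) * dzb i f z"
   "dz i (\<lambda>z. cnj (z $ j) * f z) z = cnj (z $ j) * dz i f z" for i
   by (simp_all add: wirtinger_mult[OF open_UNIV Ck_nth(2)[OF open_UNIV] C UNIV_I] wirtinger_cnj_nth)
  have "(\<Oplus>i. cnj (z $ i) * dzb i (\<lambda>z. cnj (z $ j) * f z) z)
   = (\<Oplus>i. (if j = i then cnj (z $ i) * f z else 0) + cnj (z $ j) * (cnj (z $ i) * dzb i f z))"
   unfolding w by (intro sum.cong) (auto simp: algebra_simps)
  also have "\<dots> = cnj (z $ j) * f z + cnj (z $ j) * (\<Oplus>i. cnj (z $ i) * dzb i f z)"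
   by (simp add: sum.distrib sum_distrib_left)
  also have "\<dots> = of_nat (Suc b) * (cnj (z $ j) * f z)"
   using BH_zbar.IH by (simp add: algebra_simps)
  moreover have "(\<Oplus>i. z $ i * dz i (\<lambda>z. cnj (z $ j) * f z) z) = cnj (z $ j) * (\<Oplus>i. z $ i * dz i f z)"
   unfolding w sum_distrib_left by (simp add: mult_ac)
  ultimately show ?case using BH_zbar.IH by (simp add: mult_ac)
 next
  case (BH_add a b f g)
  then show ?case
   by (simp add: wirtinger_add[OF open_UNIV BH_Ck[OF BH_add.hyps(1) open_UNIV, of "Suc 0"] BH_Ck[OF BH_add.hyps(2) open_UNIV] UNIV_I]
     distrib_left sum.distrib)
 qed simp
 then show ?g1
  ?g2 by auto
qed

definition monset :: "nat => nat => (complex^'m => complex) set" where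
 "monset a b = (\<lambda>(I, J) z. (\<Prod>i\<leftarrow>I. z $ i) * (\<Prod>j\<leftarrow>J. cnj (z $ j))) ` ({I. length I = a} \<times> {J. length J = b})"

lemma finite_monset: "finite (monset a b :: (complex^'m => complex) set)"
proof -
 have "finite {I :: 'm list. length I = n}" for n
  using finite_lists_length_eq[of "UNIV :: 'm set" n] by simp
 then show ?thesis unfolding monset_def by simp
qed

lemma monset_I: "length I = a ==> length J = b ==> (\<lambda>z. (\<Prod>i\<leftarrow>I. z $ i) * (\<Prod>j\<leftarrow>J. cnj (z $ j))) \<in> monset a b"
 unfolding monset_def by force

lemma cspan_map:
 assumes "f \<in> cspan B" "finite C" "\<And>b. b \<in> B ==> (\<lambda>x. h x * b (r x)) \<in> cspan C"
 shows "(\<lambda>x. h x * f (r x)) \<in> cspan C"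
proof -
 obtain c where "f = (\<lambda>x. \<Sum>b\<in>B. c b * b x)" using assms(1) by (auto simp: cspan_def)
 then have "(\<lambda>x. h x * f (r x)) = (\<lambda>x. \<Sum>b\<in>B. c b * (h x * b (r x)))"
  by (simp add: sum_distrib_left mult.left_commute)
 also have "\<dots> \<in> cspan C" by (intro cspan_sum cspan_cmult assms(3))
 finally show ?thesis .
qed

lemma BH_imp_cspan: "BH a b f ==> f \<in> cspan (monset a b)"
proof (induction rule: BH.induct)
 case (BH_const c)
 have "(\<lambda>z :: complex^'a. 1) \<in> cspan (monset 0 0)"
  using cspan_base[OF finite_monset monset_I[of "[]" 0 "[]" 0]] by simp
 then show ?case using cspan_cmult[of _ _ c] by fastforce
next
 case (BH_z a b f i)
 show ?case
 proof (rule cspan_map[where r="\<lambda>x. x", OF BH_z.IH finite_monset])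
  fix m :: "complex^'a => complex" assume "m \<in> monset a b"
  then obtain I J where "length I = a" "length J = b" "m = (\<lambda>z. (\<Prod>i\<leftarrow>I. z $ i) * (\<Prod>j\<leftarrow>J. cnj (z $ j)))"
   by (auto simp: monset_def)
  then show "(\<lambda>x. x $ i * m x) \<in> cspan (monset (Suc a) b)"
   using cspan_base[OF finite_monset monset_I[of "i # I" "Suc a" J b]] by (simp add: mult.assoc)
 qed
next
 case (BH_zbar a b f i)
 show ?case
 proof (rule cspan_map[where r="\<lambda>x. x", OF BH_zbar.IH finite_monset])
  fix m :: "complex^'a => complex" assume "m \<in> monset a b"
  then obtain I J where "length I = a" "length J = b" "m = (\<lambda>z. (\<Prod>i\<leftarrow>I. z $ i) * (\<Prod>j\<leftarrow>J. cnj (z $ j)))"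
   by (auto simp: monset_def)
  then show "(\<lambda>x. cnj (x $ i) * m x) \<in> cspan (monset a (Suc b))"
   using cspan_base[OF finite_monset monset_I[of I a "i # J" "Suc b"]] by (simp add: mult.left_commute)
 qed
qed (rule cspan_add)

lemma monset_BH: "m \<in> monset a b ==> BH a b m"
proof -
 assume "m \<in> monset a b"
 then obtain I J where IJ: "length I = a" "length J = b" "m = (\<lambda>z. (\<Prod>i\<leftarrow>I. z $ i) * (\<Prod>j\<leftarrow>J. cnj (z $ j)))"
  by (auto simp: monset_def)
 have 1: "BH (length I) 0 (\<lambda>z. \<Prod>i\<leftarrow>I. z $ i)" for I :: "'a list"
  by (induction I) (auto simp: BH_const intro: BH_z)
 have 2: "BH 0 (length J) (\<lambda>z. \<Prod>i\<leftarrow>J. cnj (z $ i))" for J :: "'a list"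
  by (induction J) (auto simp: BH_const intro: BH_zbar)
 show ?thesis using BH_mult[OF 1 2, of I J] IJ by simp
qed

lemma BH_cspan: "BH a b f \<longleftrightarrow> f \<in> cspan (monset a b)"
proof
 assume "f \<in> cspan (monset a b)"
 then obtain c where f: "f = (\<lambda>x. \<Sum>m\<in>monset a b. c m * m x)" by (auto simp: cspan_def)
 show "BH a b f" unfolding f by (intro BH_sum BH_cmult monset_BH)
qed (rule BH_imp_cspan)

lemma finite_multiindices: "finite {a :: 'm::finite => nat. (\<Oplus>i. a i) = k}"
proof (rule finite_subset)
 show "{a :: 'm => nat. (\<Oplus>i. a i) = k} \<subseteq> PiE UNIV (\<lambda>_. {..k})"
 proof (intro subsetI PiE_I)
  fix a :: "'m => nat" and i assume "a \<in> {a. (\<Oplus>i. a i) = k}"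
  then show "a i \<in> {..k}" using member_le_sum[of i UNIV a] by auto
 qed auto
qed (simp add: finite_PiE)

lemma homogeneous_polys_BH: "homogeneous_polys k = {f :: complex^'m => complex. BH k 0 f}"
proof (intro equalityI subsetI)
 fix f :: "complex^'m => complex" assume "f \<in> homogeneous_polys k"
 then obtain c where f: "f = (\<lambda>z. \<Sum>\<alpha> | (\<Oplus>i. \<alpha> i) = k. c (\<alpha>::'m => nat) * (\<Prod>i\<in>UNIV. (z $ i) ^ \<alpha> i))"
  by (auto simp: homogeneous_polys_def)
 have "BH k 0 (\<lambda>z :: complex^'m. \<Prod>i\<in>UNIV. (z $ i) ^ \<alpha> i)" if "(\<Oplus>i. \<alpha> i) = k" for \<alpha> :: "'m => nat"
  using BH_prod[of UNIV "\<lambda>i. \<alpha> i * 1" "\<lambda>i. \<alpha> i * 0" "\<lambda>i z. (z $ i) ^ \<alpha> i", OF _ BH_power[OF BH_nth(1)]] that by simp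
 then show "f \<in> {f. BH k 0 f}" unfolding f by (auto intro!: BH_sum BH_cmult)
next
 have "b = 0 \<longrightarrow> f \<in> homogeneous_polys a" if "BH a b f" for a b and f :: "complex^'m => complex"
  using that
 proof (induction rule: BH.induct)
  case (BH_const c)
  have "{\<alpha> :: 'm => nat. (\<Oplus>i. \<alpha> i) = 0} = {\<lambda>i. 0}" by auto
  then show ?case by (auto simp: homogeneous_polys_def intro!: exI[of _ "\<lambda>_. c"])
 next
  case (BH_z a b f j)
  show ?case
  proof
   assume "b = 0"
   then obtain c where f: "f = (\<lambda>z. \<Sum>\<alpha> | (\<Oplus>i. \<alpha> i) = a. c (\<alpha>::'m => nat) * (\<Prod>i\<in>UNIV. (z $ i) ^ \<alpha> i))"
    using BH_z.IH by (auto simp: homogeneous_polys_def)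
   let ?u = "\<lambda>\<alpha> :: 'm => nat. \<alpha>(j := Suc (\<alpha> j))"
   let ?A = "\<lambda>n. {\<alpha> :: 'm => nat. (\<Oplus>i. \<alpha> i) = n}"
   have su: "(\<Oplus>i. ?u \<alpha> i) = Suc (\<Oplus>i. \<alpha> i)" for \<alpha>
    by (subst (1 2) sum.remove[of UNIV j]) auto
   have inj: "inj_on ?u (?A a)"
    by (rule inj_onI) (metis fun_upd_triv fun_upd_upd fun_upd_same nat.inject)
   have sub: "?u ` ?A a \<subseteq> ?A (Suc a)" using su by auto
   define c' where "c' = (\<lambda>\<beta>. if \<beta> \<in> ?u ` ?A a then c (inv_into (?A a) ?u \<beta>) else 0)"
   have "z $ j * f z = (\<Sum>\<beta>\<in>?A (Suc a). c' \<beta> * (\<Prod>i\<in>UNIV. (z $ i) ^ \<beta> i))" for z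
   proof -
    let ?m = "\<lambda>\<alpha> :: 'm => nat. \<Prod>i\<in>UNIV. (z $ i) ^ \<alpha> i"
    have "(\<Sum>\<beta>\<in>?A (Suc a). c' \<beta> * ?m \<beta>) = (\<Sum>\<beta>\<in>?u ` ?A a. c' \<beta> * ?m \<beta>)"
     by (rule sum.mono_neutral_right[OF finite_multiindices sub]) (auto simp: c'_def)
    also have "\<dots> = (\<Sum>\<alpha>\<in>?A a. c' (?u \<alpha>) * ?m (?u \<alpha>))"
     by (rule sum.reindex_cong[OF inj]) auto
    also have "\<dots> = (\<Sum>\<alpha>\<in>?A a. z $ j * (c \<alpha> * ?m \<alpha>))"
    proof (rule sum.cong[OF refl])
     fix \<alpha> assume \<alpha>: "\<alpha> \<in> ?A a"
     have "c' (?u \<alpha>) = c \<alpha>" unfolding c'_def using inv_into_f_f[OF inj \<alpha>] \<alpha> by auto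
     moreover have "?m (?u \<alpha>) = z $ j * ?m \<alpha>"
     proof -
      have "(\<Prod>i\<in>UNIV - {j}. (z $ i) ^ (?u \<alpha>) i) = (\<Prod>i\<in>UNIV - {j}. (z $ i) ^ \<alpha> i)"
       by (rule prod.cong) auto
      then show ?thesis by (simp add: prod.remove[of UNIV j])
     qed
     ultimately show "c' (?u \<alpha>) * ?m (?u \<alpha>) = z $ j * (c \<alpha> * ?m \<alpha>)" by simp
    qed
    finally show ?thesis unfolding f by (simp add: sum_distrib_left)
   qed
   then show "(\<lambda>z. z $ j * f z) \<in> homogeneous_polys (Suc a)"
    unfolding homogeneous_polys_def by blast
  qed
 next
  case (BH_add a b f g)
  show ?case
  proof
   assume "b = 0"
   then obtain c d where "f = (\<lambda>z. \<Sum>\<alpha> | (\<Oplus>i. \<alpha> i) = a. c (\<alpha>::'m => nat) * (\<Prod>i\<in>UNIV. (z $ i) ^ \<alpha> i))"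
    "g = (\<lambda>z. \<Sum>\<alpha> | (\<Oplus>i. \<alpha> i) = a. d (\<alpha>::'m => nat) * (\<Prod>i\<in>UNIV. (z $ i) ^ \<alpha> i))"
    using BH_add.IH by (auto simp: homogeneous_polys_def)
   then show "(\<lambda>z. f z + g z) \<in> homogeneous_polys a"
    unfolding homogeneous_polys_def by (auto intro!: exI[of _ "\<lambda>\<alpha>. c \<alpha> + d \<alpha>"] simp: sum.distrib distrib_right)
  qed
 qed simp
 then show "f \<in> homogeneous_polys k" if "f \<in> {f. BH k 0 f}" for f :: "complex^'m => complex"
  using that by auto
qed

lemma nn_nz: "z \<noteq> 0 ==> nn z \<noteq> 0"
 by (simp add: nn_def)

lemma nn_scale: "nn (c *s z) = of_real ((norm c)^2) * nn z"
 by (simp add: nn_def norm_cmult_vec power_mult_distrib)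

definition lsq :: "complex^'m => real" where
 "lsq z = ln (z \<bullet> z)"

lemma Ck_lsq: "Ck_on k lsq (-{0})"
 unfolding lsq_def[abs_def] by (intro Ck_ln_compose Ck_inner Ck_id open_nz) auto

lemma wirtinger_lsq:
 assumes "z \<noteq> 0"
 shows "dz b (\<lambda>z. complex_of_real (lsq z)) z = cnj (z $ b) / nn z" (is ?g1)
  "dzb b (\<lambda>z. complex_of_real (lsq z)) z = z $ b / nn z" (is ?g2)
proof -
 have "((\<lambda>z. complex_of_real (lsq z)) has_derivative (\<lambda>v. of_real (2 * (z \<bullet> v) / (z \<bullet> z)))) (at z)"
  unfolding lsq_def using assms by (auto intro!: derivative_eq_intros simp: inner_commute divide_inverse)
 then have d: "dd v (\<lambda>z. complex_of_real (lsq z)) z = of_real (2 * (z \<bullet> v) / (z \<bullet> z))" for v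
  by (rule dd_eq)
 have "nn z = of_real (z \<bullet> z)" by (simp add: nn_def power2_norm_eq_inner)
 then show ?g1
  ?g2
  unfolding wirtinger_def wirtinger_bar_def d \<open>nn z = of_real (z \<bullet> z)\<close>
  by (simp_all add: inner_axis inner_complex_def complex_eq_iff field_simps)
qed

definition EE :: "nat => complex^'m => complex" where
 "EE n z = complex_of_real (exp (- (real n * lsq z)))"

lemma EE_eq: "z \<noteq> 0 ==> EE n z = 1 / nn z ^ n"
 by (simp add: EE_def lsq_def nn_def exp_minus exp_of_nat_mult power2_norm_eq_inner inverse_eq_divide)

lemma EE_Suc: "z \<noteq> 0 ==> nn z * EE (Suc n) z = EE n z"
 by (simp add: EE_eq nn_nz)

lemma Ck_EE: "Ck_on k (EE n) (-{0})"
 unfolding EE_def[abs_def]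
 by (intro Ck_of_real Ck_exp_compose Ck_minus Ck_mult Ck_const Ck_lsq open_nz)

lemma wirtinger_EE:
 assumes "z \<noteq> 0"
 shows "dz b (EE n) z = - of_nat n * cnj (z $ b) * EE (Suc n) z" (is ?g1)
  "dzb b (EE n) z = - of_nat n * z $ b * EE (Suc n) z" (is ?g2)
proof -
 have z: "z \<in> -{0}" using assms by simp
 have C: "Ck_on (Suc 0) (\<lambda>z. real n * lsq z) (-{0} :: (complex^'a) set)"
  by (intro Ck_mult Ck_const Ck_lsq open_nz)
 have C': "Ck_on (Suc 0) (\<lambda>z. complex_of_real (lsq z)) (-{0} :: (complex^'a) set)"
  by (intro Ck_of_real Ck_lsq open_nz)
 have 1: "dz b (\<lambda>z. complex_of_real (real n * lsq z)) z = of_nat n * (cnj (z $ b) / nn z)"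
  "dzb b (\<lambda>z. complex_of_real (real n * lsq z)) z = of_nat n * (z $ b / nn z)"
  using wirtinger_cmult[OF open_nz C' z, of "axis b" "of_nat n"] wirtinger_lsq[OF assms, of b] by simp_all
 have eq: "EE n = (\<lambda>z :: complex^'a. complex_of_real (exp (- (real n * lsq z))))"
  by (simp add: EE_def fun_eq_iff)
 have s: "EE n z / nn z = EE (Suc n) z" using EE_eq[OF assms] by simp
 show ?g1
  ?g2
  unfolding eq wirtinger_exp_minus[OF open_nz C z] 1 s[symmetric]
  by (simp_all add: EE_def field_simps)
qed

abbreviation qt :: "nat => (complex^'m => complex) => complex^'m => complex" where
 "qt d p \<equiv> \<lambda>z. if z = 0 then 0 else p z / nn z ^ d"

definition Pk :: "nat => nat => (complex^'m => complex) => bool" where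
 "Pk k d g \<longleftrightarrow> (\<exists>p. BH (k + d) d p \<and> g = qt d p)"

definition chom :: "nat => (complex^'m => complex) => bool" where
 "chom k g \<longleftrightarrow> (\<forall>c z. c \<noteq> 0 \<longrightarrow> z \<noteq> 0 \<longrightarrow> g (c *s z) = c ^ k * g z)"

lemma cmult_vec_nz: "c \<noteq> 0 ==> z \<noteq> 0 ==> c *s (z :: complex^'m) \<noteq> 0"
 by (simp add: vec_eq_iff)

lemma Pk_chom: assumes "Pk k d g" shows "chom k g"
proof -
 obtain p where p: "BH (k + d) d p" "g = qt d p"
  using assms by (auto simp: Pk_def)
 have "g (c *s z) = c ^ k * g z" if "c \<noteq> 0" "z \<noteq> 0" for c z
 proof -
  have "of_real ((norm c)^2) = c * cnj c" by (simp only: complex_norm_square)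
  then show ?thesis
   using that unfolding p(2) by (simp add: cmult_vec_nz BH_scale[OF p(1)] nn_scale power_mult_distrib power_add nn_nz field_simps)
 qed
 then show ?thesis by (simp add: chom_def)
qed

lemma Pk_Ck: assumes "Pk k d g" shows "Ck_on j g (-{0})"
proof -
 obtain p where p: "BH (k + d) d p" "g = qt d p"
  using assms by (auto simp: Pk_def)
 have "Ck_on j (\<lambda>z. p z * EE d z) (-{0})" by (intro Ck_mult open_nz BH_Ck[OF p(1)] Ck_EE)
 then show ?thesis by (rule Ck_cong[OF open_nz]) (simp add: p(2) EE_eq)
qed

lemma Pk_Suc: assumes "Pk k d g" shows "Pk k (Suc d) g"
proof -
 obtain p where p: "BH (k + d) d p" "g = qt d p"
  using assms by (auto simp: Pk_def)
 have "BH (k + Suc d) (Suc d) (\<lambda>z. nn z * p z)" using BH_mult[OF BH_nn p(1)] by simp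
 then show ?thesis unfolding Pk_def p(2) by (intro exI[of _ "\<lambda>z. nn z * p z"]) (auto simp: nn_nz fun_eq_iff)
qed

lemma Pk_mono: "Pk k d g ==> d \<le> d' ==> Pk k d' g"
 by (induction d') (auto simp: le_Suc_eq intro: Pk_Suc)

lemma Pk_add: assumes "Pk k d g" "Pk k d g'" shows "Pk k d (\<lambda>z. g z + g' z)"
proof -
 obtain p where p: "BH (k + d) d p" "g = qt d p"
  using assms by (auto simp: Pk_def)
 obtain p' where p': "BH (k + d) d p'" "g' = qt d p'"
  using assms by (auto simp: Pk_def)
 show ?thesis unfolding Pk_def p(2) p'(2)
  by (intro exI[of _ "\<lambda>z. p z + p' z"]) (auto simp: fun_eq_iff add_divide_distrib intro: BH_add p p')
qed

lemma Pk_cmult: assumes "Pk k d g" shows "Pk k d (\<lambda>z. c * g z)"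
proof -
 obtain p where p: "BH (k + d) d p" "g = qt d p"
  using assms by (auto simp: Pk_def)
 show ?thesis unfolding Pk_def p(2)
  by (intro exI[of _ "\<lambda>z. c * p z"]) (auto simp: fun_eq_iff intro: BH_cmult p)
qed

lemma Pk_zero: "Pk k d (\<lambda>z. 0)"
 unfolding Pk_def by (intro exI[of _ "\<lambda>z. 0"]) (auto simp: BH_zero)

lemma Pk_diff: "Pk k d g ==> Pk k d g' ==> Pk k d (\<lambda>z. g z - g' z)"
 using Pk_add[OF _ Pk_cmult[of k d g' "-1"], of g] by simp

lemma Pk_cspan: "\<exists>B. finite B \<and> {g :: complex^'m => complex. Pk k d g} = cspan B"
proof (intro exI conjI)
 let ?B = "qt d ` (monset (k + d) d :: (complex^'m => complex) set)"
 show fin: "finite ?B" by (intro finite_imageI finite_monset)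
 show "{g :: complex^'m => complex. Pk k d g} = cspan ?B"
 proof (intro equalityI subsetI)
  fix g :: "complex^'m => complex" assume "g \<in> {g. Pk k d g}"
  then obtain p where p: "BH (k + d) d p" "g = qt d p" by (auto simp: Pk_def)
  have "(\<lambda>x. (if x = 0 then 0 else 1 / nn x ^ d) * p x) \<in> cspan ?B"
  proof (rule cspan_map[where r="\<lambda>x. x", OF BH_imp_cspan[OF p(1)] fin])
   fix m :: "complex^'m => complex" assume "m \<in> monset (k + d) d"
   then have "qt d m \<in> cspan ?B" by (intro cspan_base fin) auto
   moreover have "qt d m = (\<lambda>x. (if x = 0 then 0 else 1 / nn x ^ d) * m x)" by auto
   ultimately show "(\<lambda>x. (if x = 0 then 0 else 1 / nn x ^ d) * m x) \<in> cspan ?B" by simp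
  qed
  moreover have "(\<lambda>x. (if x = 0 then 0 else 1 / nn x ^ d) * p x) = g" unfolding p(2) by auto
  ultimately show "g \<in> cspan ?B" by simp
 next
  fix g assume "g \<in> cspan ?B"
  then obtain c where g: "g = (\<lambda>x. \<Sum>b\<in>?B. c b * b x)" unfolding cspan_def by auto
  have Pb: "Pk k d b" if "b \<in> ?B" for b using that monset_BH by (auto simp: Pk_def)
  have "Pk k d (\<lambda>x. \<Sum>b\<in>B'. c b * b x)" if "finite B'" "B' \<subseteq> ?B" for B'
   using that
  proof (induction rule: finite_induct)
   case (insert b F)
   have "Pk k d (\<lambda>x. c b * b x + (\<Sum>b\<in>F. c b * b x))"
    by (intro Pk_add Pk_cmult Pb insert.IH) (use insert.prems in auto)
   then show ?case using insert.hyps by simp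
  qed (simp add: Pk_zero)
  then show "g \<in> {g. Pk k d g}" unfolding g using fin by simp
 qed
qed

definition lapl :: "(complex^'m => complex) => complex^'m => complex" where
 "lapl g z = (\<Oplus>b. dz b (dzb b g) z)"

lemma BH_lapl: "BH a b p ==> BH (a - 1) (b - 1) (lapl p)"
 unfolding lapl_def[abs_def] using BH_wirtinger by (intro BH_sum) blast

lemma lapl_Pk:
 fixes p :: "complex^'m => complex"
 assumes p: "BH (k + d) d p" and z: "z \<noteq> 0"
 shows "lapl (qt d p) z = lapl p z / nn z ^ d
  - of_nat (d * (k + d + CARD('m) - 1)) * p z / nn z ^ Suc d"
proof -
 let ?S = "-{0} :: (complex^'m) set"
 have zS: "z \<in> ?S" using z by simp
 note [intro] = open_nz
 have Cp: "Ck_on j p ?S" for j by (rule BH_Ck[OF p open_nz])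
 have Cn: "Ck_on j (\<lambda>z :: complex^'m. z $ i) ?S" for i j by (rule Ck_nth[OF open_nz])
 have Cpn: "Ck_on j (\<lambda>z. p z * z $ b) ?S" for j b by (intro Ck_mult open_nz Cp Cn)
 have Cpe: "Ck_on j (\<lambda>z. p z * z $ b * EE (Suc d) z) ?S" for j b by (intro Ck_mult open_nz Cpn Ck_EE)
 have CWp: "Ck_on j (wirtinger_bar e p) ?S" for j e by (rule Ck_wirtinger[OF open_nz Cp])
 have CWE: "Ck_on j (\<lambda>z. wirtinger_bar e p z * EE d z) ?S" for j e by (intro Ck_mult open_nz CWp Ck_EE)
 have 1: "dzb b (qt d p) x
   = dzb b p x * EE d x - of_nat d * (p x * x $ b * EE (Suc d) x)" if "x \<in> ?S" for x b
 proof -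
  have "dzb b (qt d p) x = dzb b (\<lambda>z. p z * EE d z) x"
   by (rule wirtinger_cong[OF open_nz that]) (simp add: EE_eq)
  then show ?thesis using that
   by (simp add: wirtinger_mult[OF open_nz Cp[of "Suc 0"] Ck_EE that] wirtinger_EE algebra_simps)
 qed
 have 2: "dz b (dzb b (qt d p)) z
   = dz b (dzb b p) z * EE d z
    - of_nat d * EE (Suc d) z * (cnj (z $ b) * dzb b p z)
    - of_nat d * EE (Suc d) z * (z $ b * dz b p z)
    - of_nat d * EE (Suc d) z * p z
    + of_nat d * of_nat (Suc d) * p z * EE (Suc (Suc d)) z * (z $ b * cnj (z $ b))" for b
 proof -
  have "dz b (dzb b (qt d p)) z
   = dz b (\<lambda>x. dzb b p x * EE d x - of_nat d * (p x * x $ b * EE (Suc d) x)) z"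
   by (rule wirtinger_cong[OF open_nz zS 1])
  also have "\<dots> = dz b (\<lambda>x. dzb b p x * EE d x) z
    - of_nat d * dz b (\<lambda>x. p x * x $ b * EE (Suc d) x) z"
   by (simp only: wirtinger_diff[OF open_nz CWE[of "Suc 0"] Ck_mult[OF open_nz Ck_const Cpe] zS]
     wirtinger_cmult[OF open_nz Cpe[of "Suc 0"] zS])
  also have "dz b (\<lambda>x. dzb b p x * EE d x) z
   = dz b (dzb b p) z * EE d z + dzb b p z * dz b (EE d) z"
   by (rule wirtinger_mult(1)[OF open_nz CWp[of "Suc 0"] Ck_EE zS])
  also have "dz b (\<lambda>x. p x * x $ b * EE (Suc d) x) z
   = dz b (\<lambda>x. p x * x $ b) z * EE (Suc d) z + p z * z $ b * dz b (EE (Suc d)) z"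
   by (rule wirtinger_mult(1)[OF open_nz Cpn[of "Suc 0"] Ck_EE zS])
  also have "dz b (\<lambda>x. p x * x $ b) z = dz b p z * z $ b + p z * dz b (\<lambda>x. x $ b) z"
   by (rule wirtinger_mult(1)[OF open_nz Cp[of "Suc 0"] Cn zS])
  finally show ?thesis
   unfolding wirtinger_nth wirtinger_EE[OF z] by (simp add: algebra_simps)
 qed
 have "lapl (qt d p) z
  = lapl p z * EE d z - of_nat d * EE (Suc d) z * (of_nat d * p z)
   - of_nat d * EE (Suc d) z * (of_nat (k + d) * p z)
   - of_nat d * EE (Suc d) z * (of_nat CARD('m) * p z)
   + of_nat d * of_nat (Suc d) * p z * EE (Suc (Suc d)) z * nn z"
  unfolding lapl_def 2 sum.distrib sum_subtractf sum_distrib_left[symmetric] sum_distrib_right[symmetric]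
   BH_euler[OF p] nn_sum[symmetric] by simp
 also have "of_nat d * of_nat (Suc d) * p z * EE (Suc (Suc d)) z * nn z = of_nat d * of_nat (Suc d) * p z * EE (Suc d) z"
  using EE_Suc[OF z, of "Suc d"] by (simp add: mult.assoc mult.commute[of _ "nn z"])
 finally have "lapl (qt d p) z
  = lapl p z * EE d z - of_nat d * (of_nat (k + d) + of_nat CARD('m) - 1) * p z * EE (Suc d) z"
  by (simp add: algebra_simps)
 moreover have "(of_nat (k + d + CARD('m) - 1) :: complex) = of_nat (k + d) + of_nat CARD('m) - 1"
  using zero_less_card_finite[where 'a='m] by (simp add: of_nat_diff Suc_le_eq)
 ultimately show ?thesis by (simp add: EE_eq[OF z])
qed

lemma Pk_lapl:
 fixes g :: "complex^'m => complex"
 assumes "Pk k d g" shows "Pk k d (\<lambda>z. if z = 0 then 0 else - (nn z * lapl g z))"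
proof -
 obtain p where p: "BH (k + d) d p" "g = qt d p"
  using assms by (auto simp: Pk_def)
 define q where "q = (\<lambda>z. - (nn z * lapl p z) + of_nat (d * (k + d + CARD('m) - 1)) * p z)"
 have "BH (k + d) d (\<lambda>z. nn z * lapl p z)"
 proof (cases d)
  case 0
  then have "lapl p = (\<lambda>z. 0)" using BH_wirtinger[OF p(1)] by (simp add: lapl_def[abs_def])
  then show ?thesis by (simp add: BH_zero)
 next
  case (Suc d')
  then show ?thesis using BH_mult[OF BH_nn BH_lapl[OF p(1)]] by simp
 qed
 then have q: "BH (k + d) d q"
  unfolding q_def using BH_add[OF BH_cmult[of _ _ _ "-1"] BH_cmult[OF p(1)]] by fastforce
 have "- (nn z * lapl g z) = q z / nn z ^ d" if "z \<noteq> 0" for z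
  unfolding p(2) lapl_Pk[OF p(1) that] q_def using nn_nz[OF that] by (simp add: field_simps)
 then show ?thesis unfolding Pk_def by (intro exI[of _ q] conjI q ext) auto
qed

text \<open>A harmonic element has numerator divisible by \<open>|z|^2\<close>, so its degree can be lowered
 until it is holomorphic.\<close>

lemma Pk_lapl_eq_0:
 fixes g :: "complex^'m => complex"
 assumes "Pk k d g" "\<And>z. z \<noteq> 0 ==> lapl g z = 0" shows "Pk k 0 g"
 using assms(1)
proof (induction d)
 case (Suc d)
 obtain p where p: "BH (k + Suc d) (Suc d) p" "g = qt (Suc d) p"
  using Suc.prems by (auto simp: Pk_def)
 define c :: complex where "c = of_nat (Suc d * (k + Suc d + CARD('m) - 1))"
 have "k + Suc d + CARD('m) - 1 > 0" using zero_less_card_finite[where 'a='m] by linarith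
 then have c: "c \<noteq> 0" unfolding c_def of_nat_eq_0_iff mult_eq_0_iff by simp
 have "p z / nn z ^ Suc d = (inverse c * lapl p z) / nn z ^ d" if z: "z \<noteq> 0" for z
 proof -
  have "lapl p z / nn z ^ Suc d = c * p z / nn z ^ Suc (Suc d)"
   using assms(2)[OF z] unfolding p(2) lapl_Pk[OF p(1) z] c_def by simp
  then show ?thesis using c nn_nz[OF z] by (simp add: field_simps)
 qed
 then have "g = qt d (\<lambda>z. inverse c * lapl p z)" unfolding p(2) by auto
 moreover have "BH (k + d) d (\<lambda>z. inverse c * lapl p z)" using BH_cmult[OF BH_lapl[OF p(1)]] by simp
 ultimately have "Pk k d g" unfolding Pk_def by blast
 then show ?case by (rule Suc.IH)
qed

section \<open>Density\<close>

inductive polyc :: "(complex^'m => complex) => bool" where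
 polyc_BH: "BH a b f ==> polyc f"
| polyc_add: "polyc f ==> polyc g ==> polyc (\<lambda>z. f z + g z)"

lemma polyc_mult: "polyc f ==> polyc g ==> polyc (\<lambda>z. f z * g z)"
proof (induction rule: polyc.induct)
 case (polyc_BH a b f)
 note f = polyc_BH.hyps
 show ?case using polyc_BH.prems
 proof (induction rule: polyc.induct)
  case (polyc_BH a' b' g)
  then show ?case using polyc.polyc_BH[OF BH_mult[OF f]] by blast
 next
  case (polyc_add g g')
  then show ?case using polyc.polyc_add by (fastforce simp: distrib_left)
 qed
next
 case (polyc_add f f')
 then show ?case using polyc.polyc_add by (fastforce simp: distrib_right)
qed

lemma polyc_sum: "finite I ==> (\<And>i. i \<in> I ==> polyc (f i)) ==> polyc (\<lambda>z. \<Sum>i\<in>I. f i z)"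
 by (induction I rule: finite_induct) (auto intro: polyc_BH[OF BH_zero[of 0 0]] polyc_add)

lemma real_polynomial_polyc:
 fixes q :: "complex^'m => real"
 assumes "real_polynomial_function q" shows "polyc (\<lambda>z. complex_of_real (q z))"
 using assms
proof (induction rule: real_polynomial_function.induct)
 case (linear h)
 interpret bounded_linear h by fact
 have "h z = (\<Oplus>i. Re (z $ i) * h (axis i 1) + Im (z $ i) * h (axis i \<i>))" for z
 proof -
  have "z = (\<Oplus>i. Re (z $ i) *R axis i 1 + Im (z $ i) *R axis i \<i>)"
   unfolding vec_eq_iff
  proof
   fix j
   have "(\<Oplus>i. Re (z $ i) *R axis i 1 + Im (z $ i) *R axis i \<i>) $ j = (\<Oplus>i. if i = j then z $ j else 0)"
    unfolding sum_component by (intro sum.cong) (auto simp: axis_def complex_eq_iff)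
   then show "z $ j = (\<Oplus>i. Re (z $ i) *R axis i 1 + Im (z $ i) *R axis i \<i>) $ j" by simp
  qed
  then have "h z = h (\<Oplus>i. Re (z $ i) *R axis i 1 + Im (z $ i) *R axis i \<i>)" by simp
  then show ?thesis by (simp only: sum add scaleR real_scaleR_def)
 qed
 then have "complex_of_real (h z) = (\<Oplus>i. Complex (h (axis i 1)) (- h (axis i \<i>)) / 2 * z $ i
    + Complex (h (axis i 1)) (h (axis i \<i>)) / 2 * cnj (z $ i))" for z
 proof -
  have t: "complex_of_real (Re w * p + Im w * q) = Complex p (- q) / 2 * w + Complex p q / 2 * cnj w" for w p q
   by (simp add: complex_eq_iff add_divide_distrib[symmetric])
  assume hz: "\<And>z. h z = (\<Oplus>i. Re (z $ i) * h (axis i 1) + Im (z $ i) * h (axis i \<i>))"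
  show ?thesis by (subst hz) (simp only: of_real_sum t)
 qed
 moreover have "polyc (\<lambda>z :: complex^'m. \<Oplus>i. Complex (h (axis i 1)) (- h (axis i \<i>)) / 2 * z $ i
    + Complex (h (axis i 1)) (h (axis i \<i>)) / 2 * cnj (z $ i))"
  by (intro polyc_sum polyc_add polyc_BH[OF BH_cmult[OF BH_nth(1)]] polyc_BH[OF BH_cmult[OF BH_nth(2)]]) simp
 ultimately show ?case by simp
next
 case (const c)
 show ?case by (rule polyc_BH[OF BH_const])
qed (auto intro: polyc_add polyc_mult)

abbreviation ru :: "nat => nat => complex" where
 "ru L l \<equiv> cis (2 * pi * real l / real L)"

definition wavg :: "nat => nat => (complex^'m => complex) => complex^'m => complex" where
 "wavg k L f z = (\<Sum>l<L. cnj (ru L l) ^ k * f (ru L l *s z)) / of_nat L"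

lemma roots_of_unity_sum:
 assumes "L > a + b + k"
 shows "(\<Sum>l<L. cnj (ru L l) ^ k * (ru L l ^ a * cnj (ru L l) ^ b))
  = (if a = b + k then of_nat L else 0)"
proof -
 define j where "j = int a - int b - int k"
 define \<zeta> where "\<zeta> = cis (2 * pi * of_int j / real L)"
 have L: "real L > 0" using assms by simp
 have t: "cnj (ru L l) ^ k * (ru L l ^ a * cnj (ru L l) ^ b) = \<zeta> ^ l" for l
 proof -
  let ?q = "2 * pi * real l / real L"
  have "cnj (cis ?q) ^ k * (cis ?q ^ a * cnj (cis ?q) ^ b)
   = cis (real k * - ?q + (real a * ?q + real b * - ?q))"
   by (simp only: cis_cnj Complex.DeMoivre cis_mult)
  also have "real k * - ?q + (real a * ?q + real b * - ?q) = real l * (2 * pi * of_int j / real L)"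
   using L by (simp add: field_simps j_def)
  finally show ?thesis by (simp only: Complex.DeMoivre \<zeta>_def)
 qed
 show ?thesis
 proof (cases "a = b + k")
  case True
  then have "\<zeta> = 1" by (simp add: \<zeta>_def j_def)
  then show ?thesis unfolding t using True by simp
 next
  case False
  then have j: "j \<noteq> 0" "\<bar>j\<bar> < int L" using assms by (auto simp: j_def)
  have "\<zeta> \<noteq> 1"
  proof
   assume "\<zeta> = 1"
   then have "cos (2 * pi * of_int j / real L) = 1" by (simp add: \<zeta>_def complex_eq_iff)
   then obtain n :: int where "2 * pi * of_int j / real L = of_int n * 2 * pi" using cos_one_2pi_int by blast
   then have "of_int j = of_int n * real L" using L by (simp add: field_simps)
   then have "j = n * int L" by (metis of_int_eq_iff of_int_mult of_int_of_nat_eq)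
   then show False using j by (cases "n = 0") (auto simp: abs_mult)
  qed
  moreover have "\<zeta> ^ L = 1"
  proof -
   have "\<zeta> ^ L = cis (real L * (2 * pi * of_int j / real L))" by (simp only: \<zeta>_def Complex.DeMoivre)
   also have "real L * (2 * pi * of_int j / real L) = 2 * pi * of_int j" using L by simp
   finally have "\<zeta> ^ L = cis (2 * pi * of_int j)" .
   then show ?thesis by (simp add: complex_eq_iff cos_integer_2pi sin_integer_2pi)
  qed
  ultimately show ?thesis unfolding t using False by (simp add: geometric_sum)
 qed
qed

lemma polyc_wavg:
 fixes f :: "complex^'m => complex"
 assumes "polyc f"
 shows "\<exists>D d. \<forall>L>D. \<exists>g. Pk k d g \<and> (\<forall>z. norm z = 1 \<longrightarrow> wavg k L f z = g z)"
 using assms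
proof (induction rule: polyc.induct)
 case (polyc_BH a b f)
 have "\<exists>g. Pk k b g \<and> (\<forall>z. norm z = 1 \<longrightarrow> wavg k L f z = g z)" if L: "L > a + b + k" for L
 proof -
  have "wavg k L f z = (\<Sum>l<L. cnj (ru L l) ^ k * (ru L l ^ a * cnj (ru L l) ^ b)) * f z / of_nat L" for z
   unfolding wavg_def BH_scale[OF polyc_BH.hyps] sum_distrib_right by (simp add: mult.assoc)
  then have w: "wavg k L f z = (if a = b + k then f z else 0)" for z
   unfolding roots_of_unity_sum[OF L] using L by simp
  show ?thesis
  proof (cases "a = b + k")
   case True
   then have "Pk k b (qt b f)"
    using polyc_BH.hyps by (auto simp: Pk_def add.commute)
   moreover have "wavg k L f z = (if z = 0 then 0 else f z / nn z ^ b)" if "norm z = 1" for z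
    using that True w[of z] by (auto simp: nn_def)
   ultimately show ?thesis by blast
  qed (use w Pk_zero[of k b] in \<open>auto intro!: exI[of _ "\<lambda>z. 0"]\<close>)
 qed
 then show ?case by blast
next
 case (polyc_add f f')
 obtain D d where 1: "\<And>L. L > D ==> \<exists>g. Pk k d g \<and> (\<forall>z. norm z = 1 \<longrightarrow> wavg k L f z = g z)" using polyc_add.IH by blast
 obtain D' d' where 2: "\<And>L. L > D' ==> \<exists>g. Pk k d' g \<and> (\<forall>z. norm z = 1 \<longrightarrow> wavg k L f' z = g z)" using polyc_add.IH by blast
 show ?case
 proof (rule exI[of _ "max D D'"], rule exI[of _ "max d d'"], intro allI impI)
  fix L assume L: "max D D' < L"
  obtain g where g: "Pk k d g" "\<And>z. norm z = 1 ==> wavg k L f z = g z" using 1[of L] L by auto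
  obtain g' where g': "Pk k d' g'" "\<And>z. norm z = 1 ==> wavg k L f' z = g' z" using 2[of L] L by auto
  show "\<exists>g. Pk k (max d d') g \<and> (\<forall>z. norm z = 1 \<longrightarrow> wavg k L (\<lambda>z. f z + f' z) z = g z)"
   by (intro exI[of _ "\<lambda>z. g z + g' z"] conjI Pk_add Pk_mono[OF g(1)] Pk_mono[OF g'(1)] allI impI)
    (auto simp: g(2)[symmetric] g'(2)[symmetric] wavg_def sum.distrib distrib_left add_divide_distrib)
 qed
qed

lemma Pk_dense:
 fixes G :: "complex^'m => complex"
 assumes "continuous_on (-{0}) G" "chom k G" "e > 0"
 shows "\<exists>d g. Pk k d g \<and> (\<forall>z\<in>ann. norm (G z - g z) \<le> e)"
proof -
 let ?S = "sphere 0 1 :: (complex^'m) set"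
 define \<delta> where "\<delta> = e / exp 1 ^ k / 2"
 have \<delta>: "\<delta> > 0" using assms(3) by (simp add: \<delta>_def)
 have cG: "continuous_on ?S G" by (rule continuous_on_subset[OF assms(1)]) auto
 obtain q1 where q1: "real_polynomial_function q1" "\<And>z. z \<in> ?S ==> \<bar>Re (G z) - q1 z\<bar> < \<delta>"
  using Stone_Weierstrass_real_polynomial_function[OF compact_sphere, of 0 1 "\<lambda>z. Re (G z)" \<delta>] cG \<delta>
  by (auto intro: continuous_intros)
 obtain q2 where q2: "real_polynomial_function q2" "\<And>z. z \<in> ?S ==> \<bar>Im (G z) - q2 z\<bar> < \<delta>"
  using Stone_Weierstrass_real_polynomial_function[OF compact_sphere, of 0 1 "\<lambda>z. Im (G z)" \<delta>] cG \<delta>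
  by (auto intro: continuous_intros)
 define q where "q = (\<lambda>z. complex_of_real (q1 z) + \<i> * complex_of_real (q2 z))"
 have "polyc q" unfolding q_def
  by (intro polyc_add polyc_mult real_polynomial_polyc q1 q2 polyc_BH[OF BH_const])
 from polyc_wavg[OF this, of k] obtain D d where
  "\<And>L. L > D ==> \<exists>g. Pk k d g \<and> (\<forall>z. norm z = 1 \<longrightarrow> wavg k L q z = g z)" by blast
 then obtain g L where g: "Pk k d g" "\<And>z. norm z = 1 ==> wavg k L q z = g z" "L > 0"
  by (metis lessI zero_less_Suc)
 have qG: "norm (G z - q z) \<le> 2 * \<delta>" if "norm z = 1" for z
 proof -
  have "norm (G z - q z) \<le> \<bar>Re (G z - q z)\<bar> + \<bar>Im (G z - q z)\<bar>" by (rule cmod_le)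
  then show ?thesis using q1(2)[of z] q2(2)[of z] that by (simp add: q_def)
 qed
 have sph: "norm (G z - g z) \<le> 2 * \<delta>" if z: "norm z = 1" for z
 proof -
  let ?w = "\<lambda>l. ru L l"
  have z0: "z \<noteq> 0" using z by auto
  have "(\<Sum>l<L. cnj (?w l) ^ k * G (?w l *s z)) = (\<Sum>l<L. G z)"
  proof (rule sum.cong[OF refl])
   fix l
   have "cnj (?w l) ^ k * ?w l ^ k = 1" by (simp add: power_mult_distrib[symmetric] cis_cnj cis_mult)
   moreover have "G (?w l *s z) = ?w l ^ k * G z" using assms(2) z0 by (auto simp: chom_def)
   ultimately show "cnj (?w l) ^ k * G (?w l *s z) = G z" by (simp add: mult.assoc[symmetric])
  qed
  then have "G z = (\<Sum>l<L. cnj (?w l) ^ k * G (?w l *s z)) / of_nat L" using g(3) by simp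
  then have eq: "G z - g z = (\<Sum>l<L. cnj (?w l) ^ k * (G (?w l *s z) - q (?w l *s z))) / of_nat L"
   using g(2)[OF z] by (simp add: wavg_def right_diff_distrib sum_subtractf diff_divide_distrib)
  have "norm (\<Sum>l<L. cnj (?w l) ^ k * (G (?w l *s z) - q (?w l *s z))) \<le> (\<Sum>l<L. 2 * \<delta>)"
   using qG z by (intro sum_norm_le) (auto simp: norm_mult norm_power norm_cmult_vec)
  then show ?thesis unfolding eq norm_divide using g(3) by (simp add: field_simps)
 qed
 have "norm (G z - g z) \<le> e" if z: "z \<in> ann" for z
 proof -
  define x where "x = complex_of_real (1 / norm z) *s z"
  have nz: "norm z \<noteq> 0" "z \<noteq> 0" using ann_nz[OF z] by auto
  have x: "norm x = 1" "z = complex_of_real (norm z) *s x" "x \<noteq> 0"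
   using nz by (auto simp: x_def norm_cmult_vec norm_divide vec_eq_iff)
  have "G z = complex_of_real (norm z) ^ k * G x" "g z = complex_of_real (norm z) ^ k * g x"
   using assms(2) Pk_chom[OF g(1)] x nz unfolding chom_def by (metis of_real_eq_0_iff)+
  then have "norm (G z - g z) = norm z ^ k * norm (G x - g x)"
   by (simp add: right_diff_distrib[symmetric] norm_mult norm_power)
  also have "\<dots> \<le> exp 1 ^ k * (2 * \<delta>)"
   using z sph[OF x(1)] \<delta> by (intro mult_mono power_mono) (auto simp: ann_def)
  also have "\<dots> = e" by (simp add: \<delta>_def)
  finally show ?thesis .
 qed
 then show ?thesis using g(1) by blast
qed

definition rh :: "int => ('a::real_vector => complex) => bool" where
 "rh p F \<longleftrightarrow> (\<forall>\<tau> x. \<tau> > 0 \<longrightarrow> x \<noteq> 0 \<longrightarrow> F (\<tau> *R x) = complex_of_real (\<tau> powi p) * F x)"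

lemma rhD: "rh p F ==> t > 0 ==> x \<noteq> 0 ==> F (t *R x) = complex_of_real (t powi p) * F x"
 by (simp add: rh_def)

lemma rh_mult: "rh p F ==> rh q G ==> r = p + q ==> rh r (\<lambda>x. F x * G x)"
 by (simp add: rh_def power_int_add)

lemma rh_cnj: "rh p F ==> rh p (\<lambda>x. cnj (F x))"
 by (simp add: rh_def)

lemma rh_sum: "(\<And>i. i \<in> I ==> rh p (F i)) ==> rh p (\<lambda>x. \<Sum>i\<in>I. F i x)"
 by (simp add: rh_def sum_distrib_left)

lemma rh_diff: "rh p F ==> rh p G ==> rh p (\<lambda>x. F x - G x)"
 by (simp add: rh_def right_diff_distrib)

lemma rh_minus: "rh p F ==> rh p (\<lambda>x. - F x)"
 by (simp add: rh_def)

lemma rh_nn: "rh 2 (nn :: complex^'m => complex)"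
 by (simp add: rh_def nn_def power_mult_distrib)

lemma scaleR_vec: "t *R (x :: complex^'m) = complex_of_real t *s x"
 by (simp add: vec_eq_iff) (simp add: scaleR_conv_of_real)

lemma chom_rh: "chom k g ==> rh (int k) g"
 by (simp add: rh_def chom_def scaleR_vec)

lemma rh_dd:
 fixes F :: "'a::euclidean_space => complex"
 assumes "rh p F" "Ck_on (Suc 0) F (-{0})"
 shows "rh (p - 1) (dd v F)"
 unfolding rh_def
proof (intro allI impI)
 fix t :: real and x :: 'a assume t: "t > 0" "x \<noteq> 0"
 have "t *R dd v F (t *R x) = complex_of_real (t powi p) * dd v F x"
  by (rule dd_scaled[OF assms(2) t rhD[OF assms(1) t(1)]]) (auto intro!: derivative_eq_intros)
 moreover have "t powi p = t * t powi (p - 1)" using t by (simp add: power_int_diff)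
 ultimately show "dd v F (t *R x) = complex_of_real (t powi (p - 1)) * dd v F x"
  using t by (simp add: scaleR_conv_of_real)
qed

lemma rh_wirtinger:
 fixes F :: "'a::euclidean_space => complex"
 assumes "rh p F" "Ck_on (Suc 0) F (-{0})"
 shows "rh (p - 1) (wirtinger e F)" "rh (p - 1) (wirtinger_bar e F)"
 using rh_dd[OF assms] unfolding wirtinger_def wirtinger_bar_def rh_def by (simp_all add: algebra_simps add_divide_distrib)

lemma rh_wirtinger_log:
 fixes P :: "'a::euclidean_space => real"
 assumes "Ck_on (Suc 0) P (-{0})" "\<And>t x. t > 0 ==> x \<noteq> 0 ==> P (t *R x) = P x + c * ln t"
 shows "rh (- 1) (wirtinger e (\<lambda>x. complex_of_real (P x)))" "rh (- 1) (wirtinger_bar e (\<lambda>x. complex_of_real (P x)))"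
proof -
 let ?P = "\<lambda>x. complex_of_real (P x)"
 have "rh (- 1) (dd v ?P)" for v
  unfolding rh_def
 proof (intro allI impI)
  fix t :: real and x :: 'a assume t: "t > 0" "x \<noteq> 0"
  have "t *R dd v ?P (t *R x) = dd v ?P x"
   by (rule dd_scaled[where h="\<lambda>z. z + of_real (c * ln t)"])
    (use assms t in \<open>auto intro!: derivative_eq_intros Ck_of_real simp del: Ck_on.simps\<close>)
  then show "dd v ?P (t *R x) = complex_of_real (t powi - 1) * dd v ?P x"
   using t by (simp add: scaleR_conv_of_real field_simps)
 qed
 then show "rh (- 1) (wirtinger e ?P)" "rh (- 1) (wirtinger_bar e ?P)"
  unfolding wirtinger_def wirtinger_bar_def rh_def by (simp_all add: algebra_simps add_divide_distrib)
qed

lemma Ck_continuous_ann: "Ck_on j F (-{0}) ==> continuous_on ann F"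
 by (rule continuous_on_subset[OF Ck_continuous]) (auto simp: ann_def)

lemma Ck_integrable_ann:
 fixes F :: "'a::euclidean_space => 'b::{banach, second_countable_topology}"
 shows "Ck_on j F (-{0}) ==> set_integrable lborel ann F"
 by (intro set_integrable_compact compact_ann Ck_continuous_ann)

lemma set_integral_sum:
 assumes "finite I" "\<And>i. i \<in> I ==> set_integrable M A (f i)"
 shows "(LINT x:A|M. (\<Sum>i\<in>I. f i x)) = (\<Sum>i\<in>I. (LINT x:A|M. f i x :: 'b::{banach, second_countable_topology}))"
 using assms unfolding set_lebesgue_integral_def set_integrable_def scaleR_sum_right by (intro Bochner_Integration.integral_sum) auto

lemma integral_ann_cong:
 "(\<And>z. z \<noteq> 0 ==> f z = g z) ==> (LA z. f z) = (LA z. g (z :: 'a::euclidean_space) :: 'b::{banach, second_countable_topology})"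
 unfolding set_lebesgue_integral_def
 by (rule Bochner_Integration.integral_cong) (auto simp: indicator_def ann_nz)

lemma integral_ann_wirtinger:
 fixes F :: "complex^'m => complex"
 assumes "Ck_on (Suc 0) F (-{0})" "rh (1 - 2 * int CARD('m)) F"
 shows "(LA z. wirtinger e F z) = 0" "(LA z. wirtinger_bar e F z) = 0"
proof -
 have z: "(LA z. dd v F z) = 0" for v
 proof (rule integral_ann_dd_eq_0[OF assms(1)])
  fix t :: real and x :: "complex^'m" assume "t > 0" "x \<noteq> 0"
  moreover from this have "t powi (1 - 2 * int CARD('m)) = t / t ^ DIM(complex^'m)"
   by (simp add: power_int_diff power_int_mult power_mult mult.commute)
  ultimately show "F (t *R x) = (t / t ^ DIM(complex^'m)) *R F x"
   unfolding scaleR_conv_of_real[of _ "F x"] using rhD[OF assms(2), of t x] by simp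
 qed
 note i = Ck_integrable_ann[OF Ck_dd[OF assms(1)]]
 show "(LA z. wirtinger e F z) = 0" "(LA z. wirtinger_bar e F z) = 0"
  unfolding wirtinger_def wirtinger_bar_def using i z by (simp_all add: set_integral_diff set_integral_add)
qed

section \<open>A Bochner inequality on homogeneous functions\<close>

locale weight =
 fixes P :: "complex^'m => real" and k :: nat
 assumes P2: "Ck_on 2 P (-{0})"
  and P_scale: "\<And>c z. c \<noteq> 0 ==> z \<noteq> 0 ==> P (c *s z) = P z + 2 * real (k + CARD('m)) * ln (norm c)"
begin

lemma PSS: "Ck_on (Suc (Suc 0)) P (-{0})"
 using P2 by (simp only: numeral_2_eq_2)

abbreviation PC :: "complex^'m => complex" where
 "PC z \<equiv> complex_of_real (P z)"

definition wt :: "complex^'m => complex" where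
 "wt z = complex_of_real (exp (- P z))"

definition ip :: "(complex^'m => complex) => (complex^'m => complex) => complex" where
 "ip f g = (LA z. f z * cnj (g z) * wt z)"

definition en :: "(complex^'m => complex) => (complex^'m => complex) => complex" where
 "en f g = (LA z. nn z * (\<Oplus>b. dzb b f z * cnj (dzb b g z)) * wt z)"

definition box :: "(complex^'m => complex) => complex^'m => complex" where
 "box g z = - (nn z * (\<Oplus>b. dz b (dzb b g) z - dz b PC z * dzb b g z))"

definition HP :: "'m => 'm => complex^'m => complex" where
 "HP a b z = dz a (dzb b PC) z"

lemma PC2: "Ck_on 2 PC (-{0})"
 by (rule Ck_of_real[OF open_nz P2])

lemma PCSS: "Ck_on (Suc (Suc 0)) PC (-{0})"
 by (rule Ck_of_real[OF open_nz PSS])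

lemma Ck_wt: "Ck_on (Suc (Suc 0)) wt (-{0})"
 unfolding wt_def[abs_def] by (intro Ck_of_real Ck_exp_compose Ck_minus open_nz PSS)

lemma Ck_nn: "open S ==> Ck_on j (nn :: complex^'m => complex) S"
 by (rule BH_Ck[OF BH_nn])

lemma P_scaleR: "t > 0 ==> z \<noteq> 0 ==> P (t *R z) = P z + 2 * real (k + CARD('m)) * ln t"
 using P_scale[of "complex_of_real t" z] by (simp add: scaleR_vec)

lemma rh_wt: "rh (- 2 * int (k + CARD('m))) wt"
 unfolding rh_def
proof (intro allI impI)
 fix t :: real and z :: "complex^'m" assume t: "t > 0" "z \<noteq> 0"
 let ?M = "2 * (k + CARD('m))"
 have "exp (- P (t *R z)) = exp (- P z) * exp (- (real ?M * ln t))"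
  unfolding P_scaleR[OF t] by (simp add: exp_add[symmetric] algebra_simps)
 also have "exp (- (real ?M * ln t)) = inverse (t ^ ?M)"
  using t by (simp only: exp_minus exp_of_nat_mult exp_ln)
 also have "inverse (t ^ ?M) = t powi (- int ?M)" by (simp only: power_int_minus power_int_of_nat)
 also have "- int ?M = - 2 * int (k + CARD('m))" by simp
 finally show "wt (t *R z) = complex_of_real (t powi (- 2 * int (k + CARD('m)))) * wt z"
  unfolding wt_def by (simp only: of_real_mult mult.commute)
qed

lemma wirtinger_wt:
 assumes "z \<noteq> 0"
 shows "wirtinger e wt z = - wirtinger e PC z * wt z" "wirtinger_bar e wt z = - wirtinger_bar e PC z * wt z"
 unfolding wt_def[abs_def] using wirtinger_exp_minus[OF open_nz PSS, of z e] assms by auto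

lemma ip_integrable:
 assumes "continuous_on (-{0}) f" "continuous_on (-{0}) g"
 shows "set_integrable lborel ann (\<lambda>z. f z * cnj (g z) * wt z)"
 by (rule Ck_integrable_ann[of 0]) (use assms Ck_continuous[OF Ck_wt] in \<open>auto intro!: continuous_intros\<close>)

lemma Pk_bar_euler:
 fixes g :: "complex^'m => complex"
 assumes "Pk k' d g" "z \<noteq> 0"
 shows "(\<Oplus>b. cnj (z $ b) * dzb b g z) = 0"
proof -
 obtain p where p: "BH (k' + d) d p" "g = qt d p"
  using assms by (auto simp: Pk_def)
 have z: "z \<in> -{0}" using assms by simp
 have "dzb b g z = dzb b (\<lambda>z. p z * EE d z) z" for b
  by (rule wirtinger_cong[OF open_nz z]) (simp add: EE_eq p(2))
 then have wb: "dzb b g z = dzb b p z * EE d z - of_nat d * p z * z $ b * EE (Suc d) z" for b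
  using wirtinger_mult(2)[OF open_nz BH_Ck[OF p(1) open_nz, of "Suc 0"] Ck_EE z, of "axis b" d] wirtinger_EE(2)[OF assms(2)]
  by simp
 have "(\<Oplus>b. cnj (z $ b) * dzb b g z)
  = (\<Oplus>b. cnj (z $ b) * dzb b p z) * EE d z - of_nat d * p z * EE (Suc d) z * (\<Oplus>b. z $ b * cnj (z $ b))"
  unfolding wb by (simp add: sum_distrib_left sum_distrib_right sum_subtractf[symmetric] algebra_simps)
 also have "\<dots> = 0"
  unfolding BH_euler[OF p(1)] nn_sum[symmetric] using EE_Suc[OF assms(2), of d] by (simp add: mult.assoc mult.commute[of _ "nn z"])
 finally show ?thesis .
qed

lemma nn_wirtinger: "dz b nn (z :: complex^'m) = cnj (z $ b)" "dzb b nn z = z $ b"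
proof -
 have nnf: "nn = (\<lambda>z :: complex^'m. \<Oplus>i. z $ i * cnj (z $ i))" by (simp add: fun_eq_iff nn_sum)
 have C: "Ck_on (Suc 0) (\<lambda>z :: complex^'m. z $ i * cnj (z $ i)) UNIV" for i
  by (intro Ck_mult Ck_nth open_UNIV)
 have s: "dz b nn z = (\<Oplus>i. dz b (\<lambda>z. z $ i * cnj (z $ i)) z)"
  "dzb b nn z = (\<Oplus>i. dzb b (\<lambda>z. z $ i * cnj (z $ i)) z)"
  unfolding nnf by (rule wirtinger_sum[OF open_UNIV C UNIV_I])+
 have t: "dz b (\<lambda>z :: complex^'m. z $ i * cnj (z $ i)) z = (if i = b then cnj (z $ b) else 0)"
  "dzb b (\<lambda>z :: complex^'m. z $ i * cnj (z $ i)) z = (if i = b then z $ b else 0)" for i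
  using wirtinger_mult[OF open_UNIV Ck_nth(1)[OF open_UNIV, of "Suc 0" i] Ck_nth(2)[OF open_UNIV] UNIV_I, of "axis b" i z]
  by (auto simp: wirtinger_nth wirtinger_cnj_nth)
 show "dz b nn z = cnj (z $ b)" "dzb b nn z = z $ b"
  unfolding s t by simp_all
qed

lemma ip_box:
 fixes f g :: "complex^'m => complex"
 assumes f: "Ck_on (Suc 0) f (-{0})" "rh (int k) f" and g: "Pk k d g"
 shows "ip f (box g) = en f g"
proof -
 let ?S = "-{0} :: (complex^'m) set"
 let ?g = "\<lambda>b. dzb b g"
 have Cg: "Ck_on j g ?S" for j by (rule Pk_Ck[OF g])
 have Cgb: "Ck_on j (?g b) ?S" for j b by (rule Ck_wirtinger[OF open_nz Cg])
 have Ccg: "Ck_on j (\<lambda>z. cnj (?g b z)) ?S" for j b by (intro Ck_cnj open_nz Cgb)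
 note Cwt = Ck_SucD[OF Ck_wt]
 define F where "F = (\<lambda>b z. f z * nn z * cnj (?g b z) * wt z)"
 have C1: "Ck_on (Suc 0) (\<lambda>z. f z * nn z) ?S" by (intro Ck_mult open_nz f Ck_nn)
 have C2: "Ck_on (Suc 0) (\<lambda>z. f z * nn z * cnj (?g b z)) ?S" for b by (intro Ck_mult open_nz C1 Ccg)
 have C3: "Ck_on (Suc 0) (F b) ?S" for b unfolding F_def by (intro Ck_mult open_nz C2 Cwt)
 have hg: "rh (int k - 1) (?g b)" for b by (rule rh_wirtinger[OF chom_rh[OF Pk_chom[OF g]] Cg])
 have hF: "rh (1 - 2 * int CARD('m)) (F b)" for b
  unfolding F_def
  by (rule rh_mult[OF rh_mult[OF rh_mult[OF f(2) rh_nn] rh_cnj[OF hg] refl] rh_wt]) auto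
 have dF: "dzb b (F b) z = nn z * (dzb b f z * cnj (?g b z)) * wt z
   + f z * wt z * (z $ b * cnj (?g b z))
   + f z * wt z * nn z * cnj (dz b (?g b) z - dz b PC z * ?g b z)" if "z \<in> ?S" for b z
 proof -
  have z: "z \<noteq> 0" using that by simp
  have "dzb b (F b) z = dzb b (\<lambda>z. f z * nn z * cnj (?g b z)) z * wt z + f z * nn z * cnj (?g b z) * dzb b wt z"
   unfolding F_def by (rule wirtinger_mult(2)[OF open_nz C2 Cwt that])
  also have "dzb b (\<lambda>z. f z * nn z * cnj (?g b z)) z = dzb b (\<lambda>z. f z * nn z) z * cnj (?g b z) + f z * nn z * dzb b (\<lambda>z. cnj (?g b z)) z"
   by (rule wirtinger_mult(2)[OF open_nz C1 Ccg that])
  also have "dzb b (\<lambda>z. f z * nn z) z = dzb b f z * nn z + f z * dzb b nn z"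
   by (rule wirtinger_mult(2)[OF open_nz f(1) Ck_nn[OF open_nz] that])
  also have "dzb b (\<lambda>z. cnj (?g b z)) z = cnj (dz b (?g b) z)"
   by (rule wirtinger_cnj(2)[OF open_nz Cgb[of "Suc 0"] that])
  also have "dzb b wt z = - cnj (dz b PC z) * wt z"
   unfolding wirtinger_wt[OF z] wirtinger_of_real[OF open_nz PSS that] by simp
  finally show ?thesis by (simp add: nn_wirtinger algebra_simps)
 qed
 have "0 = (\<Oplus>b. (LA z. dzb b (F b) z))"
  using integral_ann_wirtinger(2)[OF C3 hF] by simp
 also have "\<dots> = (LA z. (\<Oplus>b. dzb b (F b) z))"
  by (rule set_integral_sum[symmetric]) (auto intro: Ck_integrable_ann[OF Ck_wirtinger(2)[OF open_nz C3]])
 also have "\<dots> = (LA z. nn z * (\<Oplus>b. dzb b f z * cnj (?g b z)) * wt z - f z * cnj (box g z) * wt z)"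
 proof (rule integral_ann_cong)
  fix z :: "complex^'m" assume z: "z \<noteq> 0"
  have e: "(\<Oplus>b. z $ b * cnj (?g b z)) = 0"
   using arg_cong[OF Pk_bar_euler[OF g z], of cnj] by simp
  have cn: "cnj (nn z) = nn z" by (simp add: nn_def)
  have "(\<Oplus>b. dzb b (F b) z) = nn z * (\<Oplus>b. dzb b f z * cnj (?g b z)) * wt z
   + f z * wt z * (\<Oplus>b. z $ b * cnj (?g b z))
   + f z * wt z * nn z * (\<Oplus>b. cnj (dz b (?g b) z - dz b PC z * ?g b z))"
   using z by (simp add: dF sum.distrib sum_distrib_left sum_distrib_right)
  also have "\<dots> = nn z * (\<Oplus>b. dzb b f z * cnj (?g b z)) * wt z - f z * cnj (box g z) * wt z"
   unfolding e box_def by (simp add: cn algebra_simps)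
  finally show "(\<Oplus>b. dzb b (F b) z) = \<dots>" .
 qed
 also have "\<dots> = en f g - ip f (box g)"
  unfolding en_def ip_def
 proof (rule set_integral_diff(2))
  have "Ck_on 0 (\<lambda>z. nn z * (\<Oplus>b. dzb b f z * cnj (?g b z)) * wt z) ?S"
   by (intro Ck_mult Ck_sum open_nz Ck_nn Ccg Ck_wirtinger(2)[OF open_nz f(1)] Ck_SucD[OF Cwt])
  then show "set_integrable lborel ann (\<lambda>z. nn z * (\<Oplus>b. dzb b f z * cnj (?g b z)) * wt z)"
   by (rule Ck_integrable_ann)
  have "Ck_on 0 (box g) ?S"
   unfolding box_def[abs_def]
   by (intro Ck_minus Ck_mult Ck_sum Ck_diff open_nz Ck_nn Cgb
     Ck_SucD[OF Ck_wirtinger(1)[OF open_nz PCSS]] Ck_wirtinger(1)[OF open_nz Cgb])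
  then show "set_integrable lborel ann (\<lambda>z. f z * cnj (box g z) * wt z)"
   by (intro ip_integrable Ck_continuous[OF f(1)]) simp
 qed
 finally show ?thesis by simp
qed

end

lemma sum_symmetric_pairing:
 fixes z g :: "'m::finite => complex" and H :: "'m => 'm => complex"
 assumes sym: "\<And>a b. H a b = H b a" and N: "N = (\<Oplus>b. z b * cnj (z b))"
  and zg: "(\<Oplus>b. cnj (z b) * g b) = 0" and zH: "\<And>b. (\<Oplus>a. cnj (z a) * H b a) = - g b"
 shows "(\<Oplus>a b. (z b * g a + N * H a b) * cnj (z a * g b + N * H b a))
  = (\<Oplus>a b. of_real ((norm (N * H a b + z a * g b + z b * g a))^2))"
proof -
 define Y where "Y = (\<lambda>a b. N * H a b + z a * g b + z b * g a)"
 have Ys: "Y a b = Y b a" for a b unfolding Y_def using sym[of a b] by simp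
 have N': "(\<Oplus>b. cnj (z b) * z b) = N" using N by (simp add: mult.commute)
 have Yz: "(\<Oplus>b. cnj (z b) * Y a b) = 0" for a
 proof -
  have "(\<Oplus>b. cnj (z b) * Y a b) = N * (\<Oplus>b. cnj (z b) * H a b) + z a * (\<Oplus>b. cnj (z b) * g b) + g a * (\<Oplus>b. cnj (z b) * z b)"
   by (simp add: Y_def sum_distrib_left sum.distrib[symmetric] algebra_simps)
  then show ?thesis unfolding zH zg N' by simp
 qed
 have Yz': "(\<Oplus>a. z a * cnj (Y b a)) = 0" for b
  using arg_cong[OF Yz[of b], of cnj] by simp
 have "(\<Oplus>a b. (z b * g a + N * H a b) * cnj (z a * g b + N * H b a))
  = (\<Oplus>a b. Y a b * cnj (Y a b) - cnj (g a) * (cnj (z b) * Y a b) - g b * (z a * cnj (Y b a)) + (cnj (g a) * z a) * (cnj (z b) * g b))"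
 proof (intro sum.cong refl)
  fix a b
  have 1: "z b * g a + N * H a b = Y a b - z a * g b" by (simp add: Y_def)
  have 2: "z a * g b + N * H b a = Y a b - z b * g a" using sym[of a b] by (simp add: Y_def)
  show "(z b * g a + N * H a b) * cnj (z a * g b + N * H b a)
   = Y a b * cnj (Y a b) - cnj (g a) * (cnj (z b) * Y a b) - g b * (z a * cnj (Y b a)) + (cnj (g a) * z a) * (cnj (z b) * g b)"
   unfolding 1 2 using Ys[of a b] by (simp add: algebra_simps)
 qed
 also have "\<dots> = (\<Oplus>a b. Y a b * cnj (Y a b)) - (\<Oplus>a. cnj (g a) * (\<Oplus>b. cnj (z b) * Y a b))
   - (\<Oplus>a b. g b * (z a * cnj (Y b a))) + (\<Oplus>a. cnj (g a) * z a) * (\<Oplus>b. cnj (z b) * g b)"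
  unfolding sum_product by (simp add: sum.distrib sum_subtractf sum_distrib_left)
 also have "(\<Oplus>a b. g b * (z a * cnj (Y b a))) = (\<Oplus>b. g b * (\<Oplus>a. z a * cnj (Y b a)))"
  by (subst sum.swap) (simp add: sum_distrib_left)
 finally show ?thesis
  unfolding Yz Yz' zg complex_norm_square by (simp add: Y_def)
qed

lemma set_integrable_sum:
 fixes f :: "'i => 'a => 'b::{banach, second_countable_topology}"
 assumes "finite I" "\<And>i. i \<in> I ==> set_integrable M A (f i)"
 shows "set_integrable M A (\<lambda>x. \<Sum>i\<in>I. f i x)"
 using assms unfolding set_integrable_def scaleR_sum_right by (intro Bochner_Integration.integrable_sum) auto

context weight
begin

lemma box_Ck:
 assumes "Pk k d g" shows "Ck_on (Suc 0) (box g) (-{0})"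
proof -
 have Cg: "Ck_on j (dzb b g) (-{0})" for j b
  by (rule Ck_wirtinger[OF open_nz Pk_Ck[OF assms]])
 show ?thesis
  unfolding box_def[abs_def]
  by (intro Ck_minus Ck_mult Ck_sum Ck_diff open_nz Ck_nn Cg
    Ck_wirtinger(1)[OF open_nz PCSS] Ck_wirtinger(1)[OF open_nz Cg])
qed

lemma PC_rh: "rh (- 1) (wirtinger e PC)" "rh (- 1) (wirtinger_bar e PC)"
 using rh_wirtinger_log[OF Ck_SucD[OF PSS] P_scaleR] by auto

lemma box_rh:
 assumes "Pk k d g" shows "rh (int k) (box g)"
proof -
 have Cg: "Ck_on j (dzb b g) (-{0})" for j b
  by (rule Ck_wirtinger[OF open_nz Pk_Ck[OF assms]])
 have h1: "rh (int k - 1) (dzb b g)" for b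
  by (rule rh_wirtinger[OF chom_rh[OF Pk_chom[OF assms]] Pk_Ck[OF assms]])
 have h2: "rh (int k - 1 - 1) (dz b (dzb b g))" for b
  by (rule rh_wirtinger[OF h1 Cg])
 have h3: "rh (int k - 1 - 1) (\<lambda>z. dz b PC z * dzb b g z)" for b
  by (rule rh_mult[OF PC_rh(1) h1]) simp
 show ?thesis
  unfolding box_def[abs_def]
  by (rule rh_minus, rule rh_mult[OF rh_nn rh_sum[OF rh_diff[OF h2 h3]]]) simp
qed

lemma bochner:
 assumes g: "Pk k d g"
 shows "Re (LA z. (\<Oplus>a b. HP a b z * (nn z * dzb a g z) * cnj (nn z * dzb b g z)) * wt z)
  \<le> Re (ip (box g) (box g))"
proof -
 let ?S = "-{0} :: (complex^'m) set"
 let ?g = "\<lambda>b. dzb b g"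
 let ?W = "\<lambda>b. dz b" and ?B = "\<lambda>b. dzb b"
 define \<beta> where "\<beta> = (\<lambda>b z. nn z * ?g b z)"
 have Cg: "Ck_on j g ?S" for j by (rule Pk_Ck[OF g])
 have Cgb: "Ck_on j (?g b) ?S" for j b by (rule Ck_wirtinger[OF open_nz Cg])
 have C\<beta>: "Ck_on j (\<beta> b) ?S" for j b unfolding \<beta>_def by (intro Ck_mult open_nz Ck_nn Cgb)
 note Cwt = Ck_SucD[OF Ck_wt]
 have CP: "Ck_on (Suc 0) (?W b PC) ?S" for b by (rule Ck_wirtinger[OF open_nz PCSS])
 have dnn: "?B b \<beta>' z = z $ b * ?g a z + nn z * ?B b (?g a) z" if "\<beta>' = \<beta> a" "z \<in> ?S" for a b z \<beta>'
  unfolding that(1) \<beta>_def wirtinger_mult(2)[OF open_nz Ck_nn[OF open_nz, of "Suc 0"] Cgb that(2)] nn_wirtinger ..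
 have dnn': "?W b (\<beta> a) z = cnj (z $ b) * ?g a z + nn z * ?W b (?g a) z" if "z \<in> ?S" for a b z
  unfolding \<beta>_def wirtinger_mult(1)[OF open_nz Ck_nn[OF open_nz, of "Suc 0"] Cgb that] nn_wirtinger ..
 have boxb: "box g z = - (\<Oplus>a. ?W a (\<beta> a) z - ?W a PC z * \<beta> a z)" if "z \<in> ?S" for z
 proof -
  have "(\<Oplus>a. ?W a (\<beta> a) z - ?W a PC z * \<beta> a z)
   = (\<Oplus>a. cnj (z $ a) * ?g a z) + nn z * (\<Oplus>a. ?W a (?g a) z - ?W a PC z * ?g a z)"
   unfolding dnn'[OF that] unfolding \<beta>_def by (simp add: sum_distrib_left sum.distrib[symmetric] algebra_simps)
  then show ?thesis using Pk_bar_euler[OF g, of z] that by (simp add: box_def)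
 qed
 have CWb: "Ck_on (Suc 0) (?W a (\<beta> a)) ?S" for a by (rule Ck_wirtinger[OF open_nz C\<beta>])
 have CPb: "Ck_on (Suc 0) (\<lambda>z. ?W a PC z * \<beta> a z) ?S" for a by (intro Ck_mult open_nz CP C\<beta>)
 have Bbox: "?B b (box g) z = - (\<Oplus>a. ?W a (?B b (\<beta> a)) z - ?W a PC z * ?B b (\<beta> a) z) + (\<Oplus>a. HP a b z * \<beta> a z)" if z: "z \<in> ?S" for b z
 proof -
  have "?B b (box g) z = ?B b (\<lambda>z. - (\<Oplus>a. ?W a (\<beta> a) z - ?W a PC z * \<beta> a z)) z"
   by (rule wirtinger_cong[OF open_nz z boxb])
  also have "\<dots> = - ?B b (\<lambda>z. \<Oplus>a. ?W a (\<beta> a) z - ?W a PC z * \<beta> a z) z"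
   by (rule wirtinger_minus(2)[OF open_nz _ z, where k=0]) (intro Ck_sum Ck_diff open_nz CWb CPb)
  also have "?B b (\<lambda>z. \<Oplus>a. ?W a (\<beta> a) z - ?W a PC z * \<beta> a z) z = (\<Oplus>a. ?B b (\<lambda>z. ?W a (\<beta> a) z - ?W a PC z * \<beta> a z) z)"
   by (rule wirtinger_sum(2)[OF open_nz _ z, where k=0]) (intro Ck_diff open_nz CWb CPb)
  also have "\<dots> = (\<Oplus>a. ?W a (?B b (\<beta> a)) z - ?W a PC z * ?B b (\<beta> a) z - HP a b z * \<beta> a z)"
  proof (rule sum.cong[OF refl])
   fix a
   have "?B b (\<lambda>z. ?W a (\<beta> a) z - ?W a PC z * \<beta> a z) z = ?B b (?W a (\<beta> a)) z - ?B b (\<lambda>z. ?W a PC z * \<beta> a z) z"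
    by (rule wirtinger_diff(2)[OF open_nz CWb CPb z])
   also have "?B b (\<lambda>z. ?W a PC z * \<beta> a z) z = ?B b (?W a PC) z * \<beta> a z + ?W a PC z * ?B b (\<beta> a) z"
    by (rule wirtinger_mult(2)[OF open_nz CP C\<beta> z])
   also have "?B b (?W a PC) z = HP a b z" unfolding HP_def by (rule wirtinger_commute(1)[OF open_nz PC2 z, symmetric])
   also have "?B b (?W a (\<beta> a)) z = ?W a (?B b (\<beta> a)) z" by (rule wirtinger_commute(1)[OF open_nz C\<beta> z, symmetric])
   finally show "?B b (\<lambda>z. ?W a (\<beta> a) z - ?W a PC z * \<beta> a z) z = ?W a (?B b (\<beta> a)) z - ?W a PC z * ?B b (\<beta> a) z - HP a b z * \<beta> a z"
    by simp
  qed
  finally show ?thesis by (simp add: sum_subtractf)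
 qed
 define F where "F = (\<lambda>a b z. ?B b (\<beta> a) z * cnj (\<beta> b z) * wt z)"
 have CB\<beta>: "Ck_on j (?B b (\<beta> a)) ?S" for a b j by (rule Ck_wirtinger[OF open_nz C\<beta>])
 have Cc: "Ck_on j (\<lambda>z. cnj (\<beta> b z)) ?S" for b j by (intro Ck_cnj open_nz C\<beta>)
 have C1: "Ck_on (Suc 0) (\<lambda>z. ?B b (\<beta> a) z * cnj (\<beta> b z)) ?S" for a b by (intro Ck_mult open_nz CB\<beta> Cc)
 have CF: "Ck_on (Suc 0) (F a b) ?S" for a b unfolding F_def by (intro Ck_mult open_nz C1 Cwt)
 have h\<beta>: "rh (int k + 1) (\<beta> b)" for b
  unfolding \<beta>_def by (rule rh_mult[OF rh_nn rh_wirtinger(2)[OF chom_rh[OF Pk_chom[OF g]] Cg]]) simp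
 have hF: "rh (1 - 2 * int CARD('m)) (F a b)" for a b
  unfolding F_def
  by (rule rh_mult[OF rh_mult[OF rh_wirtinger(2)[OF h\<beta> C\<beta>] rh_cnj[OF h\<beta>] refl] rh_wt]) auto
 have dF: "?W a (F a b) z = (?W a (?B b (\<beta> a)) z - ?W a PC z * ?B b (\<beta> a) z) * cnj (\<beta> b z) * wt z
   + ?B b (\<beta> a) z * cnj (?B a (\<beta> b) z) * wt z" if z: "z \<in> ?S" for a b z
 proof -
  have "?W a (F a b) z = ?W a (\<lambda>z. ?B b (\<beta> a) z * cnj (\<beta> b z)) z * wt z + ?B b (\<beta> a) z * cnj (\<beta> b z) * ?W a wt z"
   unfolding F_def by (rule wirtinger_mult(1)[OF open_nz C1 Cwt z])
  also have "?W a (\<lambda>z. ?B b (\<beta> a) z * cnj (\<beta> b z)) z = ?W a (?B b (\<beta> a)) z * cnj (\<beta> b z) + ?B b (\<beta> a) z * ?W a (\<lambda>z. cnj (\<beta> b z)) z"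
   by (rule wirtinger_mult(1)[OF open_nz CB\<beta>[of "Suc 0"] Cc z])
  also have "?W a (\<lambda>z. cnj (\<beta> b z)) z = cnj (?B a (\<beta> b) z)"
   by (rule wirtinger_cnj(1)[OF open_nz C\<beta>[of "Suc 0"] z])
  also have "?W a wt z = - ?W a PC z * wt z" using wirtinger_wt z by simp
  finally show ?thesis by (simp add: algebra_simps)
 qed
 define X where "X = (\<lambda>z. \<Oplus>a b. ?B b (\<beta> a) z * cnj (?B a (\<beta> b) z))"
 define Hs where "Hs = (\<lambda>z. \<Oplus>a b. HP a b z * \<beta> a z * cnj (\<beta> b z))"
 have CX: "Ck_on 0 X ?S" unfolding X_def by (intro Ck_sum Ck_mult Ck_cnj open_nz CB\<beta>)
 have CH: "Ck_on 0 (HP a b) ?S" for a b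
  unfolding HP_def[abs_def] by (intro Ck_wirtinger(1)[OF open_nz] Ck_wirtinger(2)[OF open_nz PCSS])
 have CHs: "Ck_on 0 Hs ?S" unfolding Hs_def by (intro Ck_sum Ck_mult open_nz CH C\<beta> Cc)
 note Cwt0 = Ck_SucD[OF Cwt]
 have iX: "set_integrable lborel ann (\<lambda>z. X z * wt z)" by (intro Ck_integrable_ann[where j=0] Ck_mult open_nz CX Cwt0)
 have iH: "set_integrable lborel ann (\<lambda>z. Hs z * wt z)" by (intro Ck_integrable_ann[where j=0] Ck_mult open_nz CHs Cwt0)
 have iF: "set_integrable lborel ann (\<lambda>z. ?W a (F a b) z)" for a b
  by (rule Ck_integrable_ann[OF Ck_wirtinger(1)[OF open_nz CF]])
 have "ip (box g) (box g) = en (box g) g"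
  by (rule ip_box[OF box_Ck[OF g] box_rh[OF g] g])
 also have "\<dots> = (LA z. Hs z * wt z + X z * wt z - (\<Oplus>a b. ?W a (F a b) z))"
  unfolding en_def
 proof (rule integral_ann_cong)
  fix z :: "complex^'m" assume "z \<noteq> 0"
  then have z: "z \<in> ?S" by simp
  have cn: "cnj (nn z) = nn z" by (simp add: nn_def)
  have "nn z * (\<Oplus>b. ?B b (box g) z * cnj (?g b z)) * wt z = (\<Oplus>b. ?B b (box g) z * cnj (\<beta> b z) * wt z)"
   by (simp add: \<beta>_def cn sum_distrib_left sum_distrib_right mult_ac)
  also have "\<dots> = (\<Oplus>b a. HP a b z * \<beta> a z * cnj (\<beta> b z) * wt z + ?B b (\<beta> a) z * cnj (?B a (\<beta> b) z) * wt z - ?W a (F a b) z)"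
   unfolding Bbox[OF z] dF[OF z]
   by (simp add: sum_distrib_left sum_distrib_right sum_negf sum.distrib sum_subtractf algebra_simps)
  also have "\<dots> = (\<Oplus>a b. HP a b z * \<beta> a z * cnj (\<beta> b z) * wt z + ?B b (\<beta> a) z * cnj (?B a (\<beta> b) z) * wt z - ?W a (F a b) z)"
   by (rule sum.swap)
  also have "\<dots> = Hs z * wt z + X z * wt z - (\<Oplus>a b. ?W a (F a b) z)"
   by (simp add: Hs_def X_def sum_distrib_right sum.distrib sum_subtractf)
  finally show "nn z * (\<Oplus>b. ?B b (box g) z * cnj (?g b z)) * wt z = \<dots>" .
 qed
 also have "\<dots> = (LA z. Hs z * wt z + X z * wt z) - (LA z. (\<Oplus>a b. ?W a (F a b) z))"
  by (rule set_integral_diff(2)) (intro set_integral_add(1) iH iX set_integrable_sum finite iF)+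
 also have "(LA z. (\<Oplus>a b. ?W a (F a b) z)) = 0"
  by (simp add: set_integral_sum set_integrable_sum iF integral_ann_wirtinger(1)[OF CF hF])
 also have "(LA z. Hs z * wt z + X z * wt z) = (LA z. Hs z * wt z) + (LA z. X z * wt z)"
  by (rule set_integral_add(2)[OF iH iX])
 finally have eq: "ip (box g) (box g) = (LA z. Hs z * wt z) + (LA z. X z * wt z)" by simp
 let ?Y = "\<lambda>z. \<Oplus>a b. (norm (nn z * ?B b (?g a) z + z $ a * ?g b z + z $ b * ?g a z))^2"
 have "X z * wt z = of_real (?Y z) * of_real (exp (- P z))" if z0: "z \<noteq> 0" for z
 proof -
  have z: "z \<in> ?S" using z0 by simp
  have sym: "?B b (?g a) z = ?B a (?g b) z" for a b by (rule wirtinger_commute(3)[OF open_nz Cg z])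
  have zH: "(\<Oplus>a. cnj (z $ a) * ?B a (?g b) z) = - ?g b z" for b
  proof -
   have Cz: "Ck_on (Suc 0) (\<lambda>z. cnj (z $ a) * ?g a z) ?S" for a by (intro Ck_mult open_nz Ck_nth Cgb)
   have "?B b (\<lambda>z. \<Oplus>a. cnj (z $ a) * ?g a z) z = ?B b (\<lambda>z. 0) z"
    by (rule wirtinger_cong[OF open_nz z]) (use Pk_bar_euler[OF g] in auto)
   then have "0 = (\<Oplus>a. ?B b (\<lambda>z. cnj (z $ a) * ?g a z) z)"
    using wirtinger_sum(2)[where f="\<lambda>a z. cnj (z $ a) * ?g a z" and I=UNIV, OF open_nz Cz z, of "axis b"] by simp
   also have "\<dots> = (\<Oplus>a. (if a = b then ?g b z else 0) + cnj (z $ a) * ?B a (?g b) z)"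
    by (intro sum.cong refl)
     (auto simp: wirtinger_mult(2)[OF open_nz Ck_nth(2)[OF open_nz, of "Suc 0"] Cgb z] wirtinger_cnj_nth sym[of b])
   finally show ?thesis by (simp add: sum.distrib eq_neg_iff_add_eq_0 add.commute)
  qed
  have "X z = (\<Oplus>a b. (z $ b * ?g a z + nn z * ?B b (?g a) z) * cnj (z $ a * ?g b z + nn z * ?B a (?g b) z))"
   unfolding X_def by (simp only: dnn[OF refl z])
  also have "\<dots> = (\<Oplus>a b. of_real ((norm (nn z * ?B b (?g a) z + z $ a * ?g b z + z $ b * ?g a z))^2))"
   by (rule sum_symmetric_pairing[where H="\<lambda>a b. ?B b (?g a) z" and g="\<lambda>a. ?g a z" and z="\<lambda>a. z $ a"])
    (use sym nn_sum Pk_bar_euler[OF g z0] zH in auto)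
  finally show ?thesis by (simp add: wt_def)
 qed
 then have "(LA z. X z * wt z) = (LA z. complex_of_real (?Y z * exp (- P z)))"
  by (intro integral_ann_cong) simp
 also have "\<dots> = complex_of_real (LA z. (?Y z * exp (- P z)))"
  by (rule set_integral_complex_of_real)
 finally have "0 \<le> Re (LA z. X z * wt z)"
  by (simp add: set_lebesgue_integral_def sum_nonneg)
 then show ?thesis unfolding eq Hs_def \<beta>_def by simp
qed

end

section \<open>Degenerate inner products\<close>

locale sesq =
 fixes V :: "('a => complex) set" and E :: "('a => complex) => ('a => complex) => complex"
 assumes Vadd: "f \<in> V ==> g \<in> V ==> (\<lambda>x. f x + g x) \<in> V"
  and Vmul: "f \<in> V ==> (\<lambda>x. c * f x) \<in> V"
  and Eadd: "f \<in> V ==> g \<in> V ==> h \<in> V ==> E (\<lambda>x. f x + g x) h = E f h + E g h"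
  and Emul: "f \<in> V ==> h \<in> V ==> E (\<lambda>x. c * f x) h = c * E f h"
  and Eherm: "f \<in> V ==> g \<in> V ==> E g f = cnj (E f g)"
  and Epos: "f \<in> V ==> 0 \<le> Re (E f f)"
begin

lemma Vdiff: "f \<in> V ==> g \<in> V ==> (\<lambda>x. f x - g x) \<in> V"
 using Vadd[OF _ Vmul[of g "-1"], of f] by simp

lemma Ediff: "f \<in> V ==> g \<in> V ==> h \<in> V ==> E (\<lambda>x. f x - g x) h = E f h - E g h"
 using Eadd[OF _ Vmul[of g "-1"], of f h] Emul[of g h "-1"] by simp

lemma Eadd2: "f \<in> V ==> g \<in> V ==> h \<in> V ==> E h (\<lambda>x. f x + g x) = E h f + E h g"
 using Eherm[OF Vadd, of f g h] Eadd[of f g h] Eherm[of f h] Eherm[of g h] by simp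

lemma Emul2: "f \<in> V ==> h \<in> V ==> E h (\<lambda>x. c * f x) = cnj c * E h f"
 using Eherm[OF Vmul, of f h c] Emul[of f h c] Eherm[of f h] by simp

lemma Ediff2: "f \<in> V ==> g \<in> V ==> h \<in> V ==> E h (\<lambda>x. f x - g x) = E h f - E h g"
 using Eadd2[OF _ Vmul[of g "-1"], of f h] Emul2[of g h "-1"] by simp

lemma Ereal: "f \<in> V ==> E f f = of_real (Re (E f f))"
 using Eherm[of f f] by (simp add: complex_eq_iff)

definition nr :: "('a => complex) => real" where "nr f = sqrt (Re (E f f))"

lemma nr_sq: "f \<in> V ==> (nr f)^2 = Re (E f f)"
 using Epos by (simp add: nr_def)

lemma nr_nonneg: "f \<in> V ==> 0 \<le> nr f"
 using Epos by (simp add: nr_def)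

lemma nr_diff_sq:
 assumes "f \<in> V" "g \<in> V"
 shows "(nr (\<lambda>x. f x - g x))^2 = (nr f)^2 - 2 * Re (E f g) + (nr g)^2"
 using assms Eherm[of f g] by (simp add: nr_sq Vdiff Ediff Ediff2)

lemma cauchy_schwarz:
 assumes "f \<in> V" "g \<in> V" shows "norm (E f g) \<le> nr f * nr g"
proof -
 let ?e = "E f g" and ?a = "Re (E f f)" and ?b = "Re (E g g)"
 have key: "0 \<le> ?a - 2 * t * (norm ?e)^2 + t^2 * (norm ?e)^2 * ?b" for t :: real
 proof -
  define c where "c = of_real t * ?e"
  define h where "h = (\<lambda>x. c * g x)"
  have h: "h \<in> V" "E f h = cnj c * ?e" "E h f = c * cnj ?e" "E h h = c * cnj c * E g g"
   unfolding h_def using Vmul[OF assms(2)] assms Eherm[OF assms] Emul[OF assms(2), of _ c] Emul2[OF assms(2), of _ c]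
   by simp_all
  have "0 \<le> Re (E (\<lambda>x. f x - h x) (\<lambda>x. f x - h x))"
   by (intro Epos Vdiff h(1) assms)
  also have "E (\<lambda>x. f x - h x) (\<lambda>x. f x - h x) = E f f - cnj c * ?e - c * cnj ?e + c * cnj c * E g g"
   using Ediff[OF assms(1) h(1) Vdiff[OF assms(1) h(1)]] Ediff2[OF assms(1) h(1) assms(1)] Ediff2[OF assms(1) h(1) h(1)] h
   by simp
  also have "\<dots> = of_real (?a - 2 * t * (norm ?e)^2 + t^2 * (norm ?e)^2 * ?b)"
   unfolding of_real_diff of_real_add of_real_mult complex_norm_square Ereal[OF assms(1), symmetric] Ereal[OF assms(2), symmetric] c_def
   by (simp add: power2_eq_square)
  finally show ?thesis by (simp only: Re_complex_of_real)
 qed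
 have "(norm ?e)^2 \<le> ?a * ?b"
 proof (cases "?b = 0")
  case True
  have "norm ?e = 0"
  proof (rule ccontr)
   assume "norm ?e \<noteq> 0"
   then have p: "(norm ?e)^2 > 0" by simp
   define t where "t = (?a + 1) / (norm ?e)^2"
   have "2 * t * (norm ?e)^2 = 2 * (?a + 1)" using p by (simp add: t_def)
   then show False using key[of t] True Epos[OF assms(1)] by simp
  qed
  then show ?thesis using True by simp
 next
  case False
  then have b: "?b > 0" using Epos[OF assms(2)] by simp
  have "0 \<le> ?a - 2 * (1 / ?b) * (norm ?e)^2 + (1 / ?b)^2 * (norm ?e)^2 * ?b" by (rule key)
  also have "\<dots> = ?a - (norm ?e)^2 / ?b" using b by (simp add: power2_eq_square field_simps)
  finally show ?thesis using b by (simp add: field_simps)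
 qed
 also have "\<dots> = (nr f * nr g)^2" using assms by (simp add: power_mult_distrib nr_sq)
 finally show ?thesis by (rule power2_le_imp_le) (intro mult_nonneg_nonneg nr_nonneg assms)
qed

lemma nr_triangle:
 assumes "f \<in> V" "g \<in> V" shows "nr (\<lambda>x. f x + g x) \<le> nr f + nr g"
proof (rule power2_le_imp_le)
 have "Re (E f g) \<le> nr f * nr g" using cauchy_schwarz[OF assms] complex_Re_le_cmod order_trans by blast
 then show "(nr (\<lambda>x. f x + g x))^2 \<le> (nr f + nr g)^2"
  using assms Eherm[OF assms] by (simp add: nr_sq Vadd Eadd Eadd2 power2_sum)
qed (use assms nr_nonneg in auto)

lemma nr_minus: "f \<in> V ==> nr (\<lambda>x. - f x) = nr f"
proof -
 assume f: "f \<in> V"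
 have 1: "E (\<lambda>x. -1 * f x) (\<lambda>x. -1 * f x) = -1 * E f (\<lambda>x. -1 * f x)"
  by (rule Emul[OF f Vmul[OF f]])
 have 2: "E f (\<lambda>x. -1 * f x) = cnj (-1) * E f f" by (rule Emul2[OF f f])
 show ?thesis using 1 unfolding 2 nr_def by simp
qed

lemma nr_triangle_diff:
 assumes "f \<in> V" "g \<in> V" shows "nr (\<lambda>x. f x - g x) \<le> nr f + nr g"
 using nr_triangle[OF assms(1) Vmul[OF assms(2), of "-1"]] nr_minus[OF assms(2)] by simp

lemma semi_riesz:
 assumes "finite B" "cspan B \<subseteq> V"
  and "\<And>f g. f \<in> cspan B ==> g \<in> cspan B ==> L (\<lambda>x. f x + g x) = L f + L g"
  and "\<And>f c. f \<in> cspan B ==> L (\<lambda>x. c * f x) = c * L f"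
  and "\<And>f. f \<in> cspan B ==> E f f = 0 ==> L f = 0"
 shows "\<exists>g\<in>cspan B. \<forall>f\<in>cspan B. E f g = L f"
 using assms
proof (induction B arbitrary: L rule: finite_induct)
 case empty
 have c: "cspan {} = {\<lambda>x :: 'a. 0 :: complex}" by (auto simp: cspan_def)
 have "L (\<lambda>x. 0) = 0" using empty.prems(3)[of "\<lambda>x. 0" 0] c by simp
 moreover have "E (\<lambda>x. 0) (\<lambda>x. 0) = 0" using Emul[of "\<lambda>x. 0" "\<lambda>x. 0" 0] c empty.prems(1) by auto
 ultimately show ?case using c by auto
next
 case (insert b B)
 have fin: "finite (insert b B)" using insert.hyps by simp
 have sub: "f \<in> cspan B ==> f \<in> cspan (insert b B)" for f
  by (rule cspan_mono[OF fin]) auto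
 have subV: "cspan B \<subseteq> V" using sub insert.prems(1) by blast
 have bV: "b \<in> V" using cspan_base[OF fin, of b] insert.prems(1) by auto
 have "\<exists>g\<in>cspan B. \<forall>f\<in>cspan B. E f g = L f"
  by (rule insert.IH[OF subV]; intro insert.prems(2-4) sub; assumption)
 then obtain g0 where g0: "g0 \<in> cspan B" "\<And>f. f \<in> cspan B ==> E f g0 = L f" by blast
 have "\<exists>g\<in>cspan B. \<forall>f\<in>cspan B. E f g = E f b"
 proof (rule insert.IH[OF subV, of "\<lambda>f. E f b"])
  fix f assume f: "f \<in> cspan B" "E f f = 0"
  have "norm (E f b) \<le> nr f * nr b" by (rule cauchy_schwarz) (use f subV bV in auto)
  then show "E f b = 0" using f by (simp add: nr_def)
 qed (use subV bV in \<open>auto intro!: Eadd Emul\<close>)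
 then obtain b0 where b0: "b0 \<in> cspan B" "\<And>f. f \<in> cspan B ==> E f b0 = E f b" by blast
 define b' where "b' = (\<lambda>x. b x - b0 x)"
 have b'c: "b' \<in> cspan (insert b B)"
  using cspan_add[OF cspan_base[OF fin, of b] cspan_cmult[OF sub[OF b0(1)], of "-1"]] by (simp add: b'_def)
 have b'V: "b' \<in> V" using b'c insert.prems(1) by blast
 have V[simp]: "b0 \<in> V" "g0 \<in> V" "b \<in> V" "b' \<in> V" using b0 g0 subV bV b'V by auto
 have orth: "E f b' = 0" if "f \<in> cspan B" for f
  using b0(2)[OF that] that subV unfolding b'_def by (subst Ediff2) auto
 have orth': "E b' f = 0" if "f \<in> cspan B" for f
  using orth[OF that] Eherm[of f b'] that subV by auto
 define s where "s = (if E b' b' = 0 then 0 else cnj (L b' / E b' b'))"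
 have s: "cnj s * E b' b' = L b'"
  using insert.prems(4)[OF b'c] by (auto simp: s_def)
 define g where "g = (\<lambda>x. g0 x + s * b' x)"
 have "g \<in> cspan (insert b B)" unfolding g_def by (intro cspan_add cspan_cmult sub g0 b'c)
 moreover have "E f g = L f" if f: "f \<in> cspan (insert b B)" for f
 proof -
  obtain f' c where f': "f' \<in> cspan B" "f = (\<lambda>x. f' x + c * b x)"
   using cspan_insert[OF insert.hyps(1,2) f] by blast
  define f2 where "f2 = (\<lambda>x. f' x + c * b0 x)"
  have f2: "f2 \<in> cspan B" unfolding f2_def by (intro cspan_add cspan_cmult f' b0)
  have fe: "f = (\<lambda>x. f2 x + c * b' x)" by (simp add: f'(2) f2_def b'_def algebra_simps)
  have f2V: "f2 \<in> V" using f2 subV by auto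
  have "E f g = E f2 g + c * E b' g"
   unfolding fe using f2V by (subst Eadd) (auto simp: Vmul Emul g_def Vadd)
  also have "\<dots> = L f2 + c * L b'"
   unfolding g_def using f2V s g0(2)[OF f2] orth[OF f2] orth'[OF g0(1)] by (simp add: Eadd2 Vmul Emul2)
  also have "\<dots> = L f" unfolding fe
   using insert.prems(2)[OF sub[OF f2] cspan_cmult[OF b'c]] insert.prems(3)[OF b'c] by simp
  finally show ?thesis .
 qed
 ultimately show ?case by blast
qed

end

lemma continuous_ann_integral_eq_0:
 fixes F :: "'a::euclidean_space => real"
 assumes "continuous_on (-{0}) F" "\<And>x. 0 \<le> F x" "(LA x. F x) = 0" "1 < norm x" "norm x < exp 1"
 shows "F x = 0"
proof (rule ccontr)
 assume ne: "F x \<noteq> 0"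
 let ?O = "{x::'a. 1 < norm x \<and> norm x < exp 1}"
 have O: "open ?O" by (intro open_Collect_conj open_Collect_less continuous_intros)
 have "continuous_on ?O F" by (rule continuous_on_subset[OF assms(1)]) auto
 then have "open (?O \<inter> F -` (-{0}))" using O by (rule continuous_open_preimage) auto
 moreover have "?O \<inter> F -` (-{0}) \<noteq> {}" using ne assms(4,5) by auto
 ultimately have nn: "\<not> negligible (?O \<inter> F -` (-{0}))" by (rule open_not_negligible)
 have "integrable lborel (\<lambda>x. indicator ann x *R F x)"
  using set_integrable_compact[OF compact_ann continuous_on_subset[OF assms(1)]] by (auto simp: set_integrable_def ann_def)
 then have "AE x in lborel. indicator ann x *R F x = 0"
  using assms(2,3) by (subst (asm) set_lebesgue_integral_def, subst (asm) integral_nonneg_eq_0_iff_AE) auto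
 then obtain N where N: "N \<in> null_sets lborel" "{x \<in> space lborel. \<not> (indicator ann x *R F x = 0)} \<subseteq> N"
  unfolding eventually_ae_filter by blast
 then have "negligible N" by (simp add: negligible_iff_null_sets null_sets_completionI)
 then have "negligible {x. \<not> (indicator ann x *R F x = 0)}" by (rule negligible_subset) (use N in simp)
 then have "negligible (?O \<inter> F -` (-{0}))"
  by (rule negligible_subset) (auto simp: indicator_def ann_def)
 then show False using nn by simp
qed

lemma wirtinger_scaled:
 fixes F :: "complex^'m => complex"
 assumes F: "Ck_on (Suc 0) F (-{0})" and c: "c \<noteq> 0" and x: "x \<noteq> 0"
  and eq: "\<And>y. y \<noteq> 0 ==> F (c *s y) = M * F y + n"
 shows "c * dz b F (c *s x) = M * dz b F x"
  "cnj c * dzb b F (c *s x) = M * dzb b F x"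
proof -
 have nz: "c *s x \<in> -{0}" "x \<in> -{0}" using cmult_vec_nz[OF c x] x by auto
 have e: "dd (c *s v) F (c *s x) = M * dd v F x" for v
  by (rule dd_equivariant[where h="\<lambda>z. M * z + n" and A="\<lambda>x. c *s x", OF bounded_bilinear.bounded_linear_right[OF bounded_bilinear_cmult_vec] F])
   (use nz eq in \<open>auto intro!: derivative_eq_intros\<close>)
 have ax: "c *s axis b d = Re (c * d) *R axis b 1 + Im (c * d) *R axis b \<i>" for d
  by (auto simp: vec_eq_iff axis_def complex_eq_iff)
 note l = dd_linear[OF open_nz F nz(1)]
 have e1: "of_real (Re c) * dd (axis b 1) F (c *s x) + of_real (Im c) * dd (axis b \<i>) F (c *s x) = M * dd (axis b 1) F x"
  using e[of "axis b 1"] unfolding ax by (simp add: linear_add[OF l] linear_scale[OF l] scaleR_conv_of_real[where 'a=complex])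
 have e2: "- of_real (Im c) * dd (axis b 1) F (c *s x) + of_real (Re c) * dd (axis b \<i>) F (c *s x) = M * dd (axis b \<i>) F x"
  using e[of "axis b \<i>"] unfolding ax by (simp add: linear_add[OF l] linear_diff[OF l] linear_neg[OF l] linear_scale[OF l] scaleR_conv_of_real[where 'a=complex])
 have c': "c = of_real (Re c) + \<i> * of_real (Im c)" "cnj c = of_real (Re c) - \<i> * of_real (Im c)"
  by (simp_all add: complex_eq_iff)
 show "c * dz b F (c *s x) = M * dz b F x"
  unfolding wirtinger_def times_divide_eq_right right_diff_distrib mult.left_commute[of M \<i>] e1[symmetric] e2[symmetric]
  by (subst (1 2) c'(1)) (simp add: algebra_simps)
 show "cnj c * dzb b F (c *s x) = M * dzb b F x"
  unfolding wirtinger_bar_def times_divide_eq_right distrib_left mult.left_commute[of M \<i>] e1[symmetric] e2[symmetric]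
  by (subst (1 2) c'(2)) (simp add: algebra_simps)
qed

definition Vc :: "(complex^'m => complex) set" where "Vc = {f. continuous_on (-{0}) f}"
definition V1 :: "(complex^'m => complex) set" where "V1 = {f. Ck_on (Suc 0) f (-{0})}"

lemma V1_Vc: "f \<in> V1 ==> f \<in> Vc"
 unfolding V1_def Vc_def using Ck_continuous by blast

lemma Pk_V1: "Pk k d f ==> f \<in> V1"
 unfolding V1_def using Pk_Ck by blast

lemma Pk0_wirtinger_bar:
 assumes "Pk k 0 f" "z \<noteq> 0" shows "dzb b f z = 0"
proof -
 obtain p where p: "BH (k + 0) 0 p" "f = (\<lambda>z. if z = 0 then 0 else p z / nn z ^ 0)"
  using assms unfolding Pk_def by blast
 have "dzb b f z = dzb b p z"
  by (rule wirtinger_cong(2)[OF open_nz]) (use assms p in auto)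
 then show ?thesis using BH_wirtinger[OF p(1), of b] by simp
qed

context weight
begin

lemma continuous_wt: "continuous_on (-{0}) wt"
 by (rule Ck_continuous[OF Ck_wt])

lemma ip_real: "Re (ip f f) = (LA z. (norm (f z))^2 * exp (- P z))"
proof -
 have "ip f f = (LA z. complex_of_real ((norm (f z))^2 * exp (- P z)))"
  unfolding ip_def wt_def by (simp only: complex_norm_square of_real_mult)
 then show ?thesis by (simp only: set_integral_complex_of_real Re_complex_of_real)
qed

lemma en_real: "Re (en f f) = (LA z. (norm z)^2 * (\<Oplus>b. (norm (dzb b f z))^2) * exp (- P z))"
proof -
 have "en f f = (LA z. complex_of_real ((norm z)^2 * (\<Oplus>b. (norm (dzb b f z))^2) * exp (- P z)))"
  unfolding en_def wt_def nn_def by (simp only: complex_norm_square of_real_mult of_real_sum)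
 then show ?thesis by (simp only: set_integral_complex_of_real Re_complex_of_real)
qed

lemma en_integrable:
 assumes "f \<in> V1" "g \<in> V1"
 shows "set_integrable lborel ann (\<lambda>z. nn z * (\<Oplus>b. dzb b f z * cnj (dzb b g z)) * wt z)"
proof -
 have f: "Ck_on (Suc 0) f (-{0})" "Ck_on (Suc 0) g (-{0})" using assms by (auto simp: V1_def)
 have "Ck_on 0 (\<lambda>z. nn z * (\<Oplus>b. dzb b f z * cnj (dzb b g z)) * wt z) (-{0})"
  by (intro Ck_mult Ck_sum Ck_cnj open_nz Ck_nn Ck_wirtinger(2)[OF open_nz f(1)] Ck_wirtinger(2)[OF open_nz f(2)]
    Ck_SucD[OF Ck_SucD[OF Ck_wt]])
 then show ?thesis by (rule Ck_integrable_ann)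
qed

sublocale ipS: sesq Vc ip
proof
 fix f g h :: "complex^'m => complex" and c
 assume f: "f \<in> Vc" and g: "g \<in> Vc"
 show "(\<lambda>x. f x + g x) \<in> Vc" using f g by (auto simp: Vc_def intro: continuous_intros)
 show "(\<lambda>x. c * f x) \<in> Vc" using f by (auto simp: Vc_def intro: continuous_intros)
 show "ip g f = cnj (ip f g)"
  unfolding ip_def wt_def set_lebesgue_integral_def Bochner_Integration.integral_cnj[symmetric]
  by (rule Bochner_Integration.integral_cong) (simp_all add: mult_ac)
 show "0 \<le> Re (ip f f)" unfolding ip_real set_lebesgue_integral_def by (rule Bochner_Integration.integral_nonneg) simp
 assume h: "h \<in> Vc"
 note i = ip_integrable[of f h] ip_integrable[of g h]
 show "ip (\<lambda>x. f x + g x) h = ip f h + ip g h"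
  unfolding ip_def distrib_right using i f g h by (intro set_integral_add(2)) (auto simp: Vc_def)
 show "ip (\<lambda>x. c * f x) h = c * ip f h"
  unfolding ip_def mult.assoc by (rule set_integral_mult_right)
qed

sublocale enS: sesq V1 en
proof
 fix f g h :: "complex^'m => complex" and c
 assume f: "f \<in> V1" and g: "g \<in> V1"
 show "(\<lambda>x. f x + g x) \<in> V1" using f g by (auto simp: V1_def intro!: Ck_add open_nz simp del: Ck_on.simps)
 show "(\<lambda>x. c * f x) \<in> V1" using f by (auto simp: V1_def intro!: Ck_mult open_nz simp del: Ck_on.simps)
 show "en g f = cnj (en f g)"
  unfolding en_def wt_def nn_def set_lebesgue_integral_def Bochner_Integration.integral_cnj[symmetric]
  by (rule Bochner_Integration.integral_cong) (simp_all add: mult_ac)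
 show "0 \<le> Re (en f f)" unfolding en_real set_lebesgue_integral_def by (rule Bochner_Integration.integral_nonneg) (simp add: sum_nonneg)
 assume h: "h \<in> V1"
 have C: "Ck_on (Suc 0) f (-{0})" "Ck_on (Suc 0) g (-{0})" using f g by (auto simp: V1_def)
 have a: "wirtinger_bar e (\<lambda>x. f x + g x) z = wirtinger_bar e f z + wirtinger_bar e g z" if "z \<noteq> 0" for e z
  by (rule wirtinger_add(2)[OF open_nz C]) (use that in simp)
 have "en (\<lambda>x. f x + g x) h = (LA z. nn z * (\<Oplus>b. dzb b f z * cnj (dzb b h z)) * wt z
   + nn z * (\<Oplus>b. dzb b g z * cnj (dzb b h z)) * wt z)"
  unfolding en_def by (rule integral_ann_cong) (simp add: a sum.distrib distrib_right distrib_left)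
 also have "\<dots> = en f h + en g h" unfolding en_def by (rule set_integral_add(2)[OF en_integrable[OF f h] en_integrable[OF g h]])
 finally show "en (\<lambda>x. f x + g x) h = en f h + en g h" .
 have m: "wirtinger_bar e (\<lambda>x. c * f x) z = c * wirtinger_bar e f z" if "z \<noteq> 0" for e z
  by (rule wirtinger_cmult(2)[OF open_nz C(1)]) (use that in simp)
 have "en (\<lambda>x. c * f x) h = (LA z. c * (nn z * (\<Oplus>b. dzb b f z * cnj (dzb b h z)) * wt z))"
  unfolding en_def by (rule integral_ann_cong) (simp add: m sum_distrib_left sum_distrib_right mult_ac)
 also have "\<dots> = c * en f h" unfolding en_def by (rule set_integral_mult_right)
 finally show "en (\<lambda>x. c * f x) h = c * en f h" .
qed

lemma nr_cong: "(\<And>z. z \<noteq> 0 ==> f z = g z) ==> ipS.nr f = ipS.nr g"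
 unfolding ipS.nr_def ip_real by (intro arg_cong[where f=sqrt] integral_ann_cong) simp

lemma nr_bound: "\<exists>K>0. \<forall>f\<in>Vc. \<forall>e\<ge>0. (\<forall>z\<in>ann. norm (f z) \<le> e) \<longrightarrow> ipS.nr f \<le> e * K"
proof -
 have cw: "continuous_on ann (\<lambda>z. exp (- P z))"
  by (intro continuous_intros Ck_continuous_ann[OF P2])
 define I where "I = (LA z. exp (- P z))"
 have I: "I \<ge> 0" unfolding I_def set_lebesgue_integral_def by (rule Bochner_Integration.integral_nonneg) simp
 have "ipS.nr f \<le> e * sqrt (I + 1)" if f: "f \<in> Vc" "e \<ge> 0" "\<forall>z\<in>ann. norm (f z) \<le> e" for f e
 proof -
  have cf: "continuous_on ann f" using f(1) by (auto simp: Vc_def ann_def intro: continuous_on_subset)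
  have "Re (ip f f) \<le> (LA z. e^2 * exp (- P z))"
   unfolding ip_real
   using f(3) by (intro set_integral_mono set_integrable_compact compact_ann continuous_intros cf cw mult_right_mono power_mono) auto
  also have "\<dots> = e^2 * I" unfolding I_def by (rule set_integral_mult_right)
  also have "\<dots> \<le> e^2 * (I + 1)" by (intro mult_left_mono) auto
  finally have "ipS.nr f \<le> sqrt (e^2 * (I + 1))" unfolding ipS.nr_def by (rule real_sqrt_le_mono)
  then show ?thesis using f(2) by (simp add: real_sqrt_mult)
 qed
 then show ?thesis using I by (intro exI[of _ "sqrt (I + 1)"]) auto
qed

lemma en_zero_imp_Pk0:
 assumes "Pk k' d f" "Re (en f f) = 0" shows "Pk k' 0 f"
proof -
 have Cf: "Ck_on j (dzb b f) (-{0})" for j b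
  by (rule Ck_wirtinger(2)[OF open_nz Pk_Ck[OF assms(1)]])
 have h: "rh (int k' - 1) (dzb b f)" for b
  by (rule rh_wirtinger(2)[OF chom_rh[OF Pk_chom[OF assms(1)]] Pk_Ck[OF assms(1)]])
 let ?F = "\<lambda>z. (norm z)^2 * (\<Oplus>b. (norm (dzb b f z))^2) * exp (- P z)"
 have cont: "continuous_on (-{0}) ?F"
  by (intro continuous_intros Ck_continuous[OF Cf] Ck_continuous[OF P2])
 have W0: "dzb b f z = 0" if z: "z \<noteq> 0" for z b
 proof -
  define x where "x = (3 / 2 / norm z) *R z"
  have x: "norm x = 3 / 2" "z = (norm z / (3 / 2)) *R x" "x \<noteq> 0" using z by (auto simp: x_def)
  have "exp (1::real) > 3 / 2" using exp_ge_add_one_self[of 1] by linarith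
  then have "?F x = 0" using continuous_ann_integral_eq_0[OF cont _ assms(2)[unfolded en_real], of x] x by (simp add: sum_nonneg)
  then have "dzb b f x = 0" using x by (simp add: sum_nonneg_eq_0_iff)
  then show ?thesis using rhD[OF h[of b], of "norm z / (3 / 2)" x] x z by simp
 qed
 show ?thesis
 proof (rule Pk_lapl_eq_0[OF assms(1)])
  fix z :: "complex^'m" assume z: "z \<noteq> 0"
  have "dz b (dzb b f) z = dz b (\<lambda>z. 0) z" for b
   by (rule wirtinger_cong(1)[OF open_nz]) (use z W0 in auto)
  then show "lapl f z = 0" by (simp add: lapl_def)
 qed
qed

end

lemma bounded_above_ann:
 fixes f :: "'a::euclidean_space => real"
 assumes "continuous_on ann f" shows "\<exists>M\<ge>0. \<forall>z\<in>ann. f z \<le> M"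
proof -
 have "bounded (f ` ann)" using compact_continuous_image[OF assms compact_ann] by (rule compact_imp_bounded)
 then obtain M where "\<forall>y\<in>f ` ann. norm y \<le> M" unfolding bounded_iff by blast
 then show ?thesis by (intro exI[of _ "max M 0"]) fastforce
qed

lemma weight_compare:
 assumes "weight P k" "weight P' k'"
 shows "\<exists>c>0. (\<forall>f\<in>Vc. Re (weight.ip P f f) \<le> c * Re (weight.ip P' f f)) \<and>
  (\<forall>f\<in>V1. Re (weight.en P f f) \<le> c * Re (weight.en P' f f))"
proof -
 interpret A: weight P k by fact
 interpret B: weight P' k' by fact
 have cP: "continuous_on ann P" "continuous_on ann P'"
  using Ck_continuous_ann A.P2 B.P2 by blast+
 obtain M where M: "\<And>z. z \<in> ann ==> P' z - P z \<le> M"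
  using bounded_above_ann[of "\<lambda>z. P' z - P z"] cP by (auto intro: continuous_intros)
 have le: "x * exp (- P z) \<le> exp M * (x * exp (- P' z))" if "z \<in> ann" "x \<ge> 0" for z x
 proof -
  have "exp (- P z) \<le> exp (M - P' z)" using M[OF that(1)] by simp
  also have "\<dots> = exp M * exp (- P' z)" by (simp add: exp_add[symmetric])
  finally show ?thesis using that(2) by (simp add: mult_left_mono mult.left_commute)
 qed
 show ?thesis
 proof (intro exI[of _ "exp M"] conjI ballI)
  fix f :: "complex^'a => complex" assume "f \<in> Vc"
  then have cf: "continuous_on ann f" by (auto simp: Vc_def ann_def intro: continuous_on_subset)
  have "Re (A.ip f f) \<le> (LA z. exp M * ((norm (f z))^2 * exp (- P' z)))"
   unfolding A.ip_real
   by (intro set_integral_mono set_integrable_compact compact_ann continuous_intros cf cP le) auto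
  then show "Re (A.ip f f) \<le> exp M * Re (B.ip f f)"
   unfolding B.ip_real by simp
 next
  fix f :: "complex^'a => complex" assume "f \<in> V1"
  then have fC: "Ck_on (Suc 0) f (-{0})" by (simp add: V1_def del: Ck_on.simps)
  have cf: "continuous_on ann (dzb b f)" for b
   by (rule Ck_continuous_ann[OF Ck_wirtinger(2)[OF open_nz fC]])
  have "Re (A.en f f) \<le> (LA z. exp M * ((norm z)^2 * (\<Oplus>b. (norm (dzb b f z))^2) * exp (- P' z)))"
   unfolding A.en_real
   by (intro set_integral_mono set_integrable_compact compact_ann continuous_intros cf cP le mult_nonneg_nonneg sum_nonneg) auto
  then show "Re (A.en f f) \<le> exp M * Re (B.en f f)"
   unfolding B.en_real by simp
 qed simp
qed

lemma Pk_riesz: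
 assumes "sesq V E" "\<And>f :: complex^'m => complex. Pk k d f ==> f \<in> V" "v \<in> V'"  "sesq V' E'" "\<And>f. Pk k d f ==> f \<in> V'"
  and ker: "\<And>f. Pk k d f ==> E f f = 0 ==> E' f v = 0"
 shows "\<exists>g. Pk k d g \<and> (\<forall>f. Pk k d f \<longrightarrow> E f g = E' f v)"
proof -
 interpret S: sesq V E by fact
 interpret S': sesq V' E' by fact
 obtain B :: "(complex^'m => complex) set" where B: "finite B" "{g. Pk k d g} = cspan B"
  using Pk_cspan[of k d] by blast
 then have c: "f \<in> cspan B \<longleftrightarrow> Pk k d f" for f by blast
 have "\<exists>g\<in>cspan B. \<forall>f\<in>cspan B. E f g = E' f v"
  by (rule S.semi_riesz[OF B(1)]) (use assms(2,3,5) ker in \<open>auto simp: c S'.Eadd S'.Emul\<close>)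
 then obtain g where "g \<in> cspan B" "\<And>f. f \<in> cspan B ==> E f g = E' f v" by blast
 then show ?thesis using c by auto
qed

definition P0 :: "nat => complex^'m => real" where
 "P0 k z = real (k + CARD('m)) * lsq z"

lemma weight_P0: "weight (P0 k :: complex^'m => real) k"
proof
 show "Ck_on 2 (P0 k :: complex^'m => real) (-{0})" unfolding P0_def[abs_def] by (intro Ck_mult Ck_const Ck_lsq open_nz)
 fix c :: complex and z :: "complex^'m" assume "c \<noteq> 0" "z \<noteq> 0"
 then have "lsq (c *s z) = lsq z + 2 * ln (norm c)"
  by (simp add: lsq_def power2_norm_eq_inner[symmetric] norm_cmult_vec ln_mult ln_realpow power_mult_distrib)
 then show "P0 k (c *s z) = P0 k z + 2 * real (k + CARD('m)) * ln (norm c)"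
  by (simp add: P0_def algebra_simps)
qed

lemma wirtinger_P0:
 fixes z :: "complex^'m"
 assumes "z \<noteq> 0"
 shows "dz b (\<lambda>z. complex_of_real (P0 k z)) z = of_nat (k + CARD('m)) * (cnj (z $ b) / nn z)"
  "dz a (dzb b (\<lambda>z. complex_of_real (P0 k z))) z
   = of_nat (k + CARD('m)) * ((if a = b then 1 / nn z else 0) - z $ b * cnj (z $ a) / (nn z)^2)"
proof -
 let ?P = "\<lambda>z. complex_of_real (P0 k z)" and ?M = "of_nat (k + CARD('m)) :: complex"
 have zS: "z \<in> -{0}" using assms by simp
 have C: "Ck_on j (\<lambda>z :: complex^'m. complex_of_real (lsq z)) (-{0})" for j
  by (intro Ck_of_real Ck_lsq open_nz)
 have eq: "(\<lambda>z :: complex^'m. complex_of_real (P0 k z)) = (\<lambda>z. ?M * complex_of_real (lsq z))"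
  by (simp add: fun_eq_iff P0_def)
 show "dz b ?P z = ?M * (cnj (z $ b) / nn z)"
  unfolding eq wirtinger_cmult[OF open_nz C[of "Suc 0"] zS] wirtinger_lsq[OF assms] ..
 have w: "dzb b (\<lambda>z :: complex^'m. complex_of_real (P0 k z)) x = ?M * (x $ b * EE 1 x)" if "x \<in> -{0}" for x
  unfolding eq wirtinger_cmult[OF open_nz C[of "Suc 0"] that] using that by (simp add: wirtinger_lsq EE_eq)
 have Ce: "Ck_on j (\<lambda>x :: complex^'m. x $ b * EE 1 x) (-{0})" for j by (intro Ck_mult Ck_nth Ck_EE open_nz)
 have "dz a (dzb b ?P) z
  = dz a (\<lambda>x. ?M * (x $ b * EE 1 x)) z"
  by (rule wirtinger_cong(1)[OF open_nz zS w])
 also have "\<dots> = ?M * dz a (\<lambda>x. x $ b * EE 1 x) z"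
  by (rule wirtinger_cmult(1)[OF open_nz Ce[of "Suc 0"] zS])
 also have "dz a (\<lambda>x. x $ b * EE 1 x) z = dz a (\<lambda>x. x $ b) z * EE 1 z + z $ b * dz a (EE 1) z"
  by (rule wirtinger_mult(1)[OF open_nz Ck_nth(1)[OF open_nz, of "Suc 0"] Ck_EE zS])
 also have "\<dots> = (if a = b then 1 / nn z else 0) - z $ b * cnj (z $ a) / (nn z)^2"
  using assms by (simp add: wirtinger_nth wirtinger_EE EE_eq power2_eq_square)
 finally show "dz a (dzb b ?P) z
   = ?M * ((if a = b then 1 / nn z else 0) - z $ b * cnj (z $ a) / (nn z)^2)" .
qed

lemma gap_P0:
 fixes h :: "complex^'m => complex"
 assumes eta: "Pk k d h" and orth: "\<And>f. Pk k 0 f ==> weight.ip (P0 k) f h = 0"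
 shows "Re (weight.ip (P0 k) h h) \<le> Re (weight.en (P0 k) h h)"
proof -
 interpret W: weight "P0 k :: complex^'m => real" k by (rule weight_P0)
 have Vc: "Pk k d f ==> f \<in> Vc" for f :: "complex^'m => complex" and d using Pk_V1 V1_Vc by blast
 have "\<exists>g. Pk k d g \<and> (\<forall>f. Pk k d f \<longrightarrow> W.en f g = W.ip f h)"
 proof (rule Pk_riesz[OF W.enS.sesq_axioms Pk_V1 Vc[OF eta] W.ipS.sesq_axioms Vc])
  fix f :: "complex^'m => complex" assume f: "Pk k d f" "W.en f f = 0"
  show "W.ip f h = 0" by (rule orth[OF W.en_zero_imp_Pk0[OF f(1)]]) (simp add: f(2))
 qed
 then obtain g where g: "Pk k d g" "\<And>f. Pk k d f ==> W.en f g = W.ip f h" by blast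
 define q where "q = (\<lambda>z. if z = 0 then 0 else - (nn z * lapl g z))"
 have q: "Pk k d q" unfolding q_def by (rule Pk_lapl[OF g(1)])
 have boxq: "W.box g z = q z" if z: "z \<noteq> 0" for z
 proof -
  have "(\<Oplus>b. dz b W.PC z * dzb b g z)
    = of_nat (k + CARD('m)) / nn z * (\<Oplus>b. cnj (z $ b) * dzb b g z)"
   unfolding wirtinger_P0(1)[OF z] sum_distrib_left by (intro sum.cong) auto
  also have "\<dots> = 0" unfolding W.Pk_bar_euler[OF g(1) z] by simp
  finally show ?thesis using z by (simp add: W.box_def q_def lapl_def sum_subtractf)
 qed
 have ipq: "W.ip f q = W.ip f h" if f: "Pk k d f" for f
 proof -
  have "W.ip f q = W.ip f (W.box g)" unfolding W.ip_def by (rule integral_ann_cong) (simp add: boxq)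
  also have "\<dots> = W.en f g" by (rule W.ip_box[OF Pk_Ck[OF f] chom_rh[OF Pk_chom[OF f]] g(1)])
  finally show ?thesis using g(2)[OF f] by simp
 qed
 have "Re (W.ip (W.box g) (W.box g)) = Re (W.ip q q)"
  unfolding W.ip_real by (rule integral_ann_cong) (simp add: boxq)
 also have "W.ip q q = W.ip q h" by (rule ipq[OF q])
 also have "W.ip q h = cnj (W.ip h q)" by (rule W.ipS.Eherm[OF Vc[OF eta] Vc[OF q]])
 also have "W.ip h q = W.ip h h" by (rule ipq[OF eta])
 finally have nb: "Re (W.ip (W.box g) (W.box g)) = Re (W.ip h h)" by simp
 have "(LA z. (\<Oplus>a b. W.HP a b z * (nn z * dzb a g z) * cnj (nn z * dzb b g z)) * W.wt z)
   = (LA z. of_nat (k + CARD('m)) * (nn z * (\<Oplus>b. dzb b g z * cnj (dzb b g z)) * W.wt z))"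
 proof (rule integral_ann_cong)
  fix z :: "complex^'m" assume z: "z \<noteq> 0"
  let ?g = "\<lambda>b. dzb b g z"
  let ?M = "of_nat (k + CARD('m)) :: complex"
  have cn: "cnj (nn z) = nn z" by (simp add: nn_def)
  have n0: "nn z \<noteq> 0" by (rule nn_nz[OF z])
  have "(\<Oplus>a b. W.HP a b z * (nn z * ?g a) * cnj (nn z * ?g b))
   = (\<Oplus>a b. (if a = b then ?M * nn z * (?g a * cnj (?g a)) else 0) - ?M * ((cnj (z $ a) * ?g a) * (z $ b * cnj (?g b))))"
   unfolding W.HP_def wirtinger_P0(2)[OF z]
   by (intro sum.cong refl) (use n0 in \<open>auto simp: cn power2_eq_square field_simps\<close>)
  also have "\<dots> = ?M * nn z * (\<Oplus>a. ?g a * cnj (?g a)) - ?M * ((\<Oplus>a. cnj (z $ a) * ?g a) * (\<Oplus>b. z $ b * cnj (?g b)))"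
   unfolding sum_product by (simp add: sum_subtractf sum_distrib_left)
  also have "\<dots> = ?M * (nn z * (\<Oplus>a. ?g a * cnj (?g a)))" unfolding W.Pk_bar_euler[OF g(1) z] by simp
  finally show "(\<Oplus>a b. W.HP a b z * (nn z * ?g a) * cnj (nn z * ?g b)) * W.wt z
    = ?M * (nn z * (\<Oplus>b. ?g b * cnj (?g b)) * W.wt z)" by (simp add: mult.assoc)
 qed
 also have "\<dots> = of_nat (k + CARD('m)) * W.en g g" unfolding W.en_def by (rule set_integral_mult_right)
 finally have "real (k + CARD('m)) * Re (W.en g g) \<le> Re (W.ip h h)"
  using W.bochner[OF g(1)] nb by simp
 moreover have "1 \<le> k + CARD('m)" using zero_less_card_finite[where 'a='m] by linarith
 then have "1 * Re (W.en g g) \<le> real (k + CARD('m)) * Re (W.en g g)"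
  using W.enS.Epos[OF Pk_V1[OF g(1)]] by (intro mult_right_mono) (auto simp del: of_nat_add)
 ultimately have gg: "W.enS.nr g \<le> W.ipS.nr h"
  unfolding W.enS.nr_def W.ipS.nr_def by simp
 have "(W.ipS.nr h)^2 = Re (W.en h g)"
  using g(2)[OF eta] by (simp add: W.ipS.nr_sq Vc[OF eta])
 also have "\<dots> \<le> W.enS.nr h * W.enS.nr g"
  using W.enS.cauchy_schwarz[OF Pk_V1[OF eta] Pk_V1[OF g(1)]] complex_Re_le_cmod order_trans by blast
 also have "\<dots> \<le> W.enS.nr h * W.ipS.nr h"
  by (intro mult_left_mono gg W.enS.nr_nonneg Pk_V1[OF eta])
 finally have "W.ipS.nr h * W.ipS.nr h \<le> W.enS.nr h * W.ipS.nr h" by (simp add: power2_eq_square)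
 then have "W.ipS.nr h \<le> W.enS.nr h"
  using W.ipS.nr_nonneg[OF Vc[OF eta]] W.enS.nr_nonneg[OF Pk_V1[OF eta]]
  by (cases "W.ipS.nr h = 0") auto
 then show ?thesis unfolding W.ipS.nr_def W.enS.nr_def by simp
qed

context weight
begin

lemma Pk_Vc: "Pk k' d f ==> f \<in> Vc"
 using Pk_V1 V1_Vc by blast

lemma gap:
 assumes v: "v \<in> Vc" "\<And>f. Pk k 0 f ==> ip f v = 0"
 shows "\<exists>C\<ge>0. \<forall>d h. Pk k d h \<longrightarrow> norm (ip h v) \<le> C * enS.nr h"
proof -
 interpret W: weight "P0 k :: complex^'m => real" k by (rule weight_P0)
 obtain c where c: "c > 0" "\<And>f. f \<in> Vc ==> Re (ip f f) \<le> c * Re (W.ip f f)"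
  using weight_compare[OF weight_axioms W.weight_axioms] by blast
 obtain c' where c': "c' > 0" "\<And>f. f \<in> V1 ==> Re (W.en f f) \<le> c' * Re (en f f)"
  using weight_compare[OF W.weight_axioms weight_axioms] by blast
 have "norm (ip h v) \<le> (nr * sqrt (c * c')) * enS.nr h" if eta: "Pk k d h" and nr: "nr = ipS.nr v" for d h nr
 proof -
  have "\<exists>f0. Pk k 0 f0 \<and> (\<forall>f. Pk k 0 f \<longrightarrow> W.ip f f0 = W.ip f h)"
  proof (rule Pk_riesz[OF W.ipS.sesq_axioms Pk_Vc Pk_Vc[OF eta] W.ipS.sesq_axioms Pk_Vc])
   fix f :: "complex^'m => complex" assume f: "Pk k 0 f" "W.ip f f = 0"
   have "norm (W.ip f h) \<le> W.ipS.nr f * W.ipS.nr h" by (rule W.ipS.cauchy_schwarz[OF Pk_Vc[OF f(1)] Pk_Vc[OF eta]])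
   then show "W.ip f h = 0" using f(2) by (simp add: W.ipS.nr_def)
  qed
  then obtain f0 where f0: "Pk k 0 f0" "\<And>f. Pk k 0 f ==> W.ip f f0 = W.ip f h" by blast
  define h' where "h' = (\<lambda>z. h z - f0 z)"
  have eta': "Pk k d h'" unfolding h'_def by (intro Pk_diff eta Pk_mono[OF f0(1)]) simp
  have o: "W.ip f h' = 0" if "Pk k 0 f" for f
   using f0(2)[OF that] unfolding h'_def by (simp add: W.ipS.Ediff2 Pk_Vc[OF that] Pk_Vc[OF eta] Pk_Vc[OF f0(1)])
  have "ip h' v = ip h v"
   unfolding h'_def using v(2)[OF f0(1)] by (simp add: ipS.Ediff Pk_Vc[OF eta] Pk_Vc[OF f0(1)] v(1))
  then have 1: "norm (ip h v) \<le> ipS.nr h' * ipS.nr v"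
   using ipS.cauchy_schwarz[OF Pk_Vc[OF eta'] v(1)] by simp
  have weq: "dzb b h' z = dzb b h z" if "z \<noteq> 0" for b z
  proof -
   have z: "z \<in> -{0}" using that by simp
   show ?thesis unfolding h'_def wirtinger_diff(2)[OF open_nz Pk_Ck[OF eta, of "Suc 0"] Pk_Ck[OF f0(1)] z]
    using Pk0_wirtinger_bar[OF f0(1) that] by simp
  qed
  have "Re (ip h' h') \<le> c * Re (W.ip h' h')" by (rule c(2)[OF Pk_Vc[OF eta']])
  also have "\<dots> \<le> c * Re (W.en h' h')" using c(1) gap_P0[OF eta' o] by simp
  also have "\<dots> \<le> c * (c' * Re (en h' h'))" using c(1) c'(2)[OF Pk_V1[OF eta']] by simp
  also have "Re (en h' h') = Re (en h h)" unfolding en_real by (rule integral_ann_cong) (simp add: weq)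
  finally have "ipS.nr h' \<le> sqrt (c * c') * enS.nr h"
   unfolding ipS.nr_def enS.nr_def using real_sqrt_le_mono by (fastforce simp: real_sqrt_mult mult.assoc)
  then have "ipS.nr h' * ipS.nr v \<le> sqrt (c * c') * enS.nr h * ipS.nr v"
   by (rule mult_right_mono) (rule ipS.nr_nonneg[OF v(1)])
  then show ?thesis using 1 unfolding nr by (simp add: mult_ac)
 qed
 moreover have "ipS.nr v * sqrt (c * c') \<ge> 0" using ipS.nr_nonneg[OF v(1)] c c' by simp
 ultimately show ?thesis by blast
qed

definition XX :: "(complex^'m => complex) => complex^'m => complex" where
 "XX g z = nn z * (\<Oplus>b. dz b PC z * dzb b g z)"

lemma XX_Vc: "g \<in> V1 ==> XX g \<in> Vc"
proof -
 assume "g \<in> V1"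
 then have g: "Ck_on (Suc 0) g (-{0})" by (simp add: V1_def del: Ck_on.simps)
 have "Ck_on 0 (XX g) (-{0})" unfolding XX_def[abs_def]
  by (intro Ck_mult Ck_sum open_nz Ck_nn Ck_SucD[OF Ck_wirtinger(1)[OF open_nz PCSS]] Ck_wirtinger(2)[OF open_nz g])
 then show ?thesis by (simp add: Vc_def)
qed

lemma XX_bound: "\<exists>K\<ge>0. \<forall>g\<in>V1. ipS.nr (XX g) \<le> K * enS.nr g"
proof -
 have CW: "continuous_on ann (dz b PC)" for b
  by (rule Ck_continuous_ann[OF Ck_wirtinger(1)[OF open_nz PCSS]])
 have "\<exists>M\<ge>0. \<forall>z\<in>ann. (norm z)^2 * (\<Oplus>b. (norm (dz b PC z))^2) \<le> M"
  by (intro bounded_above_ann continuous_intros CW)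
 then obtain M where M: "M \<ge> 0" "\<And>z. z \<in> ann ==> (norm z)^2 * (\<Oplus>b. (norm (dz b PC z))^2) \<le> M" by blast
 have "ipS.nr (XX g) \<le> sqrt M * enS.nr g" if g: "g \<in> V1" for g
 proof -
  let ?N = "\<lambda>z. L2_set (\<lambda>b. norm (dz b PC z)) UNIV * L2_set (\<lambda>b. norm (dzb b g z)) UNIV"
  let ?w = "\<lambda>z. (\<Oplus>b. (norm (dz b PC z))^2)" and ?h = "\<lambda>z. (\<Oplus>b. (norm (dzb b g z))^2)"
  have gC: "Ck_on (Suc 0) g (-{0})" using g by (simp add: V1_def del: Ck_on.simps)
  have ch: "continuous_on ann (dzb b g)" for b
   by (rule Ck_continuous_ann[OF Ck_wirtinger(2)[OF open_nz gC]])
  have cP: "continuous_on ann P" by (rule Ck_continuous_ann[OF P2])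
  have cX: "continuous_on ann (XX g)" using XX_Vc[OF g] by (auto simp: Vc_def ann_def intro: continuous_on_subset)
  have pt: "(norm (XX g z))^2 \<le> M * ((norm z)^2 * ?h z)" if z: "z \<in> ann" for z
  proof -
   have "norm (\<Oplus>b. dz b PC z * dzb b g z)
     \<le> (\<Oplus>b. \<bar>norm (dz b PC z)\<bar> * \<bar>norm (dzb b g z)\<bar>)"
    by (rule sum_norm_le) (simp add: norm_mult)
   also have "\<dots> \<le> ?N z"
    by (rule L2_set_mult_ineq)
   finally have "(norm (\<Oplus>b. dz b PC z * dzb b g z))^2
     \<le> (?N z)^2"
    by (intro power_mono) auto
   also have "\<dots> = ?w z * ?h z" by (simp add: L2_set_def power_mult_distrib sum_nonneg)
   finally have s: "(norm (\<Oplus>b. dz b PC z * dzb b g z))^2 \<le> ?w z * ?h z" .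
   have "(norm (XX g z))^2 = ((norm z)^2)^2 * (norm (\<Oplus>b. dz b PC z * dzb b g z))^2"
    by (simp add: XX_def norm_mult power_mult_distrib nn_def norm_power)
   also have "\<dots> \<le> ((norm z)^2)^2 * (?w z * ?h z)" by (rule mult_left_mono[OF s]) simp
   also have "\<dots> = ((norm z)^2 * ?w z) * ((norm z)^2 * ?h z)" by (simp add: power2_eq_square mult_ac)
   also have "\<dots> \<le> M * ((norm z)^2 * ?h z)" by (rule mult_right_mono[OF M(2)[OF z]]) (simp add: sum_nonneg)
   finally show ?thesis .
  qed
  have "Re (ip (XX g) (XX g)) \<le> (LA z. M * ((norm z)^2 * ?h z * exp (- P z)))"
   unfolding ip_real
  proof (intro set_integral_mono set_integrable_compact compact_ann continuous_intros cX cP ch)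
   fix z :: "complex^'m" assume z: "z \<in> ann"
   show "(norm (XX g z))^2 * exp (- P z) \<le> M * ((norm z)^2 * ?h z * exp (- P z))"
    using mult_right_mono[OF pt[OF z], of "exp (- P z)"] by (simp add: mult_ac)
  qed
  also have "\<dots> = M * Re (en g g)" unfolding en_real by (rule set_integral_mult_right)
  finally have "ipS.nr (XX g) \<le> sqrt (M * Re (en g g))" unfolding ipS.nr_def by (rule real_sqrt_le_mono)
  then show ?thesis by (simp add: enS.nr_def real_sqrt_mult)
 qed
 then show ?thesis using M(1) by (intro exI[of _ "sqrt M"]) auto
qed

lemma XX_chom:
 assumes "Pk k' d g" shows "chom k' (XX g)"
 unfolding chom_def
proof (intro allI impI)
 fix c :: complex and z :: "complex^'m" assume cz: "c \<noteq> 0" "z \<noteq> 0"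
 have "c * dz b PC (c *s z) = 1 * dz b PC z" for b
  by (rule wirtinger_scaled(1)[OF Ck_SucD[OF PCSS] cz, where n="of_real (2 * real (k + CARD('m)) * ln (norm c))"])
   (simp add: P_scale[OF cz(1)])
 moreover have "cnj c * dzb b g (c *s z) = c ^ k' * dzb b g z" for b
  by (rule wirtinger_scaled(2)[OF Pk_Ck[OF assms] cz, where n=0])
   (use Pk_chom[OF assms] cz in \<open>simp add: chom_def\<close>)
 ultimately have "(c * dz b PC (c *s z)) * (cnj c * dzb b g (c *s z))
   = c ^ k' * (dz b PC z * dzb b g z)" for b by simp
 then have "(\<Oplus>b. (c * cnj c) * (dz b PC (c *s z) * dzb b g (c *s z)))
  = (\<Oplus>b. c ^ k' * (dz b PC z * dzb b g z))"
  by (intro sum.cong) (auto simp: mult_ac)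
 moreover have "nn (c *s z) = (c * cnj c) * nn z" unfolding nn_scale complex_norm_square ..
 ultimately show "XX g (c *s z) = c ^ k' * XX g z"
  unfolding XX_def sum_distrib_left[symmetric] by (simp add: mult_ac)
qed

lemma box_Vc: "Pk k d g ==> box g \<in> Vc"
 unfolding Vc_def by (simp add: Ck_continuous[OF box_Ck])

text \<open>Galerkin approximation. The energies of the approximate solutions converge, so the solutions
 are Cauchy in energy; as \<open>box\<close> differs from an operator preserving the spaces \<open>Pk k d\<close> only by
 the first-order operator \<open>XX\<close>, the residual tends to zero.\<close>

lemma box_dense:
 assumes v: "v \<in> Vc" "chom k v" "\<And>f. Pk k 0 f ==> ip f v = 0" and E: "E > 0"
 shows "\<exists>d g. Pk k d g \<and> ipS.nr (\<lambda>z. v z - box g z) < E"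
proof -
 obtain C where C: "C \<ge> 0" "\<And>d h. Pk k d h ==> norm (ip h v) \<le> C * enS.nr h" using gap[OF v(1,3)] by blast
 obtain K where K: "K \<ge> 0" "\<And>g. g \<in> V1 ==> ipS.nr (XX g) \<le> K * enS.nr g" using XX_bound by blast
 obtain K' where K': "K' > 0" "\<And>f e. f \<in> Vc ==> e \<ge> 0 ==> (\<And>z. z \<in> ann ==> norm (f z) \<le> e) ==> ipS.nr f \<le> e * K'"
  using nr_bound by blast
 have "\<exists>g. Pk k d g \<and> (\<forall>f. Pk k d f \<longrightarrow> en f g = ip f v)" for d
 proof (rule Pk_riesz[OF enS.sesq_axioms Pk_V1 v(1) ipS.sesq_axioms Pk_Vc])
  fix f :: "complex^'m => complex" assume f: "Pk k d f" "en f f = 0"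
  show "ip f v = 0" using C(2)[OF f(1)] f(2) by (simp add: enS.nr_def)
 qed
 then obtain g where g: "\<And>d. Pk k d (g d)" "\<And>d f. Pk k d f ==> en f (g d) = ip f v" by metis
 define a where "a = (\<lambda>d. Re (en (g d) (g d)))"
 have diff: "Re (en (\<lambda>z. g d' z - g d z) (\<lambda>z. g d' z - g d z)) = a d' - a d" if "d \<le> d'" for d d'
 proof -
  have e: "en (g d) (g d') = en (g d) (g d)" using g(2)[OF Pk_mono[OF g(1)[of d] that]] g(2)[OF g(1)[of d]] by simp
  have e': "en (g d') (g d) = cnj (en (g d) (g d))" using enS.Eherm[OF Pk_V1[OF g(1)] Pk_V1[OF g(1)], of d d'] e by simp
  show ?thesis
   using e e' by (simp add: enS.Ediff enS.Ediff2 enS.Vdiff Pk_V1[OF g(1)] a_def)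
 qed
 have bd: "a d \<le> C^2" for d
 proof -
  have "(enS.nr (g d))^2 = Re (ip (g d) v)" using g(2)[OF g(1)] by (simp add: enS.nr_sq Pk_V1[OF g(1)])
  also have "\<dots> \<le> C * enS.nr (g d)" using C(2)[OF g(1)] complex_Re_le_cmod order_trans by blast
  finally have "enS.nr (g d) \<le> C"
   using enS.nr_nonneg[OF Pk_V1[OF g(1)], of d] C(1) by (cases "enS.nr (g d) = 0") (auto simp: power2_eq_square)
  then have "(enS.nr (g d))^2 \<le> C^2" using enS.nr_nonneg[OF Pk_V1[OF g(1)]] by (intro power_mono) auto
  then show ?thesis by (simp add: a_def enS.nr_sq Pk_V1[OF g(1)])
 qed
 define \<delta> where "\<delta> = E / (4 * (K + 1))"
 have \<delta>: "\<delta> > 0" using E K(1) by (simp add: \<delta>_def)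
 obtain D where D: "\<And>d. d \<ge> D ==> a d - a D < \<delta>^2"
 proof -
  have "bdd_above (range a)" using bd by (intro bdd_aboveI[of _ "C^2"]) auto
  moreover have "(SUP d. a d) - \<delta>^2 < (SUP d. a d)" using \<delta> by simp
  ultimately obtain D where "(SUP d. a d) - \<delta>^2 < a D" using less_cSUP_iff[of UNIV a] by auto
  moreover have "a d \<le> (SUP d. a d)" for d using \<open>bdd_above (range a)\<close> by (intro cSUP_upper) auto
  ultimately show ?thesis using that[of D] by (metis add.commute add_less_le_mono diff_less_eq less_diff_eq order_le_less_trans)
 qed
 define e where "e = E / (4 * K')"
 have e: "e > 0" using E K'(1) by (simp add: e_def)
 have XV: "XX (g D) \<in> Vc" by (rule XX_Vc[OF Pk_V1[OF g(1)]])
 obtain d1 f1 where f1: "Pk k d1 f1" "\<And>z. z \<in> ann ==> norm (v z - f1 z) \<le> e"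
  using Pk_dense[OF _ v(2) e] v(1) by (auto simp: Vc_def)
 obtain d2 f2 where f2: "Pk k d2 f2" "\<And>z. z \<in> ann ==> norm (XX (g D) z - f2 z) \<le> e"
  using Pk_dense[OF _ XX_chom[OF g(1)] e, of D] XV by (auto simp: Vc_def)
 define d where "d = max D (max d1 d2)"
 have dD: "d \<ge> D" "d \<ge> d1" "d \<ge> d2" by (auto simp: d_def)
 define q where "q = (\<lambda>z. if z = 0 then 0 else - (nn z * lapl (g d) z))"
 have q: "Pk k d q" unfolding q_def by (rule Pk_lapl[OF g(1)])
 have boxq: "box (g d) z = q z + XX (g d) z" if "z \<noteq> 0" for z
  using that by (simp add: box_def q_def XX_def lapl_def sum_subtractf algebra_simps)
 define r where "r = (\<lambda>z. v z - box (g d) z)"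
 have boxV: "box (g d) \<in> Vc" by (rule box_Vc[OF g(1)])
 have rV: "r \<in> Vc" unfolding r_def by (rule ipS.Vdiff[OF v(1) boxV])
 have orth: "ip f r = 0" if f: "Pk k d f" for f
 proof -
  have "ip f r = ip f v - ip f (box (g d))" unfolding r_def by (rule ipS.Ediff2[OF v(1) boxV Pk_Vc[OF f]])
  also have "ip f (box (g d)) = en f (g d)" by (rule ip_box[OF Pk_Ck[OF f] chom_rh[OF Pk_chom[OF f]] g(1)])
  finally show ?thesis using g(2)[OF f] by simp
 qed
 define f where "f = (\<lambda>z. f1 z - q z - f2 z)"
 have f: "Pk k d f" unfolding f_def by (intro Pk_diff q Pk_mono[OF f1(1)] Pk_mono[OF f2(1)] dD)
 define s where "s = (\<lambda>z. (v z - f1 z) - (XX (g D) z - f2 z) - XX (\<lambda>z. g d z - g D z) z)"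
 have V: "(\<lambda>z. v z - f1 z) \<in> Vc" "(\<lambda>z. XX (g D) z - f2 z) \<in> Vc" "XX (\<lambda>z. g d z - g D z) \<in> Vc"
  "(\<lambda>z. (v z - f1 z) - (XX (g D) z - f2 z)) \<in> Vc"
  by (intro ipS.Vdiff v(1) XV Pk_Vc[OF f1(1)] Pk_Vc[OF f2(1)] XX_Vc enS.Vdiff Pk_V1[OF g(1)])+
 have sV: "s \<in> Vc" unfolding s_def by (rule ipS.Vdiff[OF V(4,3)])
 have rs: "r z - f z = s z" if z0: "z \<noteq> 0" for z
 proof -
  have z: "z \<in> -{0}" using z0 by simp
  have "XX (\<lambda>z. g d z - g D z) z = XX (g d) z - XX (g D) z"
   unfolding XX_def wirtinger_diff(2)[OF open_nz Pk_Ck[OF g(1), of "Suc 0"] Pk_Ck[OF g(1)] z]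
   by (simp add: sum_subtractf algebra_simps)
  then show ?thesis by (simp add: r_def f_def s_def boxq[OF z0])
 qed
 have "(ipS.nr r)^2 = Re (ip r r)" by (rule ipS.nr_sq[OF rV])
 also have "ip r r = ip (\<lambda>z. r z - f z) r" using ipS.Ediff[OF rV Pk_Vc[OF f] rV] orth[OF f] by simp
 also have "Re \<dots> \<le> ipS.nr (\<lambda>z. r z - f z) * ipS.nr r"
  using ipS.cauchy_schwarz[OF ipS.Vdiff[OF rV Pk_Vc[OF f]] rV] complex_Re_le_cmod order_trans by blast
 also have "ipS.nr (\<lambda>z. r z - f z) = ipS.nr s" by (rule nr_cong) (rule rs)
 finally have "ipS.nr r * ipS.nr r \<le> ipS.nr s * ipS.nr r" by (simp add: power2_eq_square)
 then have "ipS.nr r \<le> ipS.nr s"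
  using ipS.nr_nonneg[OF rV] ipS.nr_nonneg[OF sV] by (cases "ipS.nr r = 0") auto
 also have "\<dots> \<le> ipS.nr (\<lambda>z. (v z - f1 z) - (XX (g D) z - f2 z)) + ipS.nr (XX (\<lambda>z. g d z - g D z))"
  unfolding s_def by (rule ipS.nr_triangle_diff[OF V(4,3)])
 also have "ipS.nr (\<lambda>z. (v z - f1 z) - (XX (g D) z - f2 z)) \<le> ipS.nr (\<lambda>z. v z - f1 z) + ipS.nr (\<lambda>z. XX (g D) z - f2 z)"
  by (rule ipS.nr_triangle_diff[OF V(1,2)])
 also have "ipS.nr (\<lambda>z. v z - f1 z) \<le> e * K'" by (rule K'(2)[OF V(1) less_imp_le[OF e] f1(2)])
 also have "ipS.nr (\<lambda>z. XX (g D) z - f2 z) \<le> e * K'" by (rule K'(2)[OF V(2) less_imp_le[OF e] f2(2)])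
 also have "ipS.nr (XX (\<lambda>z. g d z - g D z)) \<le> K * enS.nr (\<lambda>z. g d z - g D z)"
  by (intro K(2) enS.Vdiff Pk_V1[OF g(1)])
 also have "enS.nr (\<lambda>z. g d z - g D z) \<le> \<delta>"
  unfolding enS.nr_def diff[OF dD(1)] using D[OF dD(1)] \<delta> by (intro real_le_lsqrt) auto
 finally have "ipS.nr r \<le> e * K' + e * K' + K * \<delta>" using K(1) by (simp add: mult_left_mono)
 also have "e * K' = E / 4" using K'(1) by (simp add: e_def)
 also have "K * \<delta> \<le> E / 4" using K(1) E by (simp add: \<delta>_def field_simps)
 finally have "ipS.nr r < E" using E by simp
 then show ?thesis using g(1) unfolding r_def by blast
qed

text \<open>Pairing \<open>w\<close> with \<open>box g\<close> and completing the square avoids dividing by the Hessian form.\<close>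

theorem core_inequality:
 fixes w p v G :: "complex^'m => complex" and R :: "complex^'m => real"
 assumes w: "Ck_on (Suc 0) w (-{0})" "chom k w" and p: "Pk k 0 p" and v: "v = (\<lambda>z. w z - p z)"
  and orth: "\<And>f. Pk k 0 f ==> ip f v = 0"
  and G: "continuous_on (-{0}) G" and R: "continuous_on (-{0}) R"
  and pos: "\<And>z B. z \<in> ann ==> (\<Oplus>b. cnj (z $ b) * B b) = 0 ==>
   R z \<le> Re (G z + 2 * (\<Oplus>b. dzb b w z * cnj (B b)) + (\<Oplus>a b. HP a b z * B a * cnj (B b)))"
 shows "(LA z. R z * exp (- P z)) \<le> Re (LA z. G z * wt z) - Re (ip v v)"
proof -
 have wV: "w \<in> V1" using w(1) by (simp add: V1_def del: Ck_on.simps)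
 have pV: "p \<in> V1" by (rule Pk_V1[OF p])
 have vV1: "v \<in> V1" unfolding v by (rule enS.Vdiff[OF wV pV])
 have vV: "v \<in> Vc" by (rule V1_Vc[OF vV1])
 have vch: "chom k v" using w(2) Pk_chom[OF p] by (simp add: v chom_def right_diff_distrib)
 let ?A = "LA z. R z * exp (- P z)" and ?G = "Re (LA z. G z * wt z)"
 have key: "?A \<le> ?G - Re (ip v v) + (ipS.nr (\<lambda>z. v z - box g z))^2" if g: "Pk k d g" for d g
 proof -
  have boxV: "box g \<in> Vc" by (rule box_Vc[OF g])
  have Cg: "Ck_on j (dzb b g) (-{0})" for j b by (rule Ck_wirtinger(2)[OF open_nz Pk_Ck[OF g]])
  let ?B = "\<lambda>z a. nn z * dzb a g z"
  let ?M = "\<lambda>z. \<Oplus>b. dzb b w z * cnj (?B z b)"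
  let ?H = "\<lambda>z. \<Oplus>a b. HP a b z * ?B z a * cnj (?B z b)"
  let ?T = "\<lambda>z. G z * wt z - 2 * (?M z * wt z) + ?H z * wt z"
  have cn: "cnj (nn z) = nn z" for z :: "complex^'m" by (simp add: nn_def)
  have pt: "R z \<le> Re (G z - 2 * ?M z + ?H z)" if z: "z \<in> ann" for z
  proof -
   have "(\<Oplus>b. cnj (z $ b) * - ?B z b) = - nn z * (\<Oplus>b. cnj (z $ b) * dzb b g z)"
    by (simp add: sum_distrib_left sum_negf mult_ac)
   then have "(\<Oplus>b. cnj (z $ b) * - ?B z b) = 0" using Pk_bar_euler[OF g ann_nz[OF z]] by simp
   from pos[OF z this] show ?thesis by (simp add: sum_negf)
  qed
  have CM: "Ck_on 0 (\<lambda>z. ?M z * wt z) (-{0})"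
   by (intro Ck_mult Ck_sum Ck_cnj open_nz Ck_nn Cg Ck_wirtinger(2)[OF open_nz w(1)] Ck_SucD[OF Ck_SucD[OF Ck_wt]])
  have CHP: "Ck_on 0 (HP a b) (-{0})" for a b
   unfolding HP_def[abs_def] by (intro Ck_wirtinger(1)[OF open_nz] Ck_wirtinger(2)[OF open_nz PCSS])
  have CH: "Ck_on 0 (\<lambda>z. ?H z * wt z) (-{0})"
   by (intro Ck_mult Ck_sum Ck_cnj open_nz Ck_nn Cg CHP Ck_SucD[OF Ck_SucD[OF Ck_wt]])
  have CG: "Ck_on 0 (\<lambda>z. G z * wt z) (-{0})" using G continuous_wt by (auto intro: continuous_intros)
  note i = Ck_integrable_ann[OF CM] Ck_integrable_ann[OF CH] Ck_integrable_ann[OF CG]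
  have iR: "set_integrable lborel ann (\<lambda>z. R z * exp (- P z))"
   by (rule Ck_integrable_ann[where j=0]) (use R Ck_continuous[OF P2] in \<open>auto intro!: continuous_intros\<close>)
  have i2: "set_integrable lborel ann (\<lambda>z. 2 * (?M z * wt z))" using i(1) by simp
  have i3: "set_integrable lborel ann ?T"
   by (intro set_integral_add(1) set_integral_diff(1) i i2)
  have ReI: "Re (LA z. F z) = (LA z. Re (F z))" if "set_integrable lborel ann F" for F :: "complex^'m => complex"
   using that unfolding set_lebesgue_integral_def set_integrable_def by (subst integral_Re[symmetric]) auto
  have "?A \<le> (LA z. Re (?T z))"
  proof (rule set_integral_mono[OF iR])
   show "set_integrable lborel ann (\<lambda>z. Re (?T z))"
    using i3 unfolding set_integrable_def by (auto dest: integrable_Re)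
   fix z :: "complex^'m" assume z: "z \<in> ann"
   have "?T z = (G z - 2 * ?M z + ?H z) * of_real (exp (- P z))"
    by (simp add: wt_def algebra_simps)
   moreover have "Re (x * complex_of_real t) = Re x * t" for x t by simp
   ultimately have "Re (?T z) = Re (G z - 2 * ?M z + ?H z) * exp (- P z)"
    by (simp only:)
   then show "R z * exp (- P z) \<le> Re (?T z)"
    using mult_right_mono[OF pt[OF z], of "exp (- P z)"] by simp
  qed
  also have "\<dots> = Re (LA z. ?T z)"
   by (rule ReI[OF i3, symmetric])
  also have "(LA z. ?T z)
   = (LA z. G z * wt z) - 2 * (LA z. ?M z * wt z) + (LA z. ?H z * wt z)"
   using set_integral_add(2)[OF set_integral_diff(1)[OF i(3) i2] i(2)] set_integral_diff(2)[OF i(3) i2] by simp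
  also have "(LA z. ?M z * wt z) = en w g"
   unfolding en_def by (rule integral_ann_cong) (simp add: cn sum_distrib_left mult_ac)
  also have "en w g = ip w (box g)" by (rule ip_box[OF w(1) chom_rh[OF w(2)] g, symmetric])
  also have "ip w (box g) = ip v (box g)"
  proof -
   have "ip p (box g) = en p g" by (rule ip_box[OF Pk_Ck[OF p] chom_rh[OF Pk_chom[OF p]] g])
   also have "en p g = (LINT z:(ann :: (complex^'m) set)|lborel. 0)"
    unfolding en_def by (rule integral_ann_cong) (simp add: Pk0_wirtinger_bar[OF p])
   finally have "ip p (box g) = 0" by (simp add: set_lebesgue_integral_def)
   then show ?thesis unfolding v using ipS.Ediff[OF V1_Vc[OF wV] V1_Vc[OF pV] boxV] by simp
  qed
  finally have 1: "?A \<le> ?G - 2 * Re (ip v (box g)) + Re (LA z. ?H z * wt z)" by simp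
  show ?thesis using 1 bochner[OF g] unfolding ipS.nr_diff_sq[OF vV boxV] ipS.nr_sq[OF vV] ipS.nr_sq[OF boxV] by linarith
 qed
 show ?thesis
 proof (rule field_le_epsilon)
  fix e :: real assume e: "e > 0"
  obtain d g where g: "Pk k d g" "ipS.nr (\<lambda>z. v z - box g z) < sqrt e"
   using box_dense[OF vV vch orth, of "sqrt e"] e by auto
  have boxV: "box g \<in> Vc" by (rule box_Vc[OF g(1)])
  have "(ipS.nr (\<lambda>z. v z - box g z))^2 \<le> (sqrt e)^2"
   using g(2) ipS.nr_nonneg[OF ipS.Vdiff[OF vV boxV]] by (intro power_mono) auto
  then show "?A \<le> ?G - Re (ip v v) + e" using key[OF g(1)] e by simp
 qed
qed

end

section \<open>The Chern connection of a trivial bundle\<close>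

lemma hermitian_sesq:
 assumes "hermitian_inner_product (cspan B) H"
 shows "sesq (cspan B) H"
proof
 fix f g h :: "'a => complex" and c
 assume f: "f \<in> cspan B"
 have lin: "\<And>f f' g a b. f \<in> cspan B ==> f' \<in> cspan B ==> g \<in> cspan B ==> H (\<lambda>x. a * f x + b * f' x) g = a * H f g + b * H f' g"
  by (rule assms[unfolded hermitian_inner_product_def, THEN conjunct1, rule_format])
 have herm: "\<And>f g. f \<in> cspan B ==> g \<in> cspan B ==> H g f = cnj (H f g)"
  by (rule assms[unfolded hermitian_inner_product_def, THEN conjunct2, THEN conjunct1, rule_format])
 have pos: "\<And>f. f \<in> cspan B ==> f \<noteq> (\<lambda>x. 0) ==> 0 < Re (H f f)"
  by (rule assms[unfolded hermitian_inner_product_def, THEN conjunct2, THEN conjunct2, rule_format])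
 show "(\<lambda>x. c * f x) \<in> cspan B" by (rule cspan_cmult[OF f])
 have z: "H (\<lambda>x. 0) g = 0" if "g \<in> cspan B" for g using lin[OF f f that, of 0 0] by simp
 show "0 \<le> Re (H f f)"
  using pos[OF f] f z[OF f] by (cases "f = (\<lambda>x. 0)") (simp_all add: less_imp_le)
 show "H (\<lambda>x. c * f x) h = c * H f h" if "h \<in> cspan B" using lin[OF f f that, of c 0] by simp
 assume g: "g \<in> cspan B"
 show "(\<lambda>x. f x + g x) \<in> cspan B" by (rule cspan_add[OF f g])
 show "H g f = cnj (H f g)" by (rule herm[OF f g])
 show "H (\<lambda>x. f x + g x) h = H f h + H g h" if "h \<in> cspan B" using lin[OF f g that, of 1 1] by simp
qed

context sesq
begin

lemma Esum: "(\<And>i. i \<in> I ==> f i \<in> V) ==> (\<lambda>x. 0) \<in> V ==> h \<in> V ==>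
  E (\<lambda>x. \<Sum>i\<in>I. c i * f i x) h = (\<Sum>i\<in>I. c i * E (f i) h) \<and> (\<lambda>x. \<Sum>i\<in>I. c i * f i x) \<in> V"
proof (induction I rule: infinite_finite_induct)
 case (insert i I)
 then show ?case by (simp add: Eadd Vadd Vmul Emul)
qed (use Emul[of "\<lambda>x. 0" h 0] in auto)

lemma Esum2: "(\<And>i. i \<in> I ==> f i \<in> V) ==> (\<lambda>x. 0) \<in> V ==> h \<in> V ==>
  E h (\<lambda>x. \<Sum>i\<in>I. c i * f i x) = (\<Sum>i\<in>I. cnj (c i) * E h (f i))"
 using Eherm[of "\<lambda>x. \<Sum>i\<in>I. c i * f i x" h] Esum[of I f h c] Eherm[of _ h] by simp

end

lemma cspan_subset: "finite B ==> C \<subseteq> cspan B ==> f \<in> cspan C ==> f \<in> cspan B"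
proof -
 assume *: "finite B" "C \<subseteq> cspan B" "f \<in> cspan C"
 then obtain c where "f = (\<lambda>x. \<Sum>b\<in>C. c b * b x)" by (auto simp: cspan_def)
 then show ?thesis using * by (auto intro!: cspan_sum cspan_cmult)
qed

lemma Ck_riesz:
 fixes h :: "'t::real_normed_vector => ('a => complex) => ('a => complex) => complex"
 assumes U: "open U" and "finite B"
  and "\<And>s. s \<in> U ==> hermitian_inner_product (cspan B) (h s)"
  and "\<And>f g. f \<in> cspan B ==> g \<in> cspan B ==> Ck_on k (\<lambda>s. h s f g) U"
  and "\<And>f. f \<in> cspan B ==> Ck_on k (\<lambda>s. L s f) U"
  and "\<And>s f g c. s \<in> U ==> f \<in> cspan B ==> g \<in> cspan B ==> L s (\<lambda>x. f x + c * g x) = L s f + c * L s g"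
 shows "\<exists>a. (\<forall>b\<in>B. Ck_on k (a b) U) \<and> (\<forall>s\<in>U. \<forall>f\<in>cspan B. h s f (\<lambda>x. \<Sum>b\<in>B. a b s * b x) = L s f)"
 using assms(2-)
proof (induction B arbitrary: h L rule: finite_induct)
 case empty
 have c: "cspan {} = {\<lambda>x :: 'a. 0 :: complex}" by (auto simp: cspan_def)
 have "h s (\<lambda>x. 0) (\<lambda>x. 0) = L s (\<lambda>x. 0)" if s: "s \<in> U" for s
 proof -
  interpret sesq "cspan {}" "h s" by (rule hermitian_sesq[OF empty.prems(1)[OF s]])
  show ?thesis using Emul[of "\<lambda>x. 0" "\<lambda>x. 0" 0] empty.prems(4)[OF s, of "\<lambda>x. 0" "\<lambda>x. 0" "-1"] c by simp
 qed
 then show ?case by (simp add: c)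
next
 case (insert b B)
 let ?V = "cspan (insert b B)"
 have fin: "finite (insert b B)" using insert.hyps by simp
 have sub: "f \<in> ?V" if "f \<in> cspan B" for f using that by (auto intro: cspan_mono[OF fin])
 have bI: "b \<in> ?V" by (rule cspan_base[OF fin]) simp
 note sq = hermitian_sesq[OF insert.prems(1)]
 have pos: "0 < Re (h s f f)" if "s \<in> U" "f \<in> ?V" "f \<noteq> (\<lambda>x. 0)" for s f
  using insert.prems(1)[OF that(1)] that(2,3) unfolding hermitian_inner_product_def by blast
 show ?case
 proof (cases "b \<in> cspan B")
  case True
  have eq: "f \<in> cspan B" if "f \<in> ?V" for f
   by (rule cspan_subset[OF insert.hyps(1) _ that]) (use True cspan_base[OF insert.hyps(1)] in auto)
  have V: "?V = cspan B" using eq sub by blast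
  have "\<exists>a. (\<forall>b\<in>B. Ck_on k (a b) U) \<and> (\<forall>s\<in>U. \<forall>f\<in>cspan B. h s f (\<lambda>x. \<Sum>b\<in>B. a b s * b x) = L s f)"
   by (rule insert.IH) (fact insert.prems[unfolded V])+
  then obtain a where a: "\<And>b. b \<in> B ==> Ck_on k (a b) U"
   "\<And>s f. s \<in> U ==> f \<in> cspan B ==> h s f (\<lambda>x. \<Sum>b\<in>B. a b s * b x) = L s f" by blast
  have "Ck_on k (\<lambda>s. if c = b then 0 else a c s) U" if "c \<in> insert b B" for c
   using that a(1) by (cases "c = b") (auto intro: Ck_const)
  moreover    have "(\<Sum>c\<in>insert b B. (if c = b then 0 else a c s) * c x) = (\<Sum>c\<in>B. a c s * c x)" for s x
   using insert.hyps by (simp, intro sum.cong) auto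
  ultimately show ?thesis using a(2) V by (intro exI[of _ "\<lambda>c s. if c = b then 0 else a c s"]) simp
 next
  case False
  have b0: "b \<noteq> (\<lambda>x. 0)" using False cspan_zero by metis
  define N where "N = (\<lambda>s. Re (h s b b))"
  have N: "h s b b = of_real (N s)" "0 < N s" if "s \<in> U" for s
   using sesq.Ereal[OF sq bI] pos[OF _ bI b0] that by (simp_all add: N_def)
  define r where "r = (\<lambda>s. complex_of_real (inverse (N s)))"
  have r: "r s * of_real (N s) = 1" "cnj (r s) = r s" if "s \<in> U" for s
   using N(2)[OF that] by (simp_all add: r_def flip: of_real_mult)
  have Cr: "Ck_on k r U" unfolding r_def N_def
   by (intro Ck_of_real Ck_inverse_compose Ck_Re U insert.prems(2) bI) (use N in \<open>force simp: N_def\<close>)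
  define h' where "h' = (\<lambda>s f g. h s f g - r s * h s f b * h s b g)"
  define L' where "L' = (\<lambda>s f. L s f - r s * h s f b * L s b)"
  have "\<exists>a. (\<forall>b\<in>B. Ck_on k (a b) U) \<and> (\<forall>s\<in>U. \<forall>f\<in>cspan B. h' s f (\<lambda>x. \<Sum>b\<in>B. a b s * b x) = L' s f)"
  proof (rule insert.IH)
   show "hermitian_inner_product (cspan B) (h' s)" if s: "s \<in> U" for s
   proof -
    interpret sesq ?V "h s" by (rule sq[OF s])
    show ?thesis unfolding hermitian_inner_product_def
    proof (intro conjI ballI allI impI)
     fix f f' g c d assume "f \<in> cspan B" "f' \<in> cspan B" "g \<in> cspan B"
     then show "h' s (\<lambda>x. c * f x + d * f' x) g = c * h' s f g + d * h' s f' g"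
      unfolding h'_def using bI by (simp add: Eadd Emul Vmul sub algebra_simps)
    next
     fix f g assume "f \<in> cspan B" "g \<in> cspan B"
     then show "h' s g f = cnj (h' s f g)"
      unfolding h'_def using Eherm[OF sub sub, of f g] Eherm[OF sub bI, of f] Eherm[OF sub bI, of g] r(2)[OF s] by simp
    next
     fix f assume f: "f \<in> cspan B" and f0: "f \<noteq> (\<lambda>x. 0)"
     define c where "c = r s * h s f b"
     have cb: "(\<lambda>x. c * b x) \<in> ?V" by (rule Vmul[OF bI])
     note f' = sub[OF f]
     have "(\<lambda>x. f x - c * b x) \<noteq> (\<lambda>x. 0)"
     proof
      assume "(\<lambda>x. f x - c * b x) = (\<lambda>x. 0)"
      then have fc: "f = (\<lambda>x. c * b x)" by (simp add: fun_eq_iff)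
      then have "c \<noteq> 0" using f0 by auto
      then have "b = (\<lambda>x. inverse c * f x)" unfolding fc by (simp add: fun_eq_iff)
      then show False using False cspan_cmult[OF f] by metis
     qed
     then have "0 < Re (h s (\<lambda>x. f x - c * b x) (\<lambda>x. f x - c * b x))" by (rule pos[OF s Vdiff[OF f' cb]])
     also have "h s (\<lambda>x. f x - c * b x) (\<lambda>x. f x - c * b x)
      = h s f f - c * h s b f + (c * cnj c * h s b b - cnj c * h s f b)"
      using f' cb bI Vdiff[OF f' cb] by (simp add: Ediff Ediff2 Emul Emul2 algebra_simps)
     also have "h s f f - c * h s b f = h' s f f" by (simp add: h'_def c_def)
     also have "c * cnj c * h s b b - cnj c * h s f b = cnj c * h s f b * (r s * of_real (N s) - 1)"
      by (simp add: N(1)[OF s] c_def algebra_simps)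
     finally show "0 < Re (h' s f f)" by (simp add: r(1)[OF s])
    qed
   qed
   show "Ck_on k (\<lambda>s. h' s f g) U" if "f \<in> cspan B" "g \<in> cspan B" for f g
    unfolding h'_def using that by (intro Ck_diff Ck_mult U Cr insert.prems(2) sub bI)
   show "Ck_on k (\<lambda>s. L' s f) U" if "f \<in> cspan B" for f
    unfolding L'_def using that by (intro Ck_diff Ck_mult U Cr insert.prems(2,3) sub bI)
   show "L' s (\<lambda>x. f x + c * g x) = L' s f + c * L' s g" if s: "s \<in> U" and f: "f \<in> cspan B" "g \<in> cspan B" for s f g c
    using insert.prems(4)[OF s sub[OF f(1)] sub[OF f(2)]] sesq.Eadd[OF sq[OF s] sub[OF f(1)] sesq.Vmul[OF sq[OF s] sub[OF f(2)]] bI]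
     sesq.Emul[OF sq[OF s] sub[OF f(2)] bI] unfolding L'_def by (simp add: algebra_simps)
  qed
  then obtain a0 where a0: "\<And>b. b \<in> B ==> Ck_on k (a0 b) U"
   "\<And>s f. s \<in> U ==> f \<in> cspan B ==> h' s f (\<lambda>x. \<Sum>b\<in>B. a0 b s * b x) = L' s f" by blast
  define g where "g = (\<lambda>s x. \<Sum>b\<in>B. a0 b s * b x)"
  have g: "g s \<in> ?V" for s by (rule sub) (auto simp: g_def cspan_def)
  define \<sigma> where "\<sigma> = (\<lambda>s. cnj (r s * (L s b - h s b (g s))))"
  define a where "a = (\<lambda>c s. if c = b then \<sigma> s else a0 c s)"
  have aeq: "(\<lambda>x. \<Sum>c\<in>insert b B. a c s * c x) = (\<lambda>x. g s x + \<sigma> s * b x)" for s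
  proof
   fix x
   have "(\<Sum>c\<in>B. a c s * c x) = g s x" unfolding g_def
    by (rule sum.cong) (use insert.hyps in \<open>auto simp: a_def\<close>)
   then show "(\<Sum>c\<in>insert b B. a c s * c x) = g s x + \<sigma> s * b x" using insert.hyps by (simp add: a_def)
  qed
  have hg: "h s b (g s) = (\<Sum>c\<in>B. cnj (a0 c s) * h s b c)" if "s \<in> U" for s
   unfolding g_def using sesq.Esum2[OF sq[OF that] _ cspan_zero bI, of B "\<lambda>c. c" "\<lambda>c. a0 c s"] cspan_base[OF fin] by simp
  have C\<sigma>: "Ck_on k \<sigma> U" unfolding \<sigma>_def
  proof (intro Ck_cnj Ck_mult Ck_diff U Cr insert.prems(3) bI)
   show "Ck_on k (\<lambda>s. h s b (g s)) U"
    by (rule Ck_cong[OF U _ hg[symmetric]])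
     (intro Ck_sum Ck_mult Ck_cnj U a0(1) insert.prems(2) bI cspan_base[OF fin] insertI2)
  qed
  show ?thesis
  proof (intro exI[of _ a] conjI ballI)
   show "Ck_on k (a c) U" if "c \<in> insert b B" for c using that a0(1) C\<sigma> by (cases "c = b") (auto simp: a_def)
   fix s f assume s: "s \<in> U" and f: "f \<in> ?V"
   interpret sesq ?V "h s" by (rule sq[OF s])
   obtain f' c where f': "f' \<in> cspan B" "f = (\<lambda>x. f' x + c * b x)"
    using cspan_insert[OF insert.hyps(1,2) f] by blast
   note V = sub[OF f'(1)] g[of s] bI
   have c\<sigma>: "cnj (\<sigma> s) = r s * (L s b - h s b (g s))" by (simp add: \<sigma>_def)
   have e: "h s u (\<lambda>x. g s x + \<sigma> s * b x) = h s u (g s) + cnj (\<sigma> s) * h s u b" if "u \<in> ?V" for u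
    using V that by (simp add: Eadd2 Emul2 Vmul)
   have "h s f' (g s) = L s f' - r s * h s f' b * L s b + r s * h s f' b * h s b (g s)"
    using a0(2)[OF s f'(1)] by (simp add: h'_def L'_def g_def algebra_simps)
   then have 1: "h s f' (\<lambda>x. g s x + \<sigma> s * b x) = L s f'" using e[OF V(1)] unfolding c\<sigma> by (simp add: algebra_simps)
   have "cnj (\<sigma> s) * h s b b = (r s * of_real (N s)) * (L s b - h s b (g s))" unfolding c\<sigma> N(1)[OF s] by (simp add: mult_ac)
   then have 2: "h s b (\<lambda>x. g s x + \<sigma> s * b x) = L s b" using e[OF bI] by (simp add: r(1)[OF s])
   have "h s f (\<lambda>x. g s x + \<sigma> s * b x) = L s f' + c * L s b"
    unfolding f'(2) using V 1 2 by (simp add: Eadd Emul Vadd Vmul)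
   then show "h s f (\<lambda>x. \<Sum>c\<in>insert b B. a c s * c x) = L s f"
    unfolding aeq f'(2) using insert.prems(4)[OF s V(1) bI] by simp
  qed
 qed
qed

lemma interpolation_basis:
 fixes B :: "('a => complex) set"
 assumes "finite B"
 shows "\<exists>X e. finite X \<and> (\<forall>x\<in>X. e x \<in> cspan B) \<and> (\<forall>x\<in>X. \<forall>y\<in>X. e x y = (if x = y then 1 else 0)) \<and>
  (\<forall>f\<in>cspan B. \<forall>y. f y = (\<Sum>x\<in>X. f x * e x y))"
 using assms
proof (induction B rule: finite_induct)
 case empty
 show ?case by (intro exI[of _ "{}"]) (simp add: cspan_def)
next
 case (insert b B)
 obtain X e where *: "finite X \<and> (\<forall>x\<in>X. e x \<in> cspan B) \<and> (\<forall>x\<in>X. \<forall>y\<in>X. e x y = (if x = y then 1 else 0)) \<and>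
  (\<forall>f\<in>cspan B. \<forall>y. f y = (\<Sum>x\<in>X. f x * e x y))"
  using insert.IH by (elim exE)
 then have X: "finite X" and e: "\<And>x. x \<in> X ==> e x \<in> cspan B"
  and d: "\<And>x y. x \<in> X ==> y \<in> X ==> e x y = (if x = y then 1 else 0)" by simp_all
 note f = *[THEN conjunct2, THEN conjunct2, THEN conjunct2, rule_format]
 have fin: "finite (insert b B)" using insert.hyps by simp
 have sub: "f \<in> cspan (insert b B)" if "f \<in> cspan B" for f using that by (auto intro: cspan_mono[OF fin])
 define r where "r = (\<lambda>y. b y - (\<Sum>x\<in>X. b x * e x y))"
 have r: "(\<lambda>y. r y) \<in> cspan (insert b B)"
  using cspan_add[OF cspan_base[OF fin, of b] cspan_cmult[of _ _ "-1", OF cspan_sum[of X "\<lambda>x y. b x * e x y"]]] sub e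
  by (auto simp: r_def intro: cspan_cmult)
 have rX: "r y = 0" if "y \<in> X" for y
  using that X by (simp add: r_def d if_distrib[of "\<lambda>c. _ * c"] cong: if_cong)
 have dec: "\<exists>c. \<forall>y. g y = (\<Sum>x\<in>X. g x * e x y) + c * r y" if g: "g \<in> cspan (insert b B)" for g
 proof -
  obtain g' c where g': "g' \<in> cspan B" "g = (\<lambda>x. g' x + c * b x)"
   using cspan_insert[OF insert.hyps(1,2) g] by blast
  have "g y = (\<Sum>x\<in>X. g x * e x y) + c * r y" for y
   unfolding g'(2) r_def using f[OF g'(1), of y]
   by (simp add: distrib_right sum.distrib right_diff_distrib sum_distrib_left mult.assoc)
  then show ?thesis by blast
 qed
 show ?case
 proof (cases "\<exists>z. r z \<noteq> 0")
  case False
  then have "g y = (\<Sum>x\<in>X. g x * e x y)" if "g \<in> cspan (insert b B)" for g y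
  proof -
   obtain c where "\<And>y. g y = (\<Sum>x\<in>X. g x * e x y) + c * r y" using dec[OF \<open>g \<in> _\<close>] by blast
   from this[of y] show ?thesis using False by simp
  qed
  then show ?thesis using X sub e d by (intro exI[of _ X] exI[of _ e] conjI ballI allI) blast+
 next
  case True
  then obtain z where z: "r z \<noteq> 0" by blast
  then have zX: "z \<notin> X" using rX by blast
  define r' where "r' = (\<lambda>y. 1 / r z * r y)"
  define e' where "e' = (\<lambda>x y. if x = z then r' y else e x y - e x z * r' y)"
  have r': "r' \<in> cspan (insert b B)" unfolding r'_def by (rule cspan_cmult[OF r])
  have "e' x \<in> cspan (insert b B)" if "x \<in> insert z X" for x
   using that r' cspan_add[OF sub[OF e[of x]] cspan_cmult[OF r', of "- e x z"]] by (cases "x = z") (simp_all add: e'_def)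
  moreover have "e' x y = (if x = y then 1 else 0)" if "x \<in> insert z X" "y \<in> insert z X" for x y
   using that zX z rX d by (auto simp: e'_def r'_def)
  moreover have "g y = (\<Sum>x\<in>insert z X. g x * e' x y)" if g: "g \<in> cspan (insert b B)" for g y
  proof -
   obtain c where c: "\<And>y. g y = (\<Sum>x\<in>X. g x * e x y) + c * r y" using dec[OF g] by blast
   have "(\<Sum>x\<in>X. g x * e' x y) = (\<Sum>x\<in>X. g x * e x y - g x * e x z * r' y)"
    by (rule sum.cong) (use zX in \<open>auto simp: e'_def algebra_simps\<close>)
   also have "\<dots> = (g y - c * r y) - (g z - c * r z) * r' y"
    using c[of y] c[of z] by (simp add: sum_subtractf flip: sum_distrib_right)
   finally show ?thesis using X zX z by (simp add: e'_def r'_def algebra_simps)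
  qed
  ultimately show ?thesis using X by (intro exI[of _ "insert z X"] exI[of _ e'] conjI ballI allI) blast+
 qed
qed

locale trivial_bundle =
 fixes U :: "(complex^'n) set" and B :: "('a => complex) set"
  and h :: "complex^'n => ('a => complex) => ('a => complex) => complex"
 assumes U: "open U" and B: "finite B"
  and herm: "s \<in> U ==> hermitian_inner_product (cspan B) (h s)"
  and C2: "f \<in> cspan B ==> g \<in> cspan B ==> Ck_on 2 (\<lambda>s. h s f g) U"
begin

abbreviation "V \<equiv> cspan B"

lemma sq: "s \<in> U ==> sesq V (h s)" by (rule hermitian_sesq[OF herm])

lemma C1: "f \<in> V ==> g \<in> V ==> Ck_on (Suc 0) (\<lambda>s. h s f g) U"
 by (rule Ck_mono[OF C2]) simp_all

lemma C2': "f \<in> V ==> g \<in> V ==> Ck_on (Suc (Suc 0)) (\<lambda>s. h s f g) U"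
 using C2[of f g] by (simp add: numeral_2_eq_2 del: Ck_on.simps)

lemma BV: "b \<in> B ==> b \<in> V" by (rule cspan_base[OF B])

lemma h_eqI:
 assumes s: "s \<in> U" and "f \<in> V" "g \<in> V" and eq: "\<And>v. v \<in> V ==> h s f v = h s g v"
 shows "f = g"
proof (rule ccontr)
 assume "f \<noteq> g"
 interpret sesq V "h s" by (rule sq[OF s])
 have d: "(\<lambda>x. f x - g x) \<in> V" by (rule Vdiff[OF assms(2,3)])
 have "(\<lambda>x. f x - g x) \<noteq> (\<lambda>x. 0)" using \<open>f \<noteq> g\<close> by (auto simp: fun_eq_iff)
 then have "0 < Re (h s (\<lambda>x. f x - g x) (\<lambda>x. f x - g x))"
  by (rule herm[OF s, unfolded hermitian_inner_product_def, THEN conjunct2, THEN conjunct2, rule_format, OF d])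
 then show False using Ediff[OF assms(2,3) d] eq[OF d] by simp
qed

lemma chern_D_const:
 assumes s: "s \<in> U" and u: "u \<in> V" and g: "g \<in> V"
  and eq: "\<And>v. v \<in> V ==> h s g v = dz j (\<lambda>s. h s u v) s"
 shows "chern_D U V h j (\<lambda>_. u) s = g"
 unfolding chern_D_def
proof (rule the_equality)
 have zero: "(\<lambda>x. 0) \<in> V" by (rule cspan_zero)
 show "g \<in> V \<and> (\<forall>v. Ck_section 1 U V v \<longrightarrow>
   dz j (\<lambda>s. h s u (v s)) s = h s g (v s) + h s u (dbar j v s))"
 proof (intro conjI g allI impI)
  fix v assume "Ck_section 1 U V v"
  then have v: "\<And>t. t \<in> U ==> v t \<in> V" "\<And>x. Ck_on (Suc 0) (\<lambda>t. v t x) U"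
   by (auto simp: Ck_section_def)
  obtain E e where *: "finite E \<and> (\<forall>x\<in>E. e x \<in> V) \<and> (\<forall>x\<in>E. \<forall>y\<in>E. e x y = (if x = y then 1 else 0)) \<and>
    (\<forall>f\<in>V. \<forall>y. f y = (\<Sum>x\<in>E. f x * e x y))"
   using interpolation_basis[OF B] by (elim exE)
  then have E: "\<And>x. x \<in> E ==> e x \<in> V" by simp
  note Ee = *[THEN conjunct2, THEN conjunct2, THEN conjunct2, rule_format]
  define c where "c = (\<lambda>x s. v s x)"
  have vc: "v t = (\<lambda>y. \<Sum>x\<in>E. c x t * e x y)" if "t \<in> U" for t
   unfolding c_def by (rule ext) (rule Ee[OF v(1)[OF that]])
  have Cc: "Ck_on (Suc 0) (c x) U" for x unfolding c_def by (rule v(2))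
  have hv: "h t f (v t) = (\<Sum>x\<in>E. cnj (c x t) * h t f (e x))" if "t \<in> U" "f \<in> V" for t f
   unfolding vc[OF that(1)] by (rule sesq.Esum2[OF sq[OF that(1)] E zero that(2)])
  have "dz j (\<lambda>s. h s u (v s)) s = dz j (\<lambda>s. \<Sum>x\<in>E. cnj (c x s) * h s u (e x)) s"
   by (rule wirtinger_cong[OF U s hv[OF _ u]])
  also have "\<dots> = (\<Sum>x\<in>E. dz j (\<lambda>s. cnj (c x s) * h s u (e x)) s)"
   by (rule wirtinger_sum(1)[where k=0, OF U _ s]) (intro Ck_mult Ck_cnj U Cc C1 u E)
  also have "\<dots> = (\<Sum>x\<in>E. cnj (dzb j (c x) s) * h s u (e x) + cnj (c x s) * h s g (e x))"
  proof (rule sum.cong[OF refl])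
   fix x assume x: "x \<in> E"
   show "dz j (\<lambda>s. cnj (c x s) * h s u (e x)) s
     = cnj (dzb j (c x) s) * h s u (e x) + cnj (c x s) * h s g (e x)"
    unfolding wirtinger_mult(1)[OF U Ck_cnj[OF U Cc] C1[OF u E[OF x]] s] wirtinger_cnj(1)[OF U Cc s]
     eq[OF E[OF x]] ..
  qed
  also have "\<dots> = h s u (\<lambda>y. \<Sum>x\<in>E. dzb j (c x) s * e x y) + h s g (v s)"
   using sesq.Esum2[OF sq[OF s] E zero u, where c="\<lambda>x. dzb j (c x) s"]
   unfolding hv[OF s g] by (simp add: sum.distrib)
  also have "(\<lambda>y. \<Sum>x\<in>E. dzb j (c x) s * e x y) = dbar j v s"
  proof
   fix y
   have "dbar j v s y = dzb j (\<lambda>s. \<Sum>x\<in>E. c x s * e x y) s"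
    unfolding dbar_def by (rule wirtinger_cong[OF U s]) (simp add: vc)
   also have "\<dots> = (\<Sum>x\<in>E. dzb j (\<lambda>s. c x s * e x y) s)"
    by (rule wirtinger_sum(2)[where k=0, OF U _ s]) (intro Ck_mult Ck_const U Cc)
   also have "\<dots> = (\<Sum>x\<in>E. dzb j (c x) s * e x y)"
    using wirtinger_mult(2)[OF U Cc Ck_const[of "Suc 0"] s] by simp
   finally show "(\<Sum>x\<in>E. dzb j (c x) s * e x y) = dbar j v s y" ..
  qed
  finally show "dz j (\<lambda>s. h s u (v s)) s = h s g (v s) + h s u (dbar j v s)" by simp
 qed
 fix g' assume g': "g' \<in> V \<and> (\<forall>v. Ck_section 1 U V v \<longrightarrow>
   dz j (\<lambda>s. h s u (v s)) s = h s g' (v s) + h s u (dbar j v s))"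
 show "g' = g"
 proof (rule h_eqI[OF s _ g])
  show "g' \<in> V" using g' by blast
  fix v assume v: "v \<in> V"
  have "Ck_section 1 U V (\<lambda>_. v)" using v by (auto simp: Ck_section_def intro: Ck_const)
  then have "dz j (\<lambda>s. h s u v) s = h s g' v + h s u (dbar j (\<lambda>_. v) s)" using g' by blast
  moreover have "dbar j (\<lambda>_. v) s = (\<lambda>x. 0)" by (simp add: dbar_def)
  moreover have "h s u (\<lambda>x. 0) = 0" using sesq.Emul2[OF sq[OF s] zero u, of 0] by simp
  ultimately show "h s g' v = h s g v" using eq[OF v] by simp
 qed
qed

lemma connection_coeffs:
 assumes u: "u \<in> V"
 shows "\<exists>a. (\<forall>b\<in>B. Ck_on (Suc 0) (a b) U) \<and>
  (\<forall>s\<in>U. \<forall>v\<in>V. h s (\<lambda>x. \<Sum>b\<in>B. a b s * b x) v = dz j (\<lambda>s. h s u v) s)"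
proof -
 let ?s = "\<lambda>a s x. \<Sum>b\<in>B. a b (s::complex^'n) * b x"
 define L where "L = (\<lambda>s f. cnj (dz j (\<lambda>s. h s u f) s))"
 have "\<exists>a. (\<forall>b\<in>B. Ck_on (Suc 0) (a b) U) \<and> (\<forall>s\<in>U. \<forall>f\<in>V. h s f (?s a s) = L s f)"
 proof (rule Ck_riesz[OF U B herm C1])
  show "Ck_on (Suc 0) (\<lambda>s. L s f) U" if "f \<in> V" for f
   unfolding L_def using Ck_cnj[OF U Ck_wirtinger(1)[OF U C2'[OF u that]]] .
  fix s f g c assume s: "s \<in> U" and f: "f \<in> V" and g: "g \<in> V"
  have "dz j (\<lambda>s. h s u (\<lambda>x. f x + c * g x)) s = dz j (\<lambda>s. h s u f + cnj c * h s u g) s"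
   by (rule wirtinger_cong[OF U s]) (simp add: sesq.Eadd2[OF sq f cspan_cmult[OF g] u] sesq.Emul2[OF sq g u])
  also have "\<dots> = dz j (\<lambda>s. h s u f) s + cnj c * dz j (\<lambda>s. h s u g) s"
   unfolding wirtinger_add(1)[OF U C1[OF u f] Ck_mult[OF U Ck_const C1[OF u g]] s] wirtinger_cmult(1)[OF U C1[OF u g] s] ..
  finally show "L s (\<lambda>x. f x + c * g x) = L s f + c * L s g" by (simp add: L_def)
 qed
 then obtain a where a: "\<And>b. b \<in> B ==> Ck_on (Suc 0) (a b) U"
  "\<And>s f. s \<in> U ==> f \<in> V ==> h s f (?s a s) = L s f" by blast
 show ?thesis
 proof (intro exI[of _ a] conjI ballI a(1))
  fix s v assume s: "s \<in> U" and v: "v \<in> V"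
  have "(?s a s) \<in> V" by (auto simp: cspan_def)
  then have "h s (?s a s) v = cnj (h s v (?s a s))"
   by (rule sesq.Eherm[OF sq[OF s] v])
  then show "h s (?s a s) v = dz j (\<lambda>s. h s u v) s"
   unfolding a(2)[OF s v] by (simp add: L_def)
 qed
qed

lemma connection:
 assumes u: "u \<in> V" and t: "t \<in> U"
 obtains p where "p \<in> V" "\<And>v. v \<in> V ==> h t p v = dz j (\<lambda>s. h s u v) t"
 proof -
 obtain a where "\<And>b. b \<in> B ==> Ck_on (Suc 0) (a b) U"
  and a: "\<And>s v. s \<in> U ==> v \<in> V ==> h s (\<lambda>x. \<Sum>b\<in>B. a b s * b x) v = dz j (\<lambda>s. h s u v) s"
  using connection_coeffs[OF u, of j] by blast
 have "(\<lambda>x. \<Sum>b\<in>B. a b t * b x) \<in> V" by (auto simp: cspan_def)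
 then show thesis using a[OF t] by (rule that)
qed

lemma curvature_form:
 assumes t: "t \<in> U" and u: "u \<in> V" and v: "v \<in> V" and p: "p \<in> V" and q: "q \<in> V"
  and hp: "\<And>f. f \<in> V ==> h t p f = dz j (\<lambda>s. h s u f) t"
  and hq: "\<And>f. f \<in> V ==> h t q f = dz l (\<lambda>s. h s v f) t"
 shows "h t (chern_curvature U V h j l (\<lambda>_. u) t) v
  = h t p q - dzb l (dz j (\<lambda>s. h s u v)) t"
proof -
 have zero: "(\<lambda>x. 0) \<in> V" by (rule cspan_zero)
 obtain a where a: "\<And>b. b \<in> B ==> Ck_on (Suc 0) (a b) U"
  and ga: "\<And>s v. s \<in> U ==> v \<in> V ==> h s (\<lambda>x. \<Sum>b\<in>B. a b s * b x) v = dz j (\<lambda>s. h s u v) s"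
  using connection_coeffs[OF u, of j] by blast
 define g where "g = (\<lambda>s x. \<Sum>b\<in>B. a b s * b x)"
 have gV: "g s \<in> V" for s by (auto simp: g_def cspan_def)
 have gD: "chern_D U V h j (\<lambda>_. u) s = g s" if "s \<in> U" for s
  by (rule chern_D_const[OF that u gV]) (simp add: g_def ga[OF that])
 have pg: "p = g t" by (rule h_eqI[OF t p gV]) (simp add: hp g_def ga[OF t])
 define d where "d = (\<lambda>x. \<Sum>b\<in>B. dzb l (a b) t * b x)"
 have dV: "d \<in> V" by (auto simp: d_def cspan_def)
 have "dbar l (chern_D U V h j (\<lambda>_. u)) t = d"
 proof
  fix x
  have "dbar l (chern_D U V h j (\<lambda>_. u)) t x = dzb l (\<lambda>s. \<Sum>b\<in>B. a b s * b x) t"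
   unfolding dbar_def by (rule wirtinger_cong[OF U t]) (simp add: gD g_def)
  also have "\<dots> = (\<Sum>b\<in>B. dzb l (\<lambda>s. a b s * b x) t)"
   by (rule wirtinger_sum(2)[where k=0, OF U _ t]) (intro Ck_mult Ck_const U a)
  also have "\<dots> = d x" unfolding d_def
   by (rule sum.cong[OF refl]) (use wirtinger_mult(2)[OF U a Ck_const[of "Suc 0"] t] in simp)
  finally show "dbar l (chern_D U V h j (\<lambda>_. u)) t x = d x" .
 qed
 moreover have "chern_D U V h j (dbar l (\<lambda>_. u)) t = (\<lambda>x. 0)"
 proof -
  have "dbar l (\<lambda>_. u) = (\<lambda>_ _. 0)" by (auto simp: dbar_def fun_eq_iff)
  moreover have "chern_D U V h j (\<lambda>_ _. 0) t = (\<lambda>x. 0)"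
  proof (rule chern_D_const[OF t zero zero])
   fix v assume v: "v \<in> V"
   have z: "h s (\<lambda>x. 0) v = 0" if "s \<in> U" for s using sesq.Emul[OF sq[OF that] zero v, of 0] by simp
   have "dz j (\<lambda>s. h s (\<lambda>x. 0) v) t = dz j (\<lambda>s. 0) t"
    by (rule wirtinger_cong[OF U t z])
   then show "h t (\<lambda>x. 0) v = dz j (\<lambda>s. h s (\<lambda>x. 0) v) t" using z[OF t] by simp
  qed
  ultimately show ?thesis by simp
 qed
 ultimately have "chern_curvature U V h j l (\<lambda>_. u) t = (\<lambda>x. - 1 * d x)"
  by (simp add: chern_curvature_def)
 then have 1: "h t (chern_curvature U V h j l (\<lambda>_. u) t) v = - h t d v"
  using sesq.Emul[OF sq[OF t] dV v, of "-1"] by simp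
 have hg: "h s (g s) f = (\<Sum>b\<in>B. a b s * h s b f)" if "s \<in> U" "f \<in> V" for s f
  unfolding g_def using sesq.Esum[OF sq[OF that(1)] _ zero that(2), of B "\<lambda>b. b" "\<lambda>b. a b s"] BV by simp
 have "dzb l (dz j (\<lambda>s. h s u v)) t
   = dzb l (\<lambda>s. \<Sum>b\<in>B. a b s * h s b v) t"
  by (rule wirtinger_cong[OF U t]) (simp add: ga[OF _ v, symmetric] hg[OF _ v, symmetric] g_def)
 also have "\<dots> = (\<Sum>b\<in>B. dzb l (\<lambda>s. a b s * h s b v) t)"
  by (rule wirtinger_sum(2)[where k=0, OF U _ t]) (intro Ck_mult U a C1 BV v)
 also have "\<dots> = (\<Sum>b\<in>B. dzb l (a b) t * h t b v + a b t * h t b q)"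
 proof (rule sum.cong[OF refl])
  fix b assume b: "b \<in> B"
  have "dzb l (\<lambda>s. h s b v) t = dzb l (\<lambda>s. cnj (h s v b)) t"
   by (rule wirtinger_cong[OF U t]) (simp add: sesq.Eherm[OF sq v BV[OF b]])
  also have "\<dots> = cnj (h t q b)"
   unfolding wirtinger_cnj(2)[OF U C1[OF v BV[OF b]] t] hq[OF BV[OF b]] ..
  also have "\<dots> = h t b q" using sesq.Eherm[OF sq[OF t] q BV[OF b]] by simp
  finally show "dzb l (\<lambda>s. a b s * h s b v) t
    = dzb l (a b) t * h t b v + a b t * h t b q"
   unfolding wirtinger_mult(2)[OF U a[OF b] C1[OF BV[OF b] v] t] by simp
 qed
 also have "\<dots> = h t d v + h t p q"
  unfolding sum.distrib pg hg[OF t q] d_def using sesq.Esum[OF sq[OF t] _ zero v, of B "\<lambda>b. b" "\<lambda>b. dzb l (a b) t"] BV by simp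
 finally show ?thesis unfolding 1 by simp
qed

lemma nakano_form:
 assumes t: "t \<in> U" and u: "\<And>j. u j \<in> V"
 obtains p where "p \<in> V"
  "\<And>f. f \<in> V ==> h t p f = (\<Oplus>j. dz j (\<lambda>s. h s (u j) f) t)"
  "(\<Oplus>j l. h t (chern_curvature U V h j l (\<lambda>_. u j) t) (u l))
   = h t p p - (\<Oplus>j l. dzb l (dz j (\<lambda>s. h s (u j) (u l))) t)"
proof -
 interpret sesq V "h t" by (rule sq[OF t])
 have "\<exists>p. p \<in> V \<and> (\<forall>f\<in>V. h t p f = dz j (\<lambda>s. h s (u j) f) t)" for j
  by (rule connection[OF u[of j] t]) blast
 then have "\<exists>P. \<forall>j. P j \<in> V \<and> (\<forall>f\<in>V. h t (P j) f = dz j (\<lambda>s. h s (u j) f) t)"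
  by (intro choice allI)
 then obtain P where P: "\<And>j. P j \<in> V" "\<And>j f. f \<in> V ==> h t (P j) f = dz j (\<lambda>s. h s (u j) f) t"
  by blast
 define p where "p = (\<lambda>x. \<Oplus>j. 1 * P j x)"
 have zero: "(\<lambda>x. 0) \<in> V" by (rule cspan_zero)
 have p: "p \<in> V" "\<And>f. f \<in> V ==> h t p f = (\<Oplus>j. h t (P j) f)"
  unfolding p_def using Esum[of UNIV P _ "\<lambda>_. 1", OF P(1) zero] zero by simp_all
 have p2: "h t f p = (\<Oplus>j. h t f (P j))" if "f \<in> V" for f
  unfolding p_def using Esum2[of UNIV P f "\<lambda>_. 1", OF P(1) zero that] by simp
 have cf: "h t (chern_curvature U V h j l (\<lambda>_. u j) t) (u l)
   = h t (P j) (P l) - dzb l (dz j (\<lambda>s. h s (u j) (u l))) t" for j l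
  by (rule curvature_form[OF t u u P(1) P(1) P(2) P(2)])
 show thesis
 proof (rule that[OF p(1)])
  show "h t p f = (\<Oplus>j. dz j (\<lambda>s. h s (u j) f) t)" if "f \<in> V" for f
   using p(2)[OF that] P(2)[OF that] by simp
  show "(\<Oplus>j l. h t (chern_curvature U V h j l (\<lambda>_. u j) t) (u l))
   = h t p p - (\<Oplus>j l. dzb l (dz j (\<lambda>s. h s (u j) (u l))) t)"
   unfolding p(2)[OF p(1)] p2[OF P(1)] cf sum_subtractf ..
 qed
qed

end

section \<open>Circular families\<close>

lemma has_d2_exp: "has_d2 (\<lambda>s. exp (of_real s * h :: complex)) h (h^2)"
 unfolding has_d2_defs
proof (intro exI[of _ 1] exI[of _ "\<lambda>s. h * exp (of_real s * h)"] conjI allI impI)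
 have d: "((\<lambda>s. exp (of_real s * h)) has_vector_derivative h * exp (of_real s * h)) (at s)" for s
 proof -
  have "((\<lambda>z. exp (z * h)) has_field_derivative h * exp (of_real s * h)) (at (of_real s))"
   by (auto intro!: derivative_eq_intros)
  then show ?thesis by (rule has_vector_derivative_real_field)
 qed
 then show "((\<lambda>s. exp (of_real s * h)) has_vector_derivative h * exp (of_real s * h)) (at s)" for s .
 show "((\<lambda>s. h * exp (of_real s * h)) has_vector_derivative h^2) (at 0)"
  using has_vector_derivative_mult_right[OF d[of 0], of h] by (simp add: power2_eq_square)
qed simp_all

lemma has_d2_exp_cmult_vec: "has_d2 (\<lambda>s. exp (of_real s * h) *s (x + s *R y)) (y + h *s x) ((2 * h) *s y + (h^2) *s (x :: complex^'m))"
proof -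
 have "2 *R (h *s y) = (2 * h) *s y" by (simp add: vec_eq_iff complex_eq_iff)
 then show ?thesis using has_d2_bilinear[OF bounded_bilinear_cmult_vec has_d2_exp[of h] has_d2_affine[of x y]] by simp
qed

lemma exp_of_real_cmult_vec: "exp (complex_of_real s) *s z = exp s *R (z :: complex^'m)"
 by (simp only: exp_of_real scaleR_vec)

lemma integral_less_0:
 fixes f :: "real => real"
 assumes "continuous_on {a..b} f" "a < b" "\<And>x. x \<in> {a..b} ==> f x \<le> 0" "c \<in> {a..b}" "f c < 0"
 shows "integral {a..b} f < 0"
proof -
 have "integral {a..b} (\<lambda>x. - f x) \<noteq> 0"
 proof
  assume *: "integral {a..b} (\<lambda>x. - f x) = 0"
  have "continuous_on {a..b} (\<lambda>x. - f x)" by (intro continuous_on_minus assms)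
  then have "\<forall>x\<in>{a..b}. - f x = 0" using integral_eq_0_iff[of a b "\<lambda>x. - f x"] assms(2,3) * by simp
  then show False using assms(4,5) by force
 qed
 moreover have "integral {a..b} f \<le> integral {a..b} (\<lambda>x. 0)"
  by (rule integral_le) (use assms in \<open>auto intro: integrable_continuous_interval\<close>)
 ultimately show ?thesis by simp
qed

lemma fiber_closure:
 assumes N: "closure_nbhd U \<Omega> N" and "t \<in> U" "z \<in> closure (fiber \<Omega> t)" shows "(t, z) \<in> N"
proof -
 have "Pair t ` closure (fiber \<Omega> t) \<subseteq> closure (Pair t ` fiber \<Omega> t)"
  by (rule image_closure_subset[OF _ closed_closure closure_subset]) (intro continuous_intros)
 then have "(t, z) \<in> closure (Pair t ` fiber \<Omega> t)" using assms by auto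
 moreover have "Pair t ` fiber \<Omega> t \<subseteq> \<Omega>" by (auto simp: fiber_def)
 ultimately have "(t, z) \<in> closure \<Omega>" using closure_mono by blast
 then show ?thesis using N assms by (auto simp: closure_nbhd_def)
qed

locale circular_family =
 fixes U :: "(complex^'n) set" and \<Omega> N :: "((complex^'n) \<times> (complex^'m)) set"
  and \<rho> :: "(complex^'n) \<times> (complex^'m) => real"
 assumes U: "open U" and \<Omega>: "open \<Omega>"
  and N: "closure_nbhd U \<Omega> N" and \<rho>2: "Ck_on 2 \<rho> N" and psh: "plurisubharmonic_on N \<rho>"
  and neg: "x \<in> \<Omega> ==> x \<in> N \<and> \<rho> x < 0" and nonneg: "x \<in> N ==> x \<notin> \<Omega> ==> 0 \<le> \<rho> x"
  and bdd: "t \<in> U ==> bounded (fiber \<Omega> t)"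
  and con: "t \<in> U ==> connected (fiber \<Omega> t)"
  and circ: "t \<in> U ==> circular (fiber \<Omega> t)"
  and zero: "t \<in> U ==> 0 \<in> fiber \<Omega> t"
begin

abbreviation "D \<equiv> fiber \<Omega>"

lemma openN: "open N" using N by (simp add: closure_nbhd_def)

lemma mem_D: "z \<in> D t \<longleftrightarrow> (t, z) \<in> \<Omega>" by (simp add: fiber_def)

lemma openD: "open (D t)"
proof -
 have "D t = Pair t -` \<Omega>" by (auto simp: fiber_def)
 moreover have "continuous_on UNIV (Pair t)" by (intro continuous_intros)
 ultimately show ?thesis using open_vimage[OF \<Omega>] by metis
qed

lemma closure_D: "t \<in> U ==> z \<in> closure (D t) ==> (t, z) \<in> N"
 by (rule fiber_closure[OF N])

lemma rot: "t \<in> U ==> norm c = 1 ==> z \<in> D t ==> c *s z \<in> D t"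
proof -
 assume *: "t \<in> U" "norm c = 1" "z \<in> D t"
 have "c = cis (Arg c)" using *(2) cis_Arg[of c] by (cases "c = 0") (auto simp: sgn_div_norm)
 moreover have "cis (Arg c) *s z \<in> D t" using circ[OF *(1)] *(3) unfolding circular_def by blast
 ultimately show ?thesis by simp
qed

lemma cont_\<rho>: "continuous_on N \<rho>" using psh by (simp add: plurisubharmonic_on_def)

lemma \<rho>_closure:
 assumes t: "t \<in> U" and z: "z \<in> closure (D t)" shows "\<rho> (t, z) \<le> 0"
proof (rule continuous_le_on_closure[OF _ z])
 show "continuous_on (closure (D t)) (\<lambda>z. \<rho> (t, z))"
  by (rule continuous_on_compose2[OF cont_\<rho>]) (auto intro!: continuous_intros closure_D[OF t])
 show "\<rho> (t, z) \<le> 0" if "z \<in> D t" for z using neg[of "(t, z)"] that by (auto simp: fiber_def)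
qed

lemma disc_closure:
 assumes t: "t \<in> U" and cl: "\<And>c. norm c \<le> 1 ==> c *s z \<in> closure (D t)"
  and z: "z \<in> D t" and c: "norm c \<le> 1"
 shows "c *s z \<in> D t"
proof (rule ccontr)
 assume nc: "c *s z \<notin> D t"
 then have lt: "norm c < 1" using rot[OF t _ z, of c] c by force
 define r where "r = 1 - norm c"
 define v :: "(complex^'n) \<times> (complex^'m)" where "v = (0, of_real r *s z)"
 have pt: "(t, c *s z) + cscale y v = (t, (c + y * of_real r) *s z)" for y
  by (simp add: v_def cscale_def vec_eq_iff algebra_simps)
 have le1: "norm (c + y * of_real r) \<le> 1" if "norm y \<le> 1" for y
 proof -
  have "norm (y * of_real r) = norm y * r"
   using lt unfolding norm_mult norm_of_real by (simp add: r_def)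
  also have "\<dots> \<le> r" using that lt by (simp add: r_def mult_left_le_one_le)
  finally have "norm (y * of_real r) \<le> r" .
  then show ?thesis using norm_triangle_ineq[of c "y * of_real r"] by (simp add: r_def)
 qed
 have inN: "(t, c *s z) + cscale y v \<in> N" if "norm y \<le> 1" for y
  unfolding pt by (rule closure_D[OF t cl[OF le1[OF that]]])
 define I where "I = integral {0..2*pi} (\<lambda>q. \<rho> ((t, c *s z) + cscale (cis q) v))"
 have "\<rho> (t, c *s z) \<le> I / (2 * pi)"
  unfolding I_def
  by (rule psh[unfolded plurisubharmonic_on_def, THEN conjunct2, rule_format]) (use inN in simp)
 moreover have "0 \<le> \<rho> (t, c *s z)"
  by (rule nonneg[OF closure_D[OF t cl[OF c]]]) (use nc in \<open>simp add: mem_D\<close>)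
 moreover have "I < 0"
  unfolding I_def
 proof (rule integral_less_0[of _ _ _ "Arg2pi c"])
  show "continuous_on {0..2*pi} (\<lambda>q. \<rho> ((t, c *s z) + cscale (cis q) v))"
   by (rule continuous_on_compose2[OF cont_\<rho>])
    (use inN in \<open>auto intro!: continuous_intros bounded_bilinear.continuous_on[OF bounded_bilinear_cscale]\<close>)
  show "\<rho> ((t, c *s z) + cscale (cis q) v) \<le> 0" for q
   unfolding pt by (rule \<rho>_closure[OF t cl[OF le1]]) simp
  show "Arg2pi c \<in> {0..2*pi}" using Arg2pi[of c] by auto
  have ce: "c = of_real (norm c) * cis (Arg2pi c)"
   using Arg2pi[of c] by (simp add: is_Arg_def cis_conv_exp mult.commute)
  have "c + cis (Arg2pi c) * of_real r = of_real (norm c) * cis (Arg2pi c) + cis (Arg2pi c) * of_real r"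
   using ce by simp
  also have "\<dots> = cis (Arg2pi c)" by (simp add: r_def algebra_simps)
  finally have "(c + cis (Arg2pi c) * of_real r) *s z \<in> D t" using rot[OF t _ z, of "cis (Arg2pi c)"] by simp
  then show "\<rho> ((t, c *s z) + cscale (cis (Arg2pi c)) v) < 0" unfolding pt using neg mem_D by blast
 qed simp
 ultimately show False using divide_neg_pos[of I "2 * pi"] by simp
qed

lemma balanced:
 assumes t: "t \<in> U" and z: "z \<in> D t" and c: "norm c \<le> 1"
 shows "c *s z \<in> D t"
proof -
 define T where "T = {z. \<forall>c. norm c \<le> 1 \<longrightarrow> c *s z \<in> D t}"
 define T' where "T' = {z. \<exists>c. norm c \<le> 1 \<and> c *s z \<notin> closure (D t)}"
 have 1: "open T"
  unfolding open_contains_ball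
 proof
  fix z0 assume z0: "z0 \<in> T"
  have "compact ((\<lambda>c. c *s z0) ` cball 0 1)"
   by (intro compact_continuous_image bounded_bilinear.continuous_on[OF bounded_bilinear_cmult_vec] continuous_intros compact_cball)
  moreover have "(\<lambda>c. c *s z0) ` cball 0 1 \<subseteq> D t" using z0 by (auto simp: T_def)
  ultimately obtain e where e: "e > 0" "(\<Union>x\<in>(\<lambda>c. c *s z0) ` cball 0 1. ball x e) \<subseteq> D t"
   using compact_subset_open_imp_ball_epsilon_subset openD by metis
  have "ball z0 e \<subseteq> T"
  proof
   fix z assume "z \<in> ball z0 e"
   then have z: "norm (z0 - z) < e" by (simp add: dist_norm)
   show "z \<in> T" unfolding T_def
   proof (intro CollectI allI impI)
    fix c :: complex assume c: "norm c \<le> 1"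
    have "norm (c *s z0 - c *s z) = norm c * norm (z0 - z)"
     by (simp add: vector_sub_rdistrib flip: norm_cmult_vec)
    also have "\<dots> \<le> norm (z0 - z)" using c by (simp add: mult_left_le_one_le)
    finally have "c *s z \<in> ball (c *s z0) e" using z by (simp add: dist_norm)
    moreover have "c *s z0 \<in> (\<lambda>c. c *s z0) ` cball 0 1" using c by auto
    ultimately show "c *s z \<in> D t" using e(2) by blast
   qed
  qed
  then show "\<exists>e>0. ball z0 e \<subseteq> T" using e(1) by blast
 qed
 have 2: "open T'"
 proof -
  have "T' = (\<Union>c\<in>cball 0 1. (\<lambda>z. c *s z) -` (- closure (D t)))" by (auto simp: T'_def)
  moreover have "open ((\<lambda>z. c *s z) -` (- closure (D t)))" for c
   by (intro open_vimage) (auto intro!: bounded_bilinear.continuous_on[OF bounded_bilinear_cmult_vec] continuous_intros)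
  ultimately show ?thesis by auto
 qed
 have "T \<inter> T' \<inter> D t = {}" using closure_subset[of "D t"] by (auto simp: T_def T'_def)
 moreover have "D t \<subseteq> T \<union> T'" using disc_closure[OF t] by (auto simp: T_def T'_def)
 moreover have "0 \<in> T \<inter> D t" using zero[OF t] by (simp add: T_def)
 ultimately have "T' \<inter> D t = {}" using connectedD[OF con[OF t] 1 2] by blast
 then show ?thesis using \<open>D t \<subseteq> T \<union> T'\<close> z c by (auto simp: T_def)
qed

definition Rad :: "complex^'n => complex^'m => real" where
 "Rad t x = Sup {\<tau>. 0 \<le> \<tau> \<and> \<tau> *R x \<in> D t}"

lemma balanced_real: "t \<in> U ==> z \<in> D t ==> 0 \<le> r ==> r \<le> 1 ==> r *R z \<in> D t"
 using balanced[of t z "of_real r"] by (simp add: scaleR_vec)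

lemma
 assumes t: "t \<in> U" and x: "x \<noteq> 0"
 shows Rad_pos: "0 < Rad t x" and Rad_iff: "0 \<le> u ==> u *R x \<in> D t \<longleftrightarrow> u < Rad t x"
proof -
 define S where "S = {u. 0 \<le> u \<and> u *R x \<in> D t}"
 obtain b where b: "\<And>z. z \<in> D t ==> norm z \<le> b" using bdd[OF t] by (auto simp: bounded_iff)
 have "u \<le> b / norm x" if "u \<in> S" for u
  using that b[of "u *R x"] x by (auto simp: S_def field_simps)
 then have bA: "bdd_above S" by (auto simp: bdd_above_def)
 have S0: "0 \<in> S" using zero[OF t] by (simp add: S_def)
 have up: "\<exists>u'\<in>S. u < u'" if "u \<in> S" for u
 proof -
  have op: "open ((\<lambda>u. u *R x) -` D t)" by (intro open_vimage openD continuous_intros)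
  have "u \<in> (\<lambda>u. u *R x) -` D t" using that by (simp add: S_def)
  then obtain e where e: "e > 0" "ball u e \<subseteq> (\<lambda>u. u *R x) -` D t"
   using op open_contains_ball by blast
  have "u + e / 2 \<in> ball u e" using e(1) by (simp add: dist_real_def)
  then have "u + e / 2 \<in> S" using e that by (auto simp: S_def)
  then show ?thesis using e(1) by (intro bexI[of _ "u + e / 2"]) auto
 qed
 have R: "Rad t x = Sup S" by (simp add: Rad_def S_def)
 have lt: "u < Rad t x" if u: "u \<in> S" for u
 proof -
  obtain u' where "u' \<in> S" "u < u'" using up[OF u] by blast
  then show ?thesis using cSup_upper[OF _ bA] unfolding R by (meson less_le_trans)
 qed
 show "0 < Rad t x" by (rule lt[OF S0])
 assume u: "0 \<le> u"
 show "u *R x \<in> D t \<longleftrightarrow> u < Rad t x"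
 proof
  show "u < Rad t x" if "u *R x \<in> D t" using that u by (intro lt) (simp add: S_def)
  assume "u < Rad t x"
  then obtain u' where u': "u' \<in> S" "u < u'" using less_cSup_iff[OF _ bA, of u] S0 unfolding R by auto
  have "u' *R x \<in> D t" using u' by (simp add: S_def)
  then have "(u / u') *R u' *R x \<in> D t"
   by (rule balanced_real[OF t]) (use u' u in auto)
  then show "u *R x \<in> D t" using u' u by simp
 qed
qed

lemma Rad_cmult:
 assumes t: "t \<in> U" and x: "x \<noteq> 0" and c: "c \<noteq> 0"
 shows "Rad t (c *s x) = Rad t x / norm c"
proof -
 have cx: "c *s x \<noteq> 0" using c x by (auto simp: vec_eq_iff)
 have *: "v < Rad t (c *s x) \<longleftrightarrow> v * norm c < Rad t x" if v: "0 \<le> v" for v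
 proof -
  define u where "u = c / of_real (norm c)"
  have u: "norm u = 1" "norm (inverse u) = 1" using c by (auto simp: u_def norm_divide norm_inverse)
  have e: "v *R (c *s x) = u *s ((v * norm c) *R x)"
   using c by (simp only: scaleR_vec vector_smult_assoc) (simp add: u_def)
  have "u \<noteq> 0" using u by auto
  then have e': "inverse u *s (u *s y) = y" for y by (simp add: vector_smult_assoc)
  have "u *s ((v * norm c) *R x) \<in> D t \<longleftrightarrow> (v * norm c) *R x \<in> D t"
   using rot[OF t u(1)] rot[OF t u(2)] e' by metis
  then show ?thesis using Rad_iff[OF t cx v] Rad_iff[OF t x, of "v * norm c"] v e by simp
 qed
 have p: "0 < Rad t (c *s x)" "0 < Rad t x / norm c"
  using Rad_pos[OF t cx] Rad_pos[OF t x] c by auto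
 show ?thesis
 proof (rule antisym; rule ccontr)
  assume "\<not> Rad t (c *s x) \<le> Rad t x / norm c"
  then show False using *[of "Rad t x / norm c"] p c by simp
 next
  assume "\<not> Rad t x / norm c \<le> Rad t (c *s x)"
  then have "Rad t (c *s x) * norm c < Rad t x" using c by (simp add: field_simps)
  then show False using *[of "Rad t (c *s x)"] p by simp
 qed
qed

lemma
 assumes t: "t \<in> U" and x: "x \<noteq> 0"
 shows bd_closure: "Rad t x *R x \<in> closure (D t)" and bd_not: "Rad t x *R x \<notin> D t"
  and bd_zero: "\<rho> (t, Rad t x *R x) = 0"
proof -
 show n: "Rad t x *R x \<notin> D t" using Rad_iff[OF t x, of "Rad t x"] Rad_pos[OF t x] by simp
 show c: "Rad t x *R x \<in> closure (D t)"
 proof -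
  have "(\<lambda>u. u *R x) ` closure {0<..<Rad t x} \<subseteq> closure (D t)"
   by (rule image_closure_subset[OF _ closed_closure])
    (use Rad_iff[OF t x] closure_subset in \<open>auto intro!: continuous_intros subsetD[OF closure_subset]\<close>)
  moreover have "Rad t x \<in> closure {0<..<Rad t x}" using Rad_pos[OF t x] by simp
  ultimately show ?thesis by blast
 qed
 show "\<rho> (t, Rad t x *R x) = 0"
  using \<rho>_closure[OF t c] nonneg[OF closure_D[OF t c]] n by (simp add: mem_D)
qed

lemma closure_disc:
 assumes t: "t \<in> U" and x: "x \<noteq> 0" and c: "norm c \<le> Rad t x" shows "c *s x \<in> closure (D t)"
  and "norm c < Rad t x ==> c *s x \<in> D t"
proof -
 have p: "0 < Rad t x" by (rule Rad_pos[OF t x])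
 show lt: "c *s x \<in> D t" if lt: "norm c < Rad t x" for c
 proof (cases "c = 0")
  case True then show ?thesis using zero[OF t] by simp
 next
  case False
  have "c *s x \<noteq> 0" using False x by (auto simp: vec_eq_iff)
  then show ?thesis
   using Rad_iff[OF t \<open>c *s x \<noteq> 0\<close>, of 1] Rad_cmult[OF t x False] lt False by (simp add: field_simps)
 qed
 show "c *s x \<in> closure (D t)"
 proof -
  have "(\<lambda>u. (of_real u * c) *s x) ` closure {0<..<1} \<subseteq> closure (D t)"
  proof (rule image_closure_subset[OF _ closed_closure])
   show "continuous_on (closure {0<..<1}) (\<lambda>u. (of_real u * c) *s x)"
    by (intro bounded_bilinear.continuous_on[OF bounded_bilinear_cmult_vec] continuous_intros)
   show "(\<lambda>u. (of_real u * c) *s x) ` {0<..<1} \<subseteq> closure (D t)"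
   proof clarsimp
    fix u :: real assume u: "0 < u" "u < 1"
    have "u * norm c < Rad t x"
    proof (cases "c = 0")
     case False
     then have "u * norm c < 1 * norm c" using u by (intro mult_strict_right_mono) auto
     then show ?thesis using c by simp
    qed (use p in simp)
    then show "(of_real u * c) *s x \<in> closure (D t)"
     using lt[of "of_real u * c"] u closure_subset by (force simp: norm_mult)
   qed
  qed
  moreover have "(1::real) \<in> closure {0<..<1}" by simp
  ultimately have "(of_real 1 * c) *s x \<in> closure (D t)" by blast
  then show ?thesis by simp
 qed
qed

lemma has_d2_circle_radius:
 "has_d2 (\<lambda>s. (t, exp (of_real s * h) *s z)) (0, h *s z) (0, h^2 *s (z :: complex^'m))"
 using has_d2_Pair[OF has_d2_affine[of t 0] has_d2_exp_cmult_vec[of h z 0]] by simp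

text \<open>Hopf's lemma: the maximum principle on the annulus \<open>1/e \<le> |w| \<le> 1\<close> compares \<open>\<rho>\<close> with
 a multiple of the harmonic function \<open>ln |w|\<close>; the term \<open>\<delta> (ln |w|)^2\<close> makes the comparison strict.\<close>

lemma barrier:
 assumes t: "t \<in> U" and x: "x \<noteq> 0"
 obtains \<epsilon> where "\<epsilon> > 0" "\<And>\<sigma>. -1 \<le> \<sigma> ==> \<sigma> \<le> 0 ==> \<rho> (t, exp \<sigma> *R Rad t x *R x) \<le> \<epsilon> * \<sigma>"
proof -
 define z where "z = Rad t x *R x"
 have p: "0 < Rad t x" by (rule Rad_pos[OF t x])
 have z0: "z \<noteq> 0" using p x by (simp add: z_def)
 have Rz: "Rad t z = 1" using Rad_cmult[OF t x, of "of_real (Rad t x)"] p by (simp add: z_def scaleR_vec)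
 have cl: "w *s z \<in> closure (D t)" "norm w < 1 ==> w *s z \<in> D t" if "norm w \<le> 1" for w
  using closure_disc[OF t z0] Rz that by auto
 have inN: "(t, w *s z) \<in> N" if "norm w \<le> 1" for w by (rule closure_D[OF t cl(1)[OF that]])
 have b0: "\<rho> (t, w *s z) = 0" if "norm w = 1" for w
 proof -
  have "w *s z \<noteq> 0" using z0 that by (auto simp: vec_eq_iff)
  moreover have "Rad t (w *s z) = 1" using Rad_cmult[OF t z0, of w] Rz that by (cases "w = 0") auto
  ultimately show ?thesis using bd_zero[OF t, of "w *s z"] by simp
 qed
 have cont: "continuous_on (cball 0 1) (\<lambda>w. \<rho> (t, w *s z))"
  by (rule continuous_on_compose2[OF cont_\<rho>])
   (use inN in \<open>auto intro!: continuous_intros bounded_bilinear.continuous_on[OF bounded_bilinear_cmult_vec]\<close>)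
 define C where "C = {w :: complex. norm w = exp (-1)}"
 have C: "compact C" "C \<noteq> {}" "C \<subseteq> cball 0 1"
 proof -
  have "C = sphere 0 (exp (-1))" by (auto simp: C_def)
  then show "compact C" "C \<noteq> {}" by auto
  show "C \<subseteq> cball 0 1" by (auto simp: C_def)
 qed
 obtain w1 where w1: "w1 \<in> C" "\<And>w. w \<in> C ==> \<rho> (t, w *s z) \<le> \<rho> (t, w1 *s z)"
  using continuous_attains_sup[OF C(1,2) continuous_on_subset[OF cont C(3)]] by blast
 define c0 where "c0 = - \<rho> (t, w1 *s z)"
 have c0: "c0 > 0"
 proof -
  have "norm w1 = exp (-1)" using w1(1) by (simp add: C_def)
  then have "w1 *s z \<in> D t" by (intro cl(2)) simp_all
  then show ?thesis using neg mem_D unfolding c0_def by force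
 qed
 define \<epsilon> where "\<epsilon> = c0 / 2"
 define A where "A = {w :: complex. exp (-1) \<le> norm w \<and> norm w \<le> 1}"
 have A: "compact A" "1 \<in> A" "A \<subseteq> cball 0 1"
 proof -
  have "A = cball 0 1 \<inter> {w. exp (-1) \<le> norm w}" by (auto simp: A_def)
  moreover have "closed {w :: complex. exp (-1) \<le> norm w}" by (intro closed_Collect_le continuous_intros)
  ultimately show "compact A" by auto
  show "1 \<in> A" "A \<subseteq> cball 0 1" by (auto simp: A_def)
 qed
 have An: "0 < norm w" if "w \<in> A" for w using that by (auto simp: A_def intro: less_le_trans[of _ "exp (-1)"])
 have main: "\<rho> (t, w *s z) \<le> \<epsilon> * ln (norm w) - k * (ln (norm w))^2"
  if k: "0 < k" "k \<le> c0 / 2" and w: "w \<in> A" for k w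
 proof -
  define v where "v = (\<lambda>w. \<rho> (t, w *s z) - \<epsilon> * ln (norm w) + k * (ln (norm w))^2)"
  have "continuous_on A v" unfolding v_def
   by (intro continuous_intros continuous_on_subset[OF cont A(3)]) (use An in fastforce)+
  then obtain w0 where w0: "w0 \<in> A" "\<And>w. w \<in> A ==> v w \<le> v w0"
   using continuous_attains_sup[OF A(1)] A(2) by blast
  have "v w0 \<le> 0"
  proof -
   consider "norm w0 = 1" | "norm w0 = exp (-1)" | "exp (-1) < norm w0" "norm w0 < 1"
    using w0(1) unfolding A_def by fastforce
   then show ?thesis
   proof cases
    case 1
    then show ?thesis using b0[of w0] by (simp add: v_def)
   next
    case 2
    then have "\<rho> (t, w0 *s z) \<le> - c0" using w1(2)[of w0] by (simp add: C_def c0_def)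
    then show ?thesis using 2 k by (simp add: v_def \<epsilon>_def)
   next
    case 3
    define y where "y = w0 *s z"
    have inN': "(t, exp (of_real 0 * 1) *s y) \<in> N" "(t, exp (of_real 0 * \<i>) *s y) \<in> N" "(t, y) \<in> N"
     using inN[of w0] 3 by (simp_all add: y_def)
    have c1: "has_d2 (\<lambda>s. (t, exp (of_real s * 1) *s y)) (0, y) (0, y)"
     using has_d2_circle_radius[of t 1 y] by simp
    have i: "cscale \<i> (0 :: complex^'n, y) = (0, \<i> *s y)" "- (0 :: complex^'n, y) = (0, (\<i>^2) *s y)" by (simp_all add: cscale_def vec_eq_iff)
    have c2: "has_d2 (\<lambda>s. (t, exp (of_real s * \<i>) *s y)) (cscale \<i> (0, y)) (- (0, y))"
     unfolding i by (rule has_d2_circle_radius)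
    obtain d d' where d: "has_d2 (\<lambda>s. \<rho> (t, exp (of_real s * 1) *s y)) (dd (0, y) \<rho> (t, y)) d"
     "has_d2 (\<lambda>s. \<rho> (t, exp (of_real s * \<i>) *s y)) (dd (cscale \<i> (0, y)) \<rho> (t, y)) d'"
     "d + d' = 4 * Lev \<rho> (t, y) (0, y)"
     using Lev_curve[OF openN \<rho>2 c1 c2 _ _ inN'(3)] by auto
    have n0: "w0 \<noteq> 0" using An[OF w0(1)] by auto
    define \<sigma> where "\<sigma> = ln (norm w0)"
    define a where "a = min (1 + \<sigma>) (- \<sigma>)"
    have "-1 < \<sigma>" "\<sigma> < 0" unfolding \<sigma>_def using 3 An[OF w0(1)] ln_less_cancel_iff[of "exp (-1)" "norm w0"]
     by auto
    then have a: "a > 0" by (simp add: a_def)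
    have A1: "exp (of_real s) * w0 \<in> A" if "\<bar>s\<bar> < a" for s :: real
    proof -
     have "norm (exp (of_real s) * w0) = exp (s + \<sigma>)"
      using An[OF w0(1)] by (simp add: norm_mult exp_add \<sigma>_def flip: exp_of_real)
     then show ?thesis using that by (auto simp: A_def a_def)
    qed
    have A2: "exp (of_real s * \<i>) * w0 \<in> A" for s :: real
     using w0(1) by (simp add: A_def norm_mult)
    have l1: "ln (norm (exp (of_real s) * w0)) = \<sigma> + s" for s :: real
     using n0 by (simp add: norm_mult ln_mult \<sigma>_def)
    have l2: "ln (norm (exp (of_real s * \<i>) * w0)) = \<sigma>" for s :: real
     by (simp add: norm_mult \<sigma>_def)
    define P where "P = (\<lambda>s. \<epsilon> * (\<sigma> + s) - k * (\<sigma> + s)^2)"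
    have P: "has_d2 P (\<epsilon> - 2 * k * \<sigma>) (- 2 * k)"
     unfolding has_d2_defs P_def
     by (intro exI[of _ 1] exI[of _ "\<lambda>s. \<epsilon> - 2 * k * (\<sigma> + s)"])
      (auto intro!: derivative_eq_intros simp: has_real_derivative_iff_has_vector_derivative[symmetric])
    have neg1: "has_d2 (\<lambda>s. -1 * f s) (- b) (- e)" if "has_d2 f b e" for f b and e :: real
     using has_d2_bilinear[OF bounded_bilinear_mult has_d2_affine[of "-1" "0::real"] that] by simp
    have e1: "exp (of_real s * 1) *s y = (exp (of_real s) * w0) *s z" for s :: real
     by (simp add: y_def vec_eq_iff)
    have e2: "exp (of_real s * \<i>) *s y = (exp (of_real s * \<i>) * w0) *s z" for s :: real
     by (simp add: y_def vec_eq_iff)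
    have "0 \<le> - 2 * k + - d"
    proof (rule has_d2_local_min(2)[OF has_d2_add[OF P neg1[OF d(1)]] a])
     fix s :: real assume "\<bar>s\<bar> < a"
     from w0(2)[OF A1[OF this]] show "P 0 + - 1 * \<rho> (t, exp (of_real 0 * 1) *s y) \<le> P s + - 1 * \<rho> (t, exp (of_real s * 1) *s y)"
      unfolding v_def l1 e1 P_def by (simp flip: \<sigma>_def)
    qed
    moreover have "0 \<le> - d'"
    proof (rule has_d2_local_min(2)[OF neg1[OF d(2)] a])
     fix s :: real
     from w0(2)[OF A2[of s]] show "- 1 * \<rho> (t, exp (of_real 0 * \<i>) *s y) \<le> - 1 * \<rho> (t, exp (of_real s * \<i>) *s y)"
      unfolding v_def l2 e2 by (simp flip: \<sigma>_def)
    qed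
    moreover have "0 \<le> Lev \<rho> (t, y) (0, y)" by (rule Lev_nonneg_of_psh[OF openN \<rho>2 psh inN'(3)])
    ultimately show ?thesis using d(3) k by linarith
   qed
  qed
  then have "v w \<le> 0" using w0(2)[OF w] by linarith
  then show ?thesis by (simp add: v_def)
 qed
 show thesis
 proof (rule that[of \<epsilon>])
  show "\<epsilon> > 0" using c0 by (simp add: \<epsilon>_def)
  fix \<sigma> :: real assume \<sigma>: "-1 \<le> \<sigma>" "\<sigma> \<le> 0"
  have w: "exp (of_real \<sigma>) \<in> A" using \<sigma> by (simp add: A_def)
  have "\<rho> (t, exp \<sigma> *R z) \<le> \<epsilon> * \<sigma> - k * \<sigma>^2" if "0 < k" "k \<le> c0 / 2" for k
   using main[OF that w] unfolding exp_of_real_cmult_vec by simp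
  then have "\<rho> (t, exp \<sigma> *R z) \<le> \<epsilon> * \<sigma>" by (rule order_trans[of _ "\<epsilon> * \<sigma> - (c0/2) * \<sigma>^2"]) (use c0 in auto)
  then show "\<rho> (t, exp \<sigma> *R Rad t x *R x) \<le> \<epsilon> * \<sigma>" by (simp add: z_def)
 qed
qed

lemma hopf:
 assumes t: "t \<in> U" and x: "x \<noteq> 0"
 shows "0 < dd (0, Rad t x *R x) \<rho> (t, Rad t x *R x)"
proof -
 define z where "z = Rad t x *R x"
 obtain E where e: "E > 0" "\<And>s. -1 \<le> s ==> s \<le> 0 ==> \<rho> (t, exp s *R z) \<le> E * s"
  using barrier[OF t x] unfolding z_def by blast
 have zN: "(t, z) \<in> N" unfolding z_def by (rule closure_D[OF t bd_closure[OF t x]])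
 define d where "d = dd (0, z) \<rho> (t, z)"
 note C2 = Ck_2[OF \<rho>2]
 have g: "((\<lambda>s. (t, exp s *R z)) has_derivative (\<lambda>h. (0, h *R z))) (at 0)"
  by (auto intro!: derivative_eq_intros)
 have D: "(\<rho> has_derivative frechet_derivative \<rho> (at (t, z))) (at (t, exp 0 *R z))"
  using Ck_deriv[OF openN C2 zN] by simp
 have "((\<lambda>s. \<rho> (t, exp s *R z)) has_derivative (\<lambda>h. dd (0, h *R z) \<rho> (t, z))) (at 0)"
  using has_derivative_compose[OF g D] .
 moreover have "dd (0, h *R z) \<rho> (t, z) = d * h" for h
  using linear_scale[OF dd_linear[OF openN C2 zN], of h "(0, z)"] by (simp add: d_def)
 ultimately have d: "((\<lambda>s. \<rho> (t, exp s *R z)) has_real_derivative d) (at 0)"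
  by (simp add: has_field_derivative_def)
 have "E \<le> d"
 proof (rule tendsto_lowerbound)
  have "((\<lambda>s. (\<rho> (t, exp s *R z) - \<rho> (t, exp 0 *R z)) / (s - 0)) \<longlongrightarrow> d) (at 0)"
   using d unfolding has_field_derivative_iff .
  then show "((\<lambda>s. \<rho> (t, exp s *R z) / s) \<longlongrightarrow> d) (at_left 0)"
   using bd_zero[OF t x] by (simp add: z_def) (rule tendsto_within_subset, assumption, simp)
  have "eventually (\<lambda>s. s \<in> {-1<..<0}) (at_left (0::real))" by (rule eventually_at_left_real) simp
  then show "eventually (\<lambda>s. E \<le> \<rho> (t, exp s *R z) / s) (at_left 0)"
  proof eventually_elim
   case (elim s)
   then show ?case using e(2)[of s] by (simp add: neg_le_divide_eq)
  qed
 qed simp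
 then show ?thesis using e(1) by (simp add: d_def z_def)
qed

end

lemma has_d2_cong:
 assumes "has_d2 c v a" "e0 > 0" "\<And>s. \<bar>s\<bar> < e0 ==> c s = c' s"
 shows "has_d2 c' v a"
proof -
 obtain e c1 where "d2_on e c c1 v a" using assms(1) has_d2_def by blast
 note c = d2_onD[OF this]
 have "(c' has_vector_derivative c1 s) (at s)" if "\<bar>s\<bar> < min e e0" for s
  by (rule has_vector_derivative_transform_within_open[of c _ _ "{-e0<..<e0}"]) (use c(2)[of s] that assms(3) in auto)
 then show ?thesis unfolding has_d2_defs using c assms(2) by (intro exI[of _ "min e e0"] exI[of _ c1]) auto
qed

lemma has_d2_cmult: "has_d2 f v a ==> has_d2 (\<lambda>s. c * f s :: real) (c * v) (c * a)"
 using has_d2_bilinear[OF bounded_bilinear_mult has_d2_affine[of c "0::real"]] by simp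

lemma has_d2_exp_compose:
 assumes "has_d2 f v a" shows "has_d2 (\<lambda>s. exp (f s) :: real) (exp (f 0) * v) (exp (f 0) * (v^2 + a))"
proof -
 have e: "dd w (exp :: real => real) x = w * exp x" for w x
  by (rule dd_eq[of exp "\<lambda>w. w * exp x"]) (auto intro!: derivative_eq_intros)
 have e2: "dd w (\<lambda>x. w' * exp x :: real) x = w * (w' * exp x)" for w w' x
  by (rule dd_eq[of _ "\<lambda>w. w * (w' * exp x)"]) (auto intro!: derivative_eq_intros)
 show ?thesis
  using has_d2_compose[OF assms open_UNIV Ck_exp[OF open_UNIV], simplified]
  by (simp add: e e2 power2_eq_square algebra_simps)
qed

lemma nonzero_norm_cis_scale: "cis q *s (x :: complex^'m) = 0 \<longleftrightarrow> x = 0"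
 by (auto simp: vec_eq_iff)

context circular_family
begin

definition X :: "((complex^'n) \<times> (complex^'m)) set" where "X = U \<times> (-{0})"

lemma openX: "open X" unfolding X_def by (intro open_Times U) auto

definition Rd :: "(complex^'n) \<times> (complex^'m) => real" where "Rd p = Rad (fst p) (snd p)"

lemma XD: "p \<in> X ==> fst p \<in> U \<and> snd p \<noteq> 0" by (auto simp: X_def)

lemma Rd_pos: "p \<in> X ==> 0 < Rd p" using XD[of p] Rad_pos by (simp add: Rd_def)

lemma C2\<rho>: "Ck_on (Suc (Suc 0)) \<rho> N" using \<rho>2 by (simp only: numeral_2_eq_2)

lemma ray_derivative:
 assumes "(t, u *R x) \<in> N"
 shows "((\<lambda>u. \<rho> (t, u *R x)) has_real_derivative dd (0, x) \<rho> (t, u *R x)) (at u)"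
 using dd_line_derivative[OF openN C2\<rho>, of "(t, 0)" u "(0, x)"] assms by simp

lemma bdN: "p \<in> X ==> (fst p, Rd p *R snd p) \<in> N"
 using XD[of p] closure_D bd_closure by (simp add: Rd_def)

lemma hopf': "p \<in> X ==> 0 < dd (0, snd p) \<rho> (fst p, Rd p *R snd p)"
 using hopf[of "fst p" "snd p"] XD[of p] Rd_pos[of p]
  linear_scale[OF dd_linear[OF openN C2\<rho> bdN], of p "Rd p" "(0, snd p)"]
 by (simp add: Rd_def[symmetric] zero_less_mult_iff)

lemma continuous_Rd: "continuous_on X Rd"
 unfolding continuous_on_def
proof (intro ballI order_tendstoI)
 fix p a assume p: "p \<in> X"
 have tx: "fst p \<in> U" "snd p \<noteq> 0" using XD[OF p] by auto
 have ev: "eventually (\<lambda>q. q \<in> X) (at p within X)" by (simp add: eventually_at_filter)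
 have cm: "((\<lambda>q. (fst q, \<tau> *R snd q)) \<longlongrightarrow> (fst p, \<tau> *R snd p)) (at p within X)" for \<tau>
  by (intro tendsto_intros)
 show "eventually (\<lambda>q. a < Rd q) (at p within X)" if "a < Rd p"
 proof -
  define a' where "a' = max a 0"
  have a': "0 \<le> a'" "a \<le> a'" "a' < Rd p" using that Rd_pos[OF p] by (auto simp: a'_def)
  have "(fst p, a' *R snd p) \<in> \<Omega>" using Rad_iff[OF tx a'(1)] a'(3) by (simp add: Rd_def mem_D)
  then have "eventually (\<lambda>q. (fst q, a' *R snd q) \<in> \<Omega>) (at p within X)" by (rule topological_tendstoD[OF cm \<Omega>])
  then show ?thesis using ev
  proof eventually_elim
   case (elim q)
   then show ?case using Rad_iff[of "fst q" "snd q" a'] XD[of q] a' by (auto simp: Rd_def mem_D)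
  qed
 qed
 show "eventually (\<lambda>q. Rd q < a) (at p within X)" if "Rd p < a"
 proof -
  obtain d where d: "d > 0" "\<And>h. 0 < h ==> h < d ==> 0 < \<rho> (fst p, (Rd p + h) *R snd p)"
   using DERIV_pos_inc_right[OF ray_derivative[OF bdN[OF p]] hopf'[OF p]] bd_zero[OF tx] by (auto simp: Rd_def)
  have "eventually (\<lambda>h. (fst p, (Rd p + h) *R snd p) \<in> N) (at_right 0)"
  proof (rule topological_tendstoD[OF _ openN bdN[OF p]])
   show "((\<lambda>h. (fst p, (Rd p + h) *R snd p)) \<longlongrightarrow> (fst p, Rd p *R snd p)) (at_right 0)"
    by (rule tendsto_eq_intros refl | simp)+
  qed
  moreover have "eventually (\<lambda>h. h \<in> {0<..<min d (a - Rd p)}) (at_right 0)"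
   by (rule eventually_at_right_real) (use d that in auto)
  ultimately have "eventually (\<lambda>h. (fst p, (Rd p + h) *R snd p) \<in> N \<and> h \<in> {0<..<min d (a - Rd p)}) (at_right (0::real))"
   by (rule eventually_conj)
  then obtain h where h: "(fst p, (Rd p + h) *R snd p) \<in> N" "0 < h" "h < d" "Rd p + h < a"
   using eventually_happens[of _ "at_right (0::real)"] by fastforce
  define \<tau> where "\<tau> = Rd p + h"
  have \<tau>: "0 \<le> \<tau>" using Rd_pos[OF p] h by (simp add: \<tau>_def)
  have "open {q \<in> N. 0 < \<rho> q}"
   using continuous_open_preimage[OF cont_\<rho> openN, of "{0<..}"] by (simp add: vimage_def Int_def)
  then have "eventually (\<lambda>q. (fst q, \<tau> *R snd q) \<in> {q \<in> N. 0 < \<rho> q}) (at p within X)"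
   by (rule topological_tendstoD[OF cm]) (use h d(2)[of h] in \<open>auto simp: \<tau>_def\<close>)
  then show ?thesis using ev
  proof eventually_elim
   case (elim q)
   then have "(fst q, \<tau> *R snd q) \<notin> \<Omega>" using neg by force
   then have "\<not> \<tau> < Rd q" using Rad_iff[of "fst q" "snd q" \<tau>] XD[of q] elim \<tau> by (auto simp: Rd_def mem_D)
   then show ?case using h(4) by (simp add: \<tau>_def)
  qed
 qed
qed

lemma Ck_scale: "Ck_on k (\<lambda>q :: ((complex^'n) \<times> (complex^'m)) \<times> real. (fst (fst q), snd q *R snd (fst q))) UNIV"
 by (intro Ck_Pair Ck_scaleR Ck_fst Ck_snd Ck_id open_UNIV)

lemma Ck_Rd: "Ck_on 2 Rd X"
proof -
 define g where "g = (\<lambda>q :: ((complex^'n) \<times> (complex^'m)) \<times> real. \<rho> (fst (fst q), snd q *R snd (fst q)))"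
 define T where "T = (\<lambda>q :: ((complex^'n) \<times> (complex^'m)) \<times> real. (fst (fst q), snd q *R snd (fst q))) -` N"
 have T: "open T" unfolding T_def
  by (rule open_vimage[OF openN]) (intro continuous_intros)
 have C: "Ck_on (Suc (Suc 0)) g T" unfolding g_def
  by (rule Ck_compose[OF T openN _ Ck_subset[OF Ck_scale] C2\<rho>]) (auto simp: T_def)
 have "Ck_on (Suc (Suc 0)) Rd X"
 proof (rule Ck_implicit[OF openX T C continuous_Rd], intro conjI)
  fix p assume p: "p \<in> X"
  have tx: "fst p \<in> U" "snd p \<noteq> 0" using XD[OF p] by auto
  show pT: "(p, Rd p) \<in> T" using bdN[OF p] by (simp add: T_def)
  show "g (p, Rd p) = 0" using bd_zero[OF tx] by (simp add: g_def Rd_def)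
  have "((\<lambda>t. g (p, t)) has_derivative (\<lambda>h. dd (0, h) g (p, Rd p))) (at (Rd p))"
   by (rule has_derivative_compose[of "\<lambda>t. (p, t)" "\<lambda>h. (0, h)" _ _ g, OF _ Ck_deriv[OF T C pT]])
    (auto intro!: derivative_eq_intros)
  moreover have "((\<lambda>t. g (p, t)) has_derivative (\<lambda>h. dd (0, snd p) \<rho> (fst p, Rd p *R snd p) * h)) (at (Rd p))"
   using ray_derivative[OF bdN[OF p]] unfolding g_def has_field_derivative_def by simp
  ultimately have "(\<lambda>h. dd (0, h) g (p, Rd p)) = (\<lambda>h. dd (0, snd p) \<rho> (fst p, Rd p *R snd p) * h)"
   by (rule has_derivative_unique)
  then have "dd (0, 1) g (p, Rd p) = dd (0, snd p) \<rho> (fst p, Rd p *R snd p) * 1" by (rule fun_cong)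
  then show "dd (0, 1) g (p, Rd p) \<noteq> 0" using hopf'[OF p] by simp
 qed
 then show ?thesis by (simp only: numeral_2_eq_2)
qed

definition S :: "(complex^'n) \<times> (complex^'m) => real" where "S p = ln (Rd p)"

lemma Ck_S: "Ck_on 2 S X" unfolding S_def by (rule Ck_ln_compose[OF openX Ck_Rd Rd_pos])

text \<open>A curve along the boundary, up to the factor \<open>Rd p\<close>: the modulus of the factor is dictated by
 the radial function, its argument is free.\<close>

definition bcurve where
 "bcurve p W b s = (Rd (p + s *R W) / Rd p) *R (cis (s * b) *s (snd p + s *R snd W))"

lemma line_in_X:
 assumes "p \<in> X" obtains e where "e > 0" "\<And>s. \<bar>s\<bar> < e ==> p + s *R W \<in> X"
proof -
 have "open ((\<lambda>s. p + s *R W) -` X)" by (rule open_vimage[OF openX]) (intro continuous_intros)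
 moreover have "0 \<in> (\<lambda>s. p + s *R W) -` X" using assms by simp
 ultimately obtain e where "e > 0" "ball 0 e \<subseteq> (\<lambda>s. p + s *R W) -` X" using open_contains_ball by blast
 then show thesis by (intro that[of e]) (auto simp: subset_iff)
qed

lemma has_d2_bcurve:
 assumes p: "p \<in> X"
 shows "has_d2 (bcurve p W b) (snd W + Complex (dd W S p) b *s snd p)
  ((2 * Complex (dd W S p) b) *s snd W + ((Complex (dd W S p) b)^2) *s snd p + dd W (dd W S) p *R snd p)"
proof -
 define a where "a = dd W S p"
 define h where "h = Complex a b"
 define f where "f = (\<lambda>s. S (p + s *R W) + (- S p + s *R (- a)))"
 have "has_d2 (\<lambda>s. S (p + s *R W)) a (dd W (dd W S) p)"
  using has_d2_compose[OF has_d2_affine[of p W] openX Ck_S] p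
  by (simp add: a_def linear_0[OF dd_linear[OF openX Ck_S[unfolded numeral_2_eq_2] p]])
 then have "has_d2 f 0 (dd W (dd W S) p)"
  using has_d2_add[OF _ has_d2_affine[of "- S p" "- a"], of "\<lambda>s. S (p + s *R W)"] by (force simp: f_def)
 then have E: "has_d2 (\<lambda>s. exp (f s)) 0 (dd W (dd W S) p)"
  using has_d2_exp_compose[of f 0] by (simp add: f_def)
 have "has_d2 (\<lambda>s. exp (f s) *R (exp (of_real s * h) *s (snd p + s *R snd W)))
   (snd W + h *s snd p) ((2 * h) *s snd W + h^2 *s snd p + dd W (dd W S) p *R snd p)"
  using has_d2_bilinear[OF bounded_bilinear_scaleR E has_d2_exp_cmult_vec[of h "snd p" "snd W"]] by (simp add: f_def)
 moreover obtain e where e: "e > 0" "\<And>s. \<bar>s\<bar> < e ==> p + s *R W \<in> X" using line_in_X[OF p] by blast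
 moreover have "exp (f s) *R (exp (of_real s * h) *s (snd p + s *R snd W)) = bcurve p W b s" if s: "\<bar>s\<bar> < e" for s
 proof -
  have "exp (f s) = Rd (p + s *R W) / Rd p * exp (- (s * a))"
   using Rd_pos[OF e(2)[OF s]] Rd_pos[OF p] by (simp add: f_def S_def exp_add exp_diff exp_minus divide_inverse)
  moreover have "exp (of_real s * h) = of_real (exp (s * a)) * cis (s * b)"
   by (simp add: h_def exp_eq_polar)
  ultimately have "exp (f s) *R (exp (of_real s * h) *s y) = (Rd (p + s *R W) / Rd p) *R (cis (s * b) *s y)" for y :: "complex^'m"
   by (simp add: scaleR_vec vector_smult_assoc exp_minus mult_ac flip: of_real_mult)
  then show ?thesis unfolding bcurve_def .
 qed
 ultimately show ?thesis using has_d2_cong unfolding h_def a_def by blast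
qed

lemma bcurve_0 [simp]: "p \<in> X ==> bcurve p W b 0 = snd p"
 using Rd_pos[of p] by (simp add: bcurve_def)

lemma Lev_S_nonpos:
 assumes p: "p \<in> X" shows "Lev S p V \<le> 0"
proof -
 let ?iV = "cscale \<i> V"
 define a b where "a = dd V S p" and "b = dd ?iV S p"
 define h where "h = Complex a (- b)"
 have ih: "Complex b a = \<i> * h" by (simp add: h_def complex_eq_iff)
 define x where "x = snd p"
 define R where "R = Rd p"
 define q where "q = (fst p, R *R x)"
 have q: "q \<in> N" using bdN[OF p] by (simp add: q_def R_def x_def)
 have key: "dd V1 (dd V1 \<rho>) q + dd (0, A) \<rho> q = 0"
  if c: "has_d2 (bcurve p W d) w \<alpha>" and V1: "V1 = (fst W, R *R w)" and A: "A = R *R \<alpha>" for W d w \<alpha> V1 A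
 proof -
  have "has_d2 (\<lambda>s. (fst p + s *R fst W, R *R bcurve p W d s)) V1 (0, A)"
   using has_d2_Pair[OF has_d2_affine has_d2_bilinear[OF bounded_bilinear_scaleR has_d2_affine[of R 0] c]] by (simp add: V1 A)
  from has_d2_compose[OF this openN \<rho>2] q p
  have 1: "has_d2 (\<lambda>s. \<rho> (fst p + s *R fst W, R *R bcurve p W d s)) (dd V1 \<rho> q) (dd V1 (dd V1 \<rho>) q + dd (0, A) \<rho> q)"
   by (simp add: q_def x_def)
  obtain e where e: "e > 0" "\<And>s. \<bar>s\<bar> < e ==> p + s *R W \<in> X" using line_in_X[OF p] by blast
  have 2: "has_d2 (\<lambda>s. 0 + s *R 0) 0 (0::real)" by (rule has_d2_affine)
  show ?thesis
  proof (rule has_d2_unique(2)[OF 1 2 e(1)])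
   fix s :: real assume "\<bar>s\<bar> < e"
   then have s: "p + s *R W \<in> X" by (rule e(2))
   let ?y = "cis (s * d) *s snd (p + s *R W)"
   have t: "fst (p + s *R W) \<in> U" "?y \<noteq> 0" "snd (p + s *R W) \<noteq> 0"
    using XD[OF s] by (auto simp: nonzero_norm_cis_scale simp del: snd_add snd_scaleR)
   have "Rad (fst (p + s *R W)) ?y = Rd (p + s *R W)"
    using Rad_cmult[OF t(1,3), of "cis (s * d)"] by (simp add: Rd_def)
   moreover have "R *R bcurve p W d s = Rd (p + s *R W) *R ?y"
    using Rd_pos[OF p] by (simp add: bcurve_def R_def)
   ultimately show "\<rho> (fst p + s *R fst W, R *R bcurve p W d s) = 0 + s *R 0"
    using bd_zero[OF t(1,2)] by simp
  qed
 qed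
 define \<alpha> where "\<alpha> = (2 * h) *s snd V + (h^2) *s x"
 define V1 where "V1 = (fst V, R *R (snd V + h *s x))"
 have k1: "dd V1 (dd V1 \<rho>) q + dd (0, R *R (\<alpha> + dd V (dd V S) p *R x)) \<rho> q = 0"
  by (rule key[OF has_d2_bcurve[OF p, of V "- b"]]) (simp_all add: V1_def \<alpha>_def h_def a_def x_def)
 have iV1: "cscale \<i> V1 = (fst ?iV, R *R (snd ?iV + (\<i> * h) *s x))"
  by (simp add: V1_def cscale_def vec_eq_iff) (simp add: complex_eq_iff algebra_simps)
 have i\<alpha>: "(2 * (\<i> * h)) *s snd ?iV + (\<i> * h)^2 *s x = - \<alpha>"
  by (simp add: \<alpha>_def cscale_def vec_eq_iff power2_eq_square algebra_simps)
 have k2: "dd (cscale \<i> V1) (dd (cscale \<i> V1) \<rho>) q + dd (0, R *R (- \<alpha> + dd ?iV (dd ?iV S) p *R x)) \<rho> q = 0"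
  by (rule key[OF has_d2_bcurve[OF p, of ?iV a, folded b_def, unfolded ih]])
   (simp_all only: iV1 i\<alpha> flip: x_def)
 define G where "G = (\<lambda>y. dd (0, y) \<rho> q)"
 have "linear (\<lambda>V. dd V \<rho> q)" by (rule dd_linear[OF openN C2\<rho> q])
 then have lin: "linear G" unfolding G_def
  using linear_compose[OF bounded_linear.linear[OF bounded_linear_Pair2], of "\<lambda>V. dd V \<rho> q"] by (simp add: o_def)
 have "G (R *R (\<alpha> + dd V (dd V S) p *R x)) + G (R *R (- \<alpha> + dd ?iV (dd ?iV S) p *R x))
   = R * (4 * Lev S p V) * G x"
  unfolding linear_add[OF lin] linear_scale[OF lin] linear_neg[OF lin] Lev_def by (simp add: algebra_simps)
 then have "R * (4 * Lev S p V) * G x = - 4 * Lev \<rho> q V1"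
  using k1 k2 by (simp add: G_def Lev_def)
 moreover have "0 \<le> Lev \<rho> q V1" by (rule Lev_nonneg_of_psh[OF openN \<rho>2 psh q])
 moreover have "0 < R * G x"
  using hopf'[OF p] Rd_pos[OF p] by (simp add: R_def G_def x_def q_def)
 ultimately have "Lev S p V * (R * G x) \<le> 0" by (simp add: algebra_simps)
 then show ?thesis using \<open>0 < R * G x\<close> mult_pos_pos[of "Lev S p V" "R * G x"] by linarith
qed

end

section \<open>A one-dimensional Prekopa inequality\<close>

abbreviation cont01 :: "(real => 'a::topological_space) => bool" where
 "cont01 \<equiv> continuous_on {0..1}"

abbreviation int01 :: "(real => real) => real" (binder "I01 " 10) where
 "int01 f \<equiv> integral {0..1} f"

definition wvar :: "(real => real) => (real => real) => real" where
 "wvar \<omega> a = (I01 r. (a r)^2 * \<omega> r) - ((I01 r. a r * \<omega> r))^2 / integral {0..1} \<omega>"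

locale radial_weight =
 fixes T T1 T2 :: "real => real" and p :: nat
 assumes cT: "cont01 T" and cT1: "cont01 T1" and cT2: "cont01 T2"
  and dT: "0 < r ==> r < 1 ==> (T has_real_derivative T1 r / r) (at r)"
  and dT1: "0 < r ==> r < 1 ==> (T1 has_real_derivative T2 r / r) (at r)"
begin

definition "\<omega> = (\<lambda>r. r ^ p * exp (- T r))"
definition "\<omega>1 = (\<lambda>r. r ^ Suc p * exp (- T r))"

lemma c\<omega>: "cont01 \<omega>" unfolding \<omega>_def by (intro continuous_intros cT)

lemma c\<omega>1: "cont01 \<omega>1" unfolding \<omega>1_def by (intro continuous_intros cT)

lemma \<omega>_nonneg: "0 \<le> r ==> 0 \<le> \<omega> r" and \<omega>_pos: "0 < r ==> 0 < \<omega> r" by (simp_all add: \<omega>_def)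

lemma \<omega>1_eq: "\<omega>1 r = r * \<omega> r" by (simp add: \<omega>_def \<omega>1_def)

lemma int_cont: "cont01 f ==> f integrable_on {0..(1::real)}" for f :: "real => real"
 by (rule integrable_continuous_interval)

lemma integral_pos:
 fixes f :: "real => real"
 assumes "cont01 f" "\<And>r. r \<in> {0..1} ==> 0 \<le> f r" "c \<in> {0..1}" "0 < f c"
 shows "0 < integral {0..1} f"
 using integral_less_0[of 0 1 "\<lambda>r. - f r" c] assms by (auto intro!: continuous_intros)

lemma K_pos: "0 < integral {0..1} \<omega>"
 by (rule integral_pos[OF c\<omega>, of 1]) (auto intro: \<omega>_nonneg \<omega>_pos)

lemma d\<omega>1:
 assumes r: "0 < r" "r < 1" shows "(\<omega>1 has_real_derivative \<omega> r * (real (Suc p) - T1 r)) (at r)"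
proof -
 have "(\<omega>1 has_real_derivative real (Suc p) * r ^ p * exp (- T r) + r ^ Suc p * (exp (- T r) * (- (T1 r / r)))) (at r)"
  unfolding \<omega>1_def using DERIV_pow[of "Suc p" r] dT[OF r]
  by (auto intro!: derivative_eq_intros simp del: power_Suc)
 then show ?thesis using r by (simp add: \<omega>_def field_simps)
qed

lemma half:
 assumes ca: "cont01 a" and ca1: "cont01 a1"
  and da: "\<And>r. 0 < r ==> r < 1 ==> (a has_real_derivative a1 r / r) (at r)"
 obtains y where "cont01 y" "(I01 r. a1 r * y r * \<omega> r) = - wvar \<omega> a"
  "(I01 r. T2 r * (y r)^2 * \<omega> r) \<le> wvar \<omega> a"
proof -
 define K where "K = integral {0..1} \<omega>"
 define \<mu> where "\<mu> = (I01 r. a r * \<omega> r) / K"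
 have K: "K > 0" using K_pos by (simp add: K_def)
 define d where "d = (\<lambda>r. a r - \<mu>)"
 have cd: "cont01 d" unfolding d_def by (intro continuous_intros ca)
 have dd: "(d has_real_derivative a1 r / r) (at r)" if "0 < r" "r < 1" for r
  unfolding d_def using da[OF that] by (auto intro!: derivative_eq_intros)
 have cdw: "cont01 (\<lambda>s. d s * \<omega> s)" by (intro continuous_intros cd c\<omega>)
 define Y where "Y = (\<lambda>r. integral {0..r} (\<lambda>s. d s * \<omega> s))"
 have dY': "(Y has_real_derivative d r * \<omega> r) (at r within {0..1})" if "r \<in> {0..1}" for r
  unfolding Y_def by (rule integral_has_real_derivative[OF cdw that])
 have cY: "cont01 Y"
  unfolding continuous_on_eq_continuous_within using dY' DERIV_continuous by blast
 have dY: "(Y has_real_derivative d r * \<omega> r) (at r)" if "0 < r" "r < 1" for r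
  using dY'[of r] that at_within_interior[of r "{0..1}"] by simp
 have Y0: "Y 0 = 0" by (simp add: Y_def)
 have Y1: "Y 1 = 0"
 proof -
  have "Y 1 = (I01 r. a r * \<omega> r) - \<mu> * K"
   unfolding Y_def d_def left_diff_distrib K_def
   by (subst integral_diff) (auto intro!: int_cont continuous_intros ca c\<omega>)
  then show ?thesis using K by (simp add: \<mu>_def)
 qed
 define y where "y = (\<lambda>r. if r = 0 then d 0 / real (Suc p) else Y r / \<omega>1 r)"
 have yY: "y r * \<omega>1 r = Y r" if "0 \<le> r" for r
  using that \<omega>_pos[of r] Y0 by (cases "r = 0") (auto simp: y_def \<omega>1_eq)
 have cy: "cont01 y"
  unfolding continuous_on_eq_continuous_within
 proof
  fix r :: real assume r: "r \<in> {0..1}"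
  show "continuous (at r within {0..1}) y"
  proof (cases "r = 0")
   case False
   have "\<omega>1 r \<noteq> 0" using r False \<omega>_pos[of r] by (simp add: \<omega>1_eq)
   then have "((\<lambda>r. Y r / \<omega>1 r) \<longlongrightarrow> Y r / \<omega>1 r) (at r within {0..1})"
    using r cY c\<omega>1 unfolding continuous_on_def by (intro tendsto_divide) auto
   then have c: "continuous (at r within {0..1}) (\<lambda>r. Y r / \<omega>1 r)" unfolding continuous_within .
   have "eventually (\<lambda>s. s \<in> {0<..}) (nhds r)" using r False by (intro eventually_nhds_in_open) auto
   then have "eventually (\<lambda>s. Y s / \<omega>1 s = y s) (nhds r)" by eventually_elim (auto simp: y_def)
   then show ?thesis using c r False
    by (subst (asm) continuous_within, subst continuous_within)
     (auto simp: y_def elim!: Lim_transform_eventually intro: eventually_at_filter[THEN iffD2] eventually_mono)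
  next
   case True
   have at0: "at (0::real) within {0..1} = at_right 0"
    using at_within_Icc_at_right[of 0 "1::real"] by simp
   have c0: "(f \<longlongrightarrow> f 0) (at_right 0)" if "cont01 f" for f :: "real => real"
    using that at0 unfolding continuous_on_def by force
   have ev: "eventually (\<lambda>r::real. 0 < r \<and> r < 1) (at_right 0)"
    using eventually_at_right_real[of 0 "1::real"] by (auto elim: eventually_mono)
   have "((\<lambda>r. Y r / r ^ Suc p) \<longlongrightarrow> d 0 * exp (- T 0) / real (Suc p)) (at_right 0)"
   proof (rule lhopital_right_0)
    show "(Y \<longlongrightarrow> 0) (at_right 0)" using c0[OF cY] Y0 by simp
    show "((\<lambda>r :: real. r ^ Suc p) \<longlongrightarrow> 0) (at_right 0)"
     using c0[of "\<lambda>r. r ^ Suc p", OF continuous_on_power[OF continuous_on_id]] by simp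
    show "eventually (\<lambda>r :: real. r ^ Suc p \<noteq> 0) (at_right 0)" using ev by eventually_elim auto
    show "eventually (\<lambda>r :: real. real (Suc p) * r ^ p \<noteq> 0) (at_right 0)" using ev by eventually_elim auto
    show "eventually (\<lambda>r. (Y has_real_derivative d r * \<omega> r) (at r)) (at_right 0)"
     using ev by eventually_elim (auto intro: dY)
    show "eventually (\<lambda>r. ((\<lambda>r. r ^ Suc p) has_real_derivative real (Suc p) * r ^ p) (at r)) (at_right (0 :: real))"
     using DERIV_pow[of "Suc p"] by (simp del: power_Suc)
    have "((\<lambda>r. d r * exp (- T r) / real (Suc p)) \<longlongrightarrow> d 0 * exp (- T 0) / real (Suc p)) (at_right 0)"
     by (intro tendsto_intros c0 cd cT) simp
    moreover have "eventually (\<lambda>r. d r * exp (- T r) / real (Suc p) = d r * \<omega> r / (real (Suc p) * r ^ p)) (at_right 0)"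
     using ev by eventually_elim (simp add: \<omega>_def)
    ultimately show "((\<lambda>r. d r * \<omega> r / (real (Suc p) * r ^ p)) \<longlongrightarrow> d 0 * exp (- T 0) / real (Suc p)) (at_right 0)"
     by (rule Lim_transform_eventually)
   qed
   then have "((\<lambda>r. Y r / r ^ Suc p * exp (T r)) \<longlongrightarrow> d 0 * exp (- T 0) / real (Suc p) * exp (T 0)) (at_right 0)"
    by (rule tendsto_mult) (intro tendsto_exp c0 cT)
   moreover have "d 0 * exp (- T 0) / real (Suc p) * exp (T 0) = y 0"
    by (simp add: y_def exp_minus)
   moreover have "eventually (\<lambda>r. Y r / r ^ Suc p * exp (T r) = y r) (at_right 0)"
    using ev by eventually_elim (simp add: y_def \<omega>1_def exp_minus field_simps)
   ultimately have "(y \<longlongrightarrow> y 0) (at_right 0)" using Lim_transform_eventually by fastforce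
   then show ?thesis unfolding True continuous_within at0 .
  qed
 qed
 define M where "M = (\<lambda>r. real (Suc p) - T1 r)"
 have cM: "cont01 M" unfolding M_def by (intro continuous_intros cT1)
 have dM: "(M has_real_derivative - (T2 r / r)) (at r)" if "0 < r" "r < 1" for r
  unfolding M_def using dT1[OF that] by (auto intro!: derivative_eq_intros)
 have Yr: "Y r / r = y r * \<omega> r" if "0 < r" for r using yY[of r] that by (simp add: \<omega>1_eq field_simps)
 have dy: "(y has_real_derivative (d r - M r * y r) / r) (at r)" if r: "0 < r" "r < 1" for r
 proof -
  have w: "\<omega> r > 0" "\<omega>1 r \<noteq> 0" using \<omega>_pos[OF r(1)] r by (simp_all add: \<omega>1_eq)
  have "((\<lambda>r. Y r / \<omega>1 r) has_real_derivative (d r * \<omega> r * \<omega>1 r - Y r * (\<omega> r * M r)) / (\<omega>1 r * \<omega>1 r)) (at r)"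
   unfolding M_def by (rule DERIV_divide[OF dY[OF r] d\<omega>1[OF r] w(2)])
  also have "(d r * \<omega> r * \<omega>1 r - Y r * (\<omega> r * M r)) / (\<omega>1 r * \<omega>1 r) = (d r - M r * y r) / r"
   using w r unfolding yY[of r, symmetric, OF less_imp_le[OF r(1)]] \<omega>1_eq by (simp add: field_simps)
  finally show ?thesis
   by (rule has_field_derivative_transform_within_open[of _ _ _ "{0<..}"]) (use r in \<open>auto simp: y_def\<close>)
 qed
 have var: "(I01 r. (d r)^2 * \<omega> r) = wvar \<omega> a"
 proof -
  have "(\<lambda>r. (d r)^2 * \<omega> r) = (\<lambda>r. ((a r)^2 * \<omega> r - 2 * \<mu> * (a r * \<omega> r)) + \<mu>^2 * \<omega> r)"
   by (auto simp: d_def power2_eq_square algebra_simps)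
  then have "(I01 r. (d r)^2 * \<omega> r)
   = (I01 r. (a r)^2 * \<omega> r) - 2 * \<mu> * (I01 r. a r * \<omega> r) + \<mu>^2 * K"
   using int_cont[of "\<lambda>r. (a r)^2 * \<omega> r - 2 * \<mu> * (a r * \<omega> r)"] int_cont[of "\<lambda>r. (a r)^2 * \<omega> r"]
    int_cont[of "\<lambda>r. 2 * \<mu> * (a r * \<omega> r)"] int_cont[of "\<lambda>r. \<mu>^2 * \<omega> r"]
   by (simp add: integral_add integral_diff K_def continuous_intros ca c\<omega>)
  also have "(I01 r. a r * \<omega> r) = \<mu> * K" using K by (simp add: \<mu>_def)
  finally show ?thesis using K unfolding wvar_def K_def[symmetric] by (simp add: \<mu>_def field_simps power2_eq_square)
 qed
 let ?Z = "\<lambda>r. (d r)^2 * \<omega> r - T2 r * (y r)^2 * \<omega> r - (d r - M r * y r)^2 * \<omega> r"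
 show thesis
 proof (rule that[OF cy])
  have "((\<lambda>r. a1 r * y r * \<omega> r + (d r)^2 * \<omega> r) has_integral (d 1 * Y 1 - d 0 * Y 0)) {0..1}"
  proof (rule fundamental_theorem_of_calculus_interior)
   show "cont01 (\<lambda>r. d r * Y r)" by (intro continuous_intros cd cY)
   fix r :: real assume "r \<in> {0<..<1}"
   then have r: "0 < r" "r < 1" by auto
   have "((\<lambda>r. d r * Y r) has_real_derivative a1 r / r * Y r + d r * \<omega> r * d r) (at r)"
    by (rule DERIV_mult[OF dd[OF r] dY[OF r]])
   also have "a1 r / r * Y r + d r * \<omega> r * d r = a1 r * y r * \<omega> r + (d r)^2 * \<omega> r"
   proof -
    have "a1 r / r * Y r = a1 r * (Y r / r)" by simp
    then show ?thesis unfolding Yr[OF r(1)] by (simp add: power2_eq_square algebra_simps)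
   qed
   finally show "((\<lambda>r. d r * Y r) has_vector_derivative a1 r * y r * \<omega> r + (d r)^2 * \<omega> r) (at r)"
    by (simp add: has_real_derivative_iff_has_vector_derivative)
  qed simp
  then have "(I01 r. a1 r * y r * \<omega> r + (d r)^2 * \<omega> r) = 0" using Y0 Y1 by (simp add: integral_unique)
  then have "(I01 r. a1 r * y r * \<omega> r) + (I01 r. (d r)^2 * \<omega> r) = 0"
   by (subst integral_add[symmetric]) (auto intro!: int_cont continuous_intros ca1 cy c\<omega> cd)
  then show "(I01 r. a1 r * y r * \<omega> r) = - wvar \<omega> a" unfolding var by simp
  have "(?Z has_integral (M 1 * y 1 * Y 1 - M 0 * y 0 * Y 0)) {0..1}"
  proof (rule fundamental_theorem_of_calculus_interior)
   show "cont01 (\<lambda>r. M r * y r * Y r)" by (intro continuous_intros cM cy cY)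
   fix r :: real assume "r \<in> {0<..<1}"
   then have r: "0 < r" "r < 1" by auto
   have "((\<lambda>r. M r * y r * Y r) has_real_derivative
     (- (T2 r / r) * y r + (d r - M r * y r) / r * M r) * Y r + d r * \<omega> r * (M r * y r)) (at r)"
    by (rule DERIV_mult[OF DERIV_mult[OF dM[OF r] dy[OF r]] dY[OF r]])
   also have "(- (T2 r / r) * y r + (d r - M r * y r) / r * M r) * Y r + d r * \<omega> r * (M r * y r)
     = (- T2 r * y r + (d r - M r * y r) * M r) * (Y r / r) + d r * \<omega> r * (M r * y r)"
    using r by (simp add: field_simps)
   also have "\<dots> = ?Z r"
    unfolding Yr[OF r(1)] by (simp add: power2_eq_square algebra_simps)
   finally show "((\<lambda>r. M r * y r * Y r) has_vector_derivative ?Z r) (at r)"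
    by (simp add: has_real_derivative_iff_has_vector_derivative)
  qed simp
  then have "(I01 r. ?Z r) = 0"
   using Y0 Y1 by (simp add: integral_unique)
  moreover have "(I01 r. ?Z r)
   = (I01 r. (d r)^2 * \<omega> r) - (I01 r. T2 r * (y r)^2 * \<omega> r) - (I01 r. (d r - M r * y r)^2 * \<omega> r)"
   by (subst integral_diff, (intro int_cont continuous_intros cT2 cy c\<omega> cd cM)+)
    (subst integral_diff, (intro int_cont continuous_intros cT2 cy c\<omega> cd cM)+, simp)
  moreover have "0 \<le> (I01 r. (d r - M r * y r)^2 * \<omega> r)"
   by (intro integral_nonneg int_cont continuous_intros cd cM cy c\<omega>) (auto intro!: \<omega>_nonneg mult_nonneg_nonneg)
  ultimately show "(I01 r. T2 r * (y r)^2 * \<omega> r) \<le> wvar \<omega> a" unfolding var by simp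
 qed
qed

lemma prekopa:
 assumes a: "cont01 a" "cont01 a1"
   "\<And>r. 0 < r ==> r < 1 ==> (a has_real_derivative a1 r / r) (at r)"
  and b: "cont01 b" "cont01 b1"
   "\<And>r. 0 < r ==> r < 1 ==> (b has_real_derivative b1 r / r) (at r)"
  and cQ: "cont01 Q" and L: "L \<le> 0"
  and form: "\<And>r x y. r \<in> {0..1} ==> 0 \<le> Q r - L * T1 r + 2 * a1 r * x + 2 * b1 r * y + T2 r * (x^2 + y^2)"
  and r0: "0 < r0" "r0 \<le> 1" and strict: "\<And>x y. 0 < Q r0 - L * T1 r0 + 2 * a1 r0 * x + 2 * b1 r0 * y + T2 r0 * (x^2 + y^2)"
 shows "0 < (I01 r. Q r * \<omega> r) - wvar \<omega> a - wvar \<omega> b - real (Suc p) * L * integral {0..1} \<omega>"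
proof -
 obtain x where x: "cont01 x" "(I01 r. a1 r * x r * \<omega> r) = - wvar \<omega> a"
  "(I01 r. T2 r * (x r)^2 * \<omega> r) \<le> wvar \<omega> a" by (rule half[OF a])
 obtain y where y: "cont01 y" "(I01 r. b1 r * y r * \<omega> r) = - wvar \<omega> b"
  "(I01 r. T2 r * (y r)^2 * \<omega> r) \<le> wvar \<omega> b" by (rule half[OF b])
 note ci = continuous_intros cQ cT1 cT2 a b c\<omega> x y
 have "((\<lambda>r. \<omega> r * (real (Suc p) - T1 r)) has_integral (\<omega>1 1 - \<omega>1 0)) {0..1}"
  by (rule fundamental_theorem_of_calculus_interior[OF _ c\<omega>1])
   (use d\<omega>1 in \<open>auto simp: has_real_derivative_iff_has_vector_derivative\<close>)
 then have "(I01 r. \<omega> r * (real (Suc p) - T1 r)) = exp (- T 1)"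
  by (simp add: integral_unique \<omega>1_def)
 moreover have "(I01 r. \<omega> r * (real (Suc p) - T1 r))
   = real (Suc p) * integral {0..1} \<omega> - (I01 r. T1 r * \<omega> r)"
 proof -
  have "(\<lambda>r. \<omega> r * (real (Suc p) - T1 r)) = (\<lambda>r. real (Suc p) * \<omega> r - T1 r * \<omega> r)" by (auto simp: algebra_simps)
  then show ?thesis
   using integral_diff[of "\<lambda>r. real (Suc p) * \<omega> r" "{0..1}" "\<lambda>r. T1 r * \<omega> r"] int_cont
   by (simp add: ci)
 qed
 ultimately have IT: "(I01 r. T1 r * \<omega> r) = real (Suc p) * integral {0..1} \<omega> - exp (- T 1)" by simp
 define F where "F = (\<lambda>r. Q r - L * T1 r + 2 * a1 r * x r + 2 * b1 r * y r + T2 r * ((x r)^2 + (y r)^2))"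
 have "0 < (I01 r. F r * \<omega> r)"
  by (rule integral_pos[of _ r0]) (use r0 form strict \<omega>_nonneg \<omega>_pos in \<open>auto simp: F_def intro!: ci mult_nonneg_nonneg mult_pos_pos\<close>)
 also have "(\<lambda>r. F r * \<omega> r) = (\<lambda>r. Q r * \<omega> r + (- L) * (T1 r * \<omega> r) + 2 * (a1 r * x r * \<omega> r) + 2 * (b1 r * y r * \<omega> r)
   + (T2 r * (x r)^2 * \<omega> r) + (T2 r * (y r)^2 * \<omega> r))"
  by (auto simp: F_def algebra_simps)
 also have "integral {0..1} \<dots> = (I01 r. Q r * \<omega> r) + (- L) * (I01 r. T1 r * \<omega> r)
   + 2 * (I01 r. a1 r * x r * \<omega> r) + 2 * (I01 r. b1 r * y r * \<omega> r)
   + (I01 r. T2 r * (x r)^2 * \<omega> r) + (I01 r. T2 r * (y r)^2 * \<omega> r)"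
  using integral_mult_right[of "{0..1}" "- L" "\<lambda>r. T1 r * \<omega> r"] integral_mult_right[of "{0..1}" 2 "\<lambda>r. a1 r * x r * \<omega> r"]
   integral_mult_right[of "{0..1}" 2 "\<lambda>r. b1 r * y r * \<omega> r"]
  by (subst integral_add, (intro int_cont ci)+)+ simp
 finally have "0 < (I01 r. Q r * \<omega> r) - L * (real (Suc p) * integral {0..1} \<omega> - exp (- T 1)) - wvar \<omega> a - wvar \<omega> b"
  using x(2,3) y(2,3) unfolding IT by simp
 moreover have "L * exp (- T 1) \<le> 0" using L by (simp add: mult_nonpos_nonneg)
 ultimately show ?thesis by (simp add: algebra_simps)
qed

end

lemma dd_affine_derivative:
 fixes f :: "'a::euclidean_space => real"
 assumes S: "open S" and f: "Ck_on 2 f S" and s: "x + s *R V \<in> S"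
 shows "((\<lambda>s. dd (p + s *R q) f (x + s *R V)) has_real_derivative
  dd V (dd (p + s *R q) f) (x + s *R V) + dd q f (x + s *R V)) (at s)"
proof -
 note C2 = Ck_2[OF f]
 have expand: "dd (p + s *R q) f y = dd p f y + s * dd q f y" if "y \<in> S" for s y
  using linear_add[OF dd_linear[OF S C2 that]] linear_scale[OF dd_linear[OF S C2 that]] by simp
 have o: "open ((\<lambda>s. x + s *R V) -` S)" by (rule open_vimage[OF S]) (intro continuous_intros)
 have "((\<lambda>s. dd p f (x + s *R V) + s * dd q f (x + s *R V)) has_real_derivative
   dd V (dd p f) (x + s *R V) + (dd q f (x + s *R V) + s * dd V (dd q f) (x + s *R V))) (at s)"
  by (auto intro!: derivative_eq_intros dd_line_derivative[OF S] Ck_dd[OF C2] s)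
 moreover have "dd V (dd (p + s *R q) f) (x + s *R V) = dd V (dd p f) (x + s *R V) + s * dd V (dd q f) (x + s *R V)"
  using linear_add[OF dd2_linear(2)[OF S f s]] linear_scale[OF dd2_linear(2)[OF S f s]] by simp
 ultimately have "((\<lambda>s. dd p f (x + s *R V) + s * dd q f (x + s *R V)) has_real_derivative
   dd V (dd (p + s *R q) f) (x + s *R V) + dd q f (x + s *R V)) (at s)" by (simp add: add_ac)
 then show ?thesis
  by (rule has_field_derivative_transform_within_open[OF _ o]) (use s expand in simp_all)
qed

lemma coord_expansion:
 "(\<Oplus>a. coord a (case a of Inl j => fst V $ j | Inr k => snd V $ k)) = (V :: (complex^'n) \<times> (complex^'m))"
proof -
 have "(\<Oplus>a. coord a (case a of Inl j => fst V $ j | Inr k => snd V $ k))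
   = (\<Oplus>j. (axis j (fst V $ j), 0)) + (\<Oplus>k. (0, axis k (snd V $ k)))"
  unfolding UNIV_Plus_UNIV[symmetric] Plus_def
  by (subst sum.union_disjoint) (auto simp: sum.reindex)
 also have "\<dots> = V"
  by (simp add: prod_eq_iff fst_sum snd_sum vec_eq_iff axis_def sum.delta)
 finally show ?thesis .
qed

lemma Lev_pos_of_strictly_psh:
 assumes "open S" "Ck_on 2 u S" "x \<in> S" "strictly_plurisubharmonic_on B u" "x \<in> B" "V \<noteq> 0"
 shows "0 < Lev u x V"
proof -
 define w where "w = (\<lambda>a. case a of Inl j => fst V $ j | Inr k => snd V $ k)"
 have wV: "(\<Oplus>a. coord a (w a)) = V" unfolding w_def by (rule coord_expansion)
 have ne: "(\<chi> a. w a) \<noteq> 0"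
 proof
  assume "(\<chi> a. w a) = 0"
  then have "w a = 0" for a by (simp add: vec_eq_iff)
  then have "fst V $ j = 0" "snd V $ k = 0" for j k
   by (auto simp: w_def dest: spec[of _ "Inl j :: 'a + 'b"] spec[of _ "Inr k :: 'a + 'b"] split: sum.splits) (metis sum.simps(5), metis sum.simps(6))
  then show False using assms(6) by (auto simp: prod_eq_iff vec_eq_iff)
 qed
 have "positive_definite (complex_hessian u x)" using assms(4,5) by (auto simp: strictly_plurisubharmonic_on_def)
 then have "0 < Re (\<Oplus>a b. complex_hessian u x $ a $ b * (\<chi> a. w a) $ a * cnj ((\<chi> a. w a) $ b))"
  using ne unfolding positive_definite_def Let_def by blast
 then show ?thesis using hessian_form[OF assms(1-3), of w] wV by simp
qed

lemma dd2_ln: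
 fixes u :: "'a::euclidean_space => real"
 assumes S: "open S" and u: "Ck_on 2 u S" and pos: "\<And>x. x \<in> S ==> 0 < u x" and x: "x \<in> S"
 shows "dd V (dd V (\<lambda>x. ln (u x))) x = dd V (dd V u) x / u x - (dd V u x / u x)^2"
proof -
 note C2 = Ck_2[OF u]
 have 1: "dd V (\<lambda>x. ln (u x)) y = dd V u y / u y" if y: "y \<in> S" for y
  by (rule dd_eq[of _ "\<lambda>v. dd v u y / u y"])
   (use has_derivative_ln[OF _ Ck_deriv[OF S C2 y]] pos[OF y] in \<open>simp add: divide_inverse\<close>)
 have "dd V (dd V (\<lambda>x. ln (u x))) x = dd V (\<lambda>y. dd V u y / u y) x"
  by (rule dd_cong[OF S x 1])
 also have "\<dots> = (dd V (dd V u) x * u x - dd V u x * dd V u x) / (u x * u x)"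
 proof (rule dd_eq[of _ "\<lambda>v. (dd v (dd V u) x * u x - dd V u x * dd v u x) / (u x * u x)"])
  show "((\<lambda>y. dd V u y / u y) has_derivative (\<lambda>v. (dd v (dd V u) x * u x - dd V u x * dd v u x) / (u x * u x))) (at x)"
   using has_derivative_divide'[OF Ck_deriv[OF S Ck_dd[OF C2] x] Ck_deriv[OF S C2 x]] pos[OF x] by simp
 qed
 also have "\<dots> = dd V (dd V u) x / u x - (dd V u x / u x)^2"
  using pos[OF x] by (simp add: field_simps power2_eq_square)
 finally show ?thesis .
qed

lemma set_integral_01: "continuous_on {0..1} f ==> (LINT r:{0..1}|lborel. f r) = integral {0..1} f" for f :: "real => real"
 by (rule set_borel_integral_eq_integral(2)) (rule set_integrable_compact[OF compact_Icc])

locale invariant_weight =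
 fixes W :: "((complex^'n) \<times> (complex^'m)) set" and \<phi> :: "(complex^'n) \<times> (complex^'m) => real"
 assumes openW: "open W" and \<phi>2: "Ck_on 2 \<phi> W" and psh\<phi>: "plurisubharmonic_on W \<phi>"
  and inv: "S1_invariant_on W \<phi>"
begin

lemma C2\<phi>: "Ck_on (Suc (Suc 0)) \<phi> W" using \<phi>2 by (simp only: numeral_2_eq_2)

lemma invariance: "(t, z) \<in> W ==> (t, cis q *s z) \<in> W ==> \<phi> (t, cis q *s z) = \<phi> (t, z)"
 using inv by (simp add: S1_invariant_on_def)

lemma
 assumes q: "q \<in> W"
 shows rotation_derivative: "dd (0, \<i> *s snd q) \<phi> q = 0"
  and rotation_derivative2: "dd (0, \<i> *s snd q) (dd (0, \<i> *s snd q) \<phi>) q = dd (0, snd q) \<phi> q" (is ?g1)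
proof -
 obtain t z where tz: "q = (t, z)" by (cases q)
 define c where "c = (\<lambda>s :: real. (t, exp (of_real s * \<i>) *s z))"
 have c: "has_d2 c (0, \<i> *s z) (0, - z)"
  using has_d2_Pair[OF has_d2_affine[of t 0] has_d2_exp_cmult_vec[of \<i> z 0]]
  by (simp add: c_def vec_eq_iff)
 have c0: "c 0 = q" by (simp add: c_def tz)
 have "open (c -` W)" unfolding c_def
  by (rule open_vimage[OF openW])
   (intro continuous_intros bounded_bilinear.continuous_on[OF bounded_bilinear_cmult_vec])
 moreover have "0 \<in> c -` W" using c0 q by simp
 ultimately obtain e where e: "e > 0" "ball 0 e \<subseteq> c -` W" using open_contains_ball by blast
 have const: "\<phi> (c s) = \<phi> q + s *R 0" if "\<bar>s\<bar> < e" for s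
 proof -
  have "c s \<in> W" using e(2) that by (auto simp: subset_iff)
  moreover have "exp (complex_of_real s * \<i>) = cis s" by (simp add: cis_conv_exp mult.commute)
  ultimately show ?thesis using invariance[of t z s] q by (simp add: tz c_def)
 qed
 have u: "has_d2 (\<lambda>s. \<phi> (c s)) (dd (0, \<i> *s z) \<phi> q) (dd (0, \<i> *s z) (dd (0, \<i> *s z) \<phi>) q + dd (0, - z) \<phi> q)"
  using has_d2_compose[OF c openW \<phi>2] q by (simp add: c0)
 have "dd (- (0, z)) \<phi> q = - dd (0, z) \<phi> q" by (rule linear_neg[OF dd_linear[OF openW C2\<phi> q]])
 then show "dd (0, \<i> *s snd q) \<phi> q = 0" ?g1
  using has_d2_unique[OF u has_d2_affine[of "\<phi> q" 0] e(1) const] by (simp_all add: tz)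
qed

lemma rotation_derivative_mixed:
 assumes q: "q \<in> W"
 shows "dd V (dd (0, \<i> *s snd q) \<phi>) q = - dd (0, \<i> *s snd V) \<phi> q"
proof -
 let ?f = "\<lambda>s. dd ((0, \<i> *s snd q) + s *R (0, \<i> *s snd V)) \<phi> (q + s *R V)"
 have "(?f has_real_derivative dd V (dd (0, \<i> *s snd q) \<phi>) q + dd (0, \<i> *s snd V) \<phi> q) (at 0)"
  using dd_affine_derivative[OF openW \<phi>2, of q 0 V "(0, \<i> *s snd q)" "(0, \<i> *s snd V)"] q by simp
 moreover have "(?f has_real_derivative 0) (at 0)"
 proof (rule has_field_derivative_transform_within_open[of "\<lambda>_. 0" _ _ "(\<lambda>s. q + s *R V) -` W"])
  show "open ((\<lambda>s. q + s *R V) -` W)" by (rule open_vimage[OF openW]) (intro continuous_intros)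
  fix s assume s: "s \<in> (\<lambda>s. q + s *R V) -` W"
  have "(0, \<i> *s snd q) + s *R (0, \<i> *s snd V) = (0, \<i> *s snd (q + s *R V))"
   by (simp add: vec_eq_iff algebra_simps)
  then show "0 = ?f s" using rotation_derivative[of "q + s *R V"] s by simp
 qed (use q in auto)
 ultimately show ?thesis using DERIV_unique by fastforce
qed

lemma Lev_shift:
 assumes q: "q \<in> W"
 shows "4 * Lev \<phi> q (v + cscale (Complex x (- y)) (0, snd q)) = 4 * Lev \<phi> q v
  + 2 * x * (dd (0, snd q) (dd v \<phi>) q + dd (0, snd v) \<phi> q)
  + 2 * y * (dd (0, snd q) (dd (cscale \<i> v) \<phi>) q + dd (0, \<i> *s snd v) \<phi> q)
  + (x^2 + y^2) * (dd (0, snd q) (dd (0, snd q) \<phi>) q + dd (0, snd q) \<phi> q)"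
proof -
 define e :: "(complex^'n) \<times> (complex^'m)" where "e = (0, snd q)"
 define ie :: "(complex^'n) \<times> (complex^'m)" where "ie = (0, \<i> *s snd q)"
 define iv where "iv = cscale \<i> v"
 define D where "D = (\<lambda>a b. dd a (dd b \<phi>) q)"
 have ie: "cscale \<i> e = ie" "cscale \<i> ie = - e" by (simp_all add: e_def ie_def cscale_def vec_eq_iff)
 have 1: "cscale (Complex x (- y)) e = x *R e + (- y) *R ie"
 proof -
  have "Complex x (- y) = of_real x + of_real (- y) * \<i>" by (simp add: complex_eq_iff)
  then show ?thesis by (simp only: cscale.add_left cscale_of_real ie(1) flip: cscale_cscale)
 qed
 have 2: "cscale \<i> (v + cscale (Complex x (- y)) e) = iv + x *R ie + y *R e"
  unfolding 1 by (simp add: iv_def cscale.add_right cscale.diff_right cscale.scaleR_right ie cscale.minus_right)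
 have sym: "D a b = D b a" for a b unfolding D_def by (rule dd_commute[OF openW \<phi>2 q])
 have l1: "linear (\<lambda>a. D a b)" for b unfolding D_def by (rule dd2_linear(1)[OF openW \<phi>2 q])
 have l2: "linear (\<lambda>b. D a b)" for a unfolding D_def by (rule dd2_linear(2)[OF openW \<phi>2 q])
 note lin = linear_add[OF l1] linear_add[OF l2] linear_scale[OF l1] linear_scale[OF l2]
 have r1: "D ie ie = dd e \<phi> q" unfolding D_def ie_def e_def by (rule rotation_derivative2[OF q])
 have r2: "D v ie = - dd (0, \<i> *s snd v) \<phi> q" unfolding D_def ie_def by (rule rotation_derivative_mixed[OF q])
 have "(0, \<i> *s snd iv) = - (0 :: complex^'n, snd v)" by (simp add: iv_def cscale_def vec_eq_iff)
 then have r3: "D iv ie = dd (0, snd v) \<phi> q"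
  using rotation_derivative_mixed[OF q, of iv] linear_neg[OF dd_linear[OF openW C2\<phi> q], of "(0, snd v)"] by (simp add: D_def ie_def)
 have "4 * Lev \<phi> q (v + cscale (Complex x (- y)) e)
   = D (v + (x *R e + (- y) *R ie)) (v + (x *R e + (- y) *R ie)) + D (iv + x *R ie + y *R e) (iv + x *R ie + y *R e)"
  unfolding Lev_def 2 unfolding 1 D_def by simp
 also have "\<dots> = D v v + D iv iv + 2 * x * (D e v + D iv ie) + 2 * y * (D e iv - D v ie) + (x^2 + y^2) * (D e e + D ie ie)"
  unfolding lin by (simp add: sym[of ie v] sym[of ie iv] sym[of v e] sym[of iv e] sym[of ie e] power2_eq_square algebra_simps)
 finally show ?thesis unfolding r1 r2 r3 by (simp add: Lev_def D_def e_def iv_def)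
qed

end

lemma dd_lincomb:
 fixes f g :: "'a::euclidean_space => real"
 assumes S: "open S" and f: "Ck_on (Suc k) f S" and g: "Ck_on (Suc k) g S" and x: "x \<in> S"
 shows "dd V (\<lambda>x. a * f x + b * g x) x = a * dd V f x + b * dd V g x"
 by (rule dd_eq[of _ "\<lambda>V. a * dd V f x + b * dd V g x"])
  (auto intro!: derivative_eq_intros Ck_deriv[OF S f x] Ck_deriv[OF S g x])

lemma dd2_lincomb:
 fixes f g :: "'a::euclidean_space => real"
 assumes S: "open S" and f: "Ck_on 2 f S" and g: "Ck_on 2 g S" and x: "x \<in> S"
 shows "dd V (dd V (\<lambda>x. a * f x + b * g x)) x = a * dd V (dd V f) x + b * dd V (dd V g) x"
proof -
 have C: "Ck_on (Suc (Suc 0)) f S" "Ck_on (Suc (Suc 0)) g S" using f g by (simp_all only: numeral_2_eq_2)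
 have "dd V (dd V (\<lambda>x. a * f x + b * g x)) x = dd V (\<lambda>x. a * dd V f x + b * dd V g x) x"
  by (rule dd_cong[OF S x dd_lincomb[OF S C]])
 also have "\<dots> = a * dd V (dd V f) x + b * dd V (dd V g) x"
  by (rule dd_lincomb[OF S Ck_dd[OF C(1)] Ck_dd[OF C(2)] x])
 finally show ?thesis .
qed

locale weighted_family = circular_family U \<Omega> N \<rho> + invariant_weight W \<phi>
 for U :: "(complex^'n) set" and \<Omega> N W :: "((complex^'n) \<times> (complex^'m)) set" and \<rho> \<phi> +
 fixes k :: nat and r1 r2 :: real
 assumes nbhdW: "closure_nbhd U \<Omega> W" and r12: "0 < r1" "r1 < r2"
  and shell: "t \<in> U ==> {z. r1 \<le> norm z \<and> norm z \<le> r2} \<subseteq> fiber \<Omega> t"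
  and strict: "strictly_plurisubharmonic_on (U \<times> {z. r1 \<le> norm z \<and> norm z \<le> r2}) \<phi>"
begin

definition M :: nat where "M = 2 * (k + CARD('m))"

definition pt :: "((complex^'n) \<times> (complex^'m)) \<times> real => (complex^'n) \<times> (complex^'m)" where
 "pt q = (fst (fst q), (snd q * Rd (fst q)) *R snd (fst q))"

definition F :: "((complex^'n) \<times> (complex^'m)) \<times> real => real" where
 "F q = snd q ^ (M - 1) * exp (- \<phi> (pt q))"

definition Kt :: "(complex^'n) \<times> (complex^'m) => real" where
 "Kt p = (LINT r:{0..1}|lborel. F (p, r))"

definition \<psi> :: "(complex^'n) \<times> (complex^'m) => real" where
 "\<psi> p = - real M * S p + (-1) * ln (Kt p)"

lemma M_pos: "Suc (M - 1) = M" "0 < M" by (auto simp: M_def)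

lemma disc_W: "t \<in> U ==> x \<noteq> 0 ==> norm c \<le> Rad t x ==> (t, c *s x) \<in> W"
 by (rule fiber_closure[OF nbhdW _ closure_disc(1)])

lemma pt_W: "p \<in> X ==> 0 \<le> r ==> r \<le> 1 ==> pt (p, r) \<in> W"
proof -
 assume *: "p \<in> X" "0 \<le> r" "r \<le> 1"
 have "norm (complex_of_real (r * Rd p)) \<le> Rad (fst p) (snd p)"
  using *(2,3) Rd_pos[OF *(1)] unfolding norm_of_real by (simp add: Rd_def abs_mult mult_left_le_one_le)
 then show ?thesis using disc_W[of "fst p" "snd p" "of_real (r * Rd p)"] XD[OF *(1)] by (simp add: pt_def scaleR_vec)
qed

definition T' where "T' = {q. fst q \<in> X \<and> pt q \<in> W}"

lemma Ck_pt: "Ck_on 2 pt (X \<times> UNIV)"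
proof -
 have o: "open (X \<times> (UNIV :: real set))" by (intro open_Times openX open_UNIV)
 have "Ck_on 2 (\<lambda>q. Rd (fst q)) (X \<times> (UNIV :: real set))"
  by (rule Ck_compose[OF o openX _ Ck_fst[OF o Ck_id[OF o]] Ck_Rd]) auto
 then show ?thesis unfolding pt_def
  by (intro Ck_Pair Ck_scaleR Ck_mult Ck_fst Ck_snd Ck_id o)
qed

lemma openT': "open T'"
proof -
 have o: "open (X \<times> (UNIV :: real set))" by (intro open_Times openX open_UNIV)
 have "T' = (X \<times> UNIV) \<inter> pt -` W" by (auto simp: T'_def)
 then show ?thesis using continuous_open_preimage[OF Ck_continuous[OF Ck_pt] o openW] by simp
qed

lemma Ck_F: "Ck_on 2 F T'"
proof -
 have "Ck_on 2 (\<lambda>q. \<phi> (pt q)) T'"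
  by (rule Ck_compose[OF openT' openW _ Ck_subset[OF Ck_pt] \<phi>2]) (auto simp: T'_def)
 then show ?thesis unfolding F_def
  by (intro Ck_mult Ck_power Ck_snd Ck_id Ck_exp_compose Ck_minus openT')
qed

lemma XT': "X \<times> {0..1} \<subseteq> T'" using pt_W by (auto simp: T'_def)

lemma Ck_Kt: "Ck_on 2 Kt X"
 unfolding Kt_def by (rule Ck_integral[OF openX openT' compact_Icc XT' Ck_F])

lemma cont_F: "p \<in> X ==> cont01 (\<lambda>r. F (p, r))"
 by (rule continuous_on_compose2[OF Ck_continuous[OF Ck_F]]) (use XT' in \<open>auto intro!: continuous_intros\<close>)

lemma Kt_eq: "p \<in> X ==> Kt p = (I01 r. F (p, r))"
 unfolding Kt_def by (rule set_integral_01[OF cont_F])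

lemma Kt_pos: assumes p: "p \<in> X" shows "0 < Kt p"
proof -
 have "(I01 r. - F (p, r)) < 0"
  by (rule integral_less_0[of _ _ _ 1]) (use cont_F[OF p] in \<open>auto simp: F_def intro!: continuous_intros\<close>)
 then show ?thesis by (simp add: Kt_eq[OF p])
qed

lemma Ck_\<psi>: "Ck_on 2 \<psi> X" unfolding \<psi>_def
 by (intro Ck_add Ck_mult Ck_const Ck_ln_compose openX Ck_S Ck_Kt Kt_pos)

lemma \<psi>_scale:
 assumes p: "(t, x) \<in> X" and c: "c \<noteq> 0"
 shows "\<psi> (t, c *s x) = \<psi> (t, x) + real M * ln (norm c)"
proof -
 have tx: "t \<in> U" "x \<noteq> 0" using XD[OF p] by auto
 have cp: "(t, c *s x) \<in> X" using tx c by (auto simp: X_def vec_eq_iff)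
 have R: "Rd (t, c *s x) = Rd (t, x) / norm c" using Rad_cmult[OF tx c] by (simp add: Rd_def)
 have "F ((t, c *s x), r) = F ((t, x), r)" if r: "r \<in> {0..1}" for r
 proof -
  have "(r * Rd (t, c *s x)) *R (c *s x) = cis (Arg c) *s ((r * Rd (t, x)) *R x)"
   using c by (simp add: R scaleR_vec vector_smult_assoc cis_Arg sgn_div_norm scaleR_conv_of_real divide_inverse mult_ac)
  then have "pt ((t, c *s x), r) = (t, cis (Arg c) *s snd (pt ((t, x), r)))" by (simp add: pt_def)
  then have "\<phi> (pt ((t, c *s x), r)) = \<phi> (pt ((t, x), r))"
   using invariance[of t "snd (pt ((t, x), r))" "Arg c"] pt_W[OF p, of r] pt_W[OF cp, of r] r by (simp add: pt_def)
  then show ?thesis by (simp add: F_def)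
 qed
 then have K: "Kt (t, c *s x) = Kt (t, x)" unfolding Kt_eq[OF cp] Kt_eq[OF p] by (intro integral_cong) auto
 have Sc: "S (t, c *s x) = S (t, x) - ln (norm c)"
  using Rd_pos[OF p] c by (simp add: S_def R ln_div)
 show ?thesis unfolding \<psi>_def K Sc by (simp add: algebra_simps)
qed

lemma F_second:
 assumes p: "p \<in> X" and r: "0 \<le> r" "r \<le> 1"
  and w: "w = Rd p *R (snd Y + Complex (dd Y S p) b *s snd p)"
  and a: "a = Rd p *R ((2 * Complex (dd Y S p) b) *s snd Y + ((Complex (dd Y S p) b)^2) *s snd p + dd Y (dd Y S) p *R snd p)"
  and v: "v = (fst Y, r *R w)" and A: "A = dd v \<phi> (pt (p, r))"
 shows "dd (Y, 0) F (p, r) = - A * F (p, r)"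
  "dd (Y, 0) (dd (Y, 0) F) (p, r) = (A^2 - (dd v (dd v \<phi>) (pt (p, r)) + dd (0, r *R a) \<phi> (pt (p, r)))) * F (p, r)" (is ?g1)
proof -
 have pT: "(p, r) \<in> T'" using XT' p r by auto
 note CF = Ck_2[OF Ck_F]
 have 1: "has_d2 (\<lambda>s. F ((p, r) + s *R (Y, 0))) (dd (Y, 0) F (p, r)) (dd (Y, 0) (dd (Y, 0) F) (p, r))"
  using has_d2_compose[OF has_d2_affine[of "(p, r)" "(Y, 0)"] openT' Ck_F] pT
   linear_0[OF dd_linear[OF openT' CF pT]] by simp
 define \<gamma> where "\<gamma> = (\<lambda>s. (fst p + s *R fst Y, (r * Rd p) *R bcurve p Y b s))"
 have \<gamma>0: "\<gamma> 0 = pt (p, r)" using p by (simp add: \<gamma>_def pt_def)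
 have "has_d2 \<gamma> v (0, r *R a)"
  using has_d2_Pair[OF has_d2_affine has_d2_bilinear[OF bounded_bilinear_scaleR has_d2_affine[of "r * Rd p" 0] has_d2_bcurve[OF p, of Y b]]]
  unfolding \<gamma>_def v w a by simp
 from has_d2_compose[OF this openW \<phi>2]
 have "has_d2 (\<lambda>s. \<phi> (\<gamma> s)) A (dd v (dd v \<phi>) (pt (p, r)) + dd (0, r *R a) \<phi> (pt (p, r)))"
  using pt_W[OF p r] by (simp add: \<gamma>0 A)
 from has_d2_cmult[OF has_d2_exp_compose[OF has_d2_cmult[OF this, of "-1"]], of "r ^ (M - 1)"]
 have 2: "has_d2 (\<lambda>s. r ^ (M - 1) * exp (-1 * \<phi> (\<gamma> s))) (- A * F (p, r))
   ((A^2 - (dd v (dd v \<phi>) (pt (p, r)) + dd (0, r *R a) \<phi> (pt (p, r)))) * F (p, r))"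
  by (simp add: F_def \<gamma>0 algebra_simps)
 obtain e where e: "e > 0" "\<And>s. \<bar>s\<bar> < e ==> p + s *R Y \<in> X" using line_in_X[OF p] by blast
 have "F ((p, r) + s *R (Y, 0)) = r ^ (M - 1) * exp (-1 * \<phi> (\<gamma> s))" if s: "\<bar>s\<bar> < e" for s
 proof -
  define p' where "p' = p + s *R Y"
  have p': "p' \<in> X" using e(2)[OF s] by (simp add: p'_def)
  have t': "fst p' \<in> U" "snd p' \<noteq> 0" using XD[OF p'] by auto
  have "(r * Rd p) *R bcurve p Y b s = cis (s * b) *s snd (pt (p', r))"
   using Rd_pos[OF p] by (simp add: bcurve_def pt_def p'_def scaleR_vec vector_smult_assoc mult_ac)
  then have \<gamma>s: "\<gamma> s = (fst p', cis (s * b) *s snd (pt (p', r)))" by (simp add: \<gamma>_def p'_def)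
  have "\<gamma> s \<in> W"
   using disc_W[OF t', of "cis (s * b) * of_real (r * Rd p')"] Rd_pos[OF p'] r
   unfolding \<gamma>s by (simp add: pt_def scaleR_vec vector_smult_assoc norm_mult Rd_def[symmetric] abs_mult mult_left_le_one_le)
  then have "\<phi> (\<gamma> s) = \<phi> (pt (p', r))"
   using invariance[of "fst p'" "snd (pt (p', r))" "s * b"] pt_W[OF p' r] unfolding \<gamma>s by (simp add: pt_def)
  then show ?thesis by (simp add: F_def p'_def)
 qed
 then show "dd (Y, 0) F (p, r) = - A * F (p, r)"
  ?g1
  using has_d2_unique[OF 1 2 e(1)] by blast+
qed

lemma dd_Kt:
 assumes p: "p \<in> X"
 shows "dd Y Kt p = (LINT r:{0..1}|lborel. dd (Y, 0) F (p, r))" (is ?g1)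
  "dd Y (dd Y Kt) p = (LINT r:{0..1}|lborel. dd (Y, 0) (dd (Y, 0) F) (p, r))" (is ?g2)
proof -
 note CF = Ck_2[OF Ck_F]
 have 1: "dd Y Kt q = (LINT r:{0..1}|lborel. dd (Y, 0) F (q, r))" if q: "q \<in> X" for q
  unfolding Kt_def by (rule dd_eq[OF has_derivative_integral_compact[OF openX openT' compact_Icc XT' CF q]])
 show ?g1 by (rule 1[OF p])
 have "dd Y (dd Y Kt) p = dd Y (\<lambda>q. LINT r:{0..1}|lborel. dd (Y, 0) F (q, r)) p"
  by (rule dd_cong[OF openX p 1])
 also have "\<dots> = (LINT r:{0..1}|lborel. dd (Y, 0) (dd (Y, 0) F) (p, r))"
  by (rule dd_eq[OF has_derivative_integral_compact[OF openX openT' compact_Icc XT' Ck_dd[OF CF] p]])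
 finally show ?g2 .
qed

lemma Lev_\<psi>_eq:
 assumes p: "p \<in> X"
 shows "4 * Lev \<psi> p V = - real M * (4 * Lev S p V)
   - (4 * Lev Kt p V / Kt p - ((dd V Kt p)^2 + (dd (cscale \<i> V) Kt p)^2) / (Kt p)^2)"
proof -
 have Cl: "Ck_on 2 (\<lambda>p. ln (Kt p)) X" by (rule Ck_ln_compose[OF openX Ck_Kt Kt_pos])
 have \<psi>: "\<psi> = (\<lambda>p. - real M * S p + (-1) * ln (Kt p))" by (rule ext) (rule \<psi>_def)
 have ln: "dd V (dd V (\<lambda>p. ln (Kt p))) p = dd V (dd V Kt) p / Kt p - (dd V Kt p / Kt p)^2" for V
  by (rule dd2_ln[OF openX Ck_Kt _ p]) (rule Kt_pos)
 have arith: "4 * ((- m * s + - 1 * (x - u) + (- m * s' + - 1 * (x' - u'))) / 4)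
   = - m * (4 * ((s + s') / 4)) - (x + x' - (u + u'))" for m s x u s' x' u' :: real by (simp add: field_simps)
 show ?thesis
  unfolding Lev_def \<psi> dd2_lincomb[OF openX Ck_S Cl p] ln arith
  by (simp add: add_divide_distrib power_divide)
qed

theorem Lev_\<psi>_pos:
 assumes p: "p \<in> X" and V: "\<not> (fst V = 0 \<and> (\<exists>c. snd V = c *s snd p))"
 shows "0 < Lev \<psi> p V"
proof -
 let ?iV = "cscale \<i> V"
 let ?SV = "dd V (dd V S) p" and ?SiV = "dd ?iV (dd ?iV S) p"
 let ?FV2 = "dd (V, 0) (dd (V, 0) F)" and ?FiV2 = "dd (?iV, 0) (dd (?iV, 0) F)"
 let ?I = "\<lambda>f. (I01 r. f r * F (p, r))"
 define t x where "t = fst p" and "x = snd p"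
 have tx: "t \<in> U" "x \<noteq> 0" using XD[OF p] by (auto simp: t_def x_def)
 define R where "R = Rd p"
 have R: "R > 0" using Rd_pos[OF p] by (simp add: R_def)
 define z where "z = R *R x"
 define a b where "a = dd V S p" and "b = dd ?iV S p"
 define h where "h = Complex a (- b)"
 have ih: "Complex b a = \<i> * h" by (simp add: h_def complex_eq_iff)
 define w where "w = R *R (snd V + h *s x)"
 define \<alpha> where "\<alpha> = (2 * h) *s snd V + h^2 *s x"
 define L where "L = 4 * Lev S p V"
 define X' where "X' = (\<lambda>r. pt (p, r))"
 have X'e: "X' r = (t, 0) + r *R (0, z)" for r
  by (simp add: X'_def pt_def t_def z_def x_def R_def)
 have X'W: "X' r \<in> W" if "0 \<le> r" "r \<le> 1" for r using pt_W[OF p that] by (simp add: X'_def)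
 define e :: "real => (complex^'n) \<times> (complex^'m)" where "e = (\<lambda>r. 0 + r *R (0, z))"
 have e_snd: "(0, snd (X' r)) = e r" for r by (simp add: e_def X'e)
 define v where "v = (\<lambda>r. (fst V, 0) + r *R (0, w))"
 define iv where "iv = (\<lambda>r. (\<i> *s fst V, 0) + r *R (0, \<i> *s w))"
 have iv: "cscale \<i> (v r) = iv r" for r by (simp add: v_def iv_def cscale_def vec_eq_iff)
 define D1 where "D1 = (\<lambda>a r. dd a \<phi> (X' r))"
 define D2 where "D2 = (\<lambda>a b r. dd a (dd b \<phi>) (X' r))"
 have l1: "linear (\<lambda>a. D1 a r)" if "0 \<le> r" "r \<le> 1" for r
  unfolding D1_def by (rule dd_linear[OF openW C2\<phi> X'W[OF that]])
 have l2: "linear (\<lambda>a. D2 a b r)" "linear (\<lambda>b. D2 a b r)" if "0 \<le> r" "r \<le> 1" for a b r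
  unfolding D2_def by (rule dd2_linear[OF openW \<phi>2 X'W[OF that]])+
 have cX': "cont01 X'" unfolding X'e by (intro continuous_intros)
 have c1: "cont01 (\<lambda>r. D1 (u + r *R u') r)" for u u'
 proof -
  have *: "cont01 (\<lambda>r. D1 a r)" for a
   unfolding D1_def by (rule continuous_on_compose2[OF Ck_continuous[OF Ck_dd[OF C2\<phi>]] cX']) (use X'W in auto)
  have "cont01 (\<lambda>r. D1 u r + r * D1 u' r)" by (intro continuous_intros *)
  then show ?thesis
   by (rule continuous_on_eq) (simp add: linear_add[OF l1] linear_scale[OF l1])
 qed
 have c2: "cont01 (\<lambda>r. D2 (u + r *R u') (y + r *R y') r)" for u u' y y'
 proof -
  have *: "cont01 (\<lambda>r. D2 a b r)" for a b
   unfolding D2_def by (rule continuous_on_compose2[OF Ck_continuous[OF Ck_dd[OF Ck_dd[OF C2\<phi>]]] cX']) (use X'W in auto)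
  have "cont01 (\<lambda>r. D2 u y r + r * D2 u y' r + r * (D2 u' y r + r * D2 u' y' r))" by (intro continuous_intros *)
  then show ?thesis
   by (rule continuous_on_eq)
    (simp add: linear_add[OF l2(1)] linear_scale[OF l2(1)] linear_add[OF l2(2)] linear_scale[OF l2(2)] algebra_simps)
 qed
 have d1: "((\<lambda>r. D1 (u + r *R u') r) has_real_derivative D2 (0, z) (u + r *R u') r + D1 u' r) (at r)"
  if "0 \<le> r" "r \<le> 1" for u u' r
  using dd_affine_derivative[OF openW \<phi>2, of "(t, 0)" r "(0, z)" u u'] X'W[OF that] unfolding D1_def D2_def X'e by simp
 define T where "T = (\<lambda>r. \<phi> (X' r))"
 define T1 where "T1 = (\<lambda>r. D1 (e r) r)"
 define T2 where "T2 = (\<lambda>r. D2 (e r) (e r) r + D1 (e r) r)"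
 define A where "A = (\<lambda>r. D1 (v r) r)"
 define A1 where "A1 = (\<lambda>r. D2 (e r) (v r) r + D1 (0 + r *R (0, w)) r)"
 define B where "B = (\<lambda>r. D1 (iv r) r)"
 define B1 where "B1 = (\<lambda>r. D2 (e r) (iv r) r + D1 (0 + r *R (0, \<i> *s w)) r)"
 define Q where "Q = (\<lambda>r. D2 (v r) (v r) r + D2 (iv r) (iv r) r + L * T1 r)"
 have s1: "D1 (0 + r *R a) r = r * D1 a r" and s2: "D2 (0 + r *R a) b r = r * D2 a b r" if "0 \<le> r" "r \<le> 1" for a b r
  using linear_scale[OF l1[OF that]] linear_scale[OF l2(1)[OF that]] by simp_all
 interpret P: radial_weight T T1 T2 "M - 1"
 proof
  show "cont01 T" unfolding T_def
   by (rule continuous_on_compose2[OF Ck_continuous[OF \<phi>2] cX']) (use X'W in auto)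
  show "cont01 T1" "cont01 T2"
   unfolding T1_def T2_def e_def by (intro continuous_intros c1 c2)+
  fix r :: real assume r: "0 < r" "r < 1"
  have r': "0 \<le> r" "r \<le> 1" using r by auto
  have "T1 r / r = D1 (0, z) r" using r unfolding T1_def e_def s1[OF r'] by simp
  then show "(T has_real_derivative T1 r / r) (at r)"
   using dd_line_derivative[OF openW C2\<phi>, of "(t, 0)" r "(0, z)"] X'W[OF r'] unfolding T_def D1_def X'e by simp
  have "T2 r / r = D2 (0, z) (e r) r + D1 (0, z) r" using r
   unfolding T2_def e_def s1[OF r'] s2[OF r'] by (simp add: add_divide_distrib)
  then show "(T1 has_real_derivative T2 r / r) (at r)" using d1[OF r', of 0 "(0, z)"] unfolding T1_def e_def by (simp only:)
 qed
 have \<omega>F: "P.\<omega> = (\<lambda>r. F (p, r))" unfolding P.\<omega>_def unfolding F_def T_def X'_def snd_conv ..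
 let ?qf = "\<lambda>r c d. Q r - L * T1 r + 2 * A1 r * c + 2 * B1 r * d + T2 r * (c^2 + d^2)"
 have LT: "4 * Lev \<phi> (X' r) (v r + cscale (Complex c (- d)) (e r)) = ?qf r c d"
  if r: "0 \<le> r" "r \<le> 1" for r c d
 proof -
  have s: "(0, snd (v r)) = 0 + r *R (0 :: complex^'n, w)" "(0, \<i> *s snd (v r)) = 0 + r *R (0 :: complex^'n, \<i> *s w)"
   by (simp_all add: v_def vec_eq_iff)
  show ?thesis
   using Lev_shift[OF X'W[OF r], of "v r" c d] unfolding e_snd s iv
   by (simp add: Q_def A1_def B1_def T2_def T1_def Lev_def iv D1_def D2_def algebra_simps)
 qed
 have "x \<noteq> 0" by (rule tx)
 have zn: "norm z > 0" using R \<open>x \<noteq> 0\<close> by (simp add: z_def)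
 have z_not: "z \<notin> D t" using bd_not[OF tx] by (simp add: z_def R_def Rd_def t_def x_def)
 have zr: "r2 < norm z"
 proof (rule ccontr)
  assume "\<not> r2 < norm z"
  then have le: "norm z / r2 \<le> 1" using r12 by (simp add: field_simps)
  have "norm ((r2 / norm z) *R z) = r2" using zn r12 by simp
  then have "(r2 / norm z) *R z \<in> D t" using shell[OF tx(1)] r12 by auto
  then have "(norm z / r2) *R (r2 / norm z) *R z \<in> D t"
   by (rule balanced_real[OF tx(1)]) (use le r12 in auto)
  then show False using z_not zn r12 by simp
 qed
 define r0 where "r0 = r2 / norm z"
 have r0: "0 < r0" "r0 \<le> 1" using zr r12 zn by (auto simp: r0_def)
 have shell0: "X' r0 \<in> U \<times> {z. r1 \<le> norm z \<and> norm z \<le> r2}"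
  using zn r12 tx by (auto simp: X'e r0_def)
 have "0 < (I01 r. Q r * P.\<omega> r) - wvar P.\<omega> A - wvar P.\<omega> B - real (Suc (M - 1)) * L * integral {0..1} P.\<omega>"
 proof (rule P.prekopa[of A A1 B B1 Q L r0])
  show "cont01 A" "cont01 A1" "cont01 B" "cont01 B1"
   "cont01 Q"
   unfolding A_def A1_def B_def B1_def Q_def T1_def v_def iv_def e_def by (intro continuous_intros c1 c2)+
  show "(A has_real_derivative A1 r / r) (at r)" "(B has_real_derivative B1 r / r) (at r)" if "0 < r" "r < 1" for r
  proof -
   have r': "0 \<le> r" "r \<le> 1" using that by auto
   have 1: "A1 r / r = D2 (0, z) (v r) r + D1 (0, w) r"
    using that unfolding A1_def e_def s1[OF r'] s2[OF r'] by (simp add: add_divide_distrib)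
   have 2: "B1 r / r = D2 (0, z) (iv r) r + D1 (0, \<i> *s w) r"
    using that unfolding B1_def e_def s1[OF r'] s2[OF r'] by (simp add: add_divide_distrib)
   show "(A has_real_derivative A1 r / r) (at r)" unfolding 1 A_def v_def by (rule d1[OF r'])
   show "(B has_real_derivative B1 r / r) (at r)" unfolding 2 B_def iv_def by (rule d1[OF r'])
  qed
  show "L \<le> 0" using Lev_S_nonpos[OF p] by (simp add: L_def)
  show "0 \<le> ?qf r c d" if "r \<in> {0..1}" for r c d
   using LT[of r c d] that Lev_nonneg_of_psh[OF openW \<phi>2 psh\<phi> X'W, of r "v r + cscale (Complex c (- d)) (e r)"] by simp
  show "0 < r0" "r0 \<le> 1" by (rule r0)+
  fix c d
  have "v r0 + cscale (Complex c (- d)) (e r0) \<noteq> 0"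
  proof
   assume 0: "v r0 + cscale (Complex c (- d)) (e r0) = 0"
   have "fst V = 0" using arg_cong[OF 0, of fst] by (simp add: v_def e_def cscale_def)
   moreover have "r0 *R (w + Complex c (- d) *s z) = 0"
    using arg_cong[OF 0, of snd] by (simp add: v_def e_def cscale_def scaleR_vec vector_add_ldistrib mult_ac)
   then have "w + Complex c (- d) *s z = 0" using r0 by simp
   then have "R *R (snd V + (h + Complex c (- d)) *s x) = 0"
    by (simp add: w_def z_def scaleR_vec vector_add_ldistrib vector_sadd_rdistrib mult_ac add_ac)
   then have "snd V + (h + Complex c (- d)) *s x = 0" using R unfolding scaleR_eq_0_iff by simp
   then have "snd V = (- (h + Complex c (- d))) *s x"
    unfolding vec_eq_iff by (simp add: eq_neg_iff_add_eq_0 algebra_simps)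
   ultimately show False using V unfolding x_def by blast
  qed
  then have "0 < Lev \<phi> (X' r0) (v r0 + cscale (Complex c (- d)) (e r0))"
   by (rule Lev_pos_of_strictly_psh[OF openW \<phi>2 X'W strict shell0, rotated -1]) (use r0 in auto)
  then show "0 < ?qf r0 c d" using LT[of r0 c d] r0 by simp
 qed
 then have pos: "0 < ?I Q - wvar (\<lambda>r. F (p, r)) A - wvar (\<lambda>r. F (p, r)) B - real M * L * Kt p"
  by (simp only: \<omega>F M_pos Kt_eq[OF p])
 have quot: "- m * l - ((a2 + b2 - q) / K - ((- a)^2 + (- b)^2) / K^2) = (q - (a2 - a^2 / K) - (b2 - b^2 / K) - m * l * K) / K"
  if "0 < K" for m l a2 b2 q a b K :: real
  using that by (simp add: field_simps power2_eq_square)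
 have cF: "cont01 (\<lambda>r. F (p, r))" by (rule cont_F[OF p])
 have cA: "cont01 A" "cont01 B" "cont01 Q"
  unfolding A_def B_def Q_def T1_def v_def iv_def e_def by (intro continuous_intros c1 c2)+
 let ?A2 = "\<lambda>r. ((A r)^2 - (D2 (v r) (v r) r + D1 (0, r *R R *R (\<alpha> + ?SV *R x)) r)) * F (p, r)"
 let ?B2 = "\<lambda>r. ((B r)^2 - (D2 (iv r) (iv r) r + D1 (0, r *R R *R (- \<alpha> + ?SiV *R x)) r)) * F (p, r)"
 have FA: "dd (V, 0) F (p, r) = - A r * F (p, r)"
  "?FV2 (p, r) = ?A2 r"
  if r: "0 \<le> r" "r \<le> 1" for r
 proof -
  have 1: "w = Rd p *R (snd V + Complex (dd V S p) (- b) *s snd p)"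
   by (simp add: w_def R_def x_def h_def a_def)
  have 2: "R *R (\<alpha> + ?SV *R x)
   = Rd p *R ((2 * Complex (dd V S p) (- b)) *s snd V + (Complex (dd V S p) (- b))^2 *s snd p + ?SV *R snd p)"
   by (simp add: \<alpha>_def R_def x_def h_def a_def)
  have 3: "v r = (fst V, r *R w)" by (simp add: v_def)
  note FS = F_second[OF p r 1 2 3 refl]
  show "dd (V, 0) F (p, r) = - A r * F (p, r)"
   using FS(1) unfolding A_def D1_def X'_def .
  show "?FV2 (p, r) = ?A2 r"
   using FS(2) unfolding A_def D1_def D2_def X'_def .
 qed
 have FB: "dd (?iV, 0) F (p, r) = - B r * F (p, r)"
  "?FiV2 (p, r) = ?B2 r"
  if r: "0 \<le> r" "r \<le> 1" for r
 proof -
  have 1: "\<i> *s w = Rd p *R (snd ?iV + Complex (dd ?iV S p) a *s snd p)"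
   unfolding b_def[symmetric] ih
   by (simp add: w_def R_def x_def cscale_def scaleR_vec vector_add_ldistrib vector_smult_assoc mult_ac)
  have 2: "R *R (- \<alpha> + ?SiV *R x)
   = Rd p *R ((2 * Complex (dd ?iV S p) a) *s snd ?iV + (Complex (dd ?iV S p) a)^2 *s snd p
     + ?SiV *R snd p)"
  proof -
   have "(2 * (\<i> * h)) *s snd ?iV + (\<i> * h)^2 *s x = - \<alpha>"
    by (simp add: \<alpha>_def cscale_def vec_eq_iff power2_eq_square algebra_simps)
   then show ?thesis unfolding b_def[symmetric] ih by (simp add: R_def x_def)
  qed
  have 3: "iv r = (fst ?iV, r *R (\<i> *s w))" by (simp add: iv_def cscale_def)
  note FS = F_second[OF p r 1 2 3 refl]
  show "dd (?iV, 0) F (p, r) = - B r * F (p, r)"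
   using FS(1) unfolding B_def D1_def X'_def .
  show "?FiV2 (p, r) = ?B2 r"
   using FS(2) unfolding B_def D1_def D2_def X'_def .
 qed
 have LI: "(LINT r:{0..1}|lborel. f r) = integral {0..1} g" if "\<And>r. r \<in> {0..1} ==> f r = g r" "cont01 g" for f g :: "real => real"
 proof -
  have "(LINT r:{0..1}|lborel. f r) = (LINT r:{0..1}|lborel. g r)" by (rule set_lebesgue_integral_cong) (use that in auto)
  then show ?thesis using set_integral_01[OF that(2)] by simp
 qed
 have KA: "dd V Kt p = - ?I A" "dd ?iV Kt p = - ?I B"
  unfolding dd_Kt(1)[OF p]
  by (subst LI[of _ "\<lambda>r. - (A r * F (p, r))"], use FA(1) in \<open>auto intro!: continuous_intros cA cF\<close>)
   (subst LI[of _ "\<lambda>r. - (B r * F (p, r))"], use FB(1) in \<open>auto intro!: continuous_intros cA cF\<close>)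
 have cdd: "cont01 (\<lambda>r. dd (Y, 0) (dd (Y, 0) F) (p, r))" for Y
 proof -
  note CF = Ck_2[OF Ck_F]
  show ?thesis
   by (rule continuous_on_compose2[OF Ck_continuous[OF Ck_dd[OF Ck_dd[OF CF]]]])
    (use XT' p in \<open>auto intro!: continuous_intros\<close>)
 qed
 have "4 * Lev Kt p V = (I01 r. ?FV2 (p, r)) + (I01 r. ?FiV2 (p, r))"
  unfolding Lev_def dd_Kt(2)[OF p] by (simp add: set_integral_01[OF cdd])
 also have "\<dots> = (I01 r. ?FV2 (p, r) + ?FiV2 (p, r))"
  by (rule integral_add[symmetric]) (intro integrable_continuous_interval cdd)+
 also have "\<dots> = (I01 r. (A r)^2 * F (p, r) + (B r)^2 * F (p, r) - Q r * F (p, r))"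
 proof (rule integral_cong)
  fix r :: real assume "r \<in> {0..1}"
  then have r: "0 \<le> r" "r \<le> 1" by auto
  have "D1 (0, r *R R *R (\<alpha> + c *R x)) r + D1 (0, r *R R *R (- \<alpha> + d *R x)) r = (c + d) * D1 (e r) r" for c d
  proof -
   have "(0, r *R R *R (\<alpha> + c *R x)) + (0, r *R R *R (- \<alpha> + d *R x)) = (c + d) *R e r"
    by (simp add: e_def z_def algebra_simps)
   then show ?thesis unfolding linear_add[OF l1[OF r], symmetric] by (simp only: linear_scale[OF l1[OF r]] real_scaleR_def)
  qed
  from this[of "?SV" "?SiV"]
  have "D1 (0, r *R R *R (\<alpha> + ?SV *R x)) r + D1 (0, r *R R *R (- \<alpha> + ?SiV *R x)) r = L * T1 r"
   by (simp add: L_def Lev_def T1_def)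
  then show "?FV2 (p, r) + ?FiV2 (p, r) = (A r)^2 * F (p, r) + (B r)^2 * F (p, r) - Q r * F (p, r)"
   unfolding FA(2)[OF r] FB(2)[OF r] by (simp add: Q_def algebra_simps) (simp add: distrib_left[symmetric])
 qed
 also have "\<dots> = ?I (\<lambda>r. (A r)^2) + ?I (\<lambda>r. (B r)^2) - ?I Q"
  by (subst integral_diff, (intro integrable_continuous_interval continuous_intros cA cF)+,
    subst integral_add, (intro integrable_continuous_interval continuous_intros cA cF)+, simp)
 finally have LK: "4 * Lev Kt p V = \<dots>" .
 have "4 * Lev \<psi> p V = (?I Q - wvar (\<lambda>r. F (p, r)) A - wvar (\<lambda>r. F (p, r)) B - real M * L * Kt p) / Kt p"
  unfolding Lev_\<psi>_eq[OF p] LK KA wvar_def Kt_eq[OF p, symmetric] L_def[symmetric]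
  by (rule quot[OF Kt_pos[OF p]])
 then show ?thesis using divide_pos_pos[OF pos Kt_pos[OF p]] by linarith
qed

end

section \<open>The metric as an integral over the annulus\<close>

abbreviation dt :: "'n::finite => ((complex^'n) \<times> (complex^'m) => complex) => (complex^'n) \<times> (complex^'m) => complex" where
 "dt j \<equiv> wirtinger (coord (Inl j))"

abbreviation dtb :: "'n::finite => ((complex^'n) \<times> (complex^'m) => complex) => (complex^'n) \<times> (complex^'m) => complex" where
 "dtb j \<equiv> wirtinger_bar (coord (Inl j))"

lemma dd_Pair1:
 assumes S: "open S" and f: "Ck_on (Suc k) f S" and x: "(t, x) \<in> S"
 shows "dd a (\<lambda>s. f (s, x)) t = dd (a, 0) f (t, x)"
 by (rule dd_eq[OF has_derivative_compose[of "\<lambda>s. (s, x)" "\<lambda>a. (a, 0)" _ _ f, OF _ Ck_deriv[OF S f x]]])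
  (auto intro!: derivative_eq_intros)

lemma dd_Pair2:
 assumes S: "open S" and f: "Ck_on (Suc k) f S" and x: "(t, x) \<in> S"
 shows "dd a (\<lambda>y. f (t, y)) x = dd (0, a) f (t, x)"
 by (rule dd_eq[OF has_derivative_compose[of "\<lambda>y. (t, y)" "\<lambda>a. (0, a)" _ _ f, OF _ Ck_deriv[OF S f x]]])
  (auto intro!: derivative_eq_intros)

lemma wirtinger_Pair:
 assumes S: "open S" and f: "Ck_on (Suc k) f S" and x: "(t, x) \<in> S"
 shows "dz j (\<lambda>s. f (s, x)) t = dt j f (t, x)"
  "dzb j (\<lambda>s. f (s, x)) t = dtb j f (t, x)"
  "dz b (\<lambda>y. f (t, y)) x = wirtinger (coord (Inr b)) f (t, x)"
  "dzb b (\<lambda>y. f (t, y)) x = wirtinger_bar (coord (Inr b)) f (t, x)"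
 unfolding wirtinger_def wirtinger_bar_def dd_Pair1[OF assms] dd_Pair2[OF assms] by simp_all

lemma wirtinger_snd:
 assumes "open S" "Ck_on (Suc k) c S" "snd q \<in> S"
 shows "dt j (\<lambda>q. c (snd q)) q = 0" (is ?g1) "dtb j (\<lambda>q. c (snd q)) q = 0" (is ?g2)
proof -
 have "dd (a, 0) (\<lambda>q. c (snd q)) q = dd 0 c (snd q)" for a
  by (rule dd_eq[OF has_derivative_compose[of snd snd _ _ c, OF _ Ck_deriv[OF assms], simplified], THEN trans])
   (auto intro!: derivative_eq_intros)
 then have "dd (a, 0) (\<lambda>q. c (snd q)) q = 0" for a by (simp add: linear_0[OF dd_linear[OF assms]])
 then show ?g1 ?g2
  by (simp_all add: wirtinger_def wirtinger_bar_def)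
qed

lemma wirtinger_integral:
 fixes F :: "(complex^'n) \<times> (complex^'m) => complex"
 assumes U: "open U" and T: "open T" and K: "compact K" and UK: "U \<times> K \<subseteq> T" and F: "Ck_on (Suc k) F T" and t: "t \<in> U"
 shows "dz j (\<lambda>t. LINT x:K|lborel. F (t, x)) t = (LINT x:K|lborel. dt j F (t, x))" (is ?g1)
  "dzb j (\<lambda>t. LINT x:K|lborel. F (t, x)) t = (LINT x:K|lborel. dtb j F (t, x))" (is ?g2)
proof -
 have d: "dd v (\<lambda>t. LINT x:K|lborel. F (t, x)) t = (LINT x:K|lborel. dd (v, 0) F (t, x))" for v
  by (rule dd_eq[OF has_derivative_integral_compact[OF U T K UK F t]])
 have i: "set_integrable lborel K (\<lambda>x. dd (v, 0) F (t, x))" for v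
  by (rule set_integrable_compact[OF K], rule continuous_on_compose2[OF Ck_continuous[OF Ck_dd[OF F]]])
   (use UK t in \<open>auto intro!: continuous_intros\<close>)
 show ?g1
  ?g2
  unfolding wirtinger_def wirtinger_bar_def d using i by (simp_all add: set_integral_diff set_integral_add)
qed

context weighted_family
begin

lemma L2_metric_eq:
 assumes t: "t \<in> U" and f: "BH k 0 f" and g: "BH k 0 g"
 shows "L2_metric \<Omega> \<phi> t f g = (LA x. f x * cnj (g x) * complex_of_real (exp (- \<psi> (t, x))))"
proof -
 let ?e = "\<lambda>x. complex_of_real (exp (- \<psi> (t, x)))"
 define c where "c = (\<lambda>z. f z * cnj (g z))"
 define G where "G = (\<lambda>z. indicator (D t) z *R (c z * complex_of_real (exp (- \<phi> (t, z)))))"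
 have L: "L2_metric \<Omega> \<phi> t f g = (LINT z|lborel. G z)"
  by (simp add: L2_metric_def set_lebesgue_integral_def G_def c_def)
 let ?f = "\<lambda>(x::complex^'m) u. (indicator ann x * indicator {0<..} u * u ^ (DIM(complex^'m) - 1)) *R G (u *R x)"
 have "integrable lborel G"
 proof -
  have cl: "compact (closure (D t))" using bdd[OF t] by (simp add: compact_closure)
  have "continuous_on (closure (D t)) (\<lambda>z. \<phi> (t, z))"
   by (rule continuous_on_compose2[OF Ck_continuous[OF \<phi>2]])
    (auto intro!: continuous_intros fiber_closure[OF nbhdW t])
  moreover have "continuous_on (closure (D t)) f" "continuous_on (closure (D t)) g"
   using Ck_continuous[OF BH_Ck[OF _ open_UNIV]] f g by (auto intro: continuous_on_subset)
  ultimately have "set_integrable lborel (closure (D t)) (\<lambda>z. c z * complex_of_real (exp (- \<phi> (t, z))))"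
   unfolding c_def by (intro set_integrable_compact[OF cl] continuous_intros)
  then have "set_integrable lborel (D t) (\<lambda>z. c z * complex_of_real (exp (- \<phi> (t, z))))"
   by (rule set_integrable_subset) (use openD closure_subset in auto)
  then show ?thesis by (simp add: set_integrable_def G_def)
 qed
 from integral_polar[OF this]
 have "L2_metric \<Omega> \<phi> t f g = (LINT x|lborel. (LINT u|lborel. ?f x u))"
  unfolding L by simp
 also have "\<dots> = (LINT x|lborel. indicator ann x *R (c x * ?e x))"
 proof (rule Bochner_Integration.integral_cong[OF refl])
  fix x :: "complex^'m"
  show "(LINT u|lborel. ?f x u)
   = indicator ann x *R (c x * ?e x)"
  proof (cases "x \<in> ann")
   case False
   then show ?thesis by simp
  next
   case True
   then have x0: "x \<noteq> 0" using ann_nz by blast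
   have p: "(t, x) \<in> X" using t x0 by (simp add: X_def)
   define R where "R = Rd (t, x)"
   have R: "R > 0" using Rd_pos[OF p] by (simp add: R_def)
   define H where "H = (\<lambda>u. indicator {0<..<R} u * (u ^ (M - 1) * exp (- \<phi> (t, u *R x))))"
   have "?f x u = c x * complex_of_real (H u)" for u
   proof (cases "0 < u")
    case False
    then show ?thesis by (simp add: H_def)
   next
    case u: True
    have mem: "u *R x \<in> D t \<longleftrightarrow> u < R" using Rad_iff[OF t x0, of u] u by (simp add: R_def Rd_def)
    have cs: "c (u *R x) = complex_of_real (u ^ (2 * k)) * c x"
     unfolding c_def scaleR_vec BH_scale[OF f] BH_scale[OF g] by (simp add: mult_2 power_add)
    have pw: "u ^ (M - 1) = u ^ (DIM(complex^'m) - 1) * u ^ (2 * k)"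
    proof -
     have "M - 1 = (DIM(complex^'m) - 1) + 2 * k" using zero_less_card_finite[where 'a='m] by (simp add: M_def)
     then show ?thesis by (simp only: power_add)
    qed
    have Gx: "G (u *R x) = indicator {0<..<R} u *R (c (u *R x) * complex_of_real (exp (- \<phi> (t, u *R x))))"
     unfolding G_def using mem u by (simp add: indicator_def)
    show ?thesis
     unfolding Gx cs H_def pw using True u
     by (cases "u < R") (simp_all add: scaleR_conv_of_real[where 'a=complex] del: DIM_cart)
   qed
   then have "(LINT u|lborel. ?f x u)
    = c x * complex_of_real (LINT u|lborel. H u)"
    by (simp only: integral_mult_right_zero integral_complex_of_real)
   also have "(LINT u|lborel. H u) = R * (LINT r|lborel. H (R * r))"
    using lborel_integral_real_affine[of R H 0] R by simp
   also have "(\<lambda>r. H (R * r)) = (\<lambda>r. R ^ (M - 1) * (indicator {0<..<1} r * F ((t, x), r)))"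
   proof
    fix r
    have "R * r \<in> {0<..<R} \<longleftrightarrow> r \<in> {0<..<1}" using R by (auto simp: zero_less_mult_iff)
    then show "H (R * r) = R ^ (M - 1) * (indicator {0<..<1} r * F ((t, x), r))"
     by (simp add: H_def F_def pt_def R_def[symmetric] indicator_def power_mult_distrib mult_ac del: greaterThanLessThan_iff)
   qed
   also have "(LINT r|lborel. R ^ (M - 1) * (indicator {0<..<1} r * F ((t, x), r))) = R ^ (M - 1) * (LINT r:{0<..<1}|lborel. F ((t, x), r))"
    by (simp add: set_lebesgue_integral_def)
   also have "(LINT r:{0<..<1}|lborel. F ((t, x), r)) = Kt (t, x)"
    unfolding Kt_def by (rule set_integral_discrete_difference[of "{0, 1}"]) auto
   also have "R * (R ^ (M - 1) * Kt (t, x)) = exp (- \<psi> (t, x))"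
   proof -
    have "exp (- \<psi> (t, x)) = exp (real M * ln R) * Kt (t, x)"
     using Kt_pos[OF p] by (simp add: \<psi>_def S_def R_def exp_add)
    also have "exp (real M * ln R) = R ^ M" using R by (simp add: exp_of_nat_mult)
    also have "\<dots> = R * R ^ (M - 1)" using M_pos(1) by (metis power_Suc)
    finally show ?thesis by simp
   qed
   finally show ?thesis using True by simp
  qed
 qed
 finally show ?thesis unfolding set_lebesgue_integral_def c_def .
qed

lemma weight_\<psi>:
 assumes t: "t \<in> U" shows "weight (\<lambda>x. \<psi> (t, x)) k"
proof
 have tX: "(\<lambda>x. (t, x)) ` (-{0}) \<subseteq> X" using t by (auto simp: X_def)
 show "Ck_on 2 (\<lambda>x. \<psi> (t, x)) (-{0})"
  by (rule Ck_compose[OF open_nz openX tX _ Ck_\<psi>]) (intro Ck_Pair Ck_const Ck_id open_nz)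
 fix c :: complex and z :: "complex^'m" assume "c \<noteq> 0" "z \<noteq> 0"
 then show "\<psi> (t, c *s z) = \<psi> (t, z) + 2 * real (k + CARD('m)) * ln (norm c)"
  using \<psi>_scale[of t z c] t by (simp add: X_def M_def)
qed

definition Fh where "Fh f g = (\<lambda>q. (f (snd q) * cnj (g (snd q))) * complex_of_real (exp (- \<psi> q)))"

lemma Ck_Fh:
 assumes f: "BH k 0 f" and g: "BH k 0 g" shows "Ck_on 2 (Fh f g) X"
proof -
 have Cs: "Ck_on 2 (\<lambda>q. f (snd q)) X" if "BH k 0 f" for f
  by (rule Ck_compose[OF openX open_UNIV _ Ck_snd[OF openX Ck_id[OF openX]] BH_Ck[OF that open_UNIV]]) simp
 then show ?thesis unfolding Fh_def
  by (intro Ck_mult Ck_cnj Ck_of_real Ck_exp_compose Ck_minus openX Ck_\<psi> Cs[OF f] Cs[OF g])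
qed

lemma UX: "U \<times> ann \<subseteq> X" using ann_nz by (auto simp: X_def)

lemma Ck_L2_metric:
 assumes f: "BH k 0 f" and g: "BH k 0 g" shows "Ck_on 2 (\<lambda>t. L2_metric \<Omega> \<phi> t f g) U"
 by (rule Ck_cong[OF U Ck_integral[OF U openX compact_ann UX Ck_Fh[OF f g]]])
  (simp add: L2_metric_eq f g Fh_def)

abbreviation "\<psi>C \<equiv> (\<lambda>q. complex_of_real (\<psi> q))"

lemma Ck_\<psi>C: "Ck_on (Suc (Suc 0)) \<psi>C X"
 using Ck_of_real[OF openX Ck_\<psi>] by (simp only: numeral_2_eq_2)

lemma wirtinger_Fh:
 assumes f: "BH k 0 f" and g: "BH k 0 g" and q: "q \<in> X"
 shows "dt j (Fh f g) q = - dt j \<psi>C q * Fh f g q" (is ?g1)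
  "dtb j (Fh f g) q = - dtb j \<psi>C q * Fh f g q" (is ?g2)
proof -
 define c where "c = (\<lambda>x. f x * cnj (g x))"
 have c: "Ck_on (Suc 0) c UNIV" unfolding c_def by (intro Ck_mult Ck_cnj open_UNIV BH_Ck[OF f] BH_Ck[OF g])
 have cs: "Ck_on (Suc 0) (\<lambda>q. c (snd q)) X"
  by (rule Ck_compose[OF openX open_UNIV _ Ck_snd[OF openX Ck_id[OF openX]] c]) simp
 have P: "Ck_on (Suc 0) \<psi> X" using Ck_mono[OF Ck_\<psi>, of "Suc 0"] by simp
 have e: "Ck_on (Suc 0) (\<lambda>q. complex_of_real (exp (- \<psi> q))) X"
  by (intro Ck_of_real Ck_exp_compose Ck_minus openX P)
 have F: "Fh f g = (\<lambda>q. c (snd q) * complex_of_real (exp (- \<psi> q)))" by (simp add: Fh_def c_def)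
 show ?g1
  ?g2
  unfolding F wirtinger_mult[OF openX cs e q] wirtinger_snd[OF open_UNIV c UNIV_I] wirtinger_exp_minus[OF openX P q] by simp_all
qed

lemma wirtinger_L2_metric:
 assumes f: "BH k 0 f" and g: "BH k 0 g" and t: "t \<in> U"
 shows "dz j (\<lambda>s. L2_metric \<Omega> \<phi> s f g) t
  = (LA x. - dt j \<psi>C (t, x) * Fh f g (t, x))"
proof -
 have C: "Ck_on (Suc (Suc 0)) (Fh f g) X" using Ck_Fh[OF f g] by (simp only: numeral_2_eq_2)
 have "dz j (\<lambda>s. L2_metric \<Omega> \<phi> s f g) t = dz j (\<lambda>s. LA x. Fh f g (s, x)) t"
  by (rule wirtinger_cong(1)[OF U t]) (simp add: L2_metric_eq f g Fh_def)
 also have "\<dots> = (LA x. dt j (Fh f g) (t, x))"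
  by (rule wirtinger_integral(1)[OF U openX compact_ann UX C t])
 also have "\<dots> = (LA x. - dt j \<psi>C (t, x) * Fh f g (t, x))"
  by (rule integral_ann_cong) (use wirtinger_Fh(1)[OF f g] t in \<open>auto simp: X_def\<close>)
 finally show ?thesis .
qed

lemma wirtinger2_L2_metric:
 assumes f: "BH k 0 f" and g: "BH k 0 g" and t: "t \<in> U"
 shows "dzb l (dz j (\<lambda>s. L2_metric \<Omega> \<phi> s f g)) t
  = (LA x. (dt j \<psi>C (t, x) * dtb l \<psi>C (t, x)
    - dt j (dtb l \<psi>C) (t, x)) * Fh f g (t, x))"
proof -
 define F' where "F' = (\<lambda>q. - dt j \<psi>C q * Fh f g q)"
 have C: "Ck_on (Suc 0) (Fh f g) X" using Ck_mono[OF Ck_Fh[OF f g], of "Suc 0"] by simp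
 have Cw: "Ck_on (Suc 0) (dt j \<psi>C) X" by (rule Ck_wirtinger(1)[OF openX Ck_\<psi>C])
 have Cm: "Ck_on (Suc 0) (\<lambda>q. - dt j \<psi>C q) X" by (rule Ck_minus[OF openX Cw])
 have CF: "Ck_on (Suc 0) F' X" unfolding F'_def by (rule Ck_mult[OF openX Cm C])
 have "dzb l (dz j (\<lambda>s. L2_metric \<Omega> \<phi> s f g)) t
   = dzb l (\<lambda>s. LA x. F' (s, x)) t"
  by (rule wirtinger_cong(2)[OF U t]) (simp add: wirtinger_L2_metric f g F'_def)
 also have "\<dots> = (LA x. dtb l F' (t, x))"
  by (rule wirtinger_integral(2)[OF U openX compact_ann UX CF t])
 also have "\<dots> = (LA x. (dt j \<psi>C (t, x) * dtb l \<psi>C (t, x)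
    - dt j (dtb l \<psi>C) (t, x)) * Fh f g (t, x))"
 proof (rule integral_ann_cong)
  fix x :: "complex^'m" assume "x \<noteq> 0"
  then have q: "(t, x) \<in> X" using t by (simp add: X_def)
  have com: "dtb l (dt j \<psi>C) (t, x) = dt j (dtb l \<psi>C) (t, x)"
   by (rule wirtinger_commute(1)[OF openX _ q, symmetric]) (use Ck_\<psi>C in \<open>simp only: numeral_2_eq_2\<close>)
  show "dtb l F' (t, x) = (dt j \<psi>C (t, x) * dtb l \<psi>C (t, x)
    - dt j (dtb l \<psi>C) (t, x)) * Fh f g (t, x)"
   unfolding F'_def wirtinger_mult(2)[OF openX Cm C q] wirtinger_minus(2)[OF openX Cw q] wirtinger_Fh(2)[OF f g q] com
   by (simp add: algebra_simps)
 qed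
 finally show ?thesis .
qed

end

section \<open>Nakano positivity\<close>

lemma BH_eq_0:
 assumes f: "BH k 0 f" and z: "\<And>x. 1 < norm x ==> norm x < exp 1 ==> f (x :: complex^'m) = 0"
 shows "f = (\<lambda>x. 0)"
proof
 have e: "(2::real) \<le> exp 1" using exp_ge_add_one_self[of 1] by simp
 have 1: "f y = 0" if "norm y = 3 / 2" for y using z[of y] that e by simp
 fix x :: "complex^'m"
 show "f x = 0"
 proof (cases "x = 0")
  case True
  define y :: "complex^'m" where "y = of_real (3 / 2) *s axis undefined 1"
  have "norm y = 3 / 2" unfolding y_def norm_cmult_vec norm_of_real by (simp add: norm_axis_1)
  then show ?thesis using 1[of y] BH_scale[OF f, of 0 y] True by simp
 next
  case False
  define y where "y = of_real (3 / (2 * norm x)) *s x"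
  have "norm y = 3 / 2" using False unfolding y_def norm_cmult_vec norm_of_real by simp
  moreover have "x = of_real (2 * norm x / 3) *s y" using False by (simp add: y_def vector_smult_assoc flip: of_real_mult)
  ultimately show ?thesis using 1[of y] BH_scale[OF f, of "of_real (2 * norm x / 3)" y] by simp
 qed
qed

lemma sum_Plus_UNIV: "(\<Sum>a\<in>(UNIV :: ('n::finite + 'm::finite) set). g a) = (\<Oplus>j. g (Inl j)) + (\<Oplus>k. g (Inr k))"
 unfolding UNIV_Plus_UNIV[symmetric] Plus_def by (subst sum.union_disjoint) (auto simp: sum.reindex)

context weighted_family
begin

definition H where "H a b q = wirtinger (coord a) (wirtinger_bar (coord b) \<psi>C) q"

lemma Ck_H: "continuous_on X (H a b)"
 using Ck_wirtinger(1)[OF openX Ck_wirtinger(2)[OF openX Ck_\<psi>C]] unfolding H_def[abs_def] by (simp add: Ck_on.simps(1))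

lemma H_herm:
 assumes q: "q \<in> X" shows "H b a q = cnj (H a b q)"
proof -
 have C2: "Ck_on 2 \<psi>C X" using Ck_\<psi>C by (simp only: numeral_2_eq_2)
 have C1: "Ck_on (Suc 0) \<psi> X" using Ck_mono[OF Ck_\<psi>, of "Suc 0"] by simp
 have "H b a q = wirtinger_bar (coord a) (wirtinger (coord b) \<psi>C) q"
  unfolding H_def by (rule wirtinger_commute(1)[OF openX C2 q])
 also have "\<dots> = wirtinger_bar (coord a) (\<lambda>q. cnj (wirtinger_bar (coord b) \<psi>C q)) q"
  by (rule wirtinger_cong(2)[OF openX q]) (rule wirtinger_of_real[OF openX C1])
 also have "\<dots> = cnj (H a b q)"
  unfolding H_def by (rule wirtinger_cnj(2)[OF openX Ck_wirtinger(2)[OF openX Ck_\<psi>C] q])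
 finally show ?thesis .
qed

lemma Lev_form:
 assumes q: "q \<in> X"
 shows "complex_of_real (Lev \<psi> q V) = (\<Oplus>a b. H a b q
   * (case a of Inl j => fst V $ j | Inr k => snd V $ k) * cnj (case b of Inl j => fst V $ j | Inr k => snd V $ k))"
 using hessian_form[OF openX Ck_\<psi> q, of "\<lambda>a. case a of Inl j => fst V $ j | Inr k => snd V $ k"]
 unfolding coord_expansion by (simp add: H_def complex_hessian_def)

lemma Lev_lower_bound:
 assumes t: "t \<in> U"
 obtains e where "e > 0"
  "\<And>x V. x \<in> ann ==> (\<Oplus>b. cnj (x $ b) * snd V $ b) = 0 ==> e * (norm V)^2 \<le> Lev \<psi> (t, x) V"
proof -
 define w where "w = (\<lambda>(a :: 'n + 'm) (V :: (complex^'n) \<times> (complex^'m)). case a of Inl j => fst V $ j | Inr k => snd V $ k)"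
 define K where "K = (ann \<times> sphere 0 1) \<inter> {q :: (complex^'m) \<times> ((complex^'n) \<times> (complex^'m)). (\<Oplus>b. cnj (fst q $ b) * snd (snd q) $ b) = 0}"
 have K: "compact K" unfolding K_def
  by (intro compact_Int_closed compact_Times compact_ann compact_sphere closed_Collect_eq continuous_intros)
 have KX: "(t, fst q) \<in> X" if "q \<in> K" for q using that t ann_nz[of "fst q"] by (auto simp: K_def X_def)
 have wc: "continuous_on K (\<lambda>q. w a (snd q))" for a
  by (cases a) (auto simp: w_def intro!: continuous_intros)
 have Hc: "continuous_on K (\<lambda>q. H a b (t, fst q))" for a b
  by (rule continuous_on_compose2[OF Ck_H]) (use KX in \<open>auto intro!: continuous_intros\<close>)
 have eq: "Lev \<psi> (t, x) V = Re (\<Oplus>a b. H a b (t, x) * w a V * cnj (w b V))" if "(t, x) \<in> X" for x V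
  using Lev_form[OF that, of V] unfolding w_def by (metis Re_complex_of_real)
 have "continuous_on K (\<lambda>q. Re (\<Oplus>a b. H a b (t, fst q) * w a (snd q) * cnj (w b (snd q))))"
  by (intro continuous_intros Hc wc)
 then have c: "continuous_on K (\<lambda>q. Lev \<psi> (t, fst q) (snd q))"
  by (rule continuous_on_eq) (use eq KX in auto)
 have pos: "0 < Lev \<psi> (t, fst q) (snd q)" if q: "q \<in> K" for q
 proof (rule Lev_\<psi>_pos[OF KX[OF q]], safe)
  fix c assume c: "fst (snd q) = 0" "snd (snd q) = c *s snd (t, fst q)"
  have "0 = (\<Oplus>b. cnj (fst q $ b) * snd (snd q) $ b)" using q by (simp add: K_def)
  also have "\<dots> = c * complex_of_real ((norm (fst q))^2)"
   using c(2) by (simp add: norm_vec_def L2_set_def sum_nonneg complex_norm_square sum_distrib_left mult_ac del: of_real_power)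
  finally have "c = 0 \<or> fst q = 0" by auto
  then have "snd q = 0" using c q ann_nz by (auto simp: K_def prod_eq_iff)
  then show False using q by (auto simp: K_def)
 qed
 obtain e where e: "e > 0" "\<And>q. q \<in> K ==> e \<le> Lev \<psi> (t, fst q) (snd q)"
 proof (cases "K = {}")
  case True
  then show ?thesis using that[of 1] by simp
 next
  case False
  then obtain q0 where "q0 \<in> K" "\<And>q. q \<in> K ==> Lev \<psi> (t, fst q0) (snd q0) \<le> Lev \<psi> (t, fst q) (snd q)"
   using continuous_attains_inf[OF K _ c] by blast
  then show ?thesis using that pos by blast
 qed
 show thesis
 proof (rule that[OF e(1)])
  fix x :: "complex^'m" and V :: "(complex^'n) \<times> (complex^'m)"
  assume x: "x \<in> ann" and V: "(\<Oplus>b. cnj (x $ b) * snd V $ b) = 0"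
  have q: "(t, x) \<in> X" using x t ann_nz[OF x] by (auto simp: X_def)
  show "e * (norm V)^2 \<le> Lev \<psi> (t, x) V"
  proof (cases "V = 0")
   case True
   then show ?thesis using Lev_scale[OF openX Ck_\<psi> q, of 0 V] by (simp add: cscale_def zero_prod_def)
  next
   case False
   define V' where "V' = cscale (of_real (1 / norm V)) V"
   have V': "V = cscale (of_real (norm V)) V'" using False by (simp add: V'_def flip: of_real_mult)
   have "norm V' = 1" using False unfolding V'_def norm_cscale norm_of_real by simp
   moreover have "(\<Oplus>b. cnj (x $ b) * snd V' $ b) = 0"
   proof -
    have "(\<Oplus>b. cnj (x $ b) * snd V' $ b) = of_real (1 / norm V) * (\<Oplus>b. cnj (x $ b) * snd V $ b)"
     unfolding V'_def cscale_def sum_distrib_left by (intro sum.cong refl) (simp only: snd_conv vector_smult_component mult.left_commute)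
    then show ?thesis using V by simp
   qed
   ultimately have "e \<le> Lev \<psi> (t, x) V'" using e(2)[of "(x, V')"] x by (simp add: K_def)
   then have "(norm V)^2 * e \<le> (norm V)^2 * Lev \<psi> (t, x) V'" by (intro mult_left_mono) auto
   also have "\<dots> = Lev \<psi> (t, x) (cscale (of_real (norm V)) V')"
    unfolding Lev_scale[OF openX Ck_\<psi> q] by simp
   finally show ?thesis using V' by (simp add: mult.commute)
  qed
 qed
qed

lemma Ck_slice: "t \<in> U ==> Ck_on j f X ==> Ck_on j (\<lambda>x. f (t, x)) (-{0})"
 by (rule Ck_compose[OF open_nz openX, of "\<lambda>x. (t, x)" j f])
  (auto simp: X_def intro!: Ck_Pair Ck_const Ck_id open_nz simp del: Ck_on.simps)

lemma Ck_slice1: "x \<noteq> 0 ==> Ck_on j f X ==> Ck_on j (\<lambda>s. f (s, x)) U"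
 by (rule Ck_compose[OF U openX, of "\<lambda>s. (s, x)" j f])
  (auto simp: X_def intro!: Ck_Pair Ck_const Ck_id U simp del: Ck_on.simps)

lemma wirtinger_\<psi>_invariant:
 assumes t: "t \<in> U" and x: "x \<noteq> 0" and c: "c \<noteq> 0"
 shows "dt j \<psi>C (t, c *s x) = dt j \<psi>C (t, x)"
proof -
 have q: "(s, x) \<in> X \<and> (s, c *s x) \<in> X" if "s \<in> U" for s using that x c by (auto simp: X_def vec_eq_iff)
 note P = wirtinger_Pair(1)[OF openX Ck_\<psi>C]
 have "dz j (\<lambda>s. \<psi>C (s, c *s x)) t
   = dz j (\<lambda>s. \<psi>C (s, x) + complex_of_real (real M * ln (norm c))) t"
  by (rule wirtinger_cong(1)[OF U t]) (use \<psi>_scale c q in auto)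
 also have "\<dots> = dz j (\<lambda>s. \<psi>C (s, x)) t"
  unfolding wirtinger_add(1)[OF U Ck_slice1[OF x Ck_\<psi>C] Ck_const t] by simp
 finally show ?thesis using P q[OF t] by simp
qed

lemma hermitian_L2_metric:
 assumes t: "t \<in> U"
 shows "hermitian_inner_product {f. BH k 0 f} (L2_metric \<Omega> \<phi> t)"
proof -
 interpret w: weight "\<lambda>x. \<psi> (t, x)" k by (rule weight_\<psi>[OF t])
 have ip: "L2_metric \<Omega> \<phi> t f g = w.ip f g" if "BH k 0 f" "BH k 0 g" for f g
  unfolding L2_metric_eq[OF t that] w.ip_def w.wt_def ..
 have Vc: "f \<in> Vc" if "BH k 0 f" for f
  using Ck_continuous[OF BH_Ck[OF that open_nz]] by (simp add: Vc_def)
 show ?thesis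
  unfolding hermitian_inner_product_def
 proof (intro conjI ballI allI impI; clarify?)
  fix f f' g :: "complex^'m => complex" and a b assume f: "BH k 0 f" "BH k 0 f'" "BH k 0 g"
  have "BH k 0 (\<lambda>x. a * f x + b * f' x)" by (intro BH_add BH_cmult f)
  then show "L2_metric \<Omega> \<phi> t (\<lambda>x. a * f x + b * f' x) g = a * L2_metric \<Omega> \<phi> t f g + b * L2_metric \<Omega> \<phi> t f' g"
   using f by (simp add: ip w.ipS.Eadd w.ipS.Emul w.ipS.Vmul Vc)
 next
  fix f g :: "complex^'m => complex" assume "BH k 0 f" "BH k 0 g"
  then show "L2_metric \<Omega> \<phi> t g f = cnj (L2_metric \<Omega> \<phi> t f g)"
   by (simp add: ip) (rule w.ipS.Eherm[OF Vc Vc])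
 next
  fix f :: "complex^'m => complex" assume f: "BH k 0 f" and ne: "f \<noteq> (\<lambda>x. 0)"
  let ?F = "\<lambda>x. (norm (f x))^2 * exp (- \<psi> (t, x))"
  have re: "Re (L2_metric \<Omega> \<phi> t f f) = (LA x. ?F x)" unfolding ip[OF f f] w.ip_real ..
  have nn: "0 \<le> Re (L2_metric \<Omega> \<phi> t f f)" unfolding ip[OF f f] by (rule w.ipS.Epos[OF Vc[OF f]])
  show "0 < Re (L2_metric \<Omega> \<phi> t f f)"
  proof (rule ccontr)
   assume "\<not> 0 < Re (L2_metric \<Omega> \<phi> t f f)"
   then have I0: "(LA x. ?F x) = 0" using nn re by simp
   have cF: "continuous_on (-{0}) ?F"
    using Vc[OF f] Ck_continuous[OF Ck_slice[OF t Ck_\<psi>]] by (auto simp: Vc_def intro!: continuous_intros)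
   have "f = (\<lambda>x. 0)"
   proof (rule BH_eq_0[OF f])
    fix x :: "complex^'m" assume "1 < norm x" "norm x < exp 1"
    from continuous_ann_integral_eq_0[OF cF _ I0 this] show "f x = 0" by simp
   qed
   then show False using ne by simp
  qed
 qed
qed

lemma BH_eq_cspan: "{f :: complex^'m => complex. BH k 0 f} = cspan (monset k 0)"
 using BH_cspan by blast

lemma trivial_bundle_L2: "trivial_bundle U (monset k 0) (L2_metric \<Omega> \<phi>)"
proof
 show "open U" by (rule U)
 show "finite (monset k 0 :: (complex^'m => complex) set)" by (rule finite_monset)
 show "hermitian_inner_product (cspan (monset k 0)) (L2_metric \<Omega> \<phi> s)" if "s \<in> U" for s
  using hermitian_L2_metric[OF that] unfolding BH_eq_cspan .
 show "Ck_on 2 (\<lambda>s. L2_metric \<Omega> \<phi> s f g) U" if "f \<in> cspan (monset k 0)" "g \<in> cspan (monset k 0)" for f g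
  using Ck_L2_metric that unfolding BH_cspan[symmetric] by blast
qed

theorem hermitian_bundle_L2: "hermitian_bundle U (homogeneous_polys k) (L2_metric \<Omega> \<phi>)"
 unfolding hermitian_bundle_def
proof (intro conjI ballI)
 show "finite_dim_function_space (homogeneous_polys k :: (complex^'m => complex) set)"
  unfolding finite_dim_function_space_def homogeneous_polys_BH BH_eq_cspan cspan_def
  by (intro exI[of _ "monset k 0"] conjI finite_monset refl)
qed (use hermitian_L2_metric Ck_L2_metric in \<open>auto simp: homogeneous_polys_BH\<close>)

theorem nakano_positive_L2: "nakano_positive U (homogeneous_polys k) (L2_metric \<Omega> \<phi>)"
 unfolding nakano_positive_def homogeneous_polys_BH Let_def
proof (intro ballI allI impI)
 fix t and u :: "'n => complex^'m => complex"
 assume t: "t \<in> U" and "(\<forall>j. u j \<in> {f. BH k 0 f}) \<and> (\<exists>j. u j \<noteq> (\<lambda>x. 0))"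
 then have u: "\<And>j. BH k 0 (u j)" and "\<exists>j. u j \<noteq> (\<lambda>x. 0)" by auto
 then obtain j0 where j0: "u j0 \<noteq> (\<lambda>x. 0)" by blast
 let ?h = "L2_metric \<Omega> \<phi>"
 let ?q = "\<Oplus>j l. ?h t (chern_curvature U {f. BH k 0 f} ?h j l (\<lambda>_. u j) t) (u l)"
 interpret tb: trivial_bundle U "monset k 0" ?h by (rule trivial_bundle_L2)
 interpret w: weight "\<lambda>x. \<psi> (t, x)" k by (rule weight_\<psi>[OF t])
 have uV: "u j \<in> cspan (monset k 0)" for j using u BH_cspan by blast
 obtain p where p: "p \<in> cspan (monset k 0)"
  and hp: "\<And>f. f \<in> cspan (monset k 0) ==> ?h t p f = (\<Oplus>j. dz j (\<lambda>s. ?h s (u j) f) t)"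
  and q: "?q = ?h t p p - (\<Oplus>j l. dzb l (dz j (\<lambda>s. ?h s (u j) (u l))) t)"
  using tb.nakano_form[OF t, of u] uV unfolding BH_eq_cspan by blast
 have pB: "BH k 0 p" using p BH_cspan by blast
 define \<psi>j where "\<psi>j = (\<lambda>j x. dt j \<psi>C (t, x))"
 define \<psi>jl where "\<psi>jl = (\<lambda>j l x. H (Inl j) (Inl l) (t, x))"
 define \<omega> where "\<omega> = (\<lambda>x. \<Oplus>j. \<psi>j j x * u j x)"
 define G where "G = (\<lambda>x. \<Oplus>j l. \<psi>jl j l x * u j x * cnj (u l x))"
 have X: "(t, x) \<in> X" if "x \<noteq> 0" for x using that t by (simp add: X_def)
 have C\<psi>j: "Ck_on (Suc 0) (\<psi>j j) (-{0})" for j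
  unfolding \<psi>j_def by (rule Ck_slice[OF t Ck_wirtinger(1)[OF openX Ck_\<psi>C]])
 have c\<psi>j: "continuous_on (-{0}) (\<psi>j j)" for j by (rule Ck_continuous[OF C\<psi>j])
 have c\<psi>jl: "continuous_on (-{0}) (\<psi>jl j l)" for j l
  unfolding \<psi>jl_def by (rule continuous_on_compose2[OF Ck_H]) (use X in \<open>auto intro!: continuous_intros\<close>)
 have cB: "continuous_on (-{0}) f" if "BH k 0 f" for f :: "complex^'m => complex"
  by (rule Ck_continuous[OF BH_Ck[OF that open_nz]])
 have cwt: "continuous_on (-{0}) w.wt"
  unfolding w.wt_def[abs_def] using Ck_continuous[OF w.P2] by (intro continuous_intros)
 have int: "set_integrable lborel ann F" if "continuous_on (-{0}) F" for F :: "complex^'m => complex"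
  by (rule Ck_integrable_ann[of 0]) (simp add: that)
 have C\<omega>: "Ck_on (Suc 0) \<omega> (-{0})" unfolding \<omega>_def
  by (intro Ck_sum Ck_mult C\<psi>j BH_Ck[OF u] open_nz)
 have c\<omega>: "continuous_on (-{0}) \<omega>" by (rule Ck_continuous[OF C\<omega>])
 have cG: "continuous_on (-{0}) G" unfolding G_def by (intro continuous_intros c\<psi>jl cB u)
 have \<psi>jb: "dtb l \<psi>C (t, x) = cnj (\<psi>j l x)" if "x \<noteq> 0" for l x
 proof -
  have C1: "Ck_on (Suc 0) \<psi> X" using Ck_mono[OF Ck_\<psi>, of "Suc 0"] by simp
  show ?thesis unfolding \<psi>j_def wirtinger_of_real[OF openX C1 X[OF that]] by simp
 qed
 have hip: "?h t f g = w.ip f g" if "BH k 0 f" "BH k 0 g" for f g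
  unfolding L2_metric_eq[OF t that] w.ip_def w.wt_def ..
 have Fh: "Fh f g (t, x) = f x * cnj (g x) * w.wt x" for f g x by (simp add: Fh_def w.wt_def)
 have \<omega>V: "\<omega> \<in> Vc" using c\<omega> by (simp add: Vc_def)
 have pV: "p \<in> Vc" using cB[OF pB] by (simp add: Vc_def)
 have wp: "w.ip p f = - w.ip \<omega> f" if f: "BH k 0 f" for f
 proof -
  have "w.ip p f = (\<Oplus>j. dz j (\<lambda>s. ?h s (u j) f) t)"
   using hp[of f] f BH_cspan[of k 0 f] unfolding hip[OF pB f] by simp
  also have "\<dots> = (\<Oplus>j. LA x. - \<psi>j j x * Fh (u j) f (t, x))"
   unfolding wirtinger_L2_metric[OF u f t] \<psi>j_def ..
  also have "\<dots> = (LA x. \<Oplus>j. - \<psi>j j x * Fh (u j) f (t, x))"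
   unfolding Fh by (rule set_integral_sum[symmetric]) (auto intro!: int continuous_intros c\<psi>j cB[OF u] cB[OF f] cwt)
  also have "\<dots> = (LA x. - (\<omega> x * cnj (f x) * w.wt x))"
   by (rule integral_ann_cong) (simp add: \<omega>_def Fh sum_distrib_right sum_negf mult.assoc)
  also have "\<dots> = - w.ip \<omega> f" unfolding w.ip_def by (simp add: set_lebesgue_integral_def)
  finally show ?thesis .
 qed
 define pc where "pc = (\<lambda>x. if x = 0 then 0 else - p x)"
 define v where "v = (\<lambda>x. \<omega> x - pc x)"
 have "BH (k + 0) 0 (\<lambda>x. - 1 * p x)" using BH_cmult[OF pB, of "-1"] by (simp only: add_0_right)
 then have pcPk: "Pk k 0 pc" unfolding Pk_def pc_def
  by (intro exI[of _ "\<lambda>x. - 1 * p x"] conjI) (simp_all add: fun_eq_iff)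
 have v_eq: "v x = \<omega> x + p x" if "x \<noteq> 0" for x using that by (simp add: v_def pc_def)
 have vV: "v \<in> Vc"
  using Ck_continuous[OF Pk_Ck[OF pcPk]] c\<omega> by (auto simp: Vc_def v_def intro!: continuous_intros)
 have ipv: "w.ip f v = w.ip f \<omega> + w.ip f p" "w.ip v f = w.ip \<omega> f + w.ip p f" if f: "f \<in> Vc" for f
  unfolding w.ipS.Eadd2[OF \<omega>V pV f, symmetric] w.ipS.Eadd[OF \<omega>V pV f, symmetric] unfolding w.ip_def
  by (rule integral_ann_cong; simp add: v_eq)+
 have orthB: "w.ip f v = 0" if f: "BH k 0 f" for f
 proof -
  have fV: "f \<in> Vc" using cB[OF f] by (simp add: Vc_def)
  have "w.ip f p = - w.ip f \<omega>"
   using wp[OF f] w.ipS.Eherm[OF pV fV] w.ipS.Eherm[OF \<omega>V fV] by simp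
  then show ?thesis using ipv(1)[OF fV] by simp
 qed
 have orth: "w.ip f v = 0" if "Pk k 0 f" for f
 proof -
  obtain g where g: "BH k 0 g" "f = qt 0 g" using \<open>Pk k 0 f\<close> by (auto simp: Pk_def)
  have "w.ip f v = w.ip g v" unfolding w.ip_def by (rule integral_ann_cong) (simp add: g(2))
  then show ?thesis using orthB[OF g(1)] by simp
 qed
 obtain e where e: "e > 0"
  "\<And>x V. x \<in> ann ==> (\<Oplus>b. cnj (x $ b) * snd V $ b) = 0 ==> e * (norm V)^2 \<le> Lev \<psi> (t, x) V"
  using Lev_lower_bound[OF t] by blast
 define R where "R = (\<lambda>x. e * (\<Oplus>j. (norm (u j x))^2))"
 have cR: "continuous_on (-{0}) R" unfolding R_def by (intro continuous_intros cB u)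
 have core: "(LA z. R z * exp (- \<psi> (t, z))) \<le> Re (LA z. G z * w.wt z) - Re (w.ip v v)"
 proof (rule w.core_inequality[OF C\<omega> _ pcPk v_def orth cG cR])
  show "chom k \<omega>" unfolding chom_def
  proof (intro allI impI)
   fix c :: complex and z :: "complex^'m" assume cz: "c \<noteq> 0" "z \<noteq> 0"
   have "\<psi>j j (c *s z) = \<psi>j j z" for j unfolding \<psi>j_def by (rule wirtinger_\<psi>_invariant[OF t cz(2,1)])
   then show "\<omega> (c *s z) = c ^ k * \<omega> z" by (simp add: \<omega>_def BH_scale[OF u] sum_distrib_left mult_ac)
  qed
  fix z :: "complex^'m" and B assume z: "z \<in> ann" and B: "(\<Oplus>b. cnj (z $ b) * B b) = 0"
  have z0: "z \<noteq> 0" using z ann_nz by blast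
  note q = X[OF z0]
  define V where "V = ((\<chi> j. u j z), (\<chi> b. B b))"
  have 1: "dzb b \<omega> z = (\<Oplus>j. H (Inl j) (Inr b) (t, z) * u j z)" for b
  proof -
   have zz: "z \<in> -{0}" using z0 by simp
   have "dzb b \<omega> z = (\<Oplus>j. dzb b (\<lambda>x. \<psi>j j x * u j x) z)"
    unfolding \<omega>_def by (rule wirtinger_sum(2)[OF open_nz Ck_mult[OF open_nz C\<psi>j BH_Ck[OF u open_nz]] zz])
   also have "\<dots> = (\<Oplus>j. dzb b (\<psi>j j) z * u j z)"
    unfolding wirtinger_mult(2)[OF open_nz C\<psi>j BH_Ck[OF u open_nz] zz]
    using BH_wirtinger[OF u] by simp
   also have "\<dots> = (\<Oplus>j. H (Inl j) (Inr b) (t, z) * u j z)"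
   proof (intro sum.cong refl)
    fix j
    have C2: "Ck_on 2 \<psi>C X" using Ck_\<psi>C by (simp only: numeral_2_eq_2)
    have "dzb b (\<psi>j j) z = wirtinger_bar (coord (Inr b)) (dt j \<psi>C) (t, z)"
     unfolding \<psi>j_def by (rule wirtinger_Pair(4)[OF openX Ck_wirtinger(1)[OF openX Ck_\<psi>C] q])
    also have "\<dots> = H (Inl j) (Inr b) (t, z)" unfolding H_def by (rule wirtinger_commute(1)[OF openX C2 q, symmetric])
    finally show "dzb b (\<psi>j j) z * u j z = H (Inl j) (Inr b) (t, z) * u j z" by simp
   qed
   finally show ?thesis .
  qed
  have 2: "w.HP a b z = H (Inr a) (Inr b) (t, z)" for a b
  proof -
   have "w.HP a b z = dz a (\<lambda>x. wirtinger_bar (coord (Inr b)) \<psi>C (t, x)) z"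
    unfolding w.HP_def
    by (rule wirtinger_cong(1)[OF open_nz]) (use z0 wirtinger_Pair(4)[OF openX Ck_\<psi>C X] in auto)
   also have "\<dots> = H (Inr a) (Inr b) (t, z)"
    unfolding H_def by (rule wirtinger_Pair(3)[OF openX Ck_wirtinger(2)[OF openX Ck_\<psi>C] q])
   finally show ?thesis .
  qed
  define A where "A = (\<Oplus>j b. H (Inl j) (Inr b) (t, z) * u j z * cnj (B b))"
  have A': "(\<Oplus>b j. H (Inr b) (Inl j) (t, z) * B b * cnj (u j z)) = cnj A"
   unfolding A_def by (subst sum.swap) (simp add: H_herm[OF q, of "Inr _" "Inl _"] mult_ac)
  have A2: "(\<Oplus>b. dzb b \<omega> z * cnj (B b)) = A"
   unfolding 1 A_def sum_distrib_right by (rule sum.swap)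
  have "complex_of_real (Lev \<psi> (t, z) V) = G z + A + (cnj A + (\<Oplus>a b. w.HP a b z * B a * cnj (B b)))"
   unfolding Lev_form[OF q] sum_Plus_UNIV A'[symmetric] 2
   by (simp add: V_def G_def A_def \<psi>jl_def sum.distrib)
  then have "Lev \<psi> (t, z) V = Re (G z + A + (cnj A + (\<Oplus>a b. w.HP a b z * B a * cnj (B b))))"
   by (metis Re_complex_of_real)
  also have "\<dots> = Re (G z + 2 * (\<Oplus>b. dzb b \<omega> z * cnj (B b)) + (\<Oplus>a b. w.HP a b z * B a * cnj (B b)))"
   unfolding A2 by simp
  finally have L: "Lev \<psi> (t, z) V = \<dots>" .
  have "R z \<le> e * (norm V)^2"
  proof -
   have "(\<Oplus>j. (norm (u j z))^2) = (norm (fst V))^2"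
    by (simp add: V_def norm_vec_def L2_set_def sum_nonneg)
   also have "\<dots> \<le> (norm V)^2" using norm_fst_le[of "fst V" "snd V"] by (intro power_mono) auto
   finally show ?thesis using e(1) by (simp add: R_def)
  qed
  also have "\<dots> \<le> Lev \<psi> (t, z) V" by (rule e(2)[OF z]) (use B in \<open>simp add: V_def\<close>)
  finally show "R z \<le> Re (G z + 2 * (\<Oplus>b. dzb b \<omega> z * cnj (B b)) + (\<Oplus>a b. w.HP a b z * B a * cnj (B b)))"
   unfolding L .
 qed
 have Rpos: "0 < (LA z. R z * exp (- \<psi> (t, z)))"
 proof -
  let ?F = "\<lambda>z. R z * exp (- \<psi> (t, z))"
  have cF: "continuous_on (-{0}) ?F" using Ck_continuous[OF w.P2] by (intro continuous_intros cR)
  have R0: "0 \<le> R z" for z unfolding R_def using e(1) by (intro mult_nonneg_nonneg sum_nonneg) auto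
  have "0 \<le> (LA z. ?F z)"
   unfolding set_lebesgue_integral_def by (rule Bochner_Integration.integral_nonneg) (simp add: R0)
  moreover have "(LA z. ?F z) \<noteq> 0"
  proof
   assume I0: "(LA z. ?F z) = 0"
   have "u j0 = (\<lambda>x. 0)"
   proof (rule BH_eq_0[OF u])
    fix x :: "complex^'m" assume "1 < norm x" "norm x < exp 1"
    from continuous_ann_integral_eq_0[OF cF _ I0 this] R0 have "R x = 0" by simp
    then have "(\<Oplus>j. (norm (u j x))^2) = 0" using e(1) by (simp add: R_def)
    then show "u j0 x = 0" by (simp add: sum_nonneg_eq_0_iff)
   qed
   then show False using j0 by simp
  qed
  ultimately show ?thesis by simp
 qed
 have vv: "w.ip v v = w.ip \<omega> \<omega> - w.ip p p"
 proof -
  have wpp: "w.ip \<omega> p = - w.ip p p" using wp[OF pB] by simp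
  have "w.ip v v = w.ip \<omega> \<omega> + w.ip p \<omega> + (w.ip \<omega> p + w.ip p p)" by (simp add: ipv vV \<omega>V pV)
  also have "w.ip p \<omega> = - w.ip p p"
   using w.ipS.Eherm[OF \<omega>V pV] w.ipS.Eherm[OF pV pV] unfolding wpp by simp
  finally show ?thesis unfolding wpp by simp
 qed
 have "(\<Oplus>j l. dzb l (dz j (\<lambda>s. ?h s (u j) (u l))) t)
   = (\<Oplus>j l. LA x. (\<psi>j j x * cnj (\<psi>j l x) - \<psi>jl j l x) * (u j x * cnj (u l x) * w.wt x))"
  unfolding wirtinger2_L2_metric[OF u u t]
  by (intro sum.cong refl integral_ann_cong) (simp add: \<psi>jb Fh \<psi>jl_def H_def \<psi>j_def)
 also have "\<dots> = (LA x. \<Oplus>j l. (\<psi>j j x * cnj (\<psi>j l x) - \<psi>jl j l x) * (u j x * cnj (u l x) * w.wt x))"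
  by (subst set_integral_sum, simp, (intro int continuous_intros c\<psi>j c\<psi>jl cB u cwt)[1], rule sum.cong[OF refl])
   (rule set_integral_sum[symmetric], simp, intro int continuous_intros c\<psi>j c\<psi>jl cB u cwt)
 also have "\<dots> = (LA x. \<omega> x * cnj (\<omega> x) * w.wt x - G x * w.wt x)"
 proof (rule integral_ann_cong)
  fix x :: "complex^'m"
  have "\<omega> x * cnj (\<omega> x) = (\<Oplus>j l. \<psi>j j x * u j x * (cnj (\<psi>j l x) * cnj (u l x)))"
   unfolding \<omega>_def cnj_sum sum_product by simp
  then have "\<omega> x * cnj (\<omega> x) * w.wt x - G x * w.wt x = (\<Oplus>j l. \<psi>j j x * u j x * (cnj (\<psi>j l x) * cnj (u l x)) * w.wt x - \<psi>jl j l x * u j x * cnj (u l x) * w.wt x)"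
   by (simp add: G_def sum_distrib_right sum_subtractf)
  also have "\<dots> = (\<Oplus>j l. (\<psi>j j x * cnj (\<psi>j l x) - \<psi>jl j l x) * (u j x * cnj (u l x) * w.wt x))"
   by (intro sum.cong refl) (simp add: algebra_simps)
  finally show "(\<Oplus>j l. (\<psi>j j x * cnj (\<psi>j l x) - \<psi>jl j l x) * (u j x * cnj (u l x) * w.wt x)) = \<omega> x * cnj (\<omega> x) * w.wt x - G x * w.wt x" ..
 qed
 also have "\<dots> = w.ip \<omega> \<omega> - (LA x. G x * w.wt x)"
  unfolding w.ip_def by (rule set_integral_diff) (intro int continuous_intros c\<omega> cG cwt)+
 finally have qv: "?q = (LA x. G x * w.wt x) - w.ip v v"
  unfolding q vv hip[OF pB pB] by simp
 have Greal: "(LA x. G x * w.wt x) \<in> \<real>"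
 proof -
  have "(LA x. G x * w.wt x) = (LA x. complex_of_real (Lev \<psi> (t, x) ((\<chi> j. u j x), 0) * exp (- \<psi> (t, x))))"
   by (rule integral_ann_cong) (simp add: Lev_form[OF X] sum_Plus_UNIV G_def \<psi>jl_def w.wt_def)
  then show ?thesis by (simp only: set_integral_complex_of_real Reals_of_real)
 qed
 have vreal: "w.ip v v \<in> \<real>" using w.ipS.Ereal[OF vV] by (metis Reals_of_real)
 show "?q \<in> \<real> \<and> 0 < Re ?q"
  unfolding qv using Greal vreal core Rpos by (auto intro: Reals_diff)
qed

end

theorem theorem1p10:
  fixes U :: "(complex^'n) set"
    and \<Omega> W :: "((complex^'n) \<times> (complex^'m)) set"
    and \<phi> :: "(complex^'n) \<times> (complex^'m) \<Rightarrow> real"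
    and k :: nat
    and r s :: real
  assumes "family_of_bounded_domains U \<Omega>"
    and "admits_psh_defining_function U \<Omega>"
    and "closure_nbhd U \<Omega> W"
    and "Ck_on 2 \<phi> W"
    and "plurisubharmonic_on W \<phi>"
    and "\<And>t. t \<in> U \<Longrightarrow> is_domain (fiber \<Omega> t) \<and> circular (fiber \<Omega> t) \<and> 0 \<in> fiber \<Omega> t"
    and "S1_invariant_on W \<phi>"
    and "0 < r" and "r < s"
    and "\<And>t. t \<in> U \<Longrightarrow> {z. r \<le> norm z \<and> norm z \<le> s} \<subseteq> fiber \<Omega> t"
    and "strictly_plurisubharmonic_on (U \<times> {z. r \<le> norm z \<and> norm z \<le> s}) \<phi>"
  shows "hermitian_bundle U (homogeneous_polys k) (L2_metric \<Omega> \<phi>) \<and>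
         nakano_positive U (homogeneous_polys k) (L2_metric \<Omega> \<phi>)"
proof -
 obtain W0 N \<rho> where \<rho>: "defining_function 2 U \<Omega> W0 \<rho>" "closure_nbhd U \<Omega> N" "N \<subseteq> W0" "plurisubharmonic_on N \<rho>"
  using assms(2) unfolding admits_psh_defining_function_def by blast
 have fam: "is_domain U" "is_domain \<Omega>" "fst ` \<Omega> = U" "\<And>t. t \<in> U ==> bounded (fiber \<Omega> t)"
  using assms(1) by (auto simp: family_of_bounded_domains_def)
 have \<Omega>: "\<Omega> = {x \<in> W0. \<rho> x < 0}" using \<rho>(1) by (simp add: defining_function_def)
 have "\<Omega> \<subseteq> U \<times> UNIV" using fam(3) by force
 then have \<Omega>N: "\<Omega> \<subseteq> N" using \<rho>(2) closure_subset[of \<Omega>] by (auto simp: closure_nbhd_def)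
 interpret weighted_family U \<Omega> N W \<rho> \<phi> k r s
 proof
  show "open U" "open \<Omega>" using fam by (auto simp: is_domain_def)
  show "Ck_on 2 \<rho> N" using \<rho>(1,3) Ck_subset by (auto simp: defining_function_def simp del: Ck_on.simps)
  show "x \<in> N \<and> \<rho> x < 0" if "x \<in> \<Omega>" for x using that \<Omega> \<Omega>N by blast
  show "0 \<le> \<rho> x" if "x \<in> N" "x \<notin> \<Omega>" for x using that \<Omega> \<rho>(3) by force
  show "open W" using assms(3) by (simp add: closure_nbhd_def)
  show "connected (fiber \<Omega> t)" "circular (fiber \<Omega> t)" "0 \<in> fiber \<Omega> t" if "t \<in> U" for t
   using assms(6)[OF that] by (auto simp: is_domain_def)
 qed (fact assms fam \<rho>)+
 show ?thesis using hermitian_bundle_L2 nakano_positive_L2 by blast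
qed

end
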